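(* Let $s>1$, let $V$ be an $s$-admissible potential, and let $\mu_0$ be the Gaussian measure associated with $h=-\partial_x^2+V$. (1) (Defocusing case.) For any $s>1$, the map $u\mapsto e^{-\frac12\int_{\mathbb R}|u|^4}$ is in $L^1(d\mu_0)$. Consequently, $$d\mu(u):=\frac1Z e^{-\frac12\int_{\mathbb R}|u|^4}\,d\mu_0(u)$$ makes sense as a probability measure (with $Z\in(0,\infty)$ the normalization constant). (2) (Focusing case, $s>2$.) For any $s>2$ and any $m>0$, the map $u\mapsto e^{\frac12\int_{\mathbb R}|u|^4}\mathbf 1_{\{\int_{\mathbb R}|u|^2\le m\}}$ is in $L^1(d\mu_0)$. Consequently, $$d\mu(u):=\frac1Z e^{\frac12\int_{\mathbb R}|u|^4}\mathbf 1_{\{\int_{\mathbb R}|u|^2\le m\}}\,d\mu_0(u)$$ makes sense as a probability measure. (3) (Focusing case, $\frac85<s\le2$.) For any $1<s\le 2$, the sequence $\{\mathcal M_{\le\Lambda}(u)\}_{\Lambda\ge\lambda_1}$ with $$\mathcal M_{\le\Lambda}(u):=\sum_{\lambda_j\le\Lambda}\Big(|\alpha_j|^2-\int|\alpha_j|^2\,d\mu_0(u)\Big)$$ is Cauchy in $L^2(d\mu_0)$. It thus has a limit (the renormalized mass), denoted by $\mathcal M(u)$. In addition, for any $\frac85<s\le2$ and any $m>0$, the map $u\mapsto e^{\frac12\int_{\mathbb R}|u|^4}\mathbf 1_{\{|\mathcal M(u)|\le m\}}$ is in $L^1(d\mu_0)$, hence $$d\mu(u):=\frac1Z e^{\frac12\int_{\mathbb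 R}|u|^4}\mathbf 1_{\{|\mathcal M(u)|\le m\}}\,d\mu_0(u)$$ makes sense as a probability measure.
   Context: Notation: $\langle x\rangle=\sqrt{1+|x|^2}$. A potential $V$ is called $s$-admissible ($s>1$) if $V\in C^\infty(\mathbb R,\mathbb R_+)$ and (i) there is $C\ge1$ with $\frac1C\langle x\rangle^s\le V(x)\le C\langle x\rangle^s$ for all $|x|\ge1$; (ii) for every integer $j\ge0$ there is $C_j>0$ with $|\partial^jV(x)|\le C_j\langle x\rangle^{s-j}$ for all $x$. The operator $h=-\partial_x^2+V(x)$ on $L^2(\mathbb R)$ is self-adjoint with compact resolvent; $0<\lambda_1\le\lambda_2\le\cdots\to\infty$ are its eigenvalues and $(u_j)_{j\ge1}$ an associated orthonormal basis of eigenfunctions. Write $u=\sum_j\alpha_ju_j$, $\alpha_j=\langle u_j,u\rangle_{L^2}\in\mathbb C$. For $\theta\in\mathbb R$, $\mathcal H^\theta=\{u=\sum_j\alpha_ju_j:\ \|u\|_{\mathcal H^\theta}^2=\sum_j\lambda_j^\theta|\alpha_j|^2<\infty\}$. Gaussian measure: $\mu_0$ is the probability measure on $\mathcal H^\theta$ (for any $\theta<\frac12-\frac1s$) whose cylindrical projection on $E_{\le\Lambda}=\mathrm{span}\{u_j:\lambda_j\le\Lambda\}$ is $\prod_{\lambda_j\le\Lambda}\frac{\lambda_j}{\pi}e^{-\lambda_j|\alpha_j|^2}d\alpha_j$ for every $\Lambda\ge\lambda_1$, where $d\alpha_j$ is Lebesgue measure on $\mathbb C$; i.e. under $\mu_0$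 the $\alpha_j$ are independent centered complex Gaussians with $\int|\alpha_j|^2d\mu_0=\lambda_j^{-1}$. *)

theory Defs
  imports "HOL-Probability.Probability"
begin

section \<open>Admissible potentials\<close>

definition jb :: "real \<Rightarrow> real" where
  "jb x = sqrt (1 + x\<^sup>2)"

definition smooth_fun :: "(real \<Rightarrow> real) \<Rightarrow> bool" where
  "smooth_fun f \<longleftrightarrow> (\<forall>j x. (deriv ^^ j) f differentiable at x)"

definition admissible :: "real \<Rightarrow> (real \<Rightarrow> real) \<Rightarrow> bool" where
  "admissible s V \<longleftrightarrow>
     smooth_fun V \<and> (\<forall>x. 0 \<le> V x) \<and>
     (\<exists>C\<ge>1. \<forall>x. 1 \<le> \<bar>x\<bar> \<longrightarrow> 1 / C * jb x powr s \<le> V x \<and> V x \<le> C * jb x powr s) \<and>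
     (\<forall>j. \<exists>C>0. \<forall>x. \<bar>(deriv ^^ j) V x\<bar> \<le> C * jb x powr (s - real j))"

section \<open>The operator and its eigenbasis\<close>

text \<open>Elements of the complex space \<open>L\<^sup>2(\<real>)\<close> are handled through representatives; nothing
  below depends on the values of a representative on a null set. The inner product is linear
  in its second argument.\<close>

definition in_L2 :: "(real \<Rightarrow> complex) \<Rightarrow> bool" where
  "in_L2 f \<longleftrightarrow> f \<in> borel_measurable lborel \<and> integrable lborel (\<lambda>x. (cmod (f x))\<^sup>2)"

definition inner_L2 :: "(real \<Rightarrow> complex) \<Rightarrow> (real \<Rightarrow> complex) \<Rightarrow> complex" where
  "inner_L2 f g = (\<integral>x. cnj (f x) * g x \<partial>lborel)"

definition test_fun :: "(real \<Rightarrow> real) \<Rightarrow> bool" where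
  "test_fun \<phi> \<longleftrightarrow> smooth_fun \<phi> \<and> (\<exists>R. \<forall>x. R < \<bar>x\<bar> \<longrightarrow> \<phi> x = 0)"

text \<open>The graph of \<open>h = - \<partial>\<^sub>x\<^sup>2 + V\<close>: \<open>u\<close> is in the domain and \<open>h u = f\<close>. The derivative is taken
  in the sense of distributions and the domain is \<open>{u \<in> L\<^sup>2. - u'' + V u \<in> L\<^sup>2}\<close>, which for
  smooth \<open>V \<ge> 0\<close> is the domain of the unique self-adjoint realisation. Real test functions
  suffice because both sides are complex linear in the test function.\<close>

definition schroedinger :: "(real \<Rightarrow> real) \<Rightarrow> (real \<Rightarrow> complex) \<Rightarrow> (real \<Rightarrow> complex) \<Rightarrow> bool" where
  "schroedinger V u f \<longleftrightarrow> in_L2 u \<and> in_L2 f \<and>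
     (\<forall>\<phi>. test_fun \<phi> \<longrightarrow>
        (\<integral>x. u x * of_real (- deriv (deriv \<phi>) x + V x * \<phi> x) \<partial>lborel)
        = (\<integral>x. f x * of_real (\<phi> x) \<partial>lborel))"

text \<open>Eigenvalues are repeated according to multiplicity and indexed from \<open>0\<close>, so that
  \<open>\<lambda> 0\<close> is the lowest one.\<close>

definition eigenbasis :: "(real \<Rightarrow> real) \<Rightarrow> (nat \<Rightarrow> real) \<Rightarrow> (nat \<Rightarrow> real \<Rightarrow> complex) \<Rightarrow> bool" where
  "eigenbasis V lam e \<longleftrightarrow>
     0 < lam 0 \<and> incseq lam \<and> filterlim lam at_top sequentially \<and>
     (\<forall>j. schroedinger V (e j) (\<lambda>x. of_real (lam j) * e j x)) \<and>
     (\<forall>i j. inner_L2 (e i) (e j) = (if i = j then 1 else 0)) \<and>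
     (\<forall>f. in_L2 f \<longrightarrow>
        (\<lambda>n. \<integral>x. (cmod (f x - (\<Sum>j<n. inner_L2 (e j) f * e j x)))\<^sup>2 \<partial>lborel) \<longlonglongrightarrow> 0)"

section \<open>Sobolev spaces and the Gaussian measure\<close>

text \<open>An element \<open>u = \<Sum>\<^sub>j \<alpha>\<^sub>j u\<^sub>j\<close> of \<open>H\<^sup>\<theta>\<close> is identified with its coefficient sequence
  \<open>\<alpha>\<close>; for \<open>\<theta> < 0\<close> it is in general only a distribution.\<close>

definition Hspace :: "(nat \<Rightarrow> real) \<Rightarrow> real \<Rightarrow> (nat \<Rightarrow> complex) set" where
  "Hspace lam \<theta> = {\<alpha>. summable (\<lambda>j. lam j powr \<theta> * (cmod (\<alpha> j))\<^sup>2)}"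

text \<open>The \<open>\<sigma>\<close>-algebra generated by the coordinates is the Borel \<open>\<sigma>\<close>-algebra of the separable
  Hilbert space \<open>H\<^sup>\<theta>\<close>. The finite-dimensional space \<open>E\<^sub>\<le>\<^sub>\<Lambda>\<close> is identified with the
  coefficients of index in \<open>{j. \<lambda>\<^sub>j \<le> \<Lambda>}\<close>.\<close>

definition gaussian_measure :: "(nat \<Rightarrow> real) \<Rightarrow> real \<Rightarrow> (nat \<Rightarrow> complex) measure \<Rightarrow> bool" where
  "gaussian_measure lam \<theta> \<mu>0 \<longleftrightarrow>
     prob_space \<mu>0 \<and> space \<mu>0 = Hspace lam \<theta> \<and>
     sets \<mu>0 = sets (restrict_space (\<Pi>\<^sub>M j\<in>UNIV. (borel :: complex measure)) (Hspace lam \<theta>)) \<and>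
     (\<forall>\<Lambda>\<ge>lam 0.
        distr \<mu>0 (\<Pi>\<^sub>M j\<in>{j. lam j \<le> \<Lambda>}. borel) (\<lambda>\<alpha>. restrict \<alpha> {j. lam j \<le> \<Lambda>})
        = (\<Pi>\<^sub>M j\<in>{j. lam j \<le> \<Lambda>}.
             density lborel (\<lambda>z::complex. ennreal (lam j / pi * exp (- lam j * (cmod z)\<^sup>2)))))"

section \<open>Nonlinear functionals\<close>

text \<open>The distribution \<open>\<Sum>\<^sub>j \<alpha>\<^sub>j u\<^sub>j\<close> is the locally integrable function \<open>f\<close>.\<close>

definition is_function :: "(nat \<Rightarrow> real \<Rightarrow> complex) \<Rightarrow> (nat \<Rightarrow> complex) \<Rightarrow> (real \<Rightarrow> complex) \<Rightarrow> bool" where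
  "is_function e \<alpha> f \<longleftrightarrow>
     (\<forall>R. set_integrable lborel {-R..R} f) \<and>
     (\<forall>\<phi>. test_fun \<phi> \<longrightarrow>
        (\<lambda>j. \<alpha> j * (\<integral>x. e j x * of_real (\<phi> x) \<partial>lborel)) sums (\<integral>x. f x * of_real (\<phi> x) \<partial>lborel))"

text \<open>\<open>\<integral>|u|\<^sup>p\<close> for \<open>u = \<Sum>\<^sub>j \<alpha>\<^sub>j u\<^sub>j\<close>. The function \<open>f\<close> is unique up to null sets, so the infimum
  ranges over at most one value; it is \<open>\<infinity>\<close> if \<open>u\<close> is not a function.\<close>

definition int_pow :: "(nat \<Rightarrow> real \<Rightarrow> complex) \<Rightarrow> nat \<Rightarrow> (nat \<Rightarrow> complex) \<Rightarrow> ennreal" where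
  "int_pow e p \<alpha> = (INF f\<in>{f. is_function e \<alpha> f}. \<integral>\<^sup>+x. ennreal (cmod (f x) ^ p) \<partial>lborel)"

definition exp_ereal :: "ereal \<Rightarrow> ennreal" where
  "exp_ereal x = (case x of ereal r \<Rightarrow> ennreal (exp r) | PInfty \<Rightarrow> \<infinity> | MInfty \<Rightarrow> 0)"

definition defocusing_weight :: "(nat \<Rightarrow> real \<Rightarrow> complex) \<Rightarrow> (nat \<Rightarrow> complex) \<Rightarrow> ennreal" where
  "defocusing_weight e \<alpha> = exp_ereal (- (ereal (1/2) * enn2ereal (int_pow e 4 \<alpha>)))"

definition focusing_weight ::
    "(nat \<Rightarrow> real \<Rightarrow> complex) \<Rightarrow> (nat \<Rightarrow> complex) set \<Rightarrow> (nat \<Rightarrow> complex) \<Rightarrow> ennreal" where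
  "focusing_weight e A \<alpha> = exp_ereal (ereal (1/2) * enn2ereal (int_pow e 4 \<alpha>)) * indicator A \<alpha>"

definition truncated_mass ::
    "(nat \<Rightarrow> real) \<Rightarrow> (nat \<Rightarrow> complex) measure \<Rightarrow> real \<Rightarrow> (nat \<Rightarrow> complex) \<Rightarrow> real" where
  "truncated_mass lam \<mu>0 \<Lambda> \<alpha> =
     (\<Sum>j | lam j \<le> \<Lambda>. (cmod (\<alpha> j))\<^sup>2 - (\<integral>\<beta>. (cmod (\<beta> j))\<^sup>2 \<partial>\<mu>0))"

section \<open>Integrability with respect to a measure\<close>

definition in_L1_ennreal :: "'a measure \<Rightarrow> ('a \<Rightarrow> ennreal) \<Rightarrow> bool" where
  "in_L1_ennreal M F \<longleftrightarrow> F \<in> borel_measurable M \<and> (\<integral>\<^sup>+x. F x \<partial>M) < \<infinity>"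

definition in_L2_real :: "'a measure \<Rightarrow> ('a \<Rightarrow> real) \<Rightarrow> bool" where
  "in_L2_real M F \<longleftrightarrow> F \<in> borel_measurable M \<and> integrable M (\<lambda>x. (F x)\<^sup>2)"

definition norm_L2_real :: "'a measure \<Rightarrow> ('a \<Rightarrow> real) \<Rightarrow> real" where
  "norm_L2_real M F = sqrt (\<integral>x. (F x)\<^sup>2 \<partial>M)"

definition L2_Cauchy_from :: "'a measure \<Rightarrow> real \<Rightarrow> (real \<Rightarrow> 'a \<Rightarrow> real) \<Rightarrow> bool" where
  "L2_Cauchy_from M \<Lambda>\<^sub>0 F \<longleftrightarrow> (\<forall>\<Lambda>\<ge>\<Lambda>\<^sub>0. in_L2_real M (F \<Lambda>)) \<and>
     (\<forall>\<epsilon>>0. \<exists>K\<ge>\<Lambda>\<^sub>0. \<forall>\<Lambda>\<ge>K. \<forall>\<Lambda>'\<ge>K. norm_L2_real M (\<lambda>x. F \<Lambda> x - F \<Lambda>' x) < \<epsilon>)"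

definition L2_limit :: "'a measure \<Rightarrow> (real \<Rightarrow> 'a \<Rightarrow> real) \<Rightarrow> ('a \<Rightarrow> real) \<Rightarrow> bool" where
  "L2_limit M F G \<longleftrightarrow> in_L2_real M G \<and>
     ((\<lambda>\<Lambda>. norm_L2_real M (\<lambda>x. F \<Lambda> x - G x)) \<longlongrightarrow> 0) at_top"

definition partition_const :: "'a measure \<Rightarrow> ('a \<Rightarrow> ennreal) \<Rightarrow> ennreal" where
  "partition_const M F = (\<integral>\<^sup>+x. F x \<partial>M)"

definition gibbs :: "'a measure \<Rightarrow> ('a \<Rightarrow> ennreal) \<Rightarrow> 'a measure" where
  "gibbs M F = density M (\<lambda>x. F x / partition_const M F)"

text \<open>The weight \<open>F\<close> can be normalised to a probability density: \<open>Z \<in> (0, \<infinity>)\<close> is part of the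
  claim, since division by \<open>0\<close> and by \<open>\<infinity>\<close> is total here.\<close>

definition gibbs_well_defined :: "'a measure \<Rightarrow> ('a \<Rightarrow> ennreal) \<Rightarrow> bool" where
  "gibbs_well_defined M F \<longleftrightarrow>
     0 < partition_const M F \<and> partition_const M F < \<infinity> \<and> prob_space (gibbs M F)"

end

theory Submission
  imports Defs "HOL-Computational_Algebra.Polynomial"
begin

text \<open>The weight is integrable because a large quartic functional forces a rare event. Split the
  eigenvalues into the blocks \<open>2\<^sup>k < \<lambda> \<le> 2\<^sup>k\<^sup>+\<^sup>1\<close>, and let \<open>w\<^sub>k\<close> be the corresponding part of \<open>u\<close>.
  The eigenfunction energy identity and a one-dimensional Sobolev inequality give
  \<open>\<Sum> |u\<^sub>j(x)|\<^sup>2 / \<lambda>\<^sub>j \<le> 2 \<cdot> 2\<^sup>-\<^sup>k\<^sup>/\<^sup>2\<close> over block \<open>k\<close>, uniformly in \<open>x\<close>, and counting eigenvalues gives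
  \<open>\<Sum> \<lambda>\<^sub>j\<^sup>-\<^sup>1\<^sup>-\<^sup>b < \<infinity>\<close> with \<open>b = 0\<close> for \<open>s > 2\<close> and \<open>b = 1/(2s)\<close> otherwise. Jensen's inequality for the
  density \<open>|w\<^sub>k|\<^sup>2 / \<integral> |w\<^sub>k|\<^sup>2\<close> replaces one factor \<open>|w\<^sub>k|\<^sup>2\<close> of the quartic by the block mass; the latter has
  exponential tails, so \<open>\<integral> |w\<^sub>k|\<^sup>4\<close> has exponential moments that follow from pointwise Gaussian bounds.
  The low frequencies \<open>\<lambda> \<le> 2\<^sup>K\<close> contribute at most \<open>2 \<cdot> 2\<^sup>K\<^sup>/\<^sup>2\<close> times the square of their mass. That mass is
  bounded outright for \<open>s > 2\<close>; in the renormalised case it is of size \<open>2\<^sup>K\<^sup>b\<close> up to an event on which the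
  renormalised mass of the high frequencies is very negative. At quartic level
  \<open>2\<^sup>K\<^sup>(\<^sup>1\<^sup>/\<^sup>2\<^sup>+\<^sup>2\<^sup>b\<^sup>)\<close> the rare events have probability at most \<open>exp (- 2\<^sup>K\<^sup>(\<^sup>1\<^sup>+\<^sup>b\<^sup>))\<close>, which suffices since
  \<open>b < 1/2\<close>.\<close>

section \<open>Smooth functions\<close>

text \<open>The exponential of a quartic in Gaussian variables has infinite expectation, so no
  exponential moment of \<open>quart\<close> alone is available. Once one factor
  \<open>|w|^2\<close> is traded for a bound on the block mass, the exponent is quadratic in the
  field and is integrable as long as its coefficient stays small against the inverse of the Green
  function. The exponents come from a balance: block k has at most of the order of 2^(k (1+b)) modes
  and typical mass of order at most 2^(k b), so exceeding that mass costs exp (- 2^(k (1+b))),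
  whereas the low modes reach a quartic of size 2^(k/2) (2^(k b))^2; the two exponents differ by 1/2
  - b. A second obstacle is the meaning of the integrals: \<alpha> is a priori only a distribution
  and \<open>int_pow\<close> is an infimum over representing functions, so measurability has to come
  from a countable formula in the coordinates, and weak eigenfunctions have to become classical
  before anything is integrated by parts. Positive probability of the cut-off events is a separate
  matter, settled by independence of low and high modes.\<close>

lemma smooth_fun_iff: "smooth_fun f \<longleftrightarrow> (\<forall>x. f differentiable at x) \<and> smooth_fun (deriv f)"
proof -
  have "(\<forall>j x. (deriv ^^ j) f differentiable at x) \<longleftrightarrow>
      (\<forall>x. f differentiable at x) \<and> (\<forall>j x. (deriv ^^ Suc j) f differentiable at x)"
    by (metis (no_types, lifting) funpow_0 not0_implies_Suc)
  then show ?thesis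
    unfolding smooth_fun_def by (simp add: funpow_Suc_right del: funpow.simps)
qed

lemma smooth_fun_DERIV: "smooth_fun f \<Longrightarrow> (f has_real_derivative deriv f x) (at x)"
  using smooth_fun_iff DERIV_deriv_iff_real_differentiable by blast

lemma smooth_fun_deriv: "smooth_fun f \<Longrightarrow> smooth_fun (deriv f)"
  using smooth_fun_iff by blast

lemma smooth_fun_continuous: "smooth_fun f \<Longrightarrow> continuous_on A f"
  by (meson DERIV_isCont continuous_at_imp_continuous_on smooth_fun_DERIV)

lemma smooth_fun_measurable [measurable_dest]: "smooth_fun f \<Longrightarrow> f \<in> borel_measurable borel"
  by (simp add: borel_measurable_continuous_onI smooth_fun_continuous)

text \<open>Iterated derivatives never leave a class that is closed under one derivative. Closure
  properties thus reduce to the choice of a stable class, without formulas for higher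
  derivatives.\<close>

lemma smooth_fun_coinduct:
  assumes "P f" "\<And>f. P f \<Longrightarrow> \<exists>f'. (\<forall>x. (f has_real_derivative f' x) (at x)) \<and> P f'"
  shows "smooth_fun f"
proof -
  have step: "(\<forall>x. f differentiable at x) \<and> P (deriv f)" if "P f" for f
  proof -
    obtain f' where f': "\<forall>x. (f has_real_derivative f' x) (at x)" "P f'"
      using assms(2)[OF \<open>P f\<close>] by blast
    have "deriv f = f'" using f'(1) DERIV_imp_deriv by blast
    then show ?thesis using f' real_differentiable_def by blast
  qed
  have "P ((deriv ^^ j) f)" for j
    by (induction j) (use assms(1) step in auto)
  then show ?thesis unfolding smooth_fun_def using step by blast
qed

lemma smooth_fun_intro_DERIV:
  assumes "\<And>x. (f has_real_derivative f' x) (at x)" "smooth_fun f'"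
  shows "smooth_fun f"
proof -
  have "deriv f = f'" using assms(1) DERIV_imp_deriv by blast
  then show ?thesis using assms smooth_fun_iff real_differentiable_def by metis
qed

lemma smooth_fun_add:
  assumes "smooth_fun f" "smooth_fun g" shows "smooth_fun (\<lambda>x. f x + g x)"
proof (rule smooth_fun_coinduct[where P = "\<lambda>h. \<exists>f g. smooth_fun f \<and> smooth_fun g \<and> h = (\<lambda>x. f x + g x)"])
  show "\<exists>fa ga. smooth_fun fa \<and> smooth_fun ga \<and> (\<lambda>x. f x + g x) = (\<lambda>x. fa x + ga x)"
    using assms by blast
next
  fix h assume "\<exists>f g. smooth_fun f \<and> smooth_fun g \<and> h = (\<lambda>x. f x + g x)"
  then obtain f g where *: "smooth_fun f" "smooth_fun g" "h = (\<lambda>x. f x + g x)" by blast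
  show "\<exists>h'. (\<forall>x. (h has_real_derivative h' x) (at x)) \<and>
      (\<exists>f g. smooth_fun f \<and> smooth_fun g \<and> h' = (\<lambda>x. f x + g x))"
    by (rule exI[of _ "\<lambda>x. deriv f x + deriv g x"])
       (use * in \<open>auto intro!: DERIV_add smooth_fun_DERIV smooth_fun_deriv\<close>)
qed

lemma smooth_fun_const: "smooth_fun (\<lambda>x. c)"
  by (rule smooth_fun_coinduct[where P = "\<lambda>h. \<exists>c. h = (\<lambda>x. c)"])
     (auto intro!: exI[of _ "\<lambda>x. 0"] derivative_eq_intros)

text \<open>Single products are not stable under differentiation, finite sums of products are;
  \<open>P\<close> is the class of such sums.\<close>

lemma smooth_fun_mult:
  assumes f: "smooth_fun f" and g: "smooth_fun g" shows "smooth_fun (\<lambda>x. f x * g x)"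
proof -
  define P where "P h \<longleftrightarrow> (\<exists>I::nat set. \<exists>F G. finite I \<and> (\<forall>i\<in>I. smooth_fun (F i) \<and> smooth_fun (G i)) \<and>
       h = (\<lambda>x. \<Sum>i\<in>I. F i x * G i x))" for h :: "real \<Rightarrow> real"
  show ?thesis
  proof (rule smooth_fun_coinduct[where P = P])
    show "P (\<lambda>x. f x * g x)" unfolding P_def
      by (rule exI[of _ "{0}"], rule exI[of _ "\<lambda>_. f"], rule exI[of _ "\<lambda>_. g"]) (use f g in auto)
  next
    fix h assume "P h"
    then obtain I :: "nat set" and F G where *: "finite I" "\<And>i. i \<in> I \<Longrightarrow> smooth_fun (F i)"
      "\<And>i. i \<in> I \<Longrightarrow> smooth_fun (G i)" "h = (\<lambda>x. \<Sum>i\<in>I. F i x * G i x)"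
      unfolding P_def by blast
    \<comment> \<open>The product rule doubles the index set: index 2 i carries the derivative of
      the first factor, index 2 i + 1 that of the second.\<close>
    let ?J = "(\<lambda>i. 2 * i) ` I \<union> (\<lambda>i. 2 * i + 1) ` I"
    let ?F = "\<lambda>j. if even j then deriv (F (j div 2)) else F (j div 2)"
    let ?G = "\<lambda>j. if even j then G (j div 2) else deriv (G (j div 2))"
    have eq: "(\<Sum>j\<in>?J. ?F j x * ?G j x) = (\<Sum>i\<in>I. deriv (F i) x * G i x + F i x * deriv (G i) x)" for x
    proof -
      have "(\<Sum>j\<in>?J. ?F j x * ?G j x) = (\<Sum>j\<in>(\<lambda>i. 2 * i) ` I. ?F j x * ?G j x)
          + (\<Sum>j\<in>(\<lambda>i. 2 * i + 1) ` I. ?F j x * ?G j x)"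
        using *(1) by (intro sum.union_disjoint) (auto; presburger)+
      also have "\<dots> = (\<Sum>i\<in>I. deriv (F i) x * G i x) + (\<Sum>i\<in>I. F i x * deriv (G i) x)"
        by (subst (1 2) sum.reindex) (auto simp: inj_on_def)
      finally show ?thesis by (simp add: sum.distrib)
    qed
    show "\<exists>h'. (\<forall>x. (h has_real_derivative h' x) (at x)) \<and> P h'"
    proof (intro exI conjI allI)
      fix x
      show "(h has_real_derivative (\<lambda>x. \<Sum>j\<in>?J. ?F j x * ?G j x) x) (at x)"
        unfolding eq *(4)
        by (rule DERIV_sum) (auto intro!: DERIV_mult' smooth_fun_DERIV * simp: add.commute
            intro: derivative_eq_intros)
    next
      show "P (\<lambda>x. \<Sum>j\<in>?J. ?F j x * ?G j x)"
        unfolding P_def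
        by (rule exI[of _ ?J], rule exI[of _ ?F], rule exI[of _ ?G])
           (use * in \<open>auto intro: smooth_fun_deriv\<close>)
    qed
  qed
qed

lemma smooth_fun_affine:
  assumes "smooth_fun f" shows "smooth_fun (\<lambda>x. f (a * x + b))"
proof (rule smooth_fun_coinduct[where P = "\<lambda>h. \<exists>f c. smooth_fun f \<and> h = (\<lambda>x. c * f (a * x + b))"])
  show "\<exists>fa c. smooth_fun fa \<and> (\<lambda>x. f (a * x + b)) = (\<lambda>x. c * fa (a * x + b))"
    using assms by (intro exI[of _ f] exI[of _ 1]) auto
next
  fix h assume "\<exists>f c. smooth_fun f \<and> h = (\<lambda>x. c * f (a * x + b))"
  then obtain f c where *: "smooth_fun f" "h = (\<lambda>x. c * f (a * x + b))" by blast
  show "\<exists>h'. (\<forall>x. (h has_real_derivative h' x) (at x)) \<and>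
      (\<exists>f c. smooth_fun f \<and> h' = (\<lambda>x. c * f (a * x + b)))"
  proof (intro exI conjI allI)
    fix x
    have "((\<lambda>x. f (a * x + b)) has_real_derivative deriv f (a * x + b) * a) (at x)"
      by (rule DERIV_chain2[OF smooth_fun_DERIV[OF *(1)]]) (auto intro!: derivative_eq_intros)
    then show "(h has_real_derivative (c * a) * deriv f (a * x + b)) (at x)"
      unfolding *(2) by (auto intro!: derivative_eq_intros)
  next
    show "smooth_fun (deriv f)" using * smooth_fun_deriv by blast
  qed simp
qed

lemma smooth_fun_ident: "smooth_fun (\<lambda>x. x)"
  by (rule smooth_fun_intro_DERIV[where f' = "\<lambda>x. 1"]) (auto simp: smooth_fun_const)

section \<open>Functions that are flat at the origin\<close>

lemma poly_times_exp_neg_tendsto_0: "((\<lambda>y::real. poly p y * exp (- y)) \<longlongrightarrow> 0) at_top"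
proof -
  have "((\<lambda>y::real. \<Sum>i\<le>degree p. coeff p i * (y ^ i / exp y)) \<longlongrightarrow> (\<Sum>i\<le>degree p. coeff p i * 0)) at_top"
    by (intro tendsto_intros tendsto_power_div_exp_0)
  then show ?thesis
    by (simp add: poly_altdef exp_minus divide_inverse sum_distrib_right sum_distrib_left mult_ac)
qed

text \<open>For p = 1 this is the standard flat function. The polynomial makes the family stable
  under differentiation, which replaces p by X^2 (p - p').\<close>

definition poly_exp_inv :: "real poly \<Rightarrow> real \<Rightarrow> real" where
  "poly_exp_inv p x = (if 0 < x then poly p (1 / x) * exp (- (1 / x)) else 0)"

lemma poly_exp_inv_DERIV:
  "(poly_exp_inv p has_real_derivative poly_exp_inv ([:0, 0, 1:] * (p - pderiv p)) x) (at x)"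
proof (cases x "0::real" rule: linorder_cases)
  case less
  have "((\<lambda>_. 0) has_real_derivative 0) (at x)" by simp
  then have "(poly_exp_inv p has_real_derivative 0) (at x)"
    by (rule has_field_derivative_transform_within_open[where S = "{..<0}"])
       (use less in \<open>auto simp: poly_exp_inv_def\<close>)
  then show ?thesis using less by (simp add: poly_exp_inv_def)
next
  case greater
  have "((\<lambda>x. poly p (1 / x) * exp (- (1 / x))) has_real_derivative
      poly_exp_inv ([:0, 0, 1:] * (p - pderiv p)) x) (at x)"
    using greater
    by (auto intro!: derivative_eq_intros DERIV_chain2[OF poly_DERIV]
        simp: poly_exp_inv_def field_simps power2_eq_square)
  then show ?thesis
    by (rule has_field_derivative_transform_within_open[where S = "{0<..}"])
       (use greater in \<open>auto simp: poly_exp_inv_def\<close>)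
next
  case equal
  \<comment> \<open>At the origin the difference quotient contributes one more factor 1/x, hence the
    extra X in the polynomial.\<close>
  have "((\<lambda>y. poly ([:0, 1:] * p) y * exp (- y)) \<longlongrightarrow> 0) at_top"
    by (rule poly_times_exp_neg_tendsto_0)
  moreover have "filterlim (\<lambda>x::real. 1 / x) at_top (at_right 0)"
    using filterlim_inverse_at_top_right by (simp add: inverse_eq_divide)
  ultimately have "((\<lambda>x. poly ([:0, 1:] * p) (1 / x) * exp (- (1 / x))) \<longlongrightarrow> 0) (at_right 0)"
    by (rule filterlim_compose)
  then have right: "((\<lambda>x. poly_exp_inv p x / x) \<longlongrightarrow> 0) (at_right 0)"
    by (rule Lim_transform_eventually)
       (auto simp: eventually_at_filter poly_exp_inv_def intro!: always_eventually)
  have left: "((\<lambda>x. poly_exp_inv p x / x) \<longlongrightarrow> 0) (at_left 0)"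
    by (rule Lim_transform_eventually[where f = "\<lambda>_. 0"])
       (auto simp: eventually_at_filter poly_exp_inv_def intro!: always_eventually)
  have "((\<lambda>x. poly_exp_inv p x / x) \<longlongrightarrow> 0) (at 0)"
    using left right by (simp add: filterlim_split_at)
  then have "(poly_exp_inv p has_real_derivative 0) (at 0)"
    by (simp add: DERIV_def poly_exp_inv_def)
  then show ?thesis using equal by (simp add: poly_exp_inv_def)
qed

lemma smooth_poly_exp_inv: "smooth_fun (poly_exp_inv p)"
  by (rule smooth_fun_coinduct[where P = "\<lambda>h. \<exists>p. h = poly_exp_inv p"])
     (use poly_exp_inv_DERIV in blast)+

section \<open>Test functions and mollifiers\<close>

lemma test_fun_smooth: "test_fun \<phi> \<Longrightarrow> smooth_fun \<phi>"
  by (simp add: test_fun_def)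

lemma test_fun_support:
  assumes "test_fun \<phi>" obtains R where "R > 0" "\<And>x. R < \<bar>x\<bar> \<Longrightarrow> \<phi> x = 0"
proof -
  obtain R where "\<And>x. R < \<bar>x\<bar> \<Longrightarrow> \<phi> x = 0" using assms test_fun_def by blast
  then show ?thesis by (intro that[of "max R 1"]) auto
qed

lemma deriv_zero_outside:
  assumes "\<And>x. R < \<bar>x\<bar> \<Longrightarrow> \<phi> x = (0::real)" "R < \<bar>x\<bar>"
  shows "deriv \<phi> x = 0"
proof -
  have "open {y::real. R < \<bar>y\<bar>}" by (intro open_Collect_less continuous_intros)
  then have "(\<phi> has_real_derivative 0) (at x)"
    using has_field_derivative_transform_within_open[of "\<lambda>_. 0" 0 x "{y. R < \<bar>y\<bar>}" \<phi>] assms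
    by auto
  then show ?thesis by (rule DERIV_imp_deriv)
qed

lemma test_fun_deriv: "test_fun \<phi> \<Longrightarrow> test_fun (deriv \<phi>)"
  unfolding test_fun_def using deriv_zero_outside smooth_fun_deriv by metis

lemma test_fun_mult: "smooth_fun f \<Longrightarrow> test_fun \<phi> \<Longrightarrow> test_fun (\<lambda>x. f x * \<phi> x)"
  unfolding test_fun_def by (metis mult_zero_right smooth_fun_mult)

lemma test_fun_add: "test_fun \<phi> \<Longrightarrow> test_fun \<psi> \<Longrightarrow> test_fun (\<lambda>x. \<phi> x + \<psi> x)"
proof -
  assume *: "test_fun \<phi>" "test_fun \<psi>"
  obtain R S where "\<And>x. R < \<bar>x\<bar> \<Longrightarrow> \<phi> x = 0" "\<And>x. S < \<bar>x\<bar> \<Longrightarrow> \<psi> x = 0"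
    using * unfolding test_fun_def by blast
  then have "\<forall>x. max R S < \<bar>x\<bar> \<longrightarrow> \<phi> x + \<psi> x = 0" by simp
  then show ?thesis unfolding test_fun_def using * smooth_fun_add test_fun_smooth by blast
qed

lemma test_fun_translate: "test_fun \<phi> \<Longrightarrow> test_fun (\<lambda>y. \<phi> (y - x))"
proof -
  assume *: "test_fun \<phi>"
  obtain R where R: "\<And>x. R < \<bar>x\<bar> \<Longrightarrow> \<phi> x = 0" using * unfolding test_fun_def by blast
  have "\<forall>y. R + \<bar>x\<bar> < \<bar>y\<bar> \<longrightarrow> \<phi> (y - x) = 0" using R by (auto intro!: R)
  moreover have "smooth_fun (\<lambda>y. \<phi> (1 * y + (- x)))"
    using smooth_fun_affine * test_fun_smooth by blast
  ultimately show ?thesis unfolding test_fun_def by auto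
qed

lemma test_fun_scale:
  assumes "test_fun \<phi>" "c > 0" shows "test_fun (\<lambda>y. \<phi> (c * y))"
proof -
  obtain R where R: "\<And>x. R < \<bar>x\<bar> \<Longrightarrow> \<phi> x = 0" using assms unfolding test_fun_def by blast
  have "\<forall>y. R / c < \<bar>y\<bar> \<longrightarrow> \<phi> (c * y) = 0"
    using assms(2) by (auto intro!: R simp: abs_mult field_simps)
  moreover have "smooth_fun (\<lambda>y. \<phi> (c * y + 0))"
    using smooth_fun_affine assms test_fun_smooth by blast
  ultimately show ?thesis unfolding test_fun_def by auto
qed

lemma test_fun_bounded:
  assumes "test_fun \<phi>" obtains B where "B > 0" "\<And>x. \<bar>\<phi> x\<bar> \<le> B"
proof -
  obtain R where R: "R > 0" "\<And>x. R < \<bar>x\<bar> \<Longrightarrow> \<phi> x = 0" using test_fun_support assms by blast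
  have "compact (\<phi> ` {-R..R})"
    by (intro compact_continuous_image smooth_fun_continuous test_fun_smooth assms) auto
  then obtain B where B: "\<forall>y\<in>\<phi> ` {-R..R}. norm y \<le> B" using compact_imp_bounded bounded_iff by metis
  have "\<bar>\<phi> x\<bar> \<le> max B 1" for x
    using B R(2)[of x] by (cases "\<bar>x\<bar> \<le> R") (auto simp: le_max_iff_disj abs_le_iff)
  then show ?thesis by (intro that[of "max B 1"]) auto
qed

lemma bounded_support_integrable:
  fixes f :: "real \<Rightarrow> 'b::{banach, second_countable_topology}"
  assumes [measurable]: "f \<in> borel_measurable borel" and "\<And>x. norm (f x) \<le> B" "\<And>x. R < \<bar>x\<bar> \<Longrightarrow> f x = 0"
  shows "integrable lborel f"
proof (rule Bochner_Integration.integrable_bound[where f = "\<lambda>x. B * indicator {-R..R} x"])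
  show "integrable lborel (\<lambda>x. B * indicator {-R..R} x :: real)"
    by (intro integrable_mult_right integrable_real_indicator) (auto simp: emeasure_lborel_Icc_eq)
  show "AE x in lborel. norm (f x) \<le> norm (B * indicator {- R..R} x :: real)"
    using assms(2,3) order_trans[OF norm_ge_zero assms(2)]
    by (auto simp: indicator_def abs_le_iff split: if_splits; fastforce)
qed auto

lemma test_fun_integrable: "test_fun \<phi> \<Longrightarrow> integrable lborel \<phi>"
  by (metis bounded_support_integrable real_norm_def smooth_fun_measurable test_fun_bounded test_fun_smooth
      test_fun_support)

section \<open>Normalised bumps and their rescalings\<close>

definition bump :: "real \<Rightarrow> real" where
  "bump x = poly_exp_inv 1 (1 + x) * poly_exp_inv 1 (1 - x)"

lemma test_fun_bump: "test_fun bump"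
proof -
  have "smooth_fun (\<lambda>x. poly_exp_inv 1 (1 * x + 1) * poly_exp_inv 1 ((-1) * x + 1))"
    by (intro smooth_fun_mult smooth_fun_affine smooth_poly_exp_inv)
  moreover have "bump = (\<lambda>x. poly_exp_inv 1 (1 * x + 1) * poly_exp_inv 1 ((-1) * x + 1))"
    by (auto simp: bump_def add.commute)
  moreover have "\<forall>x. 1 < \<bar>x\<bar> \<longrightarrow> bump x = 0"
    by (auto simp: bump_def poly_exp_inv_def abs_if)
  ultimately show ?thesis unfolding test_fun_def by metis
qed

lemma bump_nonneg: "0 \<le> bump x" by (simp add: bump_def poly_exp_inv_def)

lemma bump_zero: "1 \<le> \<bar>x\<bar> \<Longrightarrow> bump x = 0" by (auto simp: bump_def poly_exp_inv_def abs_if split: if_splits)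

lemma bump_pos: "\<bar>x\<bar> < 1 \<Longrightarrow> 0 < bump x" by (auto simp: bump_def poly_exp_inv_def abs_if split: if_splits)

lemma integral_bump_pos: "0 < (\<integral>x. bump x \<partial>lborel)"
proof -
  have int: "integrable lborel bump" by (rule test_fun_integrable[OF test_fun_bump])
  have [measurable]: "bump \<in> borel_measurable borel"
    using test_fun_bump smooth_fun_measurable test_fun_smooth by blast
  have "(\<integral>x. bump x \<partial>lborel) \<noteq> 0"
  proof
    assume "(\<integral>x. bump x \<partial>lborel) = 0"
    then have "AE x in lborel. bump x = 0"
      using integral_nonneg_eq_0_iff_AE[OF int] bump_nonneg by simp
    then have "emeasure lborel {x \<in> space lborel. \<not> bump x = 0} = 0"
      by (subst (asm) AE_iff_measurable[OF _ refl]) auto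
    moreover have "emeasure lborel {-1/2..1/2::real} \<le> emeasure lborel {x \<in> space lborel. \<not> bump x = 0}"
      by (intro emeasure_mono) (auto intro!: less_imp_neq[symmetric] bump_pos)
    ultimately show False by simp
  qed
  moreover have "0 \<le> (\<integral>x. bump x \<partial>lborel)" by (simp add: bump_nonneg)
  ultimately show ?thesis by linarith
qed

definition std_bump :: "real \<Rightarrow> real" where
  "std_bump x = bump x / (\<integral>x. bump x \<partial>lborel)"

lemma test_fun_std_bump: "test_fun std_bump"
  using test_fun_mult[OF smooth_fun_const test_fun_bump, of "1 / (\<integral>x. bump x \<partial>lborel)"]
  unfolding std_bump_def by simp

lemma integral_std_bump: "(\<integral>x. std_bump x \<partial>lborel) = 1"
  using integral_bump_pos by (simp add: std_bump_def)

definition mollifier :: "nat \<Rightarrow> real \<Rightarrow> real" where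
  "mollifier n x = real (Suc n) * std_bump (real (Suc n) * x)"

lemma test_fun_mollifier: "test_fun (mollifier n)"
proof -
  have "test_fun (\<lambda>y. real (Suc n) * std_bump (real (Suc n) * y))"
    by (intro test_fun_mult smooth_fun_const test_fun_scale test_fun_std_bump) simp
  then show ?thesis by (simp add: mollifier_def[abs_def])
qed

lemma mollifier_nonneg: "0 \<le> mollifier n x"
  using integral_bump_pos by (simp add: mollifier_def std_bump_def bump_nonneg)

lemma mollifier_zero: "1 / real (Suc n) \<le> \<bar>x\<bar> \<Longrightarrow> mollifier n x = 0"
  by (simp add: mollifier_def std_bump_def bump_zero abs_mult field_simps)

lemma mollifier_zero_1: "1 \<le> \<bar>x\<bar> \<Longrightarrow> mollifier n x = 0"
  by (rule mollifier_zero, rule order_trans[of _ 1]) (auto simp: field_simps)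

lemma integral_mollifier: "(\<integral>x. mollifier n x \<partial>lborel) = 1"
  using lborel_integral_real_affine[of "real (Suc n)" std_bump 0]
  by (simp add: mollifier_def[abs_def] integral_std_bump)

lemma mollifier_measurable [measurable]: "mollifier n \<in> borel_measurable borel"
  using test_fun_mollifier smooth_fun_measurable test_fun_smooth by blast

lemma nn_integral_mollifier: "(\<integral>\<^sup>+x. mollifier n x \<partial>lborel) = 1"
  using nn_integral_eq_integral[OF test_fun_integrable[OF test_fun_mollifier]]
  by (simp add: integral_mollifier mollifier_nonneg)

section \<open>Local convergence in the mean\<close>

text \<open>Fatou's lemma for an almost everywhere limit and an eventual bound, the form in which
  estimates for truncations pass to their limits.\<close>

lemma nn_integral_AE_limit_le:
  assumes [measurable]: "\<And>i. u i \<in> borel_measurable M"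
    and lim: "AE x in M. (\<lambda>i. u i x) \<longlonglongrightarrow> v x"
    and le: "eventually (\<lambda>i::nat. (\<integral>\<^sup>+x. u i x \<partial>M) \<le> C) sequentially"
  shows "(\<integral>\<^sup>+x. v x \<partial>M) \<le> (C::ennreal)"
proof -
  have "(\<integral>\<^sup>+x. v x \<partial>M) = (\<integral>\<^sup>+x. liminf (\<lambda>i. u i x) \<partial>M)"
    by (rule nn_integral_cong_AE) (use lim in \<open>auto simp: lim_imp_Liminf\<close>)
  also have "\<dots> \<le> liminf (\<lambda>i. \<integral>\<^sup>+x. u i x \<partial>M)"
    by (rule nn_integral_liminf) measurable
  also have "\<dots> \<le> C"
    using le by (intro Liminf_le) auto
  finally show ?thesis .
qed

lemma ennreal_sandwich0:
  assumes "\<And>n. a n \<le> (b n :: ennreal)" "b \<longlonglongrightarrow> 0" shows "a \<longlonglongrightarrow> 0"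
  by (rule tendsto_sandwich[OF _ _ tendsto_const assms(2)]) (use assms(1) in auto)

lemma ennreal_pos_below: "0 < a \<Longrightarrow> \<exists>e>0. ennreal e < a"
proof -
  assume "0 < a"
  then obtain b where b: "0 < b" "b < a" using dense by blast
  then obtain e where "b = ennreal e" "0 \<le> e" by (cases b) auto
  then show ?thesis using b by (intro exI[of _ e]) (auto simp: less_le)
qed

text \<open>An almost everywhere convergent subsequence supplies the limit, and Fatou in one index
  of the Cauchy condition supplies the rate. The subsequence is part of the conclusion because it
  lets other bounds, such as square-mean bounds, be transferred to the same limit.\<close>

lemma L1_complete:
  fixes s :: "nat \<Rightarrow> 'a \<Rightarrow> 'b::{banach, second_countable_topology}"
  assumes int: "\<And>n. integrable M (s n)"
    and cauchy: "\<And>e. e > 0 \<Longrightarrow> \<exists>N. \<forall>i\<ge>N. \<forall>j\<ge>N. (\<integral>\<^sup>+x. norm (s i x - s j x) \<partial>M) \<le> ennreal e"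
  shows "\<exists>f. integrable M f \<and> (\<lambda>n. \<integral>\<^sup>+x. norm (s n x - f x) \<partial>M) \<longlonglongrightarrow> 0 \<and>
    (\<exists>r. strict_mono r \<and> (AE x in M. (\<lambda>i. s (r i) x) \<longlonglongrightarrow> f x))"
proof -
  note [measurable] = borel_measurable_integrable[OF int]
  have "\<exists>N. \<forall>i\<ge>N. \<forall>j\<ge>N. LINT x|M. norm (s i x - s j x) < e" if "e > 0" for e
  proof -
    obtain N where N: "\<forall>i\<ge>N. \<forall>j\<ge>N. (\<integral>\<^sup>+x. norm (s i x - s j x) \<partial>M) \<le> ennreal (e/2)"
      using cauchy[of "e/2"] \<open>e > 0\<close> by auto
    have "LINT x|M. norm (s i x - s j x) < e" if "i \<ge> N" "j \<ge> N" for i j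
    proof -
      have "ennreal (LINT x|M. norm (s i x - s j x)) = (\<integral>\<^sup>+x. norm (s i x - s j x) \<partial>M)"
        by (rule nn_integral_eq_integral[symmetric]) (auto intro!: integrable_norm Bochner_Integration.integrable_diff int)
      also have "\<dots> \<le> ennreal (e/2)" using N that by auto
      finally show ?thesis using \<open>e > 0\<close> by (simp add: ennreal_le_iff)
    qed
    then show ?thesis by blast
  qed
  from cauchy_L1_AE_cauchy_subseq[OF int this]
  obtain r where r: "strict_mono r" "AE x in M. Cauchy (\<lambda>i. s (r i) x)" by blast
  define f where "f x = lim (\<lambda>i. s (r i) x)" for x
  have [measurable]: "f \<in> borel_measurable M" unfolding f_def by measurable
  have lim: "AE x in M. (\<lambda>i. s (r i) x) \<longlonglongrightarrow> f x"
    using r(2) by eventually_elim (auto simp: f_def Cauchy_convergent_iff convergent_LIMSEQ_iff)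
  have small: "(\<integral>\<^sup>+x. norm (s n x - f x) \<partial>M) \<le> ennreal e"
    if N: "\<forall>i\<ge>N. \<forall>j\<ge>N. (\<integral>\<^sup>+x. norm (s i x - s j x) \<partial>M) \<le> ennreal e" and "n \<ge> N" for n N e
  proof (rule nn_integral_AE_limit_le[where u = "\<lambda>i x. norm (s n x - s (r i) x)"])
    show "AE x in M. (\<lambda>i. ennreal (norm (s n x - s (r i) x))) \<longlonglongrightarrow> ennreal (norm (s n x - f x))"
      using lim by eventually_elim (intro tendsto_intros)
    show "\<forall>\<^sub>F i in sequentially. (\<integral>\<^sup>+ x. ennreal (norm (s n x - s (r i) x)) \<partial>M) \<le> ennreal e"
      using eventually_ge_at_top[of N] by eventually_elim
        (use N \<open>n \<ge> N\<close> seq_suble[OF r(1)] le_trans in blast)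
  qed measurable
  have conv: "(\<lambda>n. \<integral>\<^sup>+x. norm (s n x - f x) \<partial>M) \<longlonglongrightarrow> 0"
  proof (rule order_tendstoI)
    fix a :: ennreal assume "0 < a"
    then obtain e where e: "0 < e" "ennreal e < a"
      using ennreal_pos_below by blast
    obtain N where N: "\<forall>i\<ge>N. \<forall>j\<ge>N. (\<integral>\<^sup>+x. norm (s i x - s j x) \<partial>M) \<le> ennreal e"
      using cauchy[OF e(1)] by auto
    show "\<forall>\<^sub>F n in sequentially. (\<integral>\<^sup>+x. norm (s n x - f x) \<partial>M) < a"
      using eventually_ge_at_top[of N] by eventually_elim (use small[OF N] e(2) in force)
  qed auto
  have "integrable M f"
  proof -
    obtain N where N: "\<forall>i\<ge>N. \<forall>j\<ge>N. (\<integral>\<^sup>+x. norm (s i x - s j x) \<partial>M) \<le> ennreal 1"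
      using cauchy[of 1] by auto
    have "(\<integral>\<^sup>+x. norm (s N x - f x) \<partial>M) < \<infinity>"
      using small[OF N, of N] by (simp add: less_top[symmetric] le_less_trans) (metis ennreal_one_less_top le_less_trans less_irrefl)
    then have "integrable M (\<lambda>x. s N x - f x)" by (intro integrableI_bounded) auto
    from Bochner_Integration.integrable_diff[OF int[of N] this] show ?thesis by simp
  qed
  then show ?thesis using conv lim r(1) by blast
qed

definition loc_int :: "(real \<Rightarrow> complex) \<Rightarrow> bool" where
  "loc_int f \<longleftrightarrow> (\<forall>R. set_integrable lborel {-R..R} f)"

definition locL1 :: "(nat \<Rightarrow> real \<Rightarrow> complex) \<Rightarrow> (real \<Rightarrow> complex) \<Rightarrow> bool" where
  "locL1 s f \<longleftrightarrow> (\<forall>R. (\<lambda>n. \<integral>\<^sup>+x. ennreal (cmod (s n x - f x)) * indicator {-R..R} x \<partial>lborel) \<longlonglongrightarrow> 0)"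

text \<open>Natural radii and precisions 1/(m+1) keep every quantifier countable, so that the
  condition is measurable when the sequence depends measurably on a parameter.\<close>

definition locCauchy :: "(nat \<Rightarrow> real \<Rightarrow> complex) \<Rightarrow> bool" where
  "locCauchy s \<longleftrightarrow> (\<forall>R m::nat. \<exists>N. \<forall>i\<ge>N. \<forall>j\<ge>N.
     (\<integral>\<^sup>+x. ennreal (cmod (s i x - s j x)) * indicator {-real R..real R} x \<partial>lborel) \<le> ennreal (1 / real (Suc m)))"

lemma loc_int_measurable:
  assumes "loc_int f" shows "f \<in> borel_measurable borel"
proof (rule borel_measurable_LIMSEQ_metric)
  show "(\<lambda>x. indicator {-real n..real n} x *\<^sub>R f x) \<in> borel_measurable borel" for n
    using borel_measurable_integrable[OF assms[unfolded loc_int_def set_integrable_def, THEN spec, of "real n"]]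
    by simp
  fix x :: real
  have "\<forall>\<^sub>F n in sequentially. indicator {-real n..real n} x *\<^sub>R f x = f x"
    using eventually_ge_at_top[of "nat \<lceil>\<bar>x\<bar>\<rceil>"] by eventually_elim (auto simp: indicator_def abs_le_iff; linarith)
  then show "(\<lambda>n. indicator {-real n..real n} x *\<^sub>R f x) \<longlonglongrightarrow> f x"
    by (rule tendsto_eventually)
qed

lemma loc_intI_bound:
  assumes [measurable]: "f \<in> borel_measurable borel"
    and "\<And>R. (\<integral>\<^sup>+x. ennreal (cmod (f x)) * indicator {-R..R} x \<partial>lborel) < \<infinity>"
  shows "loc_int f"
  unfolding loc_int_def set_integrable_def
proof (intro allI integrableI_bounded)
  fix R :: real
  have "(\<integral>\<^sup>+x. ennreal (norm (indicator {-R..R} x *\<^sub>R f x)) \<partial>lborel)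
      = (\<integral>\<^sup>+x. ennreal (cmod (f x)) * indicator {-R..R} x \<partial>lborel)"
    by (intro nn_integral_cong) (auto simp: indicator_def)
  then show "(\<integral>\<^sup>+x. ennreal (norm (indicator {-R..R} x *\<^sub>R f x)) \<partial>lborel) < \<infinity>" using assms(2) by simp
qed measurable

lemma loc_int_test_integrable:
  assumes "loc_int f" "test_fun \<phi>"
  shows "integrable lborel (\<lambda>x. f x * of_real (\<phi> x))"
proof -
  note [measurable] = loc_int_measurable[OF assms(1)] smooth_fun_measurable[OF test_fun_smooth[OF assms(2)]]
  obtain R where R: "\<And>x. R < \<bar>x\<bar> \<Longrightarrow> \<phi> x = 0" using assms(2) test_fun_support by blast
  obtain B where B: "\<And>x. \<bar>\<phi> x\<bar> \<le> B" "B > 0" using assms(2) test_fun_bounded by metis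
  have "integrable lborel (\<lambda>x. B *\<^sub>R (indicator {-R..R} x *\<^sub>R f x))"
    using assms(1) unfolding loc_int_def set_integrable_def by (intro integrable_scaleR_right) auto
  then show ?thesis
  proof (rule Bochner_Integration.integrable_bound)
    have "cmod (f x) * \<bar>\<phi> x\<bar> \<le> B * (indicator {-R..R} x * cmod (f x))" for x
      using R[of x] mult_left_mono[OF B(1)[of x], of "cmod (f x)"]
      by (auto simp: indicator_def mult.commute abs_le_iff)
    then show "AE x in lborel. norm (f x * of_real (\<phi> x)) \<le> norm (B *\<^sub>R (indicator {-R..R} x *\<^sub>R f x))"
      using B(2) by (auto simp: norm_mult mult.assoc)
  qed measurable
qed

lemma locL1_unique:
  assumes f: "locL1 s f" and g: "locL1 s g"
    and [measurable]: "\<And>n. s n \<in> borel_measurable borel" "f \<in> borel_measurable borel" "g \<in> borel_measurable borel"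
  shows "AE x in lborel. f x = g x"
proof -
  have zero: "(\<integral>\<^sup>+x. ennreal (cmod (f x - g x)) * indicator {-R..R} x \<partial>lborel) = 0" for R
  proof -
    have "(\<integral>\<^sup>+x. ennreal (cmod (f x - g x)) * indicator {-R..R} x \<partial>lborel) \<le>
       (\<integral>\<^sup>+x. ennreal (cmod (s n x - f x)) * indicator {-R..R} x \<partial>lborel)
       + (\<integral>\<^sup>+x. ennreal (cmod (s n x - g x)) * indicator {-R..R} x \<partial>lborel)" for n
    proof (subst nn_integral_add[symmetric])
      have "cmod (f x - g x) \<le> cmod (s n x - f x) + cmod (s n x - g x)" for x
        using norm_triangle_ineq4[of "s n x - g x" "s n x - f x"] by (simp add: algebra_simps)
      then show "(\<integral>\<^sup>+x. ennreal (cmod (f x - g x)) * indicator {-R..R} x \<partial>lborel) \<le>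
        (\<integral>\<^sup>+x. ennreal (cmod (s n x - f x)) * indicator {-R..R} x + ennreal (cmod (s n x - g x)) * indicator {-R..R} x \<partial>lborel)"
        by (intro nn_integral_mono) (auto simp: indicator_def simp flip: ennreal_plus intro!: ennreal_leI)
    qed measurable
    moreover have "(\<lambda>n. (\<integral>\<^sup>+x. ennreal (cmod (s n x - f x)) * indicator {-R..R} x \<partial>lborel)
       + (\<integral>\<^sup>+x. ennreal (cmod (s n x - g x)) * indicator {-R..R} x \<partial>lborel)) \<longlonglongrightarrow> 0 + 0"
      using f g unfolding locL1_def by (intro tendsto_add) auto
    ultimately show ?thesis
      using LIMSEQ_le_const[of _ "0::ennreal"] by (simp only: add.right_neutral) (meson le_zero_eq)
  qed
  have "AE x in lborel. \<forall>R::nat. x \<in> {-real R..real R} \<longrightarrow> f x = g x"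
  proof (subst AE_all_countable, rule allI)
    fix R :: nat
    have "AE x in lborel. ennreal (cmod (f x - g x)) * indicator {-real R..real R} x = 0"
      using zero[of "real R"] by (subst (asm) nn_integral_0_iff_AE) auto
    then show "AE x in lborel. x \<in> {-real R..real R} \<longrightarrow> f x = g x"
      by eventually_elim (auto simp: indicator_def split: if_splits)
  qed
  then show ?thesis
  proof eventually_elim
    case (elim x)
    obtain R :: nat where "\<bar>x\<bar> \<le> real R" using real_arch_simple by blast
    then show ?case using elim by (auto simp: abs_le_iff)
  qed
qed

text \<open>Completeness on each interval with natural radius, followed by patching of the
  limits.\<close>

lemma loc_complete:
  assumes s: "\<And>n. loc_int (s n)" and c: "locCauchy s"
  shows "\<exists>f. loc_int f \<and> locL1 s f"
proof -
  note [measurable] = loc_int_measurable[OF s]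
  have "\<exists>g. integrable lborel g \<and> (\<lambda>n. \<integral>\<^sup>+x. norm (indicator {-real R..real R} x *\<^sub>R s n x - g x) \<partial>lborel) \<longlonglongrightarrow> 0" for R :: nat
  proof -
    have "\<exists>g. integrable lborel g \<and> (\<lambda>n. \<integral>\<^sup>+x. norm (indicator {-real R..real R} x *\<^sub>R s n x - g x) \<partial>lborel) \<longlonglongrightarrow> 0 \<and>
      (\<exists>r. strict_mono r \<and> (AE x in lborel. (\<lambda>i. indicator {-real R..real R} x *\<^sub>R s (r i) x) \<longlonglongrightarrow> g x))"
    proof (rule L1_complete)
      show "integrable lborel (\<lambda>x. indicator {-real R..real R} x *\<^sub>R s n x)" for n
        using s unfolding loc_int_def set_integrable_def by auto
      fix e :: real assume "e > 0"
      then obtain m where m: "1 / real (Suc m) < e" using nat_approx_posE by blast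
      obtain N where N: "\<forall>i\<ge>N. \<forall>j\<ge>N.
        (\<integral>\<^sup>+x. ennreal (cmod (s i x - s j x)) * indicator {-real R..real R} x \<partial>lborel) \<le> ennreal (1 / real (Suc m))"
        using c unfolding locCauchy_def by metis
      have eq: "(\<integral>\<^sup>+x. norm (indicator {-real R..real R} x *\<^sub>R s i x - indicator {-real R..real R} x *\<^sub>R s j x) \<partial>lborel)
        = (\<integral>\<^sup>+x. ennreal (cmod (s i x - s j x)) * indicator {-real R..real R} x \<partial>lborel)" for i j
        by (intro nn_integral_cong) (auto simp: indicator_def)
      show "\<exists>N. \<forall>i\<ge>N. \<forall>j\<ge>N. (\<integral>\<^sup>+x. norm (indicator {-real R..real R} x *\<^sub>R s i x - indicator {-real R..real R} x *\<^sub>R s j x) \<partial>lborel) \<le> ennreal e"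
        unfolding eq using N m by (meson ennreal_leI less_imp_le order_trans)
    qed
    then show ?thesis by blast
  qed
  then have all: "\<forall>R::nat. \<exists>g. integrable lborel g \<and>
    (\<lambda>n. \<integral>\<^sup>+x. norm (indicator {-real R..real R} x *\<^sub>R s n x - g x) \<partial>lborel) \<longlonglongrightarrow> 0" by (rule allI)
  from choice[OF all] obtain g where g': "\<forall>R::nat. integrable lborel (g R) \<and>
    (\<lambda>n. \<integral>\<^sup>+x. norm (indicator {-real R..real R} x *\<^sub>R s n x - g R x) \<partial>lborel) \<longlonglongrightarrow> 0"
    by (elim exE)
  note g = g'[THEN spec, THEN conjunct1] g'[THEN spec, THEN conjunct2]
  note [measurable] = borel_measurable_integrable[OF g(1)]
  \<comment> \<open>The local limits are not compared on overlaps. Each x uses the single radius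
    \<lceil>|x|\<rceil>, and on [-R, R] only finitely many radii occur, so the error is at most a
    finite sum of errors that tend to 0.\<close>
  define f where "f x = g (nat \<lceil>\<bar>x\<bar>\<rceil>) x" for x
  have [measurable]: "f \<in> borel_measurable borel"
  proof -
    have "(\<lambda>x. g (nat \<lceil>\<bar>x\<bar>\<rceil>) x) \<in> borel_measurable lborel"
      by (rule measurable_compose_countable) measurable
    then show ?thesis by (simp add: f_def[abs_def])
  qed
  have pt: "x \<in> {-real (nat \<lceil>\<bar>x\<bar>\<rceil>)..real (nat \<lceil>\<bar>x\<bar>\<rceil>)}" for x :: real by (auto; linarith)
  have le: "nat \<lceil>\<bar>x\<bar>\<rceil> \<le> nat \<lceil>R\<rceil>" if "x \<in> {-R..R}" for x R :: real
    using that by (intro nat_mono ceiling_mono) auto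
  have conv: "locL1 s f"
    unfolding locL1_def
  proof
    fix R :: real
    let ?N = "nat \<lceil>R\<rceil>"
    have bound: "(\<integral>\<^sup>+x. ennreal (cmod (s n x - f x)) * indicator {-R..R} x \<partial>lborel)
      \<le> (\<Sum>r\<le>?N. \<integral>\<^sup>+x. norm (indicator {-real r..real r} x *\<^sub>R s n x - g r x) \<partial>lborel)" for n
    proof (subst nn_integral_sum[symmetric])
      show "(\<integral>\<^sup>+x. ennreal (cmod (s n x - f x)) * indicator {-R..R} x \<partial>lborel)
        \<le> (\<integral>\<^sup>+x. (\<Sum>r\<le>?N. ennreal (norm (indicator {-real r..real r} x *\<^sub>R s n x - g r x))) \<partial>lborel)"
      proof (intro nn_integral_mono)
        fix x :: real
        show "ennreal (cmod (s n x - f x)) * indicator {-R..R} x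
          \<le> (\<Sum>r\<le>?N. ennreal (norm (indicator {-real r..real r} x *\<^sub>R s n x - g r x)))"
        proof (cases "x \<in> {-R..R}")
          case True
          have "ennreal (cmod (s n x - f x)) = ennreal (norm (indicator {-real (nat \<lceil>\<bar>x\<bar>\<rceil>)..real (nat \<lceil>\<bar>x\<bar>\<rceil>)} x *\<^sub>R s n x - g (nat \<lceil>\<bar>x\<bar>\<rceil>) x))"
            using pt[of x] by (simp add: f_def)
          also have "\<dots> \<le> (\<Sum>r\<le>?N. ennreal (norm (indicator {-real r..real r} x *\<^sub>R s n x - g r x)))"
            by (rule member_le_sum) (use le[OF True] in auto)
          finally show ?thesis using True by simp
        qed simp
      qed
    qed measurable
    have "(\<lambda>n. \<Sum>r\<le>?N. \<integral>\<^sup>+x. norm (indicator {-real r..real r} x *\<^sub>R s n x - g r x) \<partial>lborel) \<longlonglongrightarrow> (\<Sum>r\<le>?N. 0)"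
      by (intro tendsto_sum g(2))
    then show "(\<lambda>n. \<integral>\<^sup>+x. ennreal (cmod (s n x - f x)) * indicator {-R..R} x \<partial>lborel) \<longlonglongrightarrow> 0"
      using ennreal_sandwich0[OF bound] by simp
  qed
  have "loc_int f"
  proof (rule loc_intI_bound)
    fix R :: real
    let ?N = "nat \<lceil>R\<rceil>"
    have "(\<integral>\<^sup>+x. ennreal (cmod (f x)) * indicator {-R..R} x \<partial>lborel) \<le> (\<integral>\<^sup>+x. (\<Sum>r\<le>?N. ennreal (cmod (g r x))) \<partial>lborel)"
    proof (intro nn_integral_mono)
      fix x :: real
      show "ennreal (cmod (f x)) * indicator {-R..R} x \<le> (\<Sum>r\<le>?N. ennreal (cmod (g r x)))"
      proof (cases "x \<in> {-R..R}")
        case True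
        have "ennreal (cmod (g (nat \<lceil>\<bar>x\<bar>\<rceil>) x)) \<le> (\<Sum>r\<le>?N. ennreal (cmod (g r x)))"
          by (rule member_le_sum) (use le[OF True] in auto)
        then show ?thesis using True by (simp add: f_def)
      qed simp
    qed
    also have "\<dots> = (\<Sum>r\<le>?N. \<integral>\<^sup>+x. ennreal (cmod (g r x)) \<partial>lborel)" by (rule nn_integral_sum) measurable
    also have "\<dots> < \<infinity>" using g(1) by (simp add: integrable_iff_bounded less_top)
    finally show "(\<integral>\<^sup>+x. ennreal (cmod (f x)) * indicator {-R..R} x \<partial>lborel) < \<infinity>" .
  qed measurable
  then show ?thesis using conv by blast
qed

lemma locL1_imp_locCauchy:
  assumes c: "locL1 s f" and [measurable]: "\<And>n. s n \<in> borel_measurable borel" "f \<in> borel_measurable borel"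
  shows "locCauchy s"
  unfolding locCauchy_def
proof (intro allI)
  fix R m :: nat
  let ?d = "\<lambda>i. \<integral>\<^sup>+x. ennreal (cmod (s i x - f x)) * indicator {-real R..real R} x \<partial>lborel"
  have "\<forall>\<^sub>F n in sequentially. ?d n < ennreal (1 / (2 * real (Suc m)))"
    using c unfolding locL1_def by (intro order_tendstoD(2)) auto
  then obtain N where N: "\<And>n. n \<ge> N \<Longrightarrow> ?d n < ennreal (1 / (2 * real (Suc m)))"
    unfolding eventually_sequentially by blast
  have "(\<integral>\<^sup>+x. ennreal (cmod (s i x - s j x)) * indicator {-real R..real R} x \<partial>lborel) \<le> ennreal (1 / real (Suc m))"
    if "i \<ge> N" "j \<ge> N" for i j
  proof -
    have "cmod (s i x - s j x) \<le> cmod (s i x - f x) + cmod (s j x - f x)" for x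
      using norm_triangle_ineq4[of "s i x - f x" "s j x - f x"] by (simp add: algebra_simps)
    then have "(\<integral>\<^sup>+x. ennreal (cmod (s i x - s j x)) * indicator {-real R..real R} x \<partial>lborel) \<le>
       (\<integral>\<^sup>+x. ennreal (cmod (s i x - f x)) * indicator {-real R..real R} x + ennreal (cmod (s j x - f x)) * indicator {-real R..real R} x \<partial>lborel)"
      by (intro nn_integral_mono) (auto simp: indicator_def simp flip: ennreal_plus intro!: ennreal_leI)
    also have "\<dots> = ?d i + ?d j" by (intro nn_integral_add) measurable
    also have "\<dots> \<le> ennreal (1 / (2 * real (Suc m))) + ennreal (1 / (2 * real (Suc m)))"
      using N that by (intro add_mono less_imp_le) auto
    also have "\<dots> = ennreal (1 / real (Suc m))" by (simp flip: ennreal_plus add: field_simps)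
    finally show ?thesis .
  qed
  then show "\<exists>N. \<forall>i\<ge>N. \<forall>j\<ge>N. (\<integral>\<^sup>+x. ennreal (cmod (s i x - s j x)) * indicator {-real R..real R} x \<partial>lborel) \<le> ennreal (1 / real (Suc m))"
    by blast
qed

text \<open>Lower semicontinuity of the p-th power integral under local mean convergence: on a
  bounded interval a subsequence converges almost everywhere, so Fatou applies, and then the
  interval is exhausted. Bounds for partial sums reach the full function in this way.\<close>

lemma locL1_Fatou:
  assumes c: "locL1 s f" and s: "\<And>n. loc_int (s n)" and f: "loc_int f"
    and B: "eventually (\<lambda>n. (\<integral>\<^sup>+x. ennreal (cmod (s n x) ^ p) \<partial>lborel) \<le> B) sequentially"
  shows "(\<integral>\<^sup>+x. ennreal (cmod (f x) ^ p) \<partial>lborel) \<le> B"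
proof -
  note [measurable] = loc_int_measurable[OF s] loc_int_measurable[OF f]
  have R: "(\<integral>\<^sup>+x. ennreal (cmod (f x) ^ p) * indicator {-R..R} x \<partial>lborel) \<le> B" for R
  proof -
    let ?u = "\<lambda>n x. indicator {-R..R} x *\<^sub>R (s n x - f x)"
    have int: "integrable lborel (?u n)" for n
      using s f unfolding loc_int_def set_integrable_def
      by (auto simp: scaleR_diff_right intro!: Bochner_Integration.integrable_diff)
    have "(\<lambda>n. \<integral>\<^sup>+x. norm (?u n x) \<partial>lborel) = (\<lambda>n. \<integral>\<^sup>+x. ennreal (cmod (s n x - f x)) * indicator {-R..R} x \<partial>lborel)"
      by (intro ext nn_integral_cong) (auto simp: indicator_def)
    then have "(\<lambda>n. \<integral>\<^sup>+x. norm (?u n x) \<partial>lborel) \<longlonglongrightarrow> 0" using c unfolding locL1_def by simp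
    moreover have "(\<integral>\<^sup>+x. norm (?u n x) \<partial>lborel) = ennreal (\<integral>x. norm (?u n x) \<partial>lborel)" for n
      by (intro nn_integral_eq_integral integrable_norm int) auto
    ultimately have "(\<lambda>n. ennreal (\<integral>x. norm (?u n x) \<partial>lborel)) \<longlonglongrightarrow> ennreal 0" by simp
    then have "(\<lambda>n. \<integral>x. norm (?u n x) \<partial>lborel) \<longlonglongrightarrow> 0"
      by (subst (asm) tendsto_ennreal_iff) (auto intro!: always_eventually)
    from tendsto_L1_AE_subseq[OF int this]
    obtain r where r: "strict_mono r" "AE x in lborel. (\<lambda>n. ?u (r n) x) \<longlonglongrightarrow> 0" by blast
    show ?thesis
    proof (rule nn_integral_AE_limit_le[where u = "\<lambda>n x. ennreal (cmod (s (r n) x) ^ p) * indicator {-R..R} x"])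
      show "AE x in lborel. (\<lambda>n. ennreal (cmod (s (r n) x) ^ p) * indicator {-R..R} x)
          \<longlonglongrightarrow> ennreal (cmod (f x) ^ p) * indicator {-R..R} x"
        using r(2)
      proof eventually_elim
        case (elim x)
        show ?case
        proof (cases "x \<in> {-R..R}")
          case True
          then have "(\<lambda>n. s (r n) x - f x) \<longlonglongrightarrow> 0" using elim by simp
          then have "(\<lambda>n. s (r n) x) \<longlonglongrightarrow> f x" by (rule LIM_zero_cancel)
          then show ?thesis using True by (auto intro!: tendsto_intros)
        qed simp
      qed
      have "\<forall>\<^sub>F n in sequentially. (\<integral>\<^sup>+x. ennreal (cmod (s (r n) x) ^ p) \<partial>lborel) \<le> B"
        using eventually_subseq[OF r(1) B] .
      then show "\<forall>\<^sub>F n in sequentially. (\<integral>\<^sup>+x. ennreal (cmod (s (r n) x) ^ p) * indicator {-R..R} x \<partial>lborel) \<le> B"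
      proof eventually_elim
        case (elim n)
        have "(\<integral>\<^sup>+x. ennreal (cmod (s (r n) x) ^ p) * indicator {-R..R} x \<partial>lborel) \<le> (\<integral>\<^sup>+x. ennreal (cmod (s (r n) x) ^ p) \<partial>lborel)"
          by (intro nn_integral_mono) (auto simp: indicator_def)
        then show ?case using elim by order
      qed
    qed measurable
  qed
  show ?thesis
  proof (rule nn_integral_AE_limit_le[where u = "\<lambda>n x. ennreal (cmod (f x) ^ p) * indicator {-real n..real n} x"])
    have "(\<lambda>n. ennreal (cmod (f x) ^ p) * indicator {-real n..real n} x) \<longlonglongrightarrow> ennreal (cmod (f x) ^ p)" for x
    proof (rule tendsto_eventually)
      show "\<forall>\<^sub>F n in sequentially. ennreal (cmod (f x) ^ p) * indicator {-real n..real n} x = ennreal (cmod (f x) ^ p)"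
        using eventually_ge_at_top[of "nat \<lceil>\<bar>x\<bar>\<rceil>"]
        by eventually_elim (auto simp: indicator_def abs_le_iff; linarith)
    qed
    then show "AE x in lborel. (\<lambda>n. ennreal (cmod (f x) ^ p) * indicator {-real n..real n} x) \<longlonglongrightarrow> ennreal (cmod (f x) ^ p)"
      by auto
  qed (use R in auto)
qed

section \<open>Approximation by mollification\<close>

text \<open>Continuity of translations in the mean, by induction over integrable functions. For
  indicators, outer regularity replaces the set by an open one, whose indicator does converge
  pointwise under small shifts at its own points.\<close>

lemma L1_translation_seq:
  fixes f :: "real \<Rightarrow> complex" and z :: "nat \<Rightarrow> real"
  assumes f: "integrable lborel f" and z: "z \<longlonglongrightarrow> 0"
  shows "(\<lambda>n. \<integral>\<^sup>+x. cmod (f (x + z n) - f x) \<partial>lborel) \<longlonglongrightarrow> 0"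
  using f
proof (induction rule: integrable_induct)
  case (base A c)
  have [measurable]: "A \<in> sets borel" using base by simp
  have "\<forall>\<^sub>F n in sequentially. (\<integral>\<^sup>+x. cmod (indicator A (x + z n) *\<^sub>R c - indicator A x *\<^sub>R c) \<partial>lborel) < a" if "a > 0" for a
  proof -
    obtain e where e: "e > 0" "ennreal (3 * e * cmod c) < a"
    proof -
      obtain b where b: "b > 0" "ennreal b < a"
        using ennreal_pos_below \<open>a > 0\<close> by blast
      have "3 * (b / (3 * (cmod c + 1))) * cmod c \<le> b"
        using b mult_left_mono[of "cmod c" "cmod c + 1" b] by (simp add: divide_le_eq add_nonneg_pos algebra_simps not_less)
      then show ?thesis using b
        by (intro that[of "b / (3 * (cmod c + 1))"]) (auto simp: add_nonneg_pos intro: le_less_trans[OF ennreal_leI])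
    qed
    obtain U where U: "open U" "A \<subseteq> U" "emeasure lborel (U - A) < ennreal e"
      using outer_regular_lborel[of A e] e(1) by auto
    have [measurable]: "U \<in> sets borel" using U(1) by auto
    have finU: "emeasure lborel U < \<infinity>"
    proof -
      have "emeasure lborel U = emeasure lborel A + emeasure lborel (U - A)"
        using U(2) by (subst plus_emeasure) (auto intro!: arg_cong[where f = "emeasure lborel"])
      then show ?thesis using base U(3) by (auto simp: less_top[symmetric] ennreal_add_eq_top)
    qed
    \<comment> \<open>Indicator of the part of \<open>U\<close> that the shift moves out of
      \<open>U\<close>; it tends to 0 pointwise because \<open>U\<close> is open.\<close>
    define h where "h n x = (indicator U x * (1 - indicator U (x + z n)) :: real)" for n x
    have [measurable]: "h n \<in> borel_measurable borel" for n unfolding h_def[abs_def] by measurable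

    have "(\<lambda>n. \<integral>\<^sup>+x. norm (0 - h n x) \<partial>lborel) \<longlonglongrightarrow> 0"
    proof (rule nn_integral_dominated_convergence_norm[where w = "indicator U" and u' = "\<lambda>_. 0"])
      show "AE x in lborel. norm (h j x) \<le> indicator U x" for j by (auto simp: h_def indicator_def)
      show "(\<integral>\<^sup>+x. ennreal (indicator U x) \<partial>lborel) < \<infinity>"
        using finU by (simp add: ennreal_indicator)
      have "(\<lambda>i. h i x) \<longlonglongrightarrow> 0" for x
      proof (cases "x \<in> U")
        case True
        have "(\<lambda>n. x + z n) \<longlonglongrightarrow> x + 0" by (intro tendsto_intros z)
        then have "\<forall>\<^sub>F n in sequentially. x + z n \<in> U"
          using True U(1) topological_tendstoD by fastforce
        then have "\<forall>\<^sub>F n in sequentially. h n x = 0" by eventually_elim (simp add: h_def)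
        then show ?thesis by (rule tendsto_eventually)
      qed (simp add: h_def)
      then show "AE x in lborel. (\<lambda>i. h i x) \<longlonglongrightarrow> 0" by simp
    qed measurable
    then have hlim: "(\<lambda>n. \<integral>\<^sup>+x. h n x \<partial>lborel) \<longlonglongrightarrow> 0"
      by (auto simp: h_def indicator_def if_distrib cong: if_cong)
    \<comment> \<open>Since \<open>U\<close> and its translate have equal finite measure, the
      symmetric difference has twice the measure of the one-sided difference.\<close>
    have dU: "(\<integral>\<^sup>+x. \<bar>indicator U (x + z n) - indicator U x :: real\<bar> \<partial>lborel) = 2 * (\<integral>\<^sup>+x. h n x \<partial>lborel)" for n
    proof -
      have shift: "(\<integral>\<^sup>+x. ennreal (indicator U (x + z n)) \<partial>lborel) = emeasure lborel U"
        using nn_integral_real_affine[of "\<lambda>x. ennreal (indicator U x)" 1 "z n"]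
        by (simp add: ennreal_indicator add.commute)
      have "(\<integral>\<^sup>+x. \<bar>indicator U (x + z n) - indicator U x :: real\<bar> \<partial>lborel) + emeasure lborel U
         = (\<integral>\<^sup>+x. ennreal \<bar>indicator U (x + z n) - indicator U x :: real\<bar> + ennreal (indicator U x) \<partial>lborel)"
        by (subst nn_integral_add) (auto simp: ennreal_indicator)
      also have "\<dots> = (\<integral>\<^sup>+x. 2 * ennreal (h n x) + ennreal (indicator U (x + z n)) \<partial>lborel)"
        by (intro nn_integral_cong) (auto simp: h_def indicator_def simp flip: ennreal_plus)
      also have "\<dots> = 2 * (\<integral>\<^sup>+x. h n x \<partial>lborel) + emeasure lborel U"
        by (subst nn_integral_add) (auto simp: nn_integral_cmult shift)
      finally show ?thesis using finU
        by (subst (asm) (1 2) add.commute, subst (asm) ennreal_add_left_cancel) auto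
    qed
    have bound: "(\<integral>\<^sup>+x. cmod (indicator A (x + z n) *\<^sub>R c - indicator A x *\<^sub>R c) \<partial>lborel)
       \<le> cmod c * (2 * (\<integral>\<^sup>+x. h n x \<partial>lborel) + 2 * ennreal e)" for n
    proof -
      have "(\<integral>\<^sup>+x. cmod (indicator A (x + z n) *\<^sub>R c - indicator A x *\<^sub>R c) \<partial>lborel)
        \<le> (\<integral>\<^sup>+x. cmod c * (ennreal \<bar>indicator U (x + z n) - indicator U x :: real\<bar>
             + (ennreal (indicator (U - A) (x + z n)) + ennreal (indicator (U - A) x))) \<partial>lborel)"
        using U(2)
        by (intro nn_integral_mono) (auto simp: indicator_def simp flip: ennreal_plus ennreal_mult)
      also have "\<dots> = cmod c * ((\<integral>\<^sup>+x. \<bar>indicator U (x + z n) - indicator U x :: real\<bar> \<partial>lborel)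
          + ((\<integral>\<^sup>+x. ennreal (indicator (U - A) (x + z n)) \<partial>lborel) + (\<integral>\<^sup>+x. ennreal (indicator (U - A) x) \<partial>lborel)))"
        by (simp add: nn_integral_cmult nn_integral_add)
      also have "(\<integral>\<^sup>+x. ennreal (indicator (U - A) (x + z n)) \<partial>lborel) = emeasure lborel (U - A)"
        using nn_integral_real_affine[of "\<lambda>x. ennreal (indicator (U - A) x)" 1 "z n"]
        by (simp add: ennreal_indicator add.commute)
      also have "(\<integral>\<^sup>+x. ennreal (indicator (U - A) x) \<partial>lborel) = emeasure lborel (U - A)"
        by (simp add: ennreal_indicator)
      also have "emeasure lborel (U - A) + emeasure lborel (U - A) \<le> 2 * ennreal e"
        unfolding mult_2 by (intro add_mono less_imp_le U(3))
      finally show ?thesis unfolding dU by (simp add: mult_left_mono)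
    qed
    have "(\<lambda>n. cmod c * (2 * (\<integral>\<^sup>+x. h n x \<partial>lborel) + 2 * ennreal e)) \<longlonglongrightarrow> cmod c * (2 * 0 + 2 * ennreal e)"
      by (intro ennreal_tendsto_cmult tendsto_add tendsto_const hlim) auto
    moreover have "ennreal (cmod c) * (2 * 0 + 2 * ennreal e) < a"
    proof -
      have "ennreal (cmod c) * (2 * 0 + 2 * ennreal e) = ennreal (cmod c * (2 * e))"
        using e(1) by (simp add: ennreal_mult)
      also have "\<dots> \<le> ennreal (3 * e * cmod c)" using e(1) by (intro ennreal_leI) (simp add: mult_right_mono)
      finally show ?thesis using e(2) by order
    qed
    ultimately have "\<forall>\<^sub>F n in sequentially. cmod c * (2 * (\<integral>\<^sup>+x. h n x \<partial>lborel) + 2 * ennreal e) < a"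
      by (rule order_tendstoD(2))
    then show ?thesis by eventually_elim (use bound in \<open>meson le_less_trans\<close>)
  qed
  then show ?case by (intro order_tendstoI) auto
next
  case (add f g)
  have [measurable]: "f \<in> borel_measurable borel" "g \<in> borel_measurable borel"
    using add by (auto dest: borel_measurable_integrable)
  have "(\<integral>\<^sup>+x. cmod (f (x + z n) + g (x + z n) - (f x + g x)) \<partial>lborel)
     \<le> (\<integral>\<^sup>+x. cmod (f (x + z n) - f x) \<partial>lborel) + (\<integral>\<^sup>+x. cmod (g (x + z n) - g x) \<partial>lborel)" for n
    using norm_diff_triangle_ineq
    by (subst nn_integral_add[symmetric]) (auto intro!: nn_integral_mono ennreal_leI simp flip: ennreal_plus)
  then show ?case
    by (rule ennreal_sandwich0) (use tendsto_add[OF add(3) add(4)] in simp)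
next
  case (lim f s)
  have [measurable]: "f \<in> borel_measurable borel" "\<And>i. s i \<in> borel_measurable borel"
    using lim by (auto dest: borel_measurable_integrable)
  have "(\<lambda>i. \<integral>\<^sup>+x. norm (f x - s i x) \<partial>lborel) \<longlonglongrightarrow> 0"
  proof (rule nn_integral_dominated_convergence_norm[where w = "\<lambda>x. 2 * norm (f x)"])
    show "(\<integral>\<^sup>+ x. ennreal (2 * cmod (f x)) \<partial>lborel) < \<infinity>"
      using lim(4) by (auto simp: integrable_iff_bounded ennreal_mult nn_integral_cmult ennreal_mult_less_top)
  qed (use lim in auto)
  have "\<forall>\<^sub>F n in sequentially. (\<integral>\<^sup>+x. cmod (f (x + z n) - f x) \<partial>lborel) < a" if "a > 0" for a
  proof -
    obtain e where e: "e > 0" "ennreal e < a" using ennreal_pos_below[OF \<open>a > 0\<close>] by blast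
    have "\<forall>\<^sub>F i in sequentially. (\<integral>\<^sup>+x. norm (f x - s i x) \<partial>lborel) < ennreal (e/3)"
      using \<open>(\<lambda>i. \<integral>\<^sup>+x. norm (f x - s i x) \<partial>lborel) \<longlonglongrightarrow> 0\<close> e by (intro order_tendstoD(2)) auto
    then obtain i where i: "(\<integral>\<^sup>+x. norm (f x - s i x) \<partial>lborel) < ennreal (e/3)"
      unfolding eventually_sequentially by blast
    have "\<forall>\<^sub>F n in sequentially. (\<integral>\<^sup>+x. cmod (s i (x + z n) - s i x) \<partial>lborel) < ennreal (e/3)"
      using lim(5)[of i] e by (intro order_tendstoD(2)) auto
    then show ?thesis
    proof eventually_elim
      case (elim n)
      have shift: "(\<integral>\<^sup>+x. norm (f (x + z n) - s i (x + z n)) \<partial>lborel) = (\<integral>\<^sup>+x. norm (f x - s i x) \<partial>lborel)"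
        using nn_integral_real_affine[of "\<lambda>x. ennreal (norm (f x - s i x))" 1 "z n"]
        by (simp add: add.commute)
      have tri: "cmod (f (x + z n) - f x) \<le> norm (f (x + z n) - s i (x + z n)) + (norm (s i (x + z n) - s i x) + norm (f x - s i x))" for x
        using norm_triangle_ineq[of "f (x + z n) - s i (x + z n)" "s i (x + z n) - f x"]
          norm_triangle_ineq4[of "s i (x + z n) - s i x" "f x - s i x"] by (simp add: algebra_simps)
      have "(\<integral>\<^sup>+x. cmod (f (x + z n) - f x) \<partial>lborel) \<le>
         (\<integral>\<^sup>+x. ennreal (norm (f (x + z n) - s i (x + z n))) + (ennreal (norm (s i (x + z n) - s i x)) + ennreal (norm (f x - s i x))) \<partial>lborel)"
        using tri by (intro nn_integral_mono) (auto simp flip: ennreal_plus intro!: ennreal_leI)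
      also have "\<dots> = (\<integral>\<^sup>+x. norm (f x - s i x) \<partial>lborel) + ((\<integral>\<^sup>+x. cmod (s i (x + z n) - s i x) \<partial>lborel) + (\<integral>\<^sup>+x. norm (f x - s i x) \<partial>lborel))"
        by (subst nn_integral_add, simp, simp, subst nn_integral_add) (auto simp: shift)
      also have "\<dots> \<le> ennreal (e/3) + (ennreal (e/3) + ennreal (e/3))"
        using i elim by (intro add_mono less_imp_le) auto
      also have "\<dots> = ennreal e" using e(1) by (simp flip: ennreal_plus)
      finally show ?case using e(2) by order
    qed
  qed
  then show ?case by (intro order_tendstoI) auto
qed

lemma L1_translation:
  fixes f :: "real \<Rightarrow> complex"
  assumes f: "integrable lborel f" and e: "e > 0"
  shows "\<exists>d>0. \<forall>z. \<bar>z\<bar> < d \<longrightarrow> (\<integral>\<^sup>+x. cmod (f (x + z) - f x) \<partial>lborel) \<le> ennreal e"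
proof (rule ccontr)
  assume "\<not> ?thesis"
  then have "\<exists>z. \<bar>z\<bar> < 1 / real (Suc n) \<and> \<not> (\<integral>\<^sup>+x. cmod (f (x + z) - f x) \<partial>lborel) \<le> ennreal e" for n
    by (simp only: not_ex de_Morgan_conj not_all not_imp) (use zero_less_divide_1_iff[of "real (Suc n)"] in force)
  then have all: "\<forall>n. \<exists>z. \<bar>z\<bar> < 1 / real (Suc n) \<and> \<not> (\<integral>\<^sup>+x. cmod (f (x + z) - f x) \<partial>lborel) \<le> ennreal e"
    by (rule allI)
  obtain z where z': "\<forall>n. \<bar>z n\<bar> < 1 / real (Suc n) \<and> \<not> (\<integral>\<^sup>+x. cmod (f (x + z n) - f x) \<partial>lborel) \<le> ennreal e"
    using choice[OF all] by (elim exE)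
  note z = z'[THEN spec, THEN conjunct1] z'[THEN spec, THEN conjunct2]
  have "z \<longlonglongrightarrow> 0"
    by (rule Lim_null_comparison[OF _ LIMSEQ_inverse_real_of_nat])
       (use z(1) in \<open>auto intro!: always_eventually simp: less_imp_le inverse_eq_divide\<close>)
  from order_tendstoD(2)[OF L1_translation_seq[OF f this], of "ennreal e"] e
  have "\<forall>\<^sub>F n in sequentially. (\<integral>\<^sup>+x. cmod (f (x + z n) - f x) \<partial>lborel) < ennreal e" by simp
  then obtain n where "(\<integral>\<^sup>+x. cmod (f (x + z n) - f x) \<partial>lborel) < ennreal e"
    unfolding eventually_sequentially by blast
  then show False using z(2)[of n] by (simp add: less_imp_le)
qed

text \<open>The kernel is evaluated at y - x, so that the value at x is the pairing of f with a
  translated test function and is determined by the distribution f alone.\<close>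

definition mollify :: "nat \<Rightarrow> (real \<Rightarrow> complex) \<Rightarrow> real \<Rightarrow> complex" where
  "mollify n f x = (\<integral>y. f y * of_real (mollifier n (y - x)) \<partial>lborel)"

lemma mollify_measurable:
  assumes [measurable]: "f \<in> borel_measurable borel" shows "mollify n f \<in> borel_measurable borel"
proof -
  have "(\<lambda>x. \<integral>y. f y * of_real (mollifier n (y - x)) \<partial>lborel) \<in> borel_measurable lborel"
    by (rule lborel.borel_measurable_lebesgue_integral) measurable
  then show ?thesis by (simp add: mollify_def[abs_def])
qed

lemma mollify_alt: "mollify n f x = (\<integral>z. f (x + z) * of_real (mollifier n z) \<partial>lborel)"
  unfolding mollify_def
  by (subst lborel_integral_real_affine[where c = 1 and t = x]) auto

lemma loc_int_translate_integrable:
  assumes "loc_int f" "test_fun \<phi>"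
  shows "integrable lborel (\<lambda>z. f (x + z) * of_real (\<phi> z))"
proof -
  have "integrable lborel (\<lambda>y. f y * of_real (\<phi> (y - x)))"
    by (rule loc_int_test_integrable[OF assms(1) test_fun_translate[OF assms(2)]])
  then have "integrable lborel (\<lambda>z. f (x + 1 * z) * of_real (\<phi> (x + 1 * z - x)))"
    by (rule lborel_integrable_real_affine) simp
  then show ?thesis by simp
qed

lemma integrable_imp_loc_int: "integrable lborel f \<Longrightarrow> loc_int f"
  unfolding loc_int_def set_integrable_def by (auto intro!: integrable_mult_indicator)

lemma mollify_L1:
  assumes f: "integrable lborel f"
  shows "(\<lambda>n. \<integral>\<^sup>+x. cmod (mollify n f x - f x) \<partial>lborel) \<longlonglongrightarrow> 0"
proof (rule order_tendstoI)
  have [measurable]: "f \<in> borel_measurable borel" using f by (auto dest: borel_measurable_integrable)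
  fix a :: ennreal assume "0 < a"
  then obtain e where e: "e > 0" "ennreal e < a" using ennreal_pos_below by blast
  obtain d where d: "d > 0" "\<And>z. \<bar>z\<bar> < d \<Longrightarrow> (\<integral>\<^sup>+x. cmod (f (x + z) - f x) \<partial>lborel) \<le> ennreal e"
    using L1_translation[OF f e(1)] by blast
  obtain N where N: "1 / real (Suc N) < d" using nat_approx_posE[OF d(1)] by blast
  show "\<forall>\<^sub>F n in sequentially. (\<integral>\<^sup>+x. cmod (mollify n f x - f x) \<partial>lborel) < a"
    using eventually_ge_at_top[of N]
  proof eventually_elim
    case (elim n)
    have nd: "1 / real (Suc n) < d" using N elim by (meson Suc_le_mono divide_left_mono le_less_trans mult_pos_pos of_nat_0_less_iff of_nat_mono zero_le_one zero_less_Suc)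
    have pt: "cmod (mollify n f x - f x) \<le> (\<integral>\<^sup>+z. ennreal (mollifier n z) * cmod (f (x + z) - f x) \<partial>lborel)" for x
    proof -
      have i1: "integrable lborel (\<lambda>z. f (x + z) * of_real (mollifier n z))"
        by (intro loc_int_translate_integrable integrable_imp_loc_int f test_fun_mollifier)
      have i2: "integrable lborel (\<lambda>z. f x * of_real (mollifier n z))"
        by (intro integrable_mult_right integrable_of_real test_fun_integrable test_fun_mollifier)
      have "mollify n f x - f x = (\<integral>z. f (x + z) * of_real (mollifier n z) \<partial>lborel) - (\<integral>z. f x * of_real (mollifier n z) \<partial>lborel)"
        by (simp add: mollify_alt integral_mollifier)
      also have "\<dots> = (\<integral>z. (f (x + z) - f x) * of_real (mollifier n z) \<partial>lborel)"
        by (subst Bochner_Integration.integral_diff[symmetric, OF i1 i2]) (simp add: algebra_simps)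
      finally have eq: "mollify n f x - f x = (\<integral>z. (f (x + z) - f x) * of_real (mollifier n z) \<partial>lborel)" .
      have "integrable lborel (\<lambda>z. (f (x + z) - f x) * of_real (mollifier n z))"
        using Bochner_Integration.integrable_diff[OF i1 i2] by (simp add: algebra_simps)
      from integral_norm_bound_ennreal[OF this]
      show ?thesis unfolding eq
        by (auto simp: norm_mult mollifier_nonneg ennreal_mult mult.commute elim!: order_trans intro!: nn_integral_mono)
    qed
    have "(\<integral>\<^sup>+x. cmod (mollify n f x - f x) \<partial>lborel) \<le> (\<integral>\<^sup>+x. \<integral>\<^sup>+z. ennreal (mollifier n z) * cmod (f (x + z) - f x) \<partial>lborel \<partial>lborel)"
      by (intro nn_integral_mono pt)
    also have "\<dots> = (\<integral>\<^sup>+z. \<integral>\<^sup>+x. ennreal (mollifier n z) * cmod (f (x + z) - f x) \<partial>lborel \<partial>lborel)"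
      by (rule lborel_pair.Fubini') measurable
    also have "\<dots> = (\<integral>\<^sup>+z. ennreal (mollifier n z) * (\<integral>\<^sup>+x. cmod (f (x + z) - f x) \<partial>lborel) \<partial>lborel)"
      by (intro nn_integral_cong nn_integral_cmult) measurable
    also have "\<dots> \<le> (\<integral>\<^sup>+z. ennreal (mollifier n z) * ennreal e \<partial>lborel)"
    proof (intro nn_integral_mono)
      fix z
      show "ennreal (mollifier n z) * (\<integral>\<^sup>+x. cmod (f (x + z) - f x) \<partial>lborel) \<le> ennreal (mollifier n z) * ennreal e"
      proof (cases "\<bar>z\<bar> < d")
        case True
        then show ?thesis by (intro mult_left_mono d(2)) auto
      next
        case False
        then have "mollifier n z = 0" using nd by (intro mollifier_zero) linarith
        then show ?thesis by simp
      qed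
    qed
    also have "\<dots> = ennreal e" by (simp add: nn_integral_multc nn_integral_mollifier)
    finally show ?case using e(2) by order
  qed
qed auto

text \<open>All mollifiers vanish outside [-1, 1], so values at distance more than 1 do not enter.
  Local statements thereby reduce to integrable functions.\<close>

lemma mollify_cutoff:
  assumes "x \<in> {-R..R}"
  shows "mollify n (\<lambda>y. indicator {-(R+1)..R+1} y *\<^sub>R f y) x = mollify n f x"
  unfolding mollify_def
proof (intro Bochner_Integration.integral_cong refl)
  fix y
  show "(indicator {- (R + 1)..R + 1} y *\<^sub>R f y) * of_real (mollifier n (y - x)) = f y * of_real (mollifier n (y - x))"
    using assms mollifier_zero_1[of "y - x" n] by (auto simp: indicator_def)
qed

lemma mollify_locL1:
  assumes f: "loc_int f" shows "locL1 (\<lambda>n. mollify n f) f"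
  unfolding locL1_def
proof
  fix R :: real
  let ?g = "\<lambda>y. indicator {-(R+1)..R+1} y *\<^sub>R f y"
  have "integrable lborel ?g" using f unfolding loc_int_def set_integrable_def by blast
  then have lim: "(\<lambda>n. \<integral>\<^sup>+x. cmod (mollify n ?g x - ?g x) \<partial>lborel) \<longlonglongrightarrow> 0" by (rule mollify_L1)
  have "(\<integral>\<^sup>+x. ennreal (cmod (mollify n f x - f x)) * indicator {-R..R} x \<partial>lborel) \<le> (\<integral>\<^sup>+x. cmod (mollify n ?g x - ?g x) \<partial>lborel)" for n
    using mollify_cutoff[of _ R n f] by (intro nn_integral_mono) (auto simp: indicator_def)
  then show "(\<lambda>n. \<integral>\<^sup>+x. ennreal (cmod (mollify n f x - f x)) * indicator {-R..R} x \<partial>lborel) \<longlonglongrightarrow> 0"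
    by (rule ennreal_sandwich0[OF _ lim])
qed

text \<open>Jensen's inequality for exponents that are powers of two, by iterating Cauchy-Schwarz;
  the exponents in play are 1, 2 and 4.\<close>

lemma nn_integral_power2_le:
  assumes "prob_space M" and [measurable]: "f \<in> borel_measurable M"
  shows "(\<integral>\<^sup>+x. f x \<partial>M) ^ (2 ^ k) \<le> (\<integral>\<^sup>+x. f x ^ (2 ^ k) \<partial>M)"
proof (induction k)
  case (Suc k)
  interpret prob_space M by fact
  have "(\<integral>\<^sup>+x. f x \<partial>M) ^ (2 ^ Suc k) \<le> ((\<integral>\<^sup>+x. f x ^ (2 ^ k) \<partial>M))\<^sup>2"
    using power_mono[OF Suc, of 2] by (simp add: power_mult[symmetric] mult.commute)
  also have "\<dots> \<le> (\<integral>\<^sup>+x. f x ^ (2 ^ Suc k) \<partial>M)"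
    using Cauchy_Schwarz_nn_integral[of "\<lambda>x. f x ^ (2 ^ k)" M "\<lambda>_. 1"]
    by (simp add: emeasure_space_1 power_mult[symmetric] mult.commute)
  finally show ?case .
qed simp

text \<open>A mollification is an average of translates against a probability density, and
  translation preserves the integral, so Jensen and Fubini give a contraction.\<close>

lemma mollify_norm_le:
  assumes f: "loc_int f"
  shows "(\<integral>\<^sup>+x. ennreal (cmod (mollify n f x) ^ (2 ^ k)) \<partial>lborel) \<le> (\<integral>\<^sup>+x. ennreal (cmod (f x) ^ (2 ^ k)) \<partial>lborel)"
proof -
  note [measurable] = loc_int_measurable[OF f]
  let ?D = "density lborel (\<lambda>z. ennreal (mollifier n z))"
  have D: "prob_space ?D" by (rule prob_spaceI) (simp add: emeasure_density nn_integral_mollifier)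
  have pt: "ennreal (cmod (mollify n f x) ^ (2 ^ k)) \<le> (\<integral>\<^sup>+z. ennreal (mollifier n z) * cmod (f (x + z)) ^ (2 ^ k) \<partial>lborel)" for x
  proof -
    have "ennreal (cmod (mollify n f x)) \<le> (\<integral>\<^sup>+z. cmod (f (x + z) * of_real (mollifier n z)) \<partial>lborel)"
      unfolding mollify_alt by (intro integral_norm_bound_ennreal loc_int_translate_integrable f test_fun_mollifier)
    also have "\<dots> = (\<integral>\<^sup>+z. cmod (f (x + z)) \<partial>?D)"
      by (subst nn_integral_density) (auto simp: norm_mult mollifier_nonneg ennreal_mult mult.commute intro!: nn_integral_cong)
    finally have "ennreal (cmod (mollify n f x)) ^ (2 ^ k) \<le> (\<integral>\<^sup>+z. cmod (f (x + z)) \<partial>?D) ^ (2 ^ k)"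
      by (intro power_mono) auto
    also have "\<dots> \<le> (\<integral>\<^sup>+z. ennreal (cmod (f (x + z))) ^ (2 ^ k) \<partial>?D)"
      by (rule nn_integral_power2_le[OF D]) measurable
    also have "\<dots> = (\<integral>\<^sup>+z. ennreal (mollifier n z) * cmod (f (x + z)) ^ (2 ^ k) \<partial>lborel)"
      by (subst nn_integral_density) (auto simp: ennreal_power)
    finally show ?thesis by (simp add: ennreal_power)
  qed
  have "(\<integral>\<^sup>+x. ennreal (cmod (mollify n f x) ^ (2 ^ k)) \<partial>lborel)
     \<le> (\<integral>\<^sup>+x. \<integral>\<^sup>+z. ennreal (mollifier n z) * cmod (f (x + z)) ^ (2 ^ k) \<partial>lborel \<partial>lborel)"
    by (intro nn_integral_mono pt)
  also have "\<dots> = (\<integral>\<^sup>+z. \<integral>\<^sup>+x. ennreal (mollifier n z) * cmod (f (x + z)) ^ (2 ^ k) \<partial>lborel \<partial>lborel)"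
    by (rule lborel_pair.Fubini') measurable
  also have "\<dots> = (\<integral>\<^sup>+z. ennreal (mollifier n z) * (\<integral>\<^sup>+x. cmod (f (x + z)) ^ (2 ^ k) \<partial>lborel) \<partial>lborel)"
    by (intro nn_integral_cong nn_integral_cmult) measurable
  also have "\<dots> = (\<integral>\<^sup>+z. ennreal (mollifier n z) * (\<integral>\<^sup>+x. cmod (f x) ^ (2 ^ k) \<partial>lborel) \<partial>lborel)"
  proof (rule nn_integral_cong, rule arg_cong2[where f = times, OF refl])
    fix z
    show "(\<integral>\<^sup>+x. ennreal (cmod (f (x + z)) ^ (2 ^ k)) \<partial>lborel) = (\<integral>\<^sup>+x. ennreal (cmod (f x) ^ (2 ^ k)) \<partial>lborel)"
      using nn_integral_real_affine[of "\<lambda>x. ennreal (cmod (f x) ^ (2 ^ k))" 1 z] by (simp add: add.commute)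
  qed
  also have "\<dots> = (\<integral>\<^sup>+x. ennreal (cmod (f x) ^ (2 ^ k)) \<partial>lborel)"
    by (simp add: nn_integral_multc nn_integral_mollifier)
  finally show ?thesis .
qed

text \<open>Equal pairings give equal mollifications, and these converge locally to both
  functions.\<close>

lemma test_fun_unique:
  assumes f: "loc_int f" and g: "loc_int g"
    and eq: "\<And>\<phi>. test_fun \<phi> \<Longrightarrow> (\<integral>x. f x * of_real (\<phi> x) \<partial>lborel) = (\<integral>x. g x * of_real (\<phi> x) \<partial>lborel)"
  shows "AE x in lborel. f x = g x"
proof (rule locL1_unique[where s = "\<lambda>n. mollify n f"])
  have "mollify n f = mollify n g" for n
    unfolding mollify_def[abs_def] by (intro ext eq test_fun_translate test_fun_mollifier)
  then show "locL1 (\<lambda>n. mollify n f) g" using mollify_locL1[OF g] by simp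
qed (use f g mollify_locL1 mollify_measurable loc_int_measurable in auto)

lemma mollify_loc_int:
  assumes f: "loc_int f" shows "loc_int (mollify n f)"
proof (rule loc_intI_bound)
  show "mollify n f \<in> borel_measurable borel" by (intro mollify_measurable loc_int_measurable f)
  fix R :: real
  let ?g = "\<lambda>y. indicator {-(R+1)..R+1} y *\<^sub>R f y"
  have g: "integrable lborel ?g" using f unfolding loc_int_def set_integrable_def by blast
  have "(\<integral>\<^sup>+x. ennreal (cmod (mollify n f x)) * indicator {-R..R} x \<partial>lborel) \<le> (\<integral>\<^sup>+x. cmod (mollify n ?g x) \<partial>lborel)"
    using mollify_cutoff[of _ R n f] by (intro nn_integral_mono) (auto simp: indicator_def)
  also have "\<dots> \<le> (\<integral>\<^sup>+x. cmod (?g x) \<partial>lborel)"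
    using mollify_norm_le[OF integrable_imp_loc_int[OF g], of n 0] by simp
  also have "\<dots> < \<infinity>" using g by (simp add: integrable_iff_bounded)
  finally show "(\<integral>\<^sup>+x. ennreal (cmod (mollify n f x)) * indicator {-R..R} x \<partial>lborel) < \<infinity>" .
qed

section \<open>Regularity of weak solutions\<close>

lemma compact_FTC:
  fixes F :: "real \<Rightarrow> 'a::euclidean_space"
  assumes F: "\<And>x. (F has_vector_derivative f x) (at x)" and f: "continuous_on UNIV f"
    and z: "\<And>x. R < \<bar>x\<bar> \<Longrightarrow> F x = 0"
  shows "integrable lborel f" "(\<integral>x. f x \<partial>lborel) = 0"
proof -
  define S where "S = \<bar>R\<bar> + 1"
  have S: "0 < S" "R < S" by (auto simp: S_def)
  have f0: "f x = 0" if "R < \<bar>x\<bar>" for x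
  proof -
    have "open {y::real. R < \<bar>y\<bar>}" by (intro open_Collect_less continuous_intros)
    then have "(F has_vector_derivative 0) (at x)"
      using has_vector_derivative_transform_within_open[of "\<lambda>_. 0" 0 x "{y. R < \<bar>y\<bar>}" F] z that by auto
    then show ?thesis using F vector_derivative_unique_at by blast
  qed
  have eq: "(\<lambda>x. indicator {-S..S} x *\<^sub>R f x) = f"
  proof
    fix x show "indicator {-S..S} x *\<^sub>R f x = f x"
      using f0[of x] S by (cases "\<bar>x\<bar> \<le> S") (auto simp: indicator_def abs_le_iff)
  qed
  have c: "continuous_on {-S..S} f" using f continuous_on_subset by blast
  show "integrable lborel f"
    using borel_integrable_compact[of "{-S..S}" f] c eq by simp
  have "(\<integral>x. indicator {-S..S} x *\<^sub>R f x \<partial>lborel) = F S - F (-S)"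
    using S by (intro integral_FTC_atLeastAtMost has_vector_derivative_at_within[OF F] c) auto
  then show "(\<integral>x. f x \<partial>lborel) = 0" using z[of S] z[of "-S"] S unfolding eq by simp
qed

lemma antiderivative_exists:
  fixes f :: "real \<Rightarrow> 'a::euclidean_space"
  assumes "continuous_on UNIV f"
  shows "\<exists>F. \<forall>x. (F has_vector_derivative f x) (at x)"
  using einterval_antiderivative[of "-\<infinity>" \<infinity> f] assms by (simp add: continuous_on_eq_continuous_at)

lemma has_vector_derivative_continuous_on:
  "(\<And>x. (F has_vector_derivative f x) (at x)) \<Longrightarrow> continuous_on A (F :: real \<Rightarrow> 'a::real_normed_vector)"
  by (meson continuous_at_imp_continuous_on has_vector_derivative_continuous)

lemma test_fun_DERIV: "test_fun \<phi> \<Longrightarrow> (\<phi> has_vector_derivative deriv \<phi> x) (at x)"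
  by (simp add: smooth_fun_DERIV test_fun_smooth flip: has_real_derivative_iff_has_vector_derivative)

text \<open>An antiderivative is constant on each side of the support; vanishing of the integral
  makes the two constants equal, and subtracting them leaves bounded support.\<close>

lemma test_fun_primitive:
  assumes \<phi>: "test_fun \<phi>" and zero: "(\<integral>x. \<phi> x \<partial>lborel) = 0"
  shows "\<exists>\<Phi>. test_fun \<Phi> \<and> deriv \<Phi> = \<phi>"
proof -
  have cont: "continuous_on UNIV \<phi>" using \<phi> smooth_fun_continuous test_fun_smooth by blast
  obtain F where F: "\<And>x. (F has_vector_derivative \<phi> x) (at x)" using antiderivative_exists[OF cont] by blast
  then have Fd: "\<And>x. (F has_real_derivative \<phi> x) (at x)"
    by (simp add: has_real_derivative_iff_has_vector_derivative)
  obtain R where R: "R > 0" "\<And>x. R < \<bar>x\<bar> \<Longrightarrow> \<phi> x = 0" using test_fun_support[OF \<phi>] by blast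
  have right: "F x = F (R + 1)" if "x > R" for x
  proof (rule DERIV_zero_connected_constant[of "{R<..}" "{}" F])
    show "continuous_on {R<..} F" using has_vector_derivative_continuous_on[OF F] .
    show "\<forall>x\<in>{R<..} - {}. (F has_real_derivative 0) (at x)"
    proof
      fix x assume "x \<in> {R<..} - {}" then show "(F has_real_derivative 0) (at x)"
        using Fd[of x] R(2)[of x] by simp
    qed
  qed (use that in auto)
  have left: "F x = F (- R - 1)" if "x < - R" for x
  proof (rule DERIV_zero_connected_constant[of "{..<-R}" "{}" F])
    show "continuous_on {..<-R} F" using has_vector_derivative_continuous_on[OF F] .
    show "\<forall>x\<in>{..<-R} - {}. (F has_real_derivative 0) (at x)"
    proof
      fix x assume "x \<in> {..<-R} - {}" then show "(F has_real_derivative 0) (at x)"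
        using Fd[of x] R(2)[of x] R(1) by simp
    qed
  qed (use that in auto)
  have eq: "(\<lambda>x. indicator {-R-1..R+1} x *\<^sub>R \<phi> x) = \<phi>"
  proof
    fix x show "indicator {-R-1..R+1} x *\<^sub>R \<phi> x = \<phi> x"
      using R(2)[of x] by (cases "\<bar>x\<bar> \<le> R") (auto simp: indicator_def abs_le_iff)
  qed
  have "(\<integral>x. indicator {-R-1..R+1} x *\<^sub>R \<phi> x \<partial>lborel) = F (R + 1) - F (- R - 1)"
    using R(1) by (intro integral_FTC_atLeastAtMost has_vector_derivative_at_within[OF F] continuous_on_subset[OF cont]) auto
  then have ends: "F (R + 1) = F (- R - 1)" unfolding eq using zero by simp
  define \<Phi> where "\<Phi> x = F x - F (R + 1)" for x
  have d: "(\<Phi> has_real_derivative \<phi> x) (at x)" for x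
    unfolding \<Phi>_def[abs_def] by (auto intro!: derivative_eq_intros Fd)
  have "smooth_fun \<Phi>" by (rule smooth_fun_intro_DERIV[OF d test_fun_smooth[OF \<phi>]])
  moreover have "\<forall>x. R < \<bar>x\<bar> \<longrightarrow> \<Phi> x = 0"
  proof (intro allI impI)
    fix x assume "R < \<bar>x\<bar>"
    then consider "x > R" | "x < - R" by linarith
    then show "\<Phi> x = 0"
    proof cases
      case 1 then show ?thesis using right[of x] by (simp add: \<Phi>_def)
    next
      case 2 then show ?thesis using left[of x] ends by (simp add: \<Phi>_def)
    qed
  qed
  moreover have "deriv \<Phi> = \<phi>" using d DERIV_imp_deriv by blast
  ultimately show ?thesis unfolding test_fun_def by blast
qed

lemma test_fun_integral_deriv: "test_fun \<phi> \<Longrightarrow> (\<integral>x. deriv \<phi> x \<partial>lborel) = 0"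
  by (metis compact_FTC(2) smooth_fun_continuous smooth_fun_deriv test_fun_DERIV test_fun_smooth test_fun_support)

lemma deriv_add_test:
  "test_fun \<phi> \<Longrightarrow> test_fun \<psi> \<Longrightarrow> deriv (\<lambda>x. \<phi> x + c * \<psi> x) = (\<lambda>x. deriv \<phi> x + c * deriv \<psi> x)"
  by (rule ext, rule DERIV_imp_deriv)
     (auto intro!: derivative_eq_intros smooth_fun_DERIV test_fun_smooth)

lemma test_fun_lin: "test_fun \<phi> \<Longrightarrow> test_fun \<psi> \<Longrightarrow> test_fun (\<lambda>x. \<phi> x + c * \<psi> x)"
  by (intro test_fun_add test_fun_mult smooth_fun_const)

text \<open>Every test function is a second derivative up to a combination of a fixed bump and its
  derivative, with coefficients given by the moments of order \<open>0\<close> and \<open>1\<close>.\<close>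

lemma du_bois_reymond_second:
  assumes w: "loc_int w"
    and orth: "\<And>\<phi>. test_fun \<phi> \<Longrightarrow> (\<integral>x. w x * of_real (deriv (deriv \<phi>) x) \<partial>lborel) = 0"
  shows "\<exists>A B. AE x in lborel. w x = A + B * of_real x"
proof -
  let ?\<psi> = std_bump
  note \<psi> = test_fun_std_bump
  have wi: "integrable lborel (\<lambda>x. w x * of_real (\<phi> x))" if "test_fun \<phi>" for \<phi>
    using loc_int_test_integrable[OF w that] .
  have id_test: "test_fun (\<lambda>x. x * \<phi> x)" if "test_fun \<phi>" for \<phi>
    using test_fun_mult[OF smooth_fun_ident that] .
  define m where "m = (\<integral>x. x * ?\<psi> x \<partial>lborel)"
  define p where "p = (\<integral>x. w x * of_real (?\<psi> x) \<partial>lborel)"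
  define q where "q = (\<integral>x. w x * of_real (deriv ?\<psi> x) \<partial>lborel)"
  \<comment> \<open>\<open>A\<close> and \<open>B\<close> are the values forced by pairing w with a
    second derivative plus \<open>a * ?\<psi>\<close> plus \<open>b\<close> times the derivative of
    \<open>?\<psi>\<close>, once \<open>b\<close> is expressed through the moments of the test
    function.\<close>
  define A where "A = p + q * of_real m"
  define B where "B = - q"
  have lin: "loc_int (\<lambda>x. A + B * of_real x)"
    unfolding loc_int_def by (intro allI borel_integrable_atLeastAtMost' continuous_intros)
  have "(\<integral>x. w x * of_real (\<phi> x) \<partial>lborel) = (\<integral>x. (A + B * of_real x) * of_real (\<phi> x) \<partial>lborel)"
    if \<phi>: "test_fun \<phi>" for \<phi>
  proof -
    note int = test_fun_integrable
    define a where "a = (\<integral>x. \<phi> x \<partial>lborel)"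
    define \<phi>1 where "\<phi>1 = (\<lambda>x. \<phi> x + (- a) * ?\<psi> x)"
    have t1: "test_fun \<phi>1" unfolding \<phi>1_def by (rule test_fun_lin[OF \<phi> \<psi>])
    have "(\<integral>x. \<phi>1 x \<partial>lborel) = 0"
      unfolding \<phi>1_def using int[OF \<phi>] int[OF \<psi>] by (simp add: a_def integral_std_bump)
    then obtain \<Phi>1 where P1: "test_fun \<Phi>1" "deriv \<Phi>1 = \<phi>1" using test_fun_primitive[OF t1] by blast
    define b where "b = (\<integral>x. \<Phi>1 x \<partial>lborel)"
    define \<phi>2 where "\<phi>2 = (\<lambda>x. \<Phi>1 x + (- b) * ?\<psi> x)"
    have t2: "test_fun \<phi>2" unfolding \<phi>2_def by (rule test_fun_lin[OF P1(1) \<psi>])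
    have "(\<integral>x. \<phi>2 x \<partial>lborel) = 0"
      unfolding \<phi>2_def using int[OF P1(1)] int[OF \<psi>] by (simp add: b_def integral_std_bump)
    then obtain \<Phi>2 where P2: "test_fun \<Phi>2" "deriv \<Phi>2 = \<phi>2" using test_fun_primitive[OF t2] by blast
    have dd: "deriv (deriv \<Phi>2) x = \<phi> x - a * ?\<psi> x - b * deriv ?\<psi> x" for x
      unfolding P2(2) \<phi>2_def deriv_add_test[OF P1(1) \<psi>] P1(2) by (simp add: \<phi>1_def)
    have xd: "deriv (\<lambda>x. x * \<Phi>1 x) = (\<lambda>x. \<Phi>1 x + x * \<phi>1 x)"
      by (rule ext, rule DERIV_imp_deriv)
         (use smooth_fun_DERIV[OF test_fun_smooth[OF P1(1)]] in \<open>auto intro!: derivative_eq_intros simp: P1(2)\<close>)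
    \<comment> \<open>Integrating the derivative of x \<open>\<Phi>1\<close> gives 0, which turns
      the mean \<open>b\<close> of \<open>\<Phi>1\<close> into a first moment.\<close>
    have "0 = (\<integral>x. \<Phi>1 x + x * \<phi>1 x \<partial>lborel)"
      using test_fun_integral_deriv[OF id_test[OF P1(1)]] unfolding xd by simp
    also have "\<dots> = b + (\<integral>x. x * \<phi>1 x \<partial>lborel)"
      using int[OF P1(1)] int[OF id_test[OF t1]] by (simp add: b_def)
    also have "(\<integral>x. x * \<phi>1 x \<partial>lborel) = (\<integral>x. x * \<phi> x - a * (x * ?\<psi> x) \<partial>lborel)"
      by (intro Bochner_Integration.integral_cong) (auto simp: \<phi>1_def algebra_simps)
    also have "\<dots> = (\<integral>x. x * \<phi> x \<partial>lborel) - a * m"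
      using int[OF id_test[OF \<phi>]] int[OF id_test[OF \<psi>]] by (simp add: m_def)
    finally have b: "b = a * m - (\<integral>x. x * \<phi> x \<partial>lborel)" by simp
    have "0 = (\<integral>x. w x * of_real (\<phi> x - a * ?\<psi> x - b * deriv ?\<psi> x) \<partial>lborel)"
      using orth[OF P2(1)] unfolding dd by simp
    also have "\<dots> = (\<integral>x. w x * of_real (\<phi> x) - of_real a * (w x * of_real (?\<psi> x)) - of_real b * (w x * of_real (deriv ?\<psi> x)) \<partial>lborel)"
      by (intro Bochner_Integration.integral_cong) (auto simp: algebra_simps)
    also have "\<dots> = (\<integral>x. w x * of_real (\<phi> x) \<partial>lborel) - of_real a * p - of_real b * q"
      using wi[OF \<phi>] wi[OF \<psi>] wi[OF test_fun_deriv[OF \<psi>]] by (simp add: p_def q_def)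
    finally have "(\<integral>x. w x * of_real (\<phi> x) \<partial>lborel) = of_real a * A + B * of_real (\<integral>x. x * \<phi> x \<partial>lborel)"
      by (simp add: b A_def B_def algebra_simps)
    also have "\<dots> = (\<integral>x. A * of_real (\<phi> x) + B * of_real (x * \<phi> x) \<partial>lborel)"
      using int[OF \<phi>] int[OF id_test[OF \<phi>]]
      by (subst Bochner_Integration.integral_add)
         (auto simp: a_def simp del: of_real_mult intro!: integrable_mult_right integrable_of_real)
    also have "\<dots> = (\<integral>x. (A + B * of_real x) * of_real (\<phi> x) \<partial>lborel)"
      by (intro Bochner_Integration.integral_cong) (auto simp: algebra_simps)
    finally show ?thesis .
  qed
  from test_fun_unique[OF w lin this] show ?thesis by blast
qed

text \<open>For every \<open>y\<close> the kernel below is, as a function of \<open>x\<close>, a fundamental solution of the second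
  derivative with pole \<open>y\<close>; it is chosen so that for every \<open>x\<close> it has bounded support in \<open>y\<close>.\<close>

definition antideriv_kernel :: "real \<Rightarrow> real \<Rightarrow> real" where
  "antideriv_kernel x y = (if 0 \<le> y then max 0 (x - y) else max 0 (y - x))"

lemma antideriv_kernel_measurable [measurable]:
  "(\<lambda>p. antideriv_kernel (fst p) (snd p)) \<in> borel_measurable (borel \<Otimes>\<^sub>M borel)"
  "antideriv_kernel x \<in> borel_measurable borel" "(\<lambda>x. antideriv_kernel x y) \<in> borel_measurable borel"
  unfolding antideriv_kernel_def by measurable

lemma antideriv_kernel_bound:
  assumes "\<bar>x\<bar> \<le> R" shows "0 \<le> antideriv_kernel x y" "antideriv_kernel x y \<le> R * indicator {-R..R} y"
  using assms by (auto simp: antideriv_kernel_def indicator_def)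

lemma antideriv_kernel_lipschitz: "\<bar>antideriv_kernel x y - antideriv_kernel x' y\<bar> \<le> \<bar>x - x'\<bar>"
  by (auto simp: antideriv_kernel_def)

lemma antideriv_kernel_test:
  assumes \<phi>: "test_fun \<phi>"
  shows "(\<integral>x. antideriv_kernel x y * deriv (deriv \<phi>) x \<partial>lborel) = \<phi> y"
proof -
  obtain R where R: "R > 0" "\<And>x. R < \<bar>x\<bar> \<Longrightarrow> \<phi> x = 0" using test_fun_support[OF \<phi>] by blast
  have R': "deriv \<phi> x = 0" if "R < \<bar>x\<bar>" for x using deriv_zero_outside R(2) that by blast
  have R'': "deriv (deriv \<phi>) x = 0" if "R < \<bar>x\<bar>" for x using deriv_zero_outside R' that by blast
  note d1 = smooth_fun_DERIV[OF test_fun_smooth[OF \<phi>]]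
  note d2 = smooth_fun_DERIV[OF test_fun_smooth[OF test_fun_deriv[OF \<phi>]]]
  define F where "F x = (x - y) * deriv \<phi> x - \<phi> x" for x
  have F: "(F has_vector_derivative (x - y) * deriv (deriv \<phi>) x) (at x)" for x
    unfolding has_real_derivative_iff_has_vector_derivative[symmetric] F_def[abs_def]
    by (auto intro!: derivative_eq_intros d1 d2)
  have c: "continuous_on A (\<lambda>x. (x - y) * deriv (deriv \<phi>) x)" for A
    by (intro continuous_intros smooth_fun_continuous test_fun_smooth test_fun_deriv \<phi>)
  define S where "S = R + \<bar>y\<bar> + 1"
  have S: "S > R" "- S < y" "y < S" using R(1) by (auto simp: S_def)
  have FS: "F S = 0" "F (-S) = 0" "F y = - \<phi> y" using R R' S by (auto simp: F_def)
  show ?thesis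
  proof (cases "0 \<le> y")
    case True
    have "(\<integral>x. antideriv_kernel x y * deriv (deriv \<phi>) x \<partial>lborel)
      = (\<integral>x. indicator {y..S} x *\<^sub>R ((x - y) * deriv (deriv \<phi>) x) \<partial>lborel)"
      using True S R'' by (intro Bochner_Integration.integral_cong) (auto simp: antideriv_kernel_def indicator_def)
    also have "\<dots> = F S - F y"
      using S by (intro integral_FTC_atLeastAtMost has_vector_derivative_at_within[OF F] c) auto
    finally show ?thesis by (simp add: FS)
  next
    case False
    have "(\<integral>x. antideriv_kernel x y * deriv (deriv \<phi>) x \<partial>lborel)
      = (\<integral>x. - (indicator {-S..y} x *\<^sub>R ((x - y) * deriv (deriv \<phi>) x)) \<partial>lborel)"
      using False S R'' by (intro Bochner_Integration.integral_cong) (auto simp: antideriv_kernel_def indicator_def algebra_simps)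
    also have "\<dots> = - (F y - F (- S))"
      unfolding Bochner_Integration.integral_minus
      using S by (subst integral_FTC_atLeastAtMost[OF _ has_vector_derivative_at_within[OF F] c]) auto
    finally show ?thesis by (simp add: FS)
  qed
qed

lemma continuous_loc_int: "continuous_on UNIV f \<Longrightarrow> loc_int f"
  unfolding loc_int_def by (meson borel_integrable_atLeastAtMost' continuous_on_subset top_greatest)

text \<open>Integrating g against the kernel gives \<open>G\<close>. The kernel is Lipschitz in x
  and locally of bounded support in y, so \<open>G\<close> is continuous although g is only locally
  integrable; Fubini moves the second derivative onto the kernel.\<close>

lemma weak_second_antiderivative:
  assumes g: "loc_int g"
  shows "\<exists>G. continuous_on UNIV G \<and>
    (\<forall>\<phi>. test_fun \<phi> \<longrightarrow> (\<integral>x. G x * of_real (deriv (deriv \<phi>) x) \<partial>lborel) = (\<integral>x. g x * of_real (\<phi> x) \<partial>lborel))"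
proof -
  note [measurable] = loc_int_measurable[OF g]
  define G where "G x = (\<integral>y. of_real (antideriv_kernel x y) * g y \<partial>lborel)" for x
  have ig: "integrable lborel (\<lambda>y. indicator {-R..R} y *\<^sub>R g y)" for R
    using g unfolding loc_int_def set_integrable_def by blast
  have iK: "integrable lborel (\<lambda>y. of_real (antideriv_kernel x y) * g y)" for x
  proof (rule Bochner_Integration.integrable_bound[OF integrable_scaleR_right[OF ig[of "\<bar>x\<bar>"], of "\<bar>x\<bar>"]])
    show "AE y in lborel. norm (of_real (antideriv_kernel x y) * g y) \<le> norm (\<bar>x\<bar> *\<^sub>R (indicator {-\<bar>x\<bar>..\<bar>x\<bar>} y *\<^sub>R g y))"
      using antideriv_kernel_bound[of x "\<bar>x\<bar>"]
      by (intro AE_I2) (auto simp: norm_mult mult.assoc[symmetric] intro!: mult_right_mono)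
  qed measurable
  have lip: "cmod (G x - G x') \<le> \<bar>x - x'\<bar> * (\<integral>y. norm (indicator {-R..R} y *\<^sub>R g y) \<partial>lborel)"
    if "\<bar>x\<bar> \<le> R" "\<bar>x'\<bar> \<le> R" for x x' R
  proof -
    have "G x - G x' = (\<integral>y. of_real (antideriv_kernel x y) * g y - of_real (antideriv_kernel x' y) * g y \<partial>lborel)"
      unfolding G_def using iK by simp
    also have "cmod \<dots> \<le> (\<integral>y. \<bar>x - x'\<bar> * norm (indicator {-R..R} y *\<^sub>R g y) \<partial>lborel)"
    proof (rule Bochner_Integration.integral_norm_bound_integral)
      fix y
      show "norm (of_real (antideriv_kernel x y) * g y - of_real (antideriv_kernel x' y) * g y)
         \<le> \<bar>x - x'\<bar> * norm (indicator {-R..R} y *\<^sub>R g y)"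
      proof (cases "y \<in> {-R..R}")
        case True
        have "norm (of_real (antideriv_kernel x y) * g y - of_real (antideriv_kernel x' y) * g y)
          = \<bar>antideriv_kernel x y - antideriv_kernel x' y\<bar> * norm (g y)"
          by (simp add: norm_mult flip: left_diff_distrib of_real_diff)
        then show ?thesis using True by (auto intro!: mult_right_mono antideriv_kernel_lipschitz)
      next
        case False
        then have "antideriv_kernel x y = 0" "antideriv_kernel x' y = 0"
          using antideriv_kernel_bound[OF that(1), of y] antideriv_kernel_bound[OF that(2), of y] by auto
        then show ?thesis by simp
      qed
    qed (intro Bochner_Integration.integrable_diff iK integrable_mult_right integrable_norm ig)+
    finally show ?thesis by simp
  qed
  have cont: "isCont G x" for x
  proof -
    let ?R = "\<bar>x\<bar> + 1"
    let ?C = "\<integral>y. norm (indicator {-?R..?R} y *\<^sub>R g y) \<partial>lborel"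
    have "((\<lambda>x'. G x' - G x) \<longlongrightarrow> 0) (at x)"
    proof (rule Lim_null_comparison)
      have "\<forall>\<^sub>F x' in at x. \<bar>x' - x\<bar> < 1"
        by (auto simp: eventually_at dist_real_def intro!: exI[of _ 1])
      then show "\<forall>\<^sub>F x' in at x. norm (G x' - G x) \<le> \<bar>x' - x\<bar> * ?C"
        by eventually_elim (rule lip, auto)
      have "((\<lambda>x'. \<bar>x' - x\<bar> * ?C) \<longlongrightarrow> \<bar>x - x\<bar> * ?C) (at x)" by (intro tendsto_intros)
      then show "((\<lambda>x'. \<bar>x' - x\<bar> * ?C) \<longlongrightarrow> 0) (at x)" by simp
    qed
    then show ?thesis by (simp add: isCont_def LIM_zero_iff)
  qed
  have "(\<integral>x. G x * of_real (deriv (deriv \<phi>) x) \<partial>lborel) = (\<integral>x. g x * of_real (\<phi> x) \<partial>lborel)" if \<phi>: "test_fun \<phi>" for \<phi>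
  proof -
    let ?f = "deriv (deriv \<phi>)"
    have t2: "test_fun ?f" by (intro test_fun_deriv \<phi>)
    note [measurable] = smooth_fun_measurable[OF test_fun_smooth[OF t2]]
    obtain R where R: "R > 0" "\<And>x. R < \<bar>x\<bar> \<Longrightarrow> ?f x = 0" using test_fun_support[OF t2] by blast
    have int2: "integrable (lborel \<Otimes>\<^sub>M lborel) (\<lambda>(x, y). of_real (antideriv_kernel x y) * g y * of_real (?f x))"
    proof (rule Bochner_Integration.integrable_bound)
      show "integrable (lborel \<Otimes>\<^sub>M lborel) (\<lambda>(x, y). (R * ?f x) *\<^sub>R (indicator {-R..R} y *\<^sub>R g y))"
      proof (rule lborel_pair.Fubini_integrable)
        have "integrable lborel (\<lambda>x. \<bar>R * ?f x\<bar> * (\<integral>y. norm (indicator {-R..R} y *\<^sub>R g y) \<partial>lborel))"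
          by (intro integrable_mult_left integrable_abs integrable_mult_right test_fun_integrable t2)
        then show "integrable lborel (\<lambda>x. \<integral>y. norm (case (x, y) of (x, y) \<Rightarrow> (R * ?f x) *\<^sub>R (indicator {-R..R} y *\<^sub>R g y)) \<partial>lborel)"
          by (simp only: case_prod_conv norm_scaleR[of "R * _"] integral_mult_right_zero)
        show "AE x in lborel. integrable lborel (\<lambda>y. case (x, y) of (x, y) \<Rightarrow> (R * ?f x) *\<^sub>R (indicator {-R..R} y *\<^sub>R g y))"
          unfolding case_prod_conv by (intro AE_I2 integrable_scaleR_right ig)
      qed measurable
      show "AE p in lborel \<Otimes>\<^sub>M lborel. norm (case p of (x, y) \<Rightarrow> of_real (antideriv_kernel x y) * g y * of_real (?f x))
          \<le> norm (case p of (x, y) \<Rightarrow> (R * ?f x) *\<^sub>R (indicator {-R..R} y *\<^sub>R g y))"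
      proof (intro AE_I2, clarify)
        fix x y
        show "norm (of_real (antideriv_kernel x y) * g y * of_real (?f x)) \<le> norm ((R * ?f x) *\<^sub>R (indicator {-R..R} y *\<^sub>R g y))"
        proof (cases "\<bar>x\<bar> \<le> R")
          case True
          have "antideriv_kernel x y * (cmod (g y) * \<bar>?f x\<bar>) \<le> (R * indicator {-R..R} y) * (cmod (g y) * \<bar>?f x\<bar>)"
            by (intro mult_right_mono antideriv_kernel_bound[OF True]) auto
          then show ?thesis using antideriv_kernel_bound[OF True] R(1) by (simp add: norm_mult abs_mult mult_ac)
        qed (use R(2)[of x] in auto)
      qed
    qed measurable
    have "(\<integral>x. G x * of_real (?f x) \<partial>lborel) = (\<integral>x. \<integral>y. of_real (antideriv_kernel x y) * g y * of_real (?f x) \<partial>lborel \<partial>lborel)"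
      unfolding G_def using iK by simp
    also have "\<dots> = (\<integral>y. \<integral>x. of_real (antideriv_kernel x y) * g y * of_real (?f x) \<partial>lborel \<partial>lborel)"
      using lborel_pair.Fubini_integral[OF int2] by simp
    also have "\<dots> = (\<integral>y. g y * of_real (\<phi> y) \<partial>lborel)"
    proof (intro Bochner_Integration.integral_cong refl)
      fix y
      have "(\<integral>x. of_real (antideriv_kernel x y) * g y * of_real (?f x) \<partial>lborel)
        = (\<integral>x. g y * complex_of_real (antideriv_kernel x y * ?f x) \<partial>lborel)"
        by (intro Bochner_Integration.integral_cong) (auto simp: algebra_simps)
      also have "\<dots> = g y * complex_of_real (\<integral>x. antideriv_kernel x y * ?f x \<partial>lborel)"
        by (simp del: of_real_mult)
      finally show "(\<integral>x. of_real (antideriv_kernel x y) * g y * of_real (?f x) \<partial>lborel) = g y * of_real (\<phi> y)"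
        by (simp add: antideriv_kernel_test[OF \<phi>])
    qed
    finally show ?thesis .
  qed
  then show ?thesis using cont by (intro exI[of _ G]) (auto intro!: continuous_at_imp_continuous_on)
qed

lemma continuous_AE_eq_imp_eq:
  fixes f g :: "real \<Rightarrow> 'a::{real_normed_vector}"
  assumes "continuous_on UNIV f" "continuous_on UNIV g" "AE x in lborel. f x = g x"
  shows "f = g"
proof (rule ccontr)
  assume "f \<noteq> g"
  then obtain a where a: "f a \<noteq> g a" by blast
  have op: "open {x. f x \<noteq> g x}" using assms by (intro open_Collect_neq) auto
  then obtain e where e: "e > 0" "ball a e \<subseteq> {x. f x \<noteq> g x}" using a open_contains_ball by blast
  have "{x. f x \<noteq> g x} \<in> null_sets lborel"
    using assms(3) op AE_iff_null_sets[of "{x. f x \<noteq> g x}" lborel] by auto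
  then have "ball a e \<in> null_sets lborel" using e(2) null_sets_subset[of _ lborel "ball a e"] by auto
  then have "emeasure lborel (ball a e) = 0" by auto
  then show False using e(1) by (simp add: ball_eq_greaterThanLessThan)
qed

lemma antideriv_second_weak:
  fixes h :: "real \<Rightarrow> complex"
  assumes H1: "\<And>x. (H1 has_vector_derivative h x) (at x)" and H2: "\<And>x. (H2 has_vector_derivative H1 x) (at x)"
    and h: "continuous_on UNIV h" and \<phi>: "test_fun \<phi>"
  shows "(\<integral>x. H2 x * of_real (deriv (deriv \<phi>) x) \<partial>lborel) = (\<integral>x. h x * of_real (\<phi> x) \<partial>lborel)"
proof -
  obtain R where R: "R > 0" "\<And>x. R < \<bar>x\<bar> \<Longrightarrow> \<phi> x = 0" using test_fun_support[OF \<phi>] by blast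
  have R': "deriv \<phi> x = 0" if "R < \<bar>x\<bar>" for x using deriv_zero_outside R(2) that by blast
  have cH: "continuous_on UNIV H2" "continuous_on UNIV H1"
    using has_vector_derivative_continuous_on[OF H1] has_vector_derivative_continuous_on[OF H2] by auto
  define F where "F x = deriv \<phi> x *\<^sub>R H2 x - \<phi> x *\<^sub>R H1 x" for x
  have F: "(F has_vector_derivative (deriv (deriv \<phi>) x *\<^sub>R H2 x - \<phi> x *\<^sub>R h x)) (at x)" for x
    unfolding F_def[abs_def]
    by (rule derivative_eq_intros H1 H2 test_fun_DERIV[OF \<phi>] test_fun_DERIV[OF test_fun_deriv[OF \<phi>]]
         has_vector_derivative_scaleR smooth_fun_DERIV[OF test_fun_smooth[OF \<phi>]] smooth_fun_DERIV[OF test_fun_smooth[OF test_fun_deriv[OF \<phi>]]] refl)+ simp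
  have "(\<integral>x. deriv (deriv \<phi>) x *\<^sub>R H2 x - \<phi> x *\<^sub>R h x \<partial>lborel) = 0"
    by (rule compact_FTC(2)[OF F, where R = R])
       (auto simp: F_def R R' intro!: continuous_intros h cH smooth_fun_continuous test_fun_smooth test_fun_deriv \<phi>)
  moreover have "integrable lborel (\<lambda>x. H2 x * of_real (deriv (deriv \<phi>) x))" "integrable lborel (\<lambda>x. h x * of_real (\<phi> x))"
    by (intro loc_int_test_integrable continuous_loc_int cH h test_fun_deriv \<phi>)+
  ultimately show ?thesis by (simp add: scaleR_conv_of_real mult.commute)
qed

text \<open>The weak equation gives continuity first; then the right-hand side is continuous and the
  solution is twice differentiable.\<close>

lemma weak_solution_regular:
  assumes u: "loc_int u" and q: "continuous_on UNIV (q :: real \<Rightarrow> real)"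
    and weak: "\<And>\<phi>. test_fun \<phi> \<Longrightarrow>
      (\<integral>x. u x * of_real (deriv (deriv \<phi>) x) \<partial>lborel) = (\<integral>x. of_real (q x) * u x * of_real (\<phi> x) \<partial>lborel)"
    and qu: "loc_int (\<lambda>x. of_real (q x) * u x)"
  shows "\<exists>E E'. (AE x in lborel. u x = E x) \<and> (\<forall>x. (E has_vector_derivative E' x) (at x)) \<and>
    (\<forall>x. (E' has_vector_derivative of_real (q x) * E x) (at x))"
proof -
  \<comment> \<open>Every continuous weak second antiderivative of q u differs from u by an affine
    function. This is applied twice: to the kernel integral, which makes u continuous, and to a
    classical double antiderivative, which makes it twice differentiable.\<close>
  have affine: "\<exists>A B. AE x in lborel. u x - G x = A + B * of_real x"
    if G: "continuous_on UNIV G" "\<And>\<phi>. test_fun \<phi> \<Longrightarrow>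
      (\<integral>x. G x * of_real (deriv (deriv \<phi>) x) \<partial>lborel) = (\<integral>x. of_real (q x) * u x * of_real (\<phi> x) \<partial>lborel)" for G
  proof (rule du_bois_reymond_second)
    show "loc_int (\<lambda>x. u x - G x)"
      using u continuous_loc_int[OF G(1)] unfolding loc_int_def by (auto intro: set_integral_diff)
    fix \<phi> assume \<phi>: "test_fun \<phi>"
    have "integrable lborel (\<lambda>x. u x * of_real (deriv (deriv \<phi>) x))" "integrable lborel (\<lambda>x. G x * of_real (deriv (deriv \<phi>) x))"
      by (intro loc_int_test_integrable u continuous_loc_int G test_fun_deriv \<phi>)+
    then show "(\<integral>x. (u x - G x) * of_real (deriv (deriv \<phi>) x) \<partial>lborel) = 0"
      by (simp add: left_diff_distrib G(2)[OF \<phi>] weak[OF \<phi>])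
  qed
  obtain G where G: "continuous_on UNIV G" "\<And>\<phi>. test_fun \<phi> \<Longrightarrow>
      (\<integral>x. G x * of_real (deriv (deriv \<phi>) x) \<partial>lborel) = (\<integral>x. of_real (q x) * u x * of_real (\<phi> x) \<partial>lborel)"
    using weak_second_antiderivative[OF qu] by blast
  obtain A B where AB: "AE x in lborel. u x - G x = A + B * of_real x" using affine[OF G] by blast
  define E1 where "E1 x = G x + A + B * of_real x" for x
  have E1: "AE x in lborel. u x = E1 x" using AB by eventually_elim (simp add: E1_def algebra_simps)
  have cE1: "continuous_on UNIV E1" unfolding E1_def[abs_def] by (intro continuous_intros G)
  define h where "h x = of_real (q x) * E1 x" for x
  have ch: "continuous_on UNIV h" unfolding h_def[abs_def] by (intro continuous_intros q cE1)
  obtain H1 where H1: "\<And>x. (H1 has_vector_derivative h x) (at x)" using antiderivative_exists[OF ch] by blast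
  obtain H2 where H2: "\<And>x. (H2 has_vector_derivative H1 x) (at x)"
    using antiderivative_exists[OF has_vector_derivative_continuous_on[OF H1]] by blast
  have H: "(\<integral>x. H2 x * of_real (deriv (deriv \<phi>) x) \<partial>lborel) = (\<integral>x. of_real (q x) * u x * of_real (\<phi> x) \<partial>lborel)"
    if \<phi>: "test_fun \<phi>" for \<phi>
  proof -
    note [measurable] = loc_int_measurable[OF qu] borel_measurable_continuous_onI[OF ch]
      borel_measurable_continuous_onI[OF cE1] borel_measurable_continuous_onI[OF q]
      smooth_fun_measurable[OF test_fun_smooth[OF \<phi>]]
    have "(\<integral>x. h x * of_real (\<phi> x) \<partial>lborel) = (\<integral>x. of_real (q x) * u x * of_real (\<phi> x) \<partial>lborel)"
      by (rule integral_cong_AE) (use E1 in \<open>auto simp: h_def\<close>)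
    then show ?thesis using antideriv_second_weak[OF H1 H2 ch \<phi>] by simp
  qed
  obtain C D where CD: "AE x in lborel. u x - H2 x = C + D * of_real x"
    using affine[OF has_vector_derivative_continuous_on[OF H2] H] by blast
  define E where "E x = H2 x + C + D * of_real x" for x
  have uE: "AE x in lborel. u x = E x" using CD by eventually_elim (simp add: E_def algebra_simps)
  have cE: "continuous_on UNIV E"
    unfolding E_def[abs_def] by (intro continuous_intros has_vector_derivative_continuous_on[OF H2])
  \<comment> \<open>Both are continuous versions of u. The identification matters because the second
    derivative was computed from \<open>E1\<close>, while the equation is wanted for
    \<open>E\<close>.\<close>
  have "E1 = E" by (rule continuous_AE_eq_imp_eq[OF cE1 cE]) (use E1 uE in \<open>eventually_elim, simp\<close>)
  have "(E has_vector_derivative H1 x + D) (at x)" for x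
    unfolding E_def[abs_def] by (auto intro!: derivative_eq_intros H2)
  moreover have "((\<lambda>x. H1 x + D) has_vector_derivative of_real (q x) * E x) (at x)" for x
    using H1[of x] unfolding h_def \<open>E1 = E\<close> by (auto intro!: derivative_eq_intros)
  ultimately show ?thesis using uE by (intro exI[of _ E] exI[of _ "\<lambda>x. H1 x + D"]) simp
qed

section \<open>Eigenfunctions\<close>

lemma cnj_measurable [measurable]: "cnj \<in> borel_measurable borel"
  by (intro borel_measurable_continuous_onI continuous_intros)

lemma loc_int_mult_continuous:
  assumes u: "loc_int u" and q: "continuous_on UNIV (q :: real \<Rightarrow> real)"
  shows "loc_int (\<lambda>x. of_real (q x) * u x)"
proof -
  note [measurable] = loc_int_measurable[OF u] borel_measurable_continuous_onI[OF q]
  show ?thesis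
    unfolding loc_int_def set_integrable_def
  proof
    fix R :: real
    have "compact (q ` {-R..R})" by (intro compact_continuous_image continuous_on_subset[OF q]) auto
    then obtain B where B: "\<forall>y\<in>q ` {-R..R}. norm y \<le> B" using compact_imp_bounded bounded_iff by metis
    have "integrable lborel (\<lambda>x. \<bar>B\<bar> *\<^sub>R (indicator {-R..R} x *\<^sub>R u x))"
      using u unfolding loc_int_def set_integrable_def by (intro integrable_scaleR_right) auto
    then show "integrable lborel (\<lambda>x. indicator {-R..R} x *\<^sub>R (of_real (q x) * u x))"
    proof (rule Bochner_Integration.integrable_bound)
      show "AE x in lborel. norm (indicator {-R..R} x *\<^sub>R (of_real (q x) * u x)) \<le> norm (\<bar>B\<bar> *\<^sub>R (indicator {-R..R} x *\<^sub>R u x))"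
      proof (intro AE_I2)
        fix x
        show "norm (indicator {-R..R} x *\<^sub>R (of_real (q x) * u x)) \<le> norm (\<bar>B\<bar> *\<^sub>R (indicator {-R..R} x *\<^sub>R u x))"
        proof (cases "x \<in> {-R..R}")
          case True
          then have "norm (q x) \<le> B" using B by blast
          then have "\<bar>q x\<bar> \<le> \<bar>B\<bar>" by simp
          then show ?thesis using True by (auto simp: norm_mult intro!: mult_right_mono)
        qed simp
      qed
    qed measurable
  qed
qed

lemma le_of_square_le: "x\<^sup>2 \<le> c * x \<Longrightarrow> 0 \<le> x \<Longrightarrow> 0 \<le> c \<Longrightarrow> x \<le> (c::real)"
  by (cases "x = 0") (auto simp: power2_eq_square)

lemma in_L2_loc_int:
  assumes "in_L2 u" shows "loc_int u"
proof (rule loc_intI_bound)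
  have meas [measurable]: "u \<in> borel_measurable borel" and int: "integrable lborel (\<lambda>x. (cmod (u x))\<^sup>2)"
    using assms unfolding in_L2_def by auto
  show "u \<in> borel_measurable borel" by fact
  fix R :: real
  have "cmod (u x) \<le> 1 + (cmod (u x))\<^sup>2" for x
    using sum_squares_bound[of 1 "cmod (u x)"] norm_ge_zero[of "u x"] by (simp del: norm_ge_zero)
  then have "ennreal (cmod (u x)) \<le> 1 + ennreal ((cmod (u x))\<^sup>2)" for x
    by (metis ennreal_1 ennreal_leI ennreal_plus zero_le_one zero_le_power2)
  then have "(\<integral>\<^sup>+x. ennreal (cmod (u x)) * indicator {-R..R} x \<partial>lborel)
    \<le> (\<integral>\<^sup>+x. indicator {-R..R} x + ennreal ((cmod (u x))\<^sup>2) \<partial>lborel)"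
    by (intro nn_integral_mono) (auto simp: indicator_def)
  also have "\<dots> = emeasure lborel {-R..R} + (\<integral>\<^sup>+x. ennreal ((cmod (u x))\<^sup>2) \<partial>lborel)"
    by (subst nn_integral_add) auto
  also have "\<dots> < \<infinity>" using int by (auto simp: integrable_iff_bounded emeasure_lborel_Icc_eq)
  finally show "(\<integral>\<^sup>+x. ennreal (cmod (u x)) * indicator {-R..R} x \<partial>lborel) < \<infinity>" .
qed

lemma eigenfunction_regular:
  assumes V: "smooth_fun V" and u: "schroedinger V u (\<lambda>x. of_real l * u x)"
  shows "\<exists>E E'. (AE x in lborel. u x = E x) \<and> (\<forall>x. (E has_vector_derivative E' x) (at x)) \<and>
    (\<forall>x. (E' has_vector_derivative of_real (V x - l) * E x) (at x))"
proof (rule weak_solution_regular)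
  have q: "continuous_on UNIV (\<lambda>x. V x - l)" by (intro continuous_intros smooth_fun_continuous V)
  show u1: "loc_int u" using u in_L2_loc_int schroedinger_def by blast
  show "continuous_on UNIV (\<lambda>x. V x - l)" by fact
  show qu: "loc_int (\<lambda>x. of_real (V x - l) * u x)" by (rule loc_int_mult_continuous[OF u1 q])
  fix \<phi> assume \<phi>: "test_fun \<phi>"
  have Vu: "loc_int (\<lambda>x. of_real (V x) * u x)" by (intro loc_int_mult_continuous u1 smooth_fun_continuous V)
  have lu: "loc_int (\<lambda>x. of_real l * u x)" by (intro loc_int_mult_continuous u1 continuous_intros)
  note i1 = loc_int_test_integrable[OF u1 test_fun_deriv[OF test_fun_deriv[OF \<phi>]]]
  note i2 = loc_int_test_integrable[OF Vu \<phi>]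
  note i3 = loc_int_test_integrable[OF lu \<phi>]
  have "(\<integral>x. u x * of_real (- deriv (deriv \<phi>) x + V x * \<phi> x) \<partial>lborel) = (\<integral>x. of_real l * u x * of_real (\<phi> x) \<partial>lborel)"
    using u \<phi> unfolding schroedinger_def by blast
  also have "(\<integral>x. u x * of_real (- deriv (deriv \<phi>) x + V x * \<phi> x) \<partial>lborel)
    = (\<integral>x. of_real (V x) * u x * of_real (\<phi> x) - u x * of_real (deriv (deriv \<phi>) x) \<partial>lborel)"
    by (intro Bochner_Integration.integral_cong) (auto simp: algebra_simps)
  also have "\<dots> = (\<integral>x. of_real (V x) * u x * of_real (\<phi> x) \<partial>lborel) - (\<integral>x. u x * of_real (deriv (deriv \<phi>) x) \<partial>lborel)"
    using i1 i2 by simp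
  finally have "(\<integral>x. u x * of_real (deriv (deriv \<phi>) x) \<partial>lborel)
     = (\<integral>x. of_real (V x) * u x * of_real (\<phi> x) \<partial>lborel) - (\<integral>x. of_real l * u x * of_real (\<phi> x) \<partial>lborel)"
    by (simp only: diff_eq_eq) (simp only: diff_add_eq add.commute eq_diff_eq)
  also have "\<dots> = (\<integral>x. of_real (V x) * u x * of_real (\<phi> x) - of_real l * u x * of_real (\<phi> x) \<partial>lborel)"
    using i2 i3 by simp
  also have "\<dots> = (\<integral>x. of_real (V x - l) * u x * of_real (\<phi> x) \<partial>lborel)"
    by (intro Bochner_Integration.integral_cong) (auto simp: algebra_simps)
  finally show "(\<integral>x. u x * of_real (deriv (deriv \<phi>) x) \<partial>lborel) = (\<integral>x. of_real (V x - l) * u x * of_real (\<phi> x) \<partial>lborel)" .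
qed

text \<open>Eigenfunctions are represented by twice differentiable versions, with the first
  derivative \<open>E'\<close> carried along as data, so that the eigenvalue equation holds at every
  point.\<close>

locale classical_eigenbasis =
  fixes V :: "real \<Rightarrow> real" and lam :: "nat \<Rightarrow> real" and E E' :: "nat \<Rightarrow> real \<Rightarrow> complex"
  assumes V_smooth: "smooth_fun V" and V_nonneg: "0 \<le> V x"
    and lam_0: "0 < lam 0" and lam_mono: "incseq lam" and lam_lim: "filterlim lam at_top sequentially"
    and E_deriv: "(E j has_vector_derivative E' j x) (at x)"
    and E'_deriv: "(E' j has_vector_derivative of_real (V x - lam j) * E j x) (at x)"
    and E_L2: "integrable lborel (\<lambda>x. (cmod (E j x))\<^sup>2)"
    and E_orth: "(\<integral>x. cnj (E i x) * E j x \<partial>lborel) = (if i = j then 1 else 0)"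

lemma eigenbasis_classical:
  assumes V: "smooth_fun V" "\<And>x. 0 \<le> V x" and e: "eigenbasis V lam e"
  shows "\<exists>E E'. classical_eigenbasis V lam E E' \<and> (\<forall>j. AE x in lborel. e j x = E j x)"
proof -
  have sch: "schroedinger V (e j) (\<lambda>x. of_real (lam j) * e j x)" for j
    using e unfolding eigenbasis_def by blast
  have "\<forall>j. \<exists>P. (AE x in lborel. e j x = fst P x) \<and> (\<forall>x. (fst P has_vector_derivative snd P x) (at x)) \<and>
    (\<forall>x. (snd P has_vector_derivative of_real (V x - lam j) * fst P x) (at x))"
    using eigenfunction_regular[OF V(1) sch] by (metis fst_conv snd_conv)
  from choice[OF this] obtain P where P: "\<And>j. AE x in lborel. e j x = fst (P j) x"
    "\<And>j x. (fst (P j) has_vector_derivative snd (P j) x) (at x)"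
    "\<And>j x. (snd (P j) has_vector_derivative of_real (V x - lam j) * fst (P j) x) (at x)" by blast
  define E where "E j = fst (P j)" for j
  define E' where "E' j = snd (P j)" for j
  note P = P[folded E_def E'_def]
  have [measurable]: "E j \<in> borel_measurable borel" for j
    by (intro borel_measurable_continuous_onI has_vector_derivative_continuous_on[OF P(2)])
  have eL2: "in_L2 (e j)" for j using sch unfolding schroedinger_def by blast
  have [measurable]: "e j \<in> borel_measurable borel" for j using eL2 unfolding in_L2_def by auto
  have "classical_eigenbasis V lam E E'"
  proof
    show "integrable lborel (\<lambda>x. (cmod (E j x))\<^sup>2)" for j
    proof -
      have "integrable lborel (\<lambda>x. (cmod (e j x))\<^sup>2)" using eL2 unfolding in_L2_def by blast
      then show ?thesis by (rule integrable_cong_AE_imp) (use P(1)[of j] in auto)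
    qed
    show "(\<integral>x. cnj (E i x) * E j x \<partial>lborel) = (if i = j then 1 else 0)" for i j
    proof -
      have "(\<integral>x. cnj (E i x) * E j x \<partial>lborel) = (\<integral>x. cnj (e i x) * e j x \<partial>lborel)"
        by (rule integral_cong_AE) (use P(1)[of i] P(1)[of j] in auto)
      then show ?thesis using e unfolding eigenbasis_def inner_L2_def by simp
    qed
  qed (use V P(2,3) e[unfolded eigenbasis_def] in blast)+
  then show ?thesis using P(1) by blast
qed

context classical_eigenbasis
begin

lemma lam_pos: "0 < lam j"
  using lam_0 lam_mono incseqD[of lam 0 j] by linarith

lemma V_cont: "continuous_on A V" using V_smooth smooth_fun_continuous by blast
lemma E_cont: "continuous_on A (E j)" using has_vector_derivative_continuous_on[OF E_deriv] .
lemma E'_cont: "continuous_on A (E' j)" using has_vector_derivative_continuous_on[OF E'_deriv] .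

lemma E_measurable [measurable]: "E j \<in> borel_measurable borel"
  by (intro borel_measurable_continuous_onI E_cont)

lemma V_measurable [measurable]: "V \<in> borel_measurable borel"
  by (intro borel_measurable_continuous_onI V_cont)

section \<open>Finite combinations of eigenfunctions\<close>

definition comb :: "nat set \<Rightarrow> (nat \<Rightarrow> complex) \<Rightarrow> real \<Rightarrow> complex" where
  "comb F c x = (\<Sum>j\<in>F. c j * E j x)"

definition comb' :: "nat set \<Rightarrow> (nat \<Rightarrow> complex) \<Rightarrow> real \<Rightarrow> complex" where
  "comb' F c x = (\<Sum>j\<in>F. c j * E' j x)"

lemma comb_cont: "continuous_on A (comb F c)" "continuous_on A (comb' F c)"
  unfolding comb_def[abs_def] comb'_def[abs_def] by (intro continuous_intros E_cont E'_cont)+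

lemma comb_measurable [measurable]: "comb F c \<in> borel_measurable borel" "comb' F c \<in> borel_measurable borel"
  by (intro borel_measurable_continuous_onI comb_cont)+

lemma comb_deriv: "(comb F c has_vector_derivative comb' F c x) (at x)"
  unfolding comb_def[abs_def] comb'_def
  by (intro has_vector_derivative_sum has_vector_derivative_mult_right E_deriv)

lemma comb'_deriv:
  "(comb' F c has_vector_derivative of_real (V x) * comb F c x - comb F (\<lambda>j. of_real (lam j) * c j) x) (at x)"
proof -
  have "(comb' F c has_vector_derivative (\<Sum>j\<in>F. c j * (of_real (V x - lam j) * E j x))) (at x)"
    unfolding comb'_def[abs_def]
    by (intro has_vector_derivative_sum has_vector_derivative_mult_right E'_deriv)
  moreover have "(\<Sum>j\<in>F. c j * (of_real (V x - lam j) * E j x))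
      = of_real (V x) * comb F c x - comb F (\<lambda>j. of_real (lam j) * c j) x"
    unfolding comb_def by (simp add: sum_distrib_left sum_subtractf[symmetric] algebra_simps)
  ultimately show ?thesis by simp
qed

lemma E_E_integrable: "integrable lborel (\<lambda>x. cnj (E i x) * E j x)"
proof (rule Bochner_Integration.integrable_bound[OF Bochner_Integration.integrable_add[OF E_L2[of i] E_L2[of j]]])
  have "cmod (E i x) * cmod (E j x) \<le> (cmod (E i x))\<^sup>2 + (cmod (E j x))\<^sup>2" for x
    using sum_squares_bound[of "cmod (E i x)" "cmod (E j x)"] mult_nonneg_nonneg[OF norm_ge_zero norm_ge_zero, of "E i x" "E j x"]
    by linarith
  then show "AE x in lborel. norm (cnj (E i x) * E j x) \<le> norm ((cmod (E i x))\<^sup>2 + (cmod (E j x))\<^sup>2)"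
    by (auto simp: norm_mult)
qed measurable

lemma comb_inner:
  assumes F: "finite F"
  shows "integrable lborel (\<lambda>x. cnj (comb F c x) * comb F d x)"
    "(\<integral>x. cnj (comb F c x) * comb F d x \<partial>lborel) = (\<Sum>j\<in>F. cnj (c j) * d j)"
proof -
  have eq: "cnj (comb F c x) * comb F d x = (\<Sum>i\<in>F. \<Sum>j\<in>F. (cnj (c i) * d j) * (cnj (E i x) * E j x))" for x
    unfolding comb_def cnj_sum sum_product by (simp add: mult_ac)
  have int: "integrable lborel (\<lambda>x. (cnj (c i) * d j) * (cnj (E i x) * E j x))" for i j
    by (intro integrable_mult_right E_E_integrable)
  show "integrable lborel (\<lambda>x. cnj (comb F c x) * comb F d x)"
    unfolding eq by (intro Bochner_Integration.integrable_sum int)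
  have "(\<integral>x. cnj (comb F c x) * comb F d x \<partial>lborel) = (\<Sum>i\<in>F. \<Sum>j\<in>F. (cnj (c i) * d j) * (if i = j then 1 else 0))"
    unfolding eq
    by (subst Bochner_Integration.integral_sum, intro Bochner_Integration.integrable_sum int,
        subst Bochner_Integration.integral_sum, rule int) (simp add: E_orth)
  also have "\<dots> = (\<Sum>j\<in>F. cnj (c j) * d j)" using F by (simp add: if_distrib cong: if_cong)
  finally show "(\<integral>x. cnj (comb F c x) * comb F d x \<partial>lborel) = (\<Sum>j\<in>F. cnj (c j) * d j)" .
qed

lemma comb_norm:
  assumes F: "finite F"
  shows "integrable lborel (\<lambda>x. (cmod (comb F c x))\<^sup>2)"
    "(\<integral>x. (cmod (comb F c x))\<^sup>2 \<partial>lborel) = (\<Sum>j\<in>F. (cmod (c j))\<^sup>2)"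
proof -
  have eq: "(cmod z)\<^sup>2 = Re (cnj z * z)" for z by (simp add: cmod_power2 flip: power2_eq_square)
  show "integrable lborel (\<lambda>x. (cmod (comb F c x))\<^sup>2)"
    unfolding eq by (intro integrable_Re comb_inner F)
  have "(\<integral>x. (cmod (comb F c x))\<^sup>2 \<partial>lborel) = Re (\<integral>x. cnj (comb F c x) * comb F c x \<partial>lborel)"
    unfolding eq by (rule integral_Re[OF comb_inner(1)[OF F]])
  also have "\<dots> = (\<Sum>j\<in>F. (cmod (c j))\<^sup>2)" by (simp add: comb_inner(2)[OF F] eq)
  finally show "(\<integral>x. (cmod (comb F c x))\<^sup>2 \<partial>lborel) = (\<Sum>j\<in>F. (cmod (c j))\<^sup>2)" .
qed

lemma comb_inner_real:
  assumes F: "finite F"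
  shows "integrable lborel (\<lambda>x. comb F c x \<bullet> comb F d x)"
    "(\<integral>x. comb F c x \<bullet> comb F d x \<partial>lborel) = (\<Sum>j\<in>F. Re (cnj (c j) * d j))"
proof -
  have eq: "z \<bullet> w = Re (cnj z * w)" for z w by (simp add: inner_complex_def)
  show "integrable lborel (\<lambda>x. comb F c x \<bullet> comb F d x)"
    unfolding eq by (intro integrable_Re comb_inner F)
  show "(\<integral>x. comb F c x \<bullet> comb F d x \<partial>lborel) = (\<Sum>j\<in>F. Re (cnj (c j) * d j))"
    unfolding eq integral_Re[OF comb_inner(1)[OF F]] comb_inner(2)[OF F] by simp
qed

text \<open>Testing the equation for v with v itself gives the energy, but no decay of v or its
  derivative is known, so boundary terms are removed by cutoffs at radius n + 1. The remaining error
  contains only \<open>|v|^2\<close> and a factor of order 1/n^2, and Fatou removes the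
  cutoff.\<close>

lemma comb_energy:
  assumes F: "finite F"
  shows "(\<integral>\<^sup>+x. ennreal ((cmod (comb' F c x))\<^sup>2 + V x * (cmod (comb F c x))\<^sup>2) \<partial>lborel)
    \<le> ennreal (\<Sum>j\<in>F. lam j * (cmod (c j))\<^sup>2)"
proof -
  let ?v = "comb F c" and ?v' = "comb' F c"
  let ?d = "\<lambda>j. of_real (lam j) * c j"
  let ?f = "comb F ?d"
  let ?S = "\<Sum>j\<in>F. lam j * (cmod (c j))\<^sup>2"
  define g where "g x = (cmod (?v' x))\<^sup>2 + V x * (cmod (?v x))\<^sup>2" for x
  have g0: "0 \<le> g x" for x unfolding g_def using V_nonneg by simp
  have cg: "continuous_on A g" for A unfolding g_def[abs_def] by (intro continuous_intros comb_cont V_cont)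
  note [measurable] = borel_measurable_continuous_onI[OF cg]
  have S: "(\<integral>x. ?v x \<bullet> ?f x \<partial>lborel) = ?S"
  proof -
    have "Re (cnj z * (of_real r * z)) = r * (cmod z)\<^sup>2" for z and r :: real
      by (subst cmod_power2) (simp add: power2_eq_square algebra_simps)
    then show ?thesis by (simp add: comb_inner_real(2)[OF F])
  qed
  have b0: "bump 0 > 0" by (rule bump_pos) simp
  define bb where "bb x = bump x / bump 0" for x
  have tb: "test_fun bb" unfolding bb_def[abs_def]
    using test_fun_mult[OF smooth_fun_const[of "1 / bump 0"] test_fun_bump] by simp
  have bz: "bb 0 = 1" "\<And>x. 0 \<le> bb x" using b0 by (auto simp: bb_def bump_nonneg)
  have bo: "bb x = 0" if "1 \<le> \<bar>x\<bar>" for x using that by (simp add: bb_def bump_zero)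
  obtain B0 where B0: "B0 > 0" "\<And>x. \<bar>bb x\<bar> \<le> B0" using test_fun_bounded[OF tb] by blast
  obtain B2 where B2: "B2 > 0" "\<And>x. \<bar>deriv (deriv bb) x\<bar> \<le> B2"
    using test_fun_bounded[OF test_fun_deriv[OF test_fun_deriv[OF tb]]] by blast
  define k where "k n = 1 / real (Suc n)" for n
  have k: "k n > 0" for n by (simp add: k_def)
  define cu where "cu n x = bb (k n * x)" for n x
  define cu1 where "cu1 n x = k n * deriv bb (k n * x)" for n x
  define cu2 where "cu2 n x = k n * (k n * deriv (deriv bb) (k n * x))" for n x
  have sm: "smooth_fun bb" "smooth_fun (deriv bb)" "smooth_fun (deriv (deriv bb))"
    using tb test_fun_deriv test_fun_smooth by blast+
  have ch: "((\<lambda>x. h (k n * x)) has_real_derivative k n * deriv h (k n * x)) (at x)" if "smooth_fun h" for h n x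
  proof -
    have "((\<lambda>x. h (k n * x)) has_real_derivative deriv h (k n * x) * k n) (at x)"
      by (rule DERIV_chain2[OF smooth_fun_DERIV[OF that]]) (auto intro!: derivative_eq_intros)
    then show ?thesis by (simp add: mult.commute)
  qed
  have d0: "(cu n has_real_derivative cu1 n x) (at x)" for n x
    unfolding cu_def[abs_def] cu1_def by (rule ch[OF sm(1)])
  have d1: "(cu1 n has_real_derivative cu2 n x) (at x)" for n x
    unfolding cu1_def[abs_def] cu2_def by (rule DERIV_cmult[OF ch[OF sm(2)]])
  have ccu: "continuous_on A (cu n)" "continuous_on A (cu1 n)" "continuous_on A (cu2 n)" for A n
    using DERIV_isCont[OF d0] DERIV_isCont[OF d1] DERIV_isCont[OF DERIV_cmult[OF DERIV_cmult[OF ch[OF sm(3)]]]]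
    unfolding cu2_def[abs_def] by (auto intro!: continuous_at_imp_continuous_on)
  note [measurable] = borel_measurable_continuous_onI[OF ccu(1)] borel_measurable_continuous_onI[OF ccu(2)]
    borel_measurable_continuous_onI[OF ccu(3)] smooth_fun_measurable[OF sm(1)]
  have cuz: "cu n x = 0" if "real (Suc n) < \<bar>x\<bar>" for n x
    using that unfolding cu_def k_def by (intro bo) (simp add: abs_mult field_simps)
  have cu1z: "cu1 n x = 0" if "real (Suc n) < \<bar>x\<bar>" for n x
    using deriv_zero_outside[of "real (Suc n)" "cu n" x] cuz that DERIV_imp_deriv[OF d0] by metis
  \<comment> \<open>The second term shifts the derivative of v . v' onto the cutoff: the error
    becomes half of \<open>cu2\<close> times \<open>|v|^2\<close>, which is controlled by the known
    norm of v, in place of a term with v', which is not yet known to be square integrable.\<close>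
  define G where "G n x = cu n x * (?v x \<bullet> ?v' x) - 1/2 * (cu1 n x * (?v x \<bullet> ?v x))" for n x
  define G' where "G' n x = cu n x * g x - cu n x * (?v x \<bullet> ?f x) - 1/2 * (cu2 n x * (cmod (?v x))\<^sup>2)" for n x
  have dG: "(G n has_vector_derivative G' n x) (at x)" for n x
  proof -
    note inner_deriv = bounded_bilinear.has_vector_derivative[OF bounded_bilinear_inner]
    have A: "((\<lambda>x. cu n x * (?v x \<bullet> ?v' x)) has_vector_derivative
        cu n x * (?v x \<bullet> (of_real (V x) * ?v x - ?f x) + ?v' x \<bullet> ?v' x) + cu1 n x * (?v x \<bullet> ?v' x)) (at x)"
      by (rule has_vector_derivative_mult[OF d0[unfolded has_real_derivative_iff_has_vector_derivative]
            inner_deriv[OF comb_deriv comb'_deriv]])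
    have B: "((\<lambda>x. cu1 n x * (?v x \<bullet> ?v x)) has_vector_derivative
        cu1 n x * (?v x \<bullet> ?v' x + ?v' x \<bullet> ?v x) + cu2 n x * (?v x \<bullet> ?v x)) (at x)"
      by (rule has_vector_derivative_mult[OF d1[unfolded has_real_derivative_iff_has_vector_derivative]
            inner_deriv[OF comb_deriv comb_deriv]])
    have "(G n has_vector_derivative (cu n x * (?v x \<bullet> (of_real (V x) * ?v x - ?f x) + ?v' x \<bullet> ?v' x) + cu1 n x * (?v x \<bullet> ?v' x))
      - 1/2 * (cu1 n x * (?v x \<bullet> ?v' x + ?v' x \<bullet> ?v x) + cu2 n x * (?v x \<bullet> ?v x))) (at x)"
      unfolding G_def[abs_def] by (rule has_vector_derivative_diff[OF A has_vector_derivative_mult_right[OF B]])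
    moreover have "?v x \<bullet> (of_real (V x) * ?v x) = V x * (cmod (?v x))\<^sup>2"
      by (subst cmod_power2) (simp add: inner_complex_def power2_eq_square algebra_simps)
    ultimately show ?thesis
      by (simp add: G'_def g_def inner_diff_right power2_norm_eq_inner[symmetric] inner_commute algebra_simps)
  qed
  have cG': "continuous_on UNIV (G' n)" for n
    unfolding G'_def[abs_def] by (intro continuous_intros ccu cg comb_cont)
  have iG': "integrable lborel (G' n)" "(\<integral>x. G' n x \<partial>lborel) = 0" for n
    using compact_FTC[OF dG cG', of "real (Suc n)"] cuz cu1z by (auto simp: G_def)
  have i2: "integrable lborel (\<lambda>x. cu n x * (?v x \<bullet> ?f x))" for n
    by (rule Bochner_Integration.integrable_bound[OF integrable_mult_right[OF comb_inner_real(1)[OF F], of B0 c ?d]])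
       (use B0 in \<open>auto simp: cu_def abs_mult intro!: mult_right_mono\<close>)
  have cu2b: "\<bar>cu2 n x\<bar> \<le> k n * k n * B2" for n x
    using B2 k[of n] by (auto simp: cu2_def abs_mult mult.assoc intro!: mult_left_mono)
  have i3: "integrable lborel (\<lambda>x. cu2 n x * (cmod (?v x))\<^sup>2)" for n
  proof (rule Bochner_Integration.integrable_bound[OF integrable_mult_right[OF comb_norm(1)[OF F], of "k n * k n * B2" c]])
    show "AE x in lborel. norm (cu2 n x * (cmod (?v x))\<^sup>2) \<le> norm (k n * k n * B2 * (cmod (?v x))\<^sup>2)"
    proof (rule AE_I2)
      fix x
      have "\<bar>cu2 n x\<bar> * (cmod (?v x))\<^sup>2 \<le> k n * k n * B2 * (cmod (?v x))\<^sup>2"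
        by (rule mult_right_mono[OF cu2b]) simp
      then show "norm (cu2 n x * (cmod (?v x))\<^sup>2) \<le> norm (k n * k n * B2 * (cmod (?v x))\<^sup>2)"
        using B2(1) by (simp add: abs_mult)
    qed
  qed measurable
  have i1: "integrable lborel (\<lambda>x. cu n x * g x)" for n
  proof -
    have "integrable lborel (\<lambda>x. G' n x + cu n x * (?v x \<bullet> ?f x) + 1/2 * (cu2 n x * (cmod (?v x))\<^sup>2))"
      by (intro Bochner_Integration.integrable_add iG' i2 integrable_mult_right i3)
    then show ?thesis by (simp add: G'_def)
  qed
  have val: "(\<integral>x. cu n x * g x \<partial>lborel) = (\<integral>x. cu n x * (?v x \<bullet> ?f x) \<partial>lborel) + 1/2 * (\<integral>x. cu2 n x * (cmod (?v x))\<^sup>2 \<partial>lborel)" for n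
    using iG'(2)[of n] i1[of n] i2[of n] i3[of n] unfolding G'_def by simp
  have k0: "k \<longlonglongrightarrow> 0" unfolding k_def[abs_def] using LIMSEQ_inverse_real_of_nat by (simp add: inverse_eq_divide)
  have culim: "(\<lambda>n. cu n x) \<longlonglongrightarrow> 1" for x
  proof -
    have "(\<lambda>n. k n * x) \<longlonglongrightarrow> 0 * x" by (intro tendsto_intros k0)
    moreover have "isCont bb 0" using smooth_fun_continuous[OF sm(1), of UNIV] by (simp add: continuous_on_eq_continuous_at)
    ultimately have "(\<lambda>n. bb (k n * x)) \<longlonglongrightarrow> bb 0" using isCont_tendsto_compose[of 0 bb "\<lambda>n. k n * x" sequentially] by simp
    then show ?thesis by (simp add: cu_def bz)
  qed
  have l1: "(\<lambda>n. \<integral>x. cu n x * (?v x \<bullet> ?f x) \<partial>lborel) \<longlonglongrightarrow> (\<integral>x. ?v x \<bullet> ?f x \<partial>lborel)"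
  proof (rule integral_dominated_convergence[where w = "\<lambda>x. B0 * \<bar>?v x \<bullet> ?f x\<bar>"])
    show "integrable lborel (\<lambda>x. B0 * \<bar>?v x \<bullet> ?f x\<bar>)" by (intro integrable_mult_right integrable_abs comb_inner_real F)
    have "(\<lambda>n. cu n x * (?v x \<bullet> ?f x)) \<longlonglongrightarrow> 1 * (?v x \<bullet> ?f x)" for x by (intro tendsto_intros culim)
    then show "AE x in lborel. (\<lambda>n. cu n x * (?v x \<bullet> ?f x)) \<longlonglongrightarrow> ?v x \<bullet> ?f x" by simp
  qed (use B0 in \<open>auto simp: cu_def abs_mult intro!: mult_right_mono\<close>)
  have l2: "(\<lambda>n. \<integral>x. cu2 n x * (cmod (?v x))\<^sup>2 \<partial>lborel) \<longlonglongrightarrow> 0"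
  proof (rule Lim_null_comparison)
    show "\<forall>\<^sub>F n in sequentially. norm (\<integral>x. cu2 n x * (cmod (?v x))\<^sup>2 \<partial>lborel) \<le> k n * k n * B2 * (\<Sum>j\<in>F. (cmod (c j))\<^sup>2)"
    proof (intro always_eventually allI)
      fix n
      have "norm (\<integral>x. cu2 n x * (cmod (?v x))\<^sup>2 \<partial>lborel) \<le> (\<integral>x. k n * k n * B2 * (cmod (?v x))\<^sup>2 \<partial>lborel)"
        by (rule Bochner_Integration.integral_norm_bound_integral[OF i3 integrable_mult_right[OF comb_norm(1)[OF F]]])
           (auto simp: abs_mult intro!: mult_right_mono cu2b)
      then show "norm (\<integral>x. cu2 n x * (cmod (?v x))\<^sup>2 \<partial>lborel) \<le> k n * k n * B2 * (\<Sum>j\<in>F. (cmod (c j))\<^sup>2)"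
        by (simp add: comb_norm(2)[OF F])
    qed
    have "(\<lambda>n. k n * k n * B2 * (\<Sum>j\<in>F. (cmod (c j))\<^sup>2)) \<longlonglongrightarrow> 0 * 0 * B2 * (\<Sum>j\<in>F. (cmod (c j))\<^sup>2)"
      by (intro tendsto_intros k0)
    then show "(\<lambda>n. k n * k n * B2 * (\<Sum>j\<in>F. (cmod (c j))\<^sup>2)) \<longlonglongrightarrow> 0" by simp
  qed
  have lim: "(\<lambda>n. \<integral>x. cu n x * g x \<partial>lborel) \<longlonglongrightarrow> ?S"
    using tendsto_add[OF l1 tendsto_mult[OF tendsto_const[of "1/2"] l2]] unfolding val S by simp
  show ?thesis
    unfolding g_def[symmetric]
  proof (rule ennreal_le_epsilon)
    fix r :: real assume "0 < r"
    have S0: "0 \<le> ?S" using lam_pos by (intro sum_nonneg mult_nonneg_nonneg) (auto intro: less_imp_le)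
    have "(\<integral>\<^sup>+x. ennreal (g x) \<partial>lborel) \<le> ennreal (?S + r)"
    proof (rule nn_integral_AE_limit_le[where u = "\<lambda>n x. ennreal (cu n x * g x)"])
      have "(\<lambda>n. cu n x * g x) \<longlonglongrightarrow> 1 * g x" for x by (intro tendsto_intros culim)
      then show "AE x in lborel. (\<lambda>i. ennreal (cu i x * g x)) \<longlonglongrightarrow> ennreal (g x)" by (auto intro!: tendsto_ennrealI)
      have "\<forall>\<^sub>F n in sequentially. (\<integral>x. cu n x * g x \<partial>lborel) < ?S + r"
        using lim \<open>0 < r\<close> by (intro order_tendstoD(2)) auto
      then show "\<forall>\<^sub>F n in sequentially. (\<integral>\<^sup>+x. ennreal (cu n x * g x) \<partial>lborel) \<le> ennreal (?S + r)"
      proof eventually_elim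
        case (elim n)
        then show ?case
          using bz g0 by (subst nn_integral_eq_integral[OF i1]) (auto simp: cu_def intro!: ennreal_leI)
      qed
    qed measurable
    then show "(\<integral>\<^sup>+x. ennreal (g x) \<partial>lborel) \<le> ennreal ?S + ennreal r"
      using S0 \<open>0 < r\<close> by simp
  qed
qed

text \<open>A one-dimensional Sobolev inequality. The change of \<open>|v|^2\<close> between two
  points is at most the integral of 2 |v| |v'|, which Young's inequality with parameter \<epsilon>
  splits into mass and energy; since \<open>|v|^2\<close> is integrable on the line, it is
  arbitrarily small somewhere.\<close>

lemma comb_sup:
  assumes F: "finite F" and "\<epsilon> > 0"
  shows "(cmod (comb F c x))\<^sup>2 \<le> \<epsilon> * (\<Sum>j\<in>F. (cmod (c j))\<^sup>2) + (\<Sum>j\<in>F. lam j * (cmod (c j))\<^sup>2) / \<epsilon>"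
proof -
  let ?v = "comb F c" and ?v' = "comb' F c"
  let ?M = "\<Sum>j\<in>F. (cmod (c j))\<^sup>2" and ?S = "\<Sum>j\<in>F. lam j * (cmod (c j))\<^sup>2"
  have S0: "0 \<le> ?S" using lam_pos by (intro sum_nonneg mult_nonneg_nonneg) (auto intro: less_imp_le)
  have nn: "(\<integral>\<^sup>+x. ennreal ((cmod (?v' x))\<^sup>2) \<partial>lborel) \<le> ennreal ?S"
    using V_nonneg by (intro order_trans[OF nn_integral_mono comb_energy[OF F]] ennreal_leI) auto
  have iv': "integrable lborel (\<lambda>x. (cmod (?v' x))\<^sup>2)"
    using nn by (intro integrableI_bounded) (auto intro: le_less_trans)
  have v'S: "(\<integral>x. (cmod (?v' x))\<^sup>2 \<partial>lborel) \<le> ?S"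
    using nn S0 by (subst (asm) nn_integral_eq_integral[OF iv']) (auto simp: ennreal_le_iff)
  define w where "w x = \<epsilon> * (cmod (?v x))\<^sup>2 + (cmod (?v' x))\<^sup>2 / \<epsilon>" for x
  have iw: "integrable lborel w" unfolding w_def[abs_def] using comb_norm(1)[OF F] iv' by auto
  have w0: "0 \<le> w x" for x using \<open>\<epsilon> > 0\<close> by (simp add: w_def)
  have wint: "(\<integral>x. w x \<partial>lborel) \<le> \<epsilon> * ?M + ?S / \<epsilon>"
    unfolding w_def using comb_norm[OF F] iv' v'S \<open>\<epsilon> > 0\<close> by (simp add: divide_right_mono)
  have d: "((\<lambda>x. ?v x \<bullet> ?v x) has_vector_derivative 2 * (?v x \<bullet> ?v' x)) (at x)" for x
  proof -
    have "((\<lambda>x. ?v x \<bullet> ?v x) has_vector_derivative ?v x \<bullet> ?v' x + ?v' x \<bullet> ?v x) (at x)"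
      by (intro bounded_bilinear.has_vector_derivative[OF bounded_bilinear_inner] comb_deriv)
    then show ?thesis by (simp add: inner_commute)
  qed
  have cont: "continuous_on A (\<lambda>x. 2 * (?v x \<bullet> ?v' x))" for A by (intro continuous_intros comb_cont)
  have young: "\<bar>2 * (?v x \<bullet> ?v' x)\<bar> \<le> w x" for x
  proof -
    have "\<bar>2 * (?v x \<bullet> ?v' x)\<bar> \<le> 2 * (cmod (?v x) * cmod (?v' x))"
      using Cauchy_Schwarz_ineq2[of "?v x" "?v' x"] by simp
    also have "2 * (a * b) \<le> \<epsilon> * a\<^sup>2 + b\<^sup>2 / \<epsilon>" for a b :: real
    proof -
      have "0 \<le> (\<epsilon> * a - b)\<^sup>2 / \<epsilon>" using \<open>\<epsilon> > 0\<close> by simp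
      also have "\<dots> = \<epsilon> * a\<^sup>2 + b\<^sup>2 / \<epsilon> - 2 * (a * b)" using \<open>\<epsilon> > 0\<close> by (simp add: field_simps power2_eq_square)
      finally show ?thesis by simp
    qed
    finally show ?thesis unfolding w_def .
  qed
  have diff: "\<bar>?v b \<bullet> ?v b - ?v a \<bullet> ?v a\<bar> \<le> \<epsilon> * ?M + ?S / \<epsilon>" if "a \<le> b" for a b
  proof -
    have int: "integrable lborel (\<lambda>x. indicator {a..b} x *\<^sub>R (2 * (?v x \<bullet> ?v' x)))"
      using borel_integrable_compact[of "{a..b}", OF _ cont] by simp
    have "\<bar>?v b \<bullet> ?v b - ?v a \<bullet> ?v a\<bar> = norm (\<integral>x. indicator {a..b} x *\<^sub>R (2 * (?v x \<bullet> ?v' x)) \<partial>lborel)"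
      using that by (subst integral_FTC_atLeastAtMost[OF _ has_vector_derivative_at_within[OF d] cont]) auto
    also have "\<dots> \<le> (\<integral>x. w x \<partial>lborel)"
      by (rule Bochner_Integration.integral_norm_bound_integral[OF int iw])
         (use young w0 in \<open>auto simp: indicator_def\<close>)
    finally show ?thesis using wint by linarith
  qed
  show ?thesis
  proof (rule field_le_epsilon)
    fix r :: real assume r: "0 < r"
    have "\<exists>y. (cmod (?v y))\<^sup>2 < r"
    proof (rule ccontr)
      assume "\<not> ?thesis"
      then have le: "r \<le> (cmod (?v y))\<^sup>2" for y by (auto simp: not_less)
      have "(\<integral>\<^sup>+y. ennreal r \<partial>(lborel :: real measure)) \<le> (\<integral>\<^sup>+y. ennreal ((cmod (?v y))\<^sup>2) \<partial>(lborel :: real measure))"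
        by (rule nn_integral_mono, rule ennreal_leI, rule le)
      also have "\<dots> < \<infinity>" using comb_norm(1)[OF F, of c] by (auto simp: integrable_iff_bounded)
      finally show False using r by (simp add: ennreal_mult_less_top)
    qed
    then obtain y where y: "(cmod (?v y))\<^sup>2 < r" by blast
    have "\<bar>?v x \<bullet> ?v x - ?v y \<bullet> ?v y\<bar> \<le> \<epsilon> * ?M + ?S / \<epsilon>"
      using diff[of x y] diff[of y x] by (cases "x \<le> y") (auto simp: abs_minus_commute)
    then show "(cmod (?v x))\<^sup>2 \<le> \<epsilon> * ?M + ?S / \<epsilon> + r"
      using y by (simp add: power2_norm_eq_inner)
  qed
qed

text \<open>The choice \<epsilon> = sqrt \<Lambda> balances mass against energy below frequency
  \<Lambda>.\<close>

lemma comb_sup_low: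
  assumes F: "finite F" and L: "\<Lambda> > 0" "\<And>j. j \<in> F \<Longrightarrow> lam j \<le> \<Lambda>"
  shows "(cmod (comb F c x))\<^sup>2 \<le> 2 * sqrt \<Lambda> * (\<Sum>j\<in>F. (cmod (c j))\<^sup>2)"
proof -
  have "(\<Sum>j\<in>F. lam j * (cmod (c j))\<^sup>2) \<le> \<Lambda> * (\<Sum>j\<in>F. (cmod (c j))\<^sup>2)"
    unfolding sum_distrib_left by (intro sum_mono mult_right_mono L) auto
  then have "(\<Sum>j\<in>F. lam j * (cmod (c j))\<^sup>2) / sqrt \<Lambda> \<le> sqrt \<Lambda> * (\<Sum>j\<in>F. (cmod (c j))\<^sup>2)"
    using L(1) by (simp add: divide_le_eq mult.assoc mult.commute[of _ "sqrt \<Lambda>"]) (simp flip: mult.assoc)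
  then show ?thesis using comb_sup[OF F, of "sqrt \<Lambda>" c x] L(1) by simp
qed

text \<open>The coefficients \<open>cnj (E j x)\<close> form the reproducing kernel with pole x. Its
  value at x and its squared norm are both the spectral density, so the sup bound becomes a
  quadratic inequality for that density.\<close>

lemma spectral_density_low:
  assumes F: "finite F" and L: "\<Lambda> > 0" "\<And>j. j \<in> F \<Longrightarrow> lam j \<le> \<Lambda>"
  shows "(\<Sum>j\<in>F. (cmod (E j x))\<^sup>2) \<le> 2 * sqrt \<Lambda>"
proof -
  let ?\<rho> = "\<Sum>j\<in>F. (cmod (E j x))\<^sup>2"
  have "comb F (\<lambda>j. cnj (E j x)) x = of_real ?\<rho>"
    unfolding comb_def by (simp add: complex_norm_square[symmetric] mult.commute)
  then have "?\<rho>\<^sup>2 \<le> 2 * sqrt \<Lambda> * ?\<rho>" using comb_sup_low[OF F L, of "\<lambda>j. cnj (E j x)" x] by (simp add: norm_power del: of_real_sum)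
  moreover have "0 \<le> ?\<rho>" by (intro sum_nonneg) auto
  ultimately show ?thesis using L(1) by (cases "?\<rho> = 0") (auto simp: power2_eq_square)
qed

text \<open>The test vector is the Green function of the block with pole \<open>x\<close>.\<close>

lemma green_diagonal_high:
  assumes F: "finite F" and L: "\<Lambda> > 0" "\<And>j. j \<in> F \<Longrightarrow> \<Lambda> \<le> lam j"
  shows "(\<Sum>j\<in>F. (cmod (E j x))\<^sup>2 / lam j) \<le> 2 / sqrt \<Lambda>"
proof -
  let ?g = "\<Sum>j\<in>F. (cmod (E j x))\<^sup>2 / lam j"
  let ?c = "\<lambda>j. cnj (E j x) / of_real (lam j)"
  have g0: "0 \<le> ?g" using lam_pos by (intro sum_nonneg) (auto intro: divide_nonneg_pos)
  have cg: "comb F ?c x = of_real ?g"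
    unfolding comb_def by (simp add: complex_norm_square[symmetric] mult.commute)
  have c2: "(cmod (?c j))\<^sup>2 = (cmod (E j x))\<^sup>2 / lam j / lam j" for j
    using lam_pos[of j] by (simp add: norm_divide power_divide power2_eq_square)
  have "(\<Sum>j\<in>F. (cmod (?c j))\<^sup>2) \<le> ?g / \<Lambda>"
    unfolding c2 sum_divide_distrib
    using L lam_pos by (intro sum_mono divide_left_mono) (auto intro: divide_nonneg_pos)
  moreover have "(\<Sum>j\<in>F. lam j * (cmod (?c j))\<^sup>2) = ?g"
    unfolding c2 using lam_pos by (intro sum.cong) (auto simp: less_imp_neq[symmetric])
  moreover have "?g\<^sup>2 \<le> sqrt \<Lambda> * (\<Sum>j\<in>F. (cmod (?c j))\<^sup>2) + (\<Sum>j\<in>F. lam j * (cmod (?c j))\<^sup>2) / sqrt \<Lambda>"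
    using comb_sup[OF F, of "sqrt \<Lambda>" ?c x] L(1) unfolding cg by (simp only: norm_of_real power2_abs real_sqrt_gt_zero)
  ultimately have "?g\<^sup>2 \<le> sqrt \<Lambda> * (?g / \<Lambda>) + ?g / sqrt \<Lambda>"
    using mult_left_mono[of "\<Sum>j\<in>F. (cmod (?c j))\<^sup>2" "?g / \<Lambda>" "sqrt \<Lambda>"] L(1) by simp
  also have "\<dots> = 2 / sqrt \<Lambda> * ?g"
    using L(1) by (simp add: field_simps)
  finally show ?thesis by (rule le_of_square_le) (use g0 L(1) in auto)
qed

lemma potential_energy: "(\<integral>\<^sup>+x. ennreal (V x * (cmod (E j x))\<^sup>2) \<partial>lborel) \<le> ennreal (lam j)"
proof -
  have "(\<integral>\<^sup>+x. ennreal (V x * (cmod (E j x))\<^sup>2) \<partial>lborel)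
    \<le> (\<integral>\<^sup>+x. ennreal ((cmod (comb' {j} (\<lambda>_. 1) x))\<^sup>2 + V x * (cmod (comb {j} (\<lambda>_. 1) x))\<^sup>2) \<partial>lborel)"
    by (intro nn_integral_mono ennreal_leI) (auto simp: comb_def)
  also have "\<dots> \<le> ennreal (lam j)" using comb_energy[of "{j}" "\<lambda>_. 1"] by simp
  finally show ?thesis .
qed

lemma E_norm: "(\<integral>\<^sup>+x. ennreal ((cmod (E j x))\<^sup>2) \<partial>lborel) = 1"
  using comb_norm[of "{j}" "\<lambda>_. 1"] nn_integral_eq_integral[OF E_L2[of j]] by (simp add: comb_def)

text \<open>A phase space bound. An eigenfunction with eigenvalue at most \<Lambda> has potential
  energy at most \<Lambda>, so at least half of its norm lies in the interval outside of which V
  \<ge> 2 \<Lambda>. Summing over \<open>F\<close> and inserting the spectral density bound limits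
  the number by the length of the interval times sqrt \<Lambda>.\<close>

lemma eigenvalue_count:
  assumes C: "C \<ge> 1" and s: "s > 0" and V: "\<And>x. 1 \<le> \<bar>x\<bar> \<Longrightarrow> \<bar>x\<bar> powr s / C \<le> V x"
    and F: "finite F" and L: "\<Lambda> \<ge> 1" "\<And>j. j \<in> F \<Longrightarrow> lam j \<le> \<Lambda>"
  shows "real (card F) \<le> 8 * (2 * C) powr (1/s) * \<Lambda> powr (1/2 + 1/s)"
proof -
  \<comment> \<open>Chosen so that r^s / C = 2 \<Lambda>, which is the lower bound for V beyond
    r.\<close>
  define r where "r = (2 * C * \<Lambda>) powr (1/s)"
  have CL: "1 \<le> 2 * C * \<Lambda>" using C L(1) mult_mono[of 1 "2 * C" 1 \<Lambda>] by simp
  have r1: "r \<ge> 1" unfolding r_def using CL s by (intro ge_one_powr_ge_zero) auto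
  have rs: "r powr s = 2 * C * \<Lambda>" unfolding r_def using s CL by (simp add: powr_powr)
  have half: "ennreal (1/2) \<le> (\<integral>\<^sup>+x. ennreal ((cmod (E j x))\<^sup>2) * indicator {-r..r} x \<partial>lborel)" if "j \<in> F" for j
  proof -
    let ?a = "\<integral>\<^sup>+x. ennreal ((cmod (E j x))\<^sup>2) * indicator {-r..r} x \<partial>lborel"
    let ?b = "\<integral>\<^sup>+x. ennreal ((cmod (E j x))\<^sup>2) * indicator (-{-r..r}) x \<partial>lborel"
    have "?a + ?b = (\<integral>\<^sup>+x. ennreal ((cmod (E j x))\<^sup>2) \<partial>lborel)"
      by (subst nn_integral_add[symmetric]) (auto intro!: nn_integral_cong simp: indicator_def)
    then have ab: "?a + ?b = 1" by (simp add: E_norm)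
    have "ennreal (2 * \<Lambda>) * ?b = (\<integral>\<^sup>+x. ennreal (2 * \<Lambda>) * (ennreal ((cmod (E j x))\<^sup>2) * indicator (-{-r..r}) x) \<partial>lborel)"
      by (rule nn_integral_cmult[symmetric]) measurable
    also have "\<dots> \<le> (\<integral>\<^sup>+x. ennreal (V x * (cmod (E j x))\<^sup>2) \<partial>lborel)"
    proof (intro nn_integral_mono)
      fix x :: real
      show "ennreal (2 * \<Lambda>) * (ennreal ((cmod (E j x))\<^sup>2) * indicator (-{-r..r}) x) \<le> ennreal (V x * (cmod (E j x))\<^sup>2)"
      proof (cases "x \<in> {-r..r}")
        case False
        then have "r \<le> \<bar>x\<bar>" by (auto simp: abs_if)
        then have "2 * \<Lambda> \<le> \<bar>x\<bar> powr s / C"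
          using powr_mono2[of s r "\<bar>x\<bar>"] r1 s C unfolding rs by (simp add: field_simps)
        also have "\<dots> \<le> V x" using \<open>r \<le> \<bar>x\<bar>\<close> r1 by (intro V) auto
        finally have "2 * \<Lambda> * (cmod (E j x))\<^sup>2 \<le> V x * (cmod (E j x))\<^sup>2" by (rule mult_right_mono) simp
        then show ?thesis using False L(1) by (auto simp: ennreal_mult[symmetric] intro!: ennreal_leI)
      qed simp
    qed
    also have "\<dots> \<le> ennreal (lam j)" by (rule potential_energy)
    also have "\<dots> \<le> ennreal \<Lambda>" using L(2)[OF that] by (rule ennreal_leI)
    finally have b: "ennreal (2 * \<Lambda>) * ?b \<le> ennreal \<Lambda>" .
    have "?b \<le> ?a + ?b" by (rule add_increasing) auto
    then have "?b \<le> 1" unfolding ab .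
    then obtain b where b': "?b = ennreal b" "0 \<le> b" by (cases ?b) (auto simp: top_unique)
    have "2 * \<Lambda> * b \<le> \<Lambda>" using b b' L(1) by (simp add: ennreal_mult[symmetric] ennreal_le_iff)
    then have b2: "b \<le> 1/2" using L(1) by simp
    have "?a \<le> ?a + ?b" by (rule add_increasing2) auto
    then have "?a \<le> 1" unfolding ab .
    then obtain a where a': "?a = ennreal a" "0 \<le> a" by (cases ?a) (auto simp: top_unique)
    have "a + b = 1" using ab a' b' by (simp flip: ennreal_plus)
    then have "1/2 \<le> a" using b2 by simp
    then show ?thesis unfolding a' by (rule ennreal_leI)
  qed
  have "ennreal (real (card F) / 2) = (\<Sum>j\<in>F. ennreal (1/2))"
    by (subst sum_ennreal) auto
  also have "\<dots> \<le> (\<Sum>j\<in>F. \<integral>\<^sup>+x. ennreal ((cmod (E j x))\<^sup>2) * indicator {-r..r} x \<partial>lborel)"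
    by (rule sum_mono) (rule half)
  also have "\<dots> = (\<integral>\<^sup>+x. (\<Sum>j\<in>F. ennreal ((cmod (E j x))\<^sup>2) * indicator {-r..r} x) \<partial>lborel)"
    by (rule nn_integral_sum[symmetric]) measurable
  also have "\<dots> \<le> (\<integral>\<^sup>+x. ennreal (2 * sqrt \<Lambda>) * indicator {-r..r} x \<partial>lborel)"
  proof (intro nn_integral_mono)
    fix x :: real
    show "(\<Sum>j\<in>F. ennreal ((cmod (E j x))\<^sup>2) * indicator {-r..r} x) \<le> ennreal (2 * sqrt \<Lambda>) * indicator {-r..r} x"
      using spectral_density_low[OF F _ L(2), of x] L(1) by (auto simp: indicator_def intro!: ennreal_leI)
  qed
  also have "\<dots> = ennreal (2 * sqrt \<Lambda> * (2 * r))"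
  proof -
    have em: "emeasure lborel {-r..r} = ennreal (2 * r)"
      using r1 by (subst emeasure_lborel_Icc) (auto intro!: arg_cong[where f = ennreal])
    show ?thesis
      using r1 L(1) by (subst nn_integral_cmult) (auto simp only: nn_integral_indicator sets_lborel borel_closed closed_atLeastAtMost measurable_lborel1 borel_measurable_indicator em intro!: ennreal_mult[symmetric] mult_nonneg_nonneg real_sqrt_ge_zero)
  qed
  finally have "real (card F) / 2 \<le> 2 * sqrt \<Lambda> * (2 * r)"
    using r1 L(1) by (subst (asm) ennreal_le_iff) auto
  then have "real (card F) \<le> 8 * (sqrt \<Lambda> * r)" by simp
  also have "sqrt \<Lambda> * r = (2 * C) powr (1/s) * \<Lambda> powr (1/2 + 1/s)"
    using L(1) C unfolding r_def by (simp add: powr_mult powr_add powr_half_sqrt)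
  finally show ?thesis by simp
qed

text \<open>Counting the first j + 1 eigenvalues at level \<open>lam j\<close> shows that
  \<open>lam j\<close> grows at least like (j+1)^(1/a) with a = 1/2 + 1/s, and the series is
  compared with a convergent power series.\<close>

lemma eigenvalue_sum:
  assumes C: "C \<ge> 1" and s: "s > 0" and V: "\<And>x. 1 \<le> \<bar>x\<bar> \<Longrightarrow> \<bar>x\<bar> powr s / C \<le> V x"
    and p: "p > 1/2 + 1/s"
  shows "summable (\<lambda>j. lam j powr (- p))"
proof -
  define a where "a = 1/2 + 1/s"
  define K where "K = 8 * (2 * C) powr (1/s)"
  have a: "a > 0" "p > a" "p > 0" using s p divide_pos_pos[of 1 s] unfolding a_def by linarith+
  have K: "K > 0" unfolding K_def using C by simp
  show ?thesis
  proof (rule summable_comparison_test_ev)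
    have "\<forall>\<^sub>F j in sequentially. 1 \<le> lam j"
      using lam_lim by (simp add: filterlim_at_top)
    then show "\<forall>\<^sub>F j in sequentially. norm (lam j powr (- p)) \<le> K powr (p/a) * real (Suc j) powr (- (p/a))"
    proof eventually_elim
      case (elim j)
      have "real (card {..j}) \<le> K * lam j powr a"
        unfolding K_def a_def by (rule eigenvalue_count[OF C s V]) (use elim incseqD[OF lam_mono] in auto)
      then have "real (Suc j) / K \<le> lam j powr a" using K by (simp add: field_simps)
      then have "(lam j powr a) powr (- (p/a)) \<le> (real (Suc j) / K) powr (- (p/a))"
        using a K by (intro powr_mono2') (auto simp: divide_pos_pos)
      also have "(lam j powr a) powr (- (p/a)) = lam j powr (- p)" using a by (simp add: powr_powr)
      also have "(real (Suc j) / K) powr (- (p/a)) = K powr (p/a) * real (Suc j) powr (- (p/a))"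
        using K by (simp add: powr_divide powr_minus field_simps)
      finally show ?case by simp
    qed
    have "summable (\<lambda>j. real (Suc j) powr (- (p/a)))"
      using a by (subst summable_Suc_iff[of "\<lambda>j. real j powr (- (p/a))"]) (simp add: summable_real_powr_iff)
    then show "summable (\<lambda>j. K powr (p/a) * real (Suc j) powr (- (p/a)))" by (rule summable_mult)
  qed
qed

end

section \<open>Pairing with test functions\<close>

text \<open>Families of test functions that are bounded in the topology of compactly supported smooth functions.\<close>

definition bdd_family :: "(real \<Rightarrow> real) set \<Rightarrow> bool" where
  "bdd_family S \<longleftrightarrow> (\<forall>\<phi>\<in>S. smooth_fun \<phi>) \<and> (\<exists>R. \<forall>\<phi>\<in>S. \<forall>x. R < \<bar>x\<bar> \<longrightarrow> \<phi> x = 0) \<and>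
     (\<forall>i. \<exists>B. \<forall>\<phi>\<in>S. \<forall>x. \<bar>(deriv ^^ i) \<phi> x\<bar> \<le> B)"

lemma bdd_family_test: "bdd_family S \<Longrightarrow> \<phi> \<in> S \<Longrightarrow> test_fun \<phi>"
  unfolding bdd_family_def test_fun_def by blast

lemma bdd_family_deriv:
  assumes S: "bdd_family S" shows "bdd_family (deriv ` S)"
proof -
  obtain R where R: "\<And>\<phi> x. \<phi> \<in> S \<Longrightarrow> R < \<bar>x\<bar> \<Longrightarrow> \<phi> x = 0" using S unfolding bdd_family_def by blast
  have "\<forall>\<psi>\<in>deriv ` S. \<forall>x. R < \<bar>x\<bar> \<longrightarrow> \<psi> x = 0" using deriv_zero_outside R by blast
  moreover have "\<exists>B. \<forall>\<psi>\<in>deriv ` S. \<forall>x. \<bar>(deriv ^^ i) \<psi> x\<bar> \<le> B" for i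
  proof -
    obtain B where "\<forall>\<phi>\<in>S. \<forall>x. \<bar>(deriv ^^ Suc i) \<phi> x\<bar> \<le> B" using S unfolding bdd_family_def by blast
    then show ?thesis by (intro exI[of _ B]) (auto simp: funpow_swap1)
  qed
  ultimately show ?thesis using S smooth_fun_deriv unfolding bdd_family_def by blast
qed

lemma deriv_iter_add:
  assumes "smooth_fun f" "smooth_fun g"
  shows "(deriv ^^ i) (\<lambda>x. f x + g x) = (\<lambda>x. (deriv ^^ i) f x + (deriv ^^ i) g x)"
  using assms
proof (induction i arbitrary: f g)
  case (Suc i)
  have "deriv (\<lambda>x. f x + g x) = (\<lambda>x. deriv f x + deriv g x)"
    using Suc.prems by (intro ext DERIV_imp_deriv DERIV_add smooth_fun_DERIV)
  then show ?case using Suc.IH[of "deriv f" "deriv g"] Suc.prems smooth_fun_deriv by (simp add: funpow_swap1)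
qed simp

lemma bdd_family_image:
  "bdd_family (F ` I) \<longleftrightarrow> (\<forall>i\<in>I. smooth_fun (F i)) \<and> (\<exists>R. \<forall>i\<in>I. \<forall>x. R < \<bar>x\<bar> \<longrightarrow> F i x = 0) \<and>
     (\<forall>n. \<exists>B. \<forall>i\<in>I. \<forall>x. \<bar>(deriv ^^ n) (F i) x\<bar> \<le> B)"
  by (simp add: bdd_family_def)

lemma bdd_family_add:
  assumes S: "bdd_family (F ` I)" and T: "bdd_family (G ` I)"
  shows "bdd_family ((\<lambda>i x. F i x + G i x) ` I)"
proof -
  note S' = S[unfolded bdd_family_image] and T' = T[unfolded bdd_family_image]
  obtain R1 where R1: "\<forall>i\<in>I. \<forall>x. R1 < \<bar>x\<bar> \<longrightarrow> F i x = 0" using S' by blast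
  obtain R2 where R2: "\<forall>i\<in>I. \<forall>x. R2 < \<bar>x\<bar> \<longrightarrow> G i x = 0" using T' by blast
  have sm: "smooth_fun (F i)" "smooth_fun (G i)" if "i \<in> I" for i using S' T' that by auto
  have 3: "\<exists>B. \<forall>i\<in>I. \<forall>x. \<bar>(deriv ^^ n) (\<lambda>x. F i x + G i x) x\<bar> \<le> B" for n
  proof -
    obtain B1 where B1: "\<forall>i\<in>I. \<forall>x. \<bar>(deriv ^^ n) (F i) x\<bar> \<le> B1" using S' by blast
    obtain B2 where B2: "\<forall>i\<in>I. \<forall>x. \<bar>(deriv ^^ n) (G i) x\<bar> \<le> B2" using T' by blast
    have "\<bar>(deriv ^^ n) (\<lambda>x. F i x + G i x) x\<bar> \<le> B1 + B2" if "i \<in> I" for i x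
      unfolding deriv_iter_add[OF sm[OF that]] using B1[rule_format, OF that, of x] B2[rule_format, OF that, of x] by linarith
    then show ?thesis by blast
  qed
  show ?thesis unfolding bdd_family_image
  proof (intro conjI allI 3)
    show "\<forall>i\<in>I. smooth_fun (\<lambda>x. F i x + G i x)" using sm smooth_fun_add by blast
    show "\<exists>R. \<forall>i\<in>I. \<forall>x. R < \<bar>x\<bar> \<longrightarrow> F i x + G i x = 0"
      by (rule exI[of _ "max R1 R2"]) (use R1 R2 in auto)
  qed
qed

text \<open>The Leibniz rule by induction on the order, with family and factor both generalised: one
  derivative splits the product into f' \<phi> and f \<phi>', to which the hypothesis applies with a
  new factor or a new family.\<close>

lemma bdd_family_mult:
  assumes S: "bdd_family S" and f: "smooth_fun f"
  shows "bdd_family ((\<lambda>\<phi> x. f x * \<phi> x) ` S)"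
proof -
  have bound: "\<exists>B. \<forall>\<phi>\<in>S. \<forall>x. \<bar>(deriv ^^ i) (\<lambda>x. f x * \<phi> x) x\<bar> \<le> B"
    if "bdd_family S" "smooth_fun f" for i S f
    using that
  proof (induction i arbitrary: S f)
    case 0
    obtain R where R: "\<And>\<phi> x. \<phi> \<in> S \<Longrightarrow> R < \<bar>x\<bar> \<Longrightarrow> \<phi> x = 0" using 0(1) unfolding bdd_family_def by blast
    obtain B where B: "\<And>\<phi> x. \<phi> \<in> S \<Longrightarrow> \<bar>(deriv ^^ 0) \<phi> x\<bar> \<le> B" using 0(1) unfolding bdd_family_def by blast
    have "compact (f ` {-R..R})" by (intro compact_continuous_image smooth_fun_continuous 0) auto
    then obtain M where M: "\<forall>y\<in>f ` {-R..R}. norm y \<le> M" using compact_imp_bounded bounded_iff by metis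
    have "\<bar>f x * \<phi> x\<bar> \<le> \<bar>M\<bar> * \<bar>B\<bar>" if "\<phi> \<in> S" for \<phi> x
    proof (cases "\<bar>x\<bar> \<le> R")
      case True
      then have "norm (f x) \<le> M" using M by (auto simp: abs_le_iff)
      then show ?thesis using B[OF that, of x] unfolding abs_mult by (intro mult_mono) auto
    qed (use R[OF that, of x] in auto)
    then show ?case by auto
  next
    case (Suc i)
    have sm: "smooth_fun \<phi>" if "\<phi> \<in> S" for \<phi> using Suc.prems(1) that unfolding bdd_family_def by blast
    obtain B1 where B1: "\<And>\<phi> x. \<phi> \<in> S \<Longrightarrow> \<bar>(deriv ^^ i) (\<lambda>x. deriv f x * \<phi> x) x\<bar> \<le> B1"
      using Suc.IH[OF Suc.prems(1) smooth_fun_deriv[OF Suc.prems(2)]] by blast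
    obtain B2 where B2: "\<And>\<phi> x. \<phi> \<in> S \<Longrightarrow> \<bar>(deriv ^^ i) (\<lambda>x. f x * deriv \<phi> x) x\<bar> \<le> B2"
      using Suc.IH[OF bdd_family_deriv[OF Suc.prems(1)] Suc.prems(2)] by blast
    have "\<bar>(deriv ^^ Suc i) (\<lambda>x. f x * \<phi> x) x\<bar> \<le> B1 + B2" if "\<phi> \<in> S" for \<phi> x
    proof -
      have "deriv (\<lambda>x. f x * \<phi> x) = (\<lambda>x. deriv f x * \<phi> x + f x * deriv \<phi> x)"
        by (intro ext DERIV_imp_deriv)
           (auto intro!: derivative_eq_intros smooth_fun_DERIV sm[OF that] Suc.prems)
      then have "(deriv ^^ Suc i) (\<lambda>x. f x * \<phi> x) = (\<lambda>x. (deriv ^^ i) (\<lambda>x. deriv f x * \<phi> x) x + (deriv ^^ i) (\<lambda>x. f x * deriv \<phi> x) x)"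
        by (simp add: funpow_swap1 deriv_iter_add smooth_fun_mult smooth_fun_deriv sm[OF that] Suc.prems)
      then show ?thesis using B1[OF that, of x] B2[OF that, of x] by simp
    qed
    then show ?case by blast
  qed
  obtain R where R: "\<And>\<phi> x. \<phi> \<in> S \<Longrightarrow> R < \<bar>x\<bar> \<Longrightarrow> \<phi> x = 0" using S unfolding bdd_family_def by blast
  have 1: "\<forall>\<psi>\<in>(\<lambda>\<phi> x. f x * \<phi> x) ` S. smooth_fun \<psi>" using S f smooth_fun_mult unfolding bdd_family_def by blast
  have 2: "\<forall>\<psi>\<in>(\<lambda>\<phi> x. f x * \<phi> x) ` S. \<forall>x. R < \<bar>x\<bar> \<longrightarrow> \<psi> x = 0" using R by auto
  have 3: "\<exists>B. \<forall>\<psi>\<in>(\<lambda>\<phi> x. f x * \<phi> x) ` S. \<forall>x. \<bar>(deriv ^^ i) \<psi> x\<bar> \<le> B" for i using bound[OF S f, of i] by blast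
  show ?thesis unfolding bdd_family_def using 1 2 3 by blast
qed

lemma deriv_iter_translate:
  assumes "smooth_fun \<phi>" shows "(deriv ^^ i) (\<lambda>y. \<phi> (y - z)) = (\<lambda>y. (deriv ^^ i) \<phi> (y - z))"
  using assms
proof (induction i arbitrary: \<phi>)
  case (Suc i)
  have "((\<lambda>y. \<phi> (y - z)) has_real_derivative deriv \<phi> (y - z) * 1) (at y)" for y
    by (rule DERIV_chain2[OF smooth_fun_DERIV[OF Suc.prems]]) (auto intro!: derivative_eq_intros)
  then have "deriv (\<lambda>y. \<phi> (y - z)) = (\<lambda>y. deriv \<phi> (y - z))" by (intro ext DERIV_imp_deriv) simp
  then show ?case using Suc.IH[OF smooth_fun_deriv[OF Suc.prems]] by (simp add: funpow_swap1)
qed simp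

lemma bdd_family_translates:
  assumes \<phi>: "test_fun \<phi>" shows "bdd_family ((\<lambda>z y. \<phi> (y - z)) ` {-r..r})"
proof -
  obtain R where R: "R > 0" "\<And>x. R < \<bar>x\<bar> \<Longrightarrow> \<phi> x = 0" using test_fun_support[OF \<phi>] by blast
  have it: "test_fun ((deriv ^^ i) \<phi>)" for i by (induction i) (use \<phi> test_fun_deriv in auto)
  have 1: "\<forall>\<psi>\<in>(\<lambda>z y. \<phi> (y - z)) ` {-r..r}. smooth_fun \<psi>"
    using test_fun_translate[OF \<phi>] test_fun_smooth by blast
  have 2: "\<forall>\<psi>\<in>(\<lambda>z y. \<phi> (y - z)) ` {-r..r}. \<forall>x. R + \<bar>r\<bar> < \<bar>x\<bar> \<longrightarrow> \<psi> x = 0"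
    by (auto intro!: R(2))
  have 3: "\<exists>B. \<forall>\<psi>\<in>(\<lambda>z y. \<phi> (y - z)) ` {-r..r}. \<forall>x. \<bar>(deriv ^^ i) \<psi> x\<bar> \<le> B" for i
  proof -
    obtain B where "\<And>x. \<bar>(deriv ^^ i) \<phi> x\<bar> \<le> B" using test_fun_bounded[OF it] by blast
    then show ?thesis by (intro exI[of _ B]) (auto simp: deriv_iter_translate[OF test_fun_smooth[OF \<phi>]])
  qed
  show ?thesis unfolding bdd_family_def using 1 2 3 by blast
qed

lemma locL1_pairing:
  assumes c: "locL1 s f" and s: "\<And>n. loc_int (s n)" and f: "loc_int f" and \<phi>: "test_fun \<phi>"
  shows "(\<lambda>n. \<integral>x. s n x * of_real (\<phi> x) \<partial>lborel) \<longlonglongrightarrow> (\<integral>x. f x * of_real (\<phi> x) \<partial>lborel)"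
proof -
  note [measurable] = loc_int_measurable[OF s] loc_int_measurable[OF f] smooth_fun_measurable[OF test_fun_smooth[OF \<phi>]]
  obtain R where R: "R > 0" "\<And>x. R < \<bar>x\<bar> \<Longrightarrow> \<phi> x = 0" using test_fun_support[OF \<phi>] by blast
  obtain B where B: "B > 0" "\<And>x. \<bar>\<phi> x\<bar> \<le> B" using test_fun_bounded[OF \<phi>] by blast
  have isn: "integrable lborel (\<lambda>x. s n x * of_real (\<phi> x))" for n by (rule loc_int_test_integrable[OF s \<phi>])
  have if': "integrable lborel (\<lambda>x. f x * of_real (\<phi> x))" by (rule loc_int_test_integrable[OF f \<phi>])
  let ?d = "\<lambda>n. \<integral>\<^sup>+x. ennreal (cmod (s n x - f x)) * indicator {-R..R} x \<partial>lborel"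
  have bound: "ennreal (cmod ((\<integral>x. s n x * of_real (\<phi> x) \<partial>lborel) - (\<integral>x. f x * of_real (\<phi> x) \<partial>lborel))) \<le> ennreal B * ?d n" for n
  proof -
    have "ennreal (cmod ((\<integral>x. s n x * of_real (\<phi> x) \<partial>lborel) - (\<integral>x. f x * of_real (\<phi> x) \<partial>lborel)))
      = ennreal (cmod (\<integral>x. s n x * of_real (\<phi> x) - f x * of_real (\<phi> x) \<partial>lborel))"
      using isn if' by simp
    also have "\<dots> \<le> (\<integral>\<^sup>+x. cmod (s n x * of_real (\<phi> x) - f x * of_real (\<phi> x)) \<partial>lborel)"
      by (intro integral_norm_bound_ennreal Bochner_Integration.integrable_diff isn if')
    also have "\<dots> \<le> (\<integral>\<^sup>+x. ennreal B * (ennreal (cmod (s n x - f x)) * indicator {-R..R} x) \<partial>lborel)"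
    proof (intro nn_integral_mono)
      fix x
      show "ennreal (cmod (s n x * of_real (\<phi> x) - f x * of_real (\<phi> x))) \<le> ennreal B * (ennreal (cmod (s n x - f x)) * indicator {-R..R} x)"
      proof (cases "\<bar>x\<bar> \<le> R")
        case True
        have "cmod (s n x * of_real (\<phi> x) - f x * of_real (\<phi> x)) = \<bar>\<phi> x\<bar> * cmod (s n x - f x)"
          unfolding left_diff_distrib[symmetric] by (simp add: norm_mult mult.commute)
        also have "\<dots> \<le> B * cmod (s n x - f x)" by (intro mult_right_mono B) auto
        finally show ?thesis using True B(1) by (auto simp: abs_le_iff ennreal_mult[symmetric] intro!: ennreal_leI)
      qed (simp add: R(2))
    qed
    also have "\<dots> = ennreal B * ?d n" by (rule nn_integral_cmult) measurable
    finally show ?thesis .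
  qed
  have "(\<lambda>n. ennreal B * ?d n) \<longlonglongrightarrow> ennreal B * 0"
    using c unfolding locL1_def by (intro ennreal_tendsto_cmult) auto
  then have "(\<lambda>n. ennreal (cmod ((\<integral>x. s n x * of_real (\<phi> x) \<partial>lborel) - (\<integral>x. f x * of_real (\<phi> x) \<partial>lborel)))) \<longlonglongrightarrow> 0"
    by (intro ennreal_sandwich0[OF bound]) simp
  then have "(\<lambda>n. cmod ((\<integral>x. s n x * of_real (\<phi> x) \<partial>lborel) - (\<integral>x. f x * of_real (\<phi> x) \<partial>lborel))) \<longlonglongrightarrow> 0"
    using tendsto_ennreal_iff[of "\<lambda>n. cmod ((\<integral>x. s n x * of_real (\<phi> x) \<partial>lborel) - (\<integral>x. f x * of_real (\<phi> x) \<partial>lborel))" sequentially 0] by simp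
  then show ?thesis using tendsto_norm_zero_iff LIM_zero_iff by blast
qed

lemma norm_integral_le:
  fixes f :: "real \<Rightarrow> complex"
  assumes g: "integrable lborel g" and le: "\<And>x. norm (f x) \<le> g x"
  shows "norm (\<integral>x. f x \<partial>lborel) \<le> (\<integral>x. g x \<partial>lborel)"
proof (cases "integrable lborel f")
  case True then show ?thesis by (rule Bochner_Integration.integral_norm_bound_integral[OF _ g le])
next
  case False
  have "0 \<le> g x" for x using le[of x] norm_ge_zero order_trans by blast
  then show ?thesis using False by (simp add: not_integrable_integral_eq)
qed

text \<open>The exponent b measures how far the inverse of the operator is from trace class: b = 0
  is the trace class case, and in general the partial traces below \<Lambda> grow at most like
  \<Lambda>^b.\<close>

locale admissible_eigenbasis = classical_eigenbasis +
  fixes b :: real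
  assumes b: "0 \<le> b" "b < 1/2" and lam_sum: "summable (\<lambda>j. lam j powr (- (1 + b)))"
begin

lemma lam_summable:
  assumes "q \<ge> 1 + b" shows "summable (\<lambda>j. lam j powr (- q))"
proof (rule summable_comparison_test'[OF summable_mult[OF lam_sum, of "lam 0 powr (- (q - (1 + b)))"]])
  fix j :: nat
  have "lam j powr (- q) = lam j powr (- (q - (1 + b))) * lam j powr (- (1 + b))"
    by (simp flip: powr_add)
  also have "\<dots> \<le> lam 0 powr (- (q - (1 + b))) * lam j powr (- (1 + b))"
    using assms lam_pos incseqD[OF lam_mono, of 0 j] by (intro mult_right_mono powr_mono2') auto
  finally show "norm (lam j powr (- q)) \<le> lam 0 powr (- (q - (1 + b))) * lam j powr (- (1 + b))" by simp
qed

definition pairing :: "nat \<Rightarrow> (real \<Rightarrow> real) \<Rightarrow> complex" where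
  "pairing j \<phi> = (\<integral>x. E j x * of_real (\<phi> x) \<partial>lborel)"

text \<open>The operator acting on a test function. By symmetry, pairing with an eigenfunction turns
  it into multiplication by the eigenvalue.\<close>

definition hop :: "(real \<Rightarrow> real) \<Rightarrow> real \<Rightarrow> real" where
  "hop \<phi> x = - deriv (deriv \<phi>) x + V x * \<phi> x"

lemma E_loc_int: "loc_int (E j)" by (intro continuous_loc_int E_cont)

lemma pairing_hop:
  assumes \<phi>: "test_fun \<phi>" shows "pairing j (hop \<phi>) = of_real (lam j) * pairing j \<phi>"
proof -
  let ?h = "\<lambda>x. of_real (V x - lam j) * E j x"
  have ch: "continuous_on UNIV ?h" by (intro continuous_intros V_cont E_cont)
  have t2: "test_fun (deriv (deriv \<phi>))" by (intro test_fun_deriv \<phi>)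
  have iE: "integrable lborel (\<lambda>x. E j x * of_real (\<psi> x))" if "test_fun \<psi>" for \<psi>
    by (rule loc_int_test_integrable[OF E_loc_int that])
  have ih: "integrable lborel (\<lambda>x. ?h x * of_real (\<phi> x))" by (intro loc_int_test_integrable continuous_loc_int ch \<phi>)
  have eq: "E j x * of_real (hop \<phi> x) = (?h x * of_real (\<phi> x) - E j x * of_real (deriv (deriv \<phi>) x)) + of_real (lam j) * (E j x * of_real (\<phi> x))" for x
    by (simp add: hop_def algebra_simps)
  have "pairing j (hop \<phi>) = (\<integral>x. ?h x * of_real (\<phi> x) \<partial>lborel) - (\<integral>x. E j x * of_real (deriv (deriv \<phi>) x) \<partial>lborel) + of_real (lam j) * pairing j \<phi>"
    unfolding pairing_def eq
    by (subst Bochner_Integration.integral_add, intro Bochner_Integration.integrable_diff ih iE t2,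
        intro integrable_mult_right iE \<phi>, subst Bochner_Integration.integral_diff[OF ih iE[OF t2]]) simp
  then show ?thesis using antideriv_second_weak[OF E'_deriv E_deriv ch \<phi>] by simp
qed

lemma bdd_family_hop:
  assumes S: "bdd_family S" shows "bdd_family (hop ` S)"
proof -
  have 1: "bdd_family ((\<lambda>\<phi> x. (- 1) * deriv (deriv \<phi>) x) ` S)"
    using bdd_family_mult[OF bdd_family_deriv[OF bdd_family_deriv[OF S]] smooth_fun_const[of "-1"]]
    by (simp add: image_image)
  have "bdd_family ((\<lambda>\<phi> x. (- 1) * deriv (deriv \<phi>) x + V x * \<phi> x) ` S)"
    by (rule bdd_family_add[OF 1 bdd_family_mult[OF S V_smooth]])
  moreover have "(\<lambda>\<phi> x. (- 1) * deriv (deriv \<phi>) x + V x * \<phi> x) = hop"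
    by (intro ext) (simp add: hop_def)
  ultimately show ?thesis by (simp only:)
qed

lemma pairing_bound_0:
  assumes S: "bdd_family S" shows "\<exists>C\<ge>0. \<forall>\<phi>\<in>S. \<forall>j. cmod (pairing j \<phi>) \<le> C"
proof -
  obtain R where R: "\<And>\<phi> x. \<phi> \<in> S \<Longrightarrow> R < \<bar>x\<bar> \<Longrightarrow> \<phi> x = 0" using S unfolding bdd_family_def by blast
  obtain B where B: "\<And>\<phi> x. \<phi> \<in> S \<Longrightarrow> \<bar>(deriv ^^ 0) \<phi> x\<bar> \<le> B" using S unfolding bdd_family_def by blast
  have iI: "integrable lborel (\<lambda>x. indicator {-R..R} x *\<^sub>R B\<^sup>2)"
    by (intro borel_integrable_compact continuous_intros) auto
  have "cmod (pairing j \<phi>) \<le> 1 + (\<integral>x. indicator {-R..R} x *\<^sub>R B\<^sup>2 \<partial>lborel)" if "\<phi> \<in> S" for \<phi> j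
  proof -
    have "cmod (pairing j \<phi>) \<le> (\<integral>x. (cmod (E j x))\<^sup>2 + indicator {-R..R} x *\<^sub>R B\<^sup>2 \<partial>lborel)"
      unfolding pairing_def
    proof (rule Bochner_Integration.integral_norm_bound_integral)
      show "integrable lborel (\<lambda>x. E j x * of_real (\<phi> x))"
        by (rule loc_int_test_integrable[OF E_loc_int bdd_family_test[OF S that]])
      show "integrable lborel (\<lambda>x. (cmod (E j x))\<^sup>2 + indicator {-R..R} x *\<^sub>R B\<^sup>2)"
        by (intro Bochner_Integration.integrable_add E_L2 iI)
      fix x
      have "cmod (E j x) * \<bar>\<phi> x\<bar> \<le> (cmod (E j x))\<^sup>2 + (\<phi> x)\<^sup>2"
      proof -
        have "2 * (cmod (E j x) * \<bar>\<phi> x\<bar>) \<le> (cmod (E j x))\<^sup>2 + (\<phi> x)\<^sup>2"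
          using sum_squares_bound[of "cmod (E j x)" "\<bar>\<phi> x\<bar>"] by (simp add: mult.assoc)
        moreover have "0 \<le> cmod (E j x) * \<bar>\<phi> x\<bar>" by simp
        ultimately show ?thesis by linarith
      qed
      moreover have "(\<phi> x)\<^sup>2 \<le> indicator {-R..R} x *\<^sub>R B\<^sup>2"
        using B[OF that, of x] R[OF that, of x] abs_le_square_iff[of "\<phi> x" B]
        by (cases "\<bar>x\<bar> \<le> R") (auto simp: abs_le_iff)
      ultimately show "norm (E j x * of_real (\<phi> x)) \<le> (cmod (E j x))\<^sup>2 + indicator {-R..R} x *\<^sub>R B\<^sup>2"
        by (simp add: norm_mult)
    qed
    also have "\<dots> = 1 + (\<integral>x. indicator {-R..R} x *\<^sub>R B\<^sup>2 \<partial>lborel)"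
      using comb_norm(2)[of "{j}" "\<lambda>_. 1"] by (subst Bochner_Integration.integral_add[OF E_L2 iI]) (simp add: comb_def)
    finally show ?thesis .
  qed
  moreover have "0 \<le> 1 + (\<integral>x. indicator {-R..R} x *\<^sub>R B\<^sup>2 \<partial>lborel)"
    by (intro add_nonneg_nonneg Bochner_Integration.integral_nonneg) auto
  ultimately show ?thesis by blast
qed

text \<open>Applying the operator k times multiplies the pairing by \<open>lam j ^ k\<close> while
  the family stays bounded. Pairings therefore decay faster than any power of the eigenvalue,
  uniformly over the family.\<close>

lemma pairing_bound:
  assumes S: "bdd_family S" shows "\<exists>C\<ge>0. \<forall>\<phi>\<in>S. \<forall>j. cmod (pairing j \<phi>) \<le> C * lam j powr (- real k)"
proof -
  have Sk: "bdd_family ((hop ^^ i) ` S)" for i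
    by (induction i) (use S bdd_family_hop in \<open>auto simp: image_image[symmetric]\<close>)
  have pk: "pairing j ((hop ^^ i) \<phi>) = of_real (lam j ^ i) * pairing j \<phi>" if "\<phi> \<in> S" for j i \<phi>
  proof (induction i)
    case (Suc i)
    have "test_fun ((hop ^^ i) \<phi>)" using bdd_family_test[OF Sk] that by blast
    then show ?case using Suc by (simp add: pairing_hop)
  qed simp
  obtain C where C: "C \<ge> 0" "\<And>\<psi> j. \<psi> \<in> (hop ^^ k) ` S \<Longrightarrow> cmod (pairing j \<psi>) \<le> C"
    using pairing_bound_0[OF Sk[of k]] by blast
  have "cmod (pairing j \<phi>) \<le> C * lam j powr (- real k)" if "\<phi> \<in> S" for \<phi> j
  proof -
    have "lam j ^ k * cmod (pairing j \<phi>) \<le> C"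
      using C(2)[of "(hop ^^ k) \<phi>" j] that lam_pos[of j] by (simp add: pk[OF that] norm_mult norm_power)
    then show ?thesis using lam_pos[of j] by (simp add: powr_minus powr_realpow field_simps)
  qed
  then show ?thesis using C(1) by blast
qed

lemma Hspace_growth:
  assumes "\<alpha> \<in> Hspace lam \<theta>" shows "\<exists>A\<ge>0. \<forall>j. cmod (\<alpha> j) \<le> A * lam j powr (- \<theta> / 2)"
proof -
  have sm: "summable (\<lambda>j. lam j powr \<theta> * (cmod (\<alpha> j))\<^sup>2)" using assms unfolding Hspace_def by simp
  let ?T = "\<Sum>j. lam j powr \<theta> * (cmod (\<alpha> j))\<^sup>2"
  have T0: "0 \<le> ?T" by (intro suminf_nonneg sm) auto
  have "cmod (\<alpha> j) \<le> sqrt ?T * lam j powr (- \<theta> / 2)" for j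
  proof -
    have "(lam j powr (\<theta>/2) * cmod (\<alpha> j))\<^sup>2 = lam j powr \<theta> * (cmod (\<alpha> j))\<^sup>2"
      using lam_pos[of j] by (simp add: power_mult_distrib powr_power)
    also have "\<dots> \<le> ?T" using sum_le_suminf[OF sm, of "{j}"] by simp
    finally have "lam j powr (\<theta>/2) * cmod (\<alpha> j) \<le> sqrt ?T" by (rule real_le_rsqrt)
    then show ?thesis using lam_pos[of j] by (simp add: powr_minus field_simps)
  qed
  then show ?thesis using T0 by (intro exI[of _ "sqrt ?T"]) auto
qed

text \<open>Coefficients in \<open>Hspace lam \<theta>\<close> grow at most polynomially in the
  eigenvalue for every real \<theta>, and rapid decay of the pairings wins. Uniformity over the
  family is what permits the exchanges of limits below.\<close>

lemma action_bound:
  assumes \<alpha>: "\<alpha> \<in> Hspace lam \<theta>" and S: "bdd_family S"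
  shows "\<exists>T. summable T \<and> (\<forall>\<phi>\<in>S. \<forall>j. cmod (\<alpha> j * pairing j \<phi>) \<le> T j)"
proof -
  obtain A where A: "A \<ge> 0" "\<And>j. cmod (\<alpha> j) \<le> A * lam j powr (- \<theta> / 2)" using Hspace_growth[OF \<alpha>] by blast
  \<comment> \<open>With this k the total exponent \<theta>/2 + k is at least 2, hence above 1 +
    b.\<close>
  obtain k :: nat where k: "real k \<ge> 2 - \<theta> / 2" using real_arch_simple by blast
  obtain C where C: "C \<ge> 0" "\<And>\<phi> j. \<phi> \<in> S \<Longrightarrow> cmod (pairing j \<phi>) \<le> C * lam j powr (- real k)"
    using pairing_bound[OF S] by blast
  let ?q = "\<theta> / 2 + real k"
  have "cmod (\<alpha> j * pairing j \<phi>) \<le> (A * C) * lam j powr (- ?q)" if "\<phi> \<in> S" for \<phi> j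
  proof -
    have "cmod (\<alpha> j * pairing j \<phi>) \<le> (A * lam j powr (- \<theta> / 2)) * (C * lam j powr (- real k))"
      unfolding norm_mult using A C(1) C(2)[OF that] by (intro mult_mono) auto
    also have "\<dots> = (A * C) * (lam j powr (- \<theta> / 2) * lam j powr (- real k))" by (simp only: mult_ac)
    also have "lam j powr (- \<theta> / 2) * lam j powr (- real k) = lam j powr (- ?q)" by (simp flip: powr_add)
    finally show ?thesis .
  qed
  moreover have "summable (\<lambda>j. (A * C) * lam j powr (- ?q))" using k b by (intro summable_mult lam_summable) auto
  ultimately show ?thesis by blast
qed

section \<open>Coefficient sequences as distributions, and their mollifications\<close>

definition action :: "(nat \<Rightarrow> complex) \<Rightarrow> (real \<Rightarrow> real) \<Rightarrow> complex" where
  "action \<alpha> \<phi> = (\<Sum>j. \<alpha> j * pairing j \<phi>)"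

lemma action_sums:
  assumes \<alpha>: "\<alpha> \<in> Hspace lam \<theta>" and \<phi>: "test_fun \<phi>"
  shows "(\<lambda>j. \<alpha> j * pairing j \<phi>) sums action \<alpha> \<phi>"
proof -
  obtain T where "summable T" "\<And>j. cmod (\<alpha> j * pairing j \<phi>) \<le> T j"
    using action_bound[OF \<alpha> bdd_family_translates[OF \<phi>, of 0]] by auto
  then have "summable (\<lambda>j. \<alpha> j * pairing j \<phi>)" by (rule summable_comparison_test'[of T 0])
  then show ?thesis unfolding action_def by (rule summable_sums)
qed

text \<open>A series of mollified eigenfunctions: it makes sense for every sequence in
  \<open>Hspace lam \<theta>\<close>, even if the distribution is not a function, and is jointly
  measurable in the coefficients and x.\<close>

definition mollified :: "nat \<Rightarrow> (nat \<Rightarrow> complex) \<Rightarrow> real \<Rightarrow> complex" where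
  "mollified n \<alpha> x = (\<Sum>j. \<alpha> j * mollify n (E j) x)"

lemma mollified_action: "mollified n \<alpha> x = action \<alpha> (\<lambda>y. mollifier n (y - x))"
  by (simp add: mollified_def action_def pairing_def mollify_def)

lemma mollify_E_measurable [measurable]: "mollify n (E j) \<in> borel_measurable borel"
  by (rule mollify_measurable) measurable

lemma mollified_measurable [measurable]: "mollified n \<alpha> \<in> borel_measurable borel"
  unfolding mollified_def[abs_def] by measurable

lemma mollified_dominated:
  assumes \<alpha>: "\<alpha> \<in> Hspace lam \<theta>"
  shows "\<exists>T. summable T \<and> (\<forall>x\<in>{-R..R}. \<forall>j. cmod (\<alpha> j * mollify n (E j) x) \<le> T j)"
proof -
  have "mollify n (E j) x = pairing j (\<lambda>y. mollifier n (y - x))" for j x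
    by (simp add: pairing_def mollify_def)
  then show ?thesis using action_bound[OF \<alpha> bdd_family_translates[OF test_fun_mollifier[of n], of R]] by simp
qed

lemma mollified_loc_int:
  assumes \<alpha>: "\<alpha> \<in> Hspace lam \<theta>" shows "loc_int (mollified n \<alpha>)"
proof (rule loc_intI_bound)
  fix R :: real
  obtain T where T: "summable T" "\<And>x j. x \<in> {-R..R} \<Longrightarrow> cmod (\<alpha> j * mollify n (E j) x) \<le> T j"
    using mollified_dominated[OF \<alpha>, of R n] by blast
  have "cmod (mollified n \<alpha> x) \<le> suminf T" if "x \<in> {-R..R}" for x
    unfolding mollified_def by (rule norm_suminf_le[OF T(2)[OF that] T(1)])
  then have "(\<integral>\<^sup>+x. ennreal (cmod (mollified n \<alpha> x)) * indicator {-R..R} x \<partial>lborel)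
     \<le> (\<integral>\<^sup>+x. ennreal (suminf T) * indicator {-R..R} x \<partial>lborel)"
    by (intro nn_integral_mono) (auto simp: indicator_def intro!: ennreal_leI)
  also have "\<dots> < \<infinity>" by (subst nn_integral_cmult) (auto simp: ennreal_mult_less_top emeasure_lborel_Icc_eq)
  finally show "(\<integral>\<^sup>+x. ennreal (cmod (mollified n \<alpha> x)) * indicator {-R..R} x \<partial>lborel) < \<infinity>" .
qed measurable

text \<open>Fubini moves the mollification from the eigenfunction to shifts of the test function,
  where pairings are bounded uniformly in j and in the shift.\<close>

lemma mollify_E_pairing:
  assumes \<phi>: "test_fun \<phi>"
  shows "(\<integral>x. mollify n (E j) x * of_real (\<phi> x) \<partial>lborel) = (\<integral>z. of_real (mollifier n z) * pairing j (\<lambda>y. \<phi> (y - z)) \<partial>lborel)"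
proof -
  note [measurable] = smooth_fun_measurable[OF test_fun_smooth[OF \<phi>]]
  obtain R where R: "R > 0" "\<And>x. R < \<bar>x\<bar> \<Longrightarrow> \<phi> x = 0" using test_fun_support[OF \<phi>] by blast
  have "compact (E j ` {-(R+1)..R+1})" by (intro compact_continuous_image E_cont) auto
  then obtain M where M: "\<forall>y\<in>E j ` {-(R+1)..R+1}. norm y \<le> M" using compact_imp_bounded bounded_iff by metis
  have "norm (E j 0) \<le> M" using M R(1) by auto
  then have M0: "0 \<le> M" using norm_ge_zero order_trans by blast
  have int: "integrable (lborel \<Otimes>\<^sub>M lborel) (\<lambda>(x, z). E j (x + z) * of_real (mollifier n z) * of_real (\<phi> x))"
  proof (rule Bochner_Integration.integrable_bound)
    show "integrable (lborel \<Otimes>\<^sub>M lborel) (\<lambda>(x, z). M * \<phi> x * mollifier n z)"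
    proof (rule lborel_pair.Fubini_integrable)
      have "integrable lborel (\<lambda>x. \<bar>M * \<phi> x\<bar> * (\<integral>z. \<bar>mollifier n z\<bar> \<partial>lborel))"
        by (intro integrable_mult_left integrable_abs integrable_mult_right test_fun_integrable \<phi>)
      then show "integrable lborel (\<lambda>x. \<integral>z. norm (case (x, z) of (x, z) \<Rightarrow> M * \<phi> x * mollifier n z) \<partial>lborel)"
        by (simp only: case_prod_conv real_norm_def abs_mult[of "M * _"] integral_mult_right_zero)
      show "AE x in lborel. integrable lborel (\<lambda>z. case (x, z) of (x, z) \<Rightarrow> M * \<phi> x * mollifier n z)"
        unfolding case_prod_conv by (intro AE_I2 integrable_mult_right test_fun_integrable test_fun_mollifier)
    qed measurable
    show "AE p in lborel \<Otimes>\<^sub>M lborel. norm (case p of (x, z) \<Rightarrow> E j (x + z) * of_real (mollifier n z) * of_real (\<phi> x))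
       \<le> norm (case p of (x, z) \<Rightarrow> M * \<phi> x * mollifier n z)"
    proof (intro AE_I2, clarify)
      fix x z
      show "norm (E j (x + z) * of_real (mollifier n z) * of_real (\<phi> x)) \<le> norm (M * \<phi> x * mollifier n z)"
      proof (cases "\<bar>x\<bar> \<le> R \<and> \<bar>z\<bar> \<le> 1")
        case True
        then have "norm (E j (x + z)) \<le> M" using M by (auto simp: abs_le_iff)
        then have "norm (E j (x + z)) * (\<bar>mollifier n z\<bar> * \<bar>\<phi> x\<bar>) \<le> M * (\<bar>mollifier n z\<bar> * \<bar>\<phi> x\<bar>)"
          by (intro mult_right_mono) auto
        then show ?thesis using M0 by (simp add: norm_mult abs_mult mult_ac)
      next
        case False
        then have "\<phi> x = 0 \<or> mollifier n z = 0" using R(2)[of x] mollifier_zero_1[of z n] by linarith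
        then show ?thesis by auto
      qed
    qed
  qed measurable
  have "(\<integral>x. mollify n (E j) x * of_real (\<phi> x) \<partial>lborel) = (\<integral>x. \<integral>z. E j (x + z) * of_real (mollifier n z) * of_real (\<phi> x) \<partial>lborel \<partial>lborel)"
    unfolding mollify_alt by simp
  also have "\<dots> = (\<integral>z. \<integral>x. E j (x + z) * of_real (mollifier n z) * of_real (\<phi> x) \<partial>lborel \<partial>lborel)"
    using lborel_pair.Fubini_integral[OF int] by simp
  also have "\<dots> = (\<integral>z. of_real (mollifier n z) * pairing j (\<lambda>y. \<phi> (y - z)) \<partial>lborel)"
  proof (rule Bochner_Integration.integral_cong[OF refl])
    fix z
    have "(\<integral>x. E j (x + z) * of_real (mollifier n z) * of_real (\<phi> x) \<partial>lborel)
      = (\<integral>x. of_real (mollifier n z) * (E j (z + 1 * x) * of_real (\<phi> ((z + 1 * x) - z))) \<partial>lborel)"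
      by (intro Bochner_Integration.integral_cong) (auto simp: algebra_simps)
    also have "\<dots> = of_real (mollifier n z) * (\<integral>x. E j (z + 1 * x) * of_real (\<phi> ((z + 1 * x) - z)) \<partial>lborel)"
      by (rule integral_mult_right_zero)
    also have "(\<integral>x. E j (z + 1 * x) * of_real (\<phi> ((z + 1 * x) - z)) \<partial>lborel) = pairing j (\<lambda>y. \<phi> (y - z))"
      unfolding pairing_def by (subst lborel_integral_real_affine[where c = 1 and t = z]) auto
    finally show "(\<integral>x. E j (x + z) * of_real (mollifier n z) * of_real (\<phi> x) \<partial>lborel) = of_real (mollifier n z) * pairing j (\<lambda>y. \<phi> (y - z))" .
  qed
  finally show ?thesis .
qed

text \<open>Sum and integral are exchanged by domination on the support of the test function; then n
  tends to infinity inside the sum by Tannery's theorem.\<close>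

lemma mollified_pairing_tendsto:
  assumes \<alpha>: "\<alpha> \<in> Hspace lam \<theta>" and \<phi>: "test_fun \<phi>"
  shows "(\<lambda>n. \<integral>x. mollified n \<alpha> x * of_real (\<phi> x) \<partial>lborel) \<longlonglongrightarrow> action \<alpha> \<phi>"
proof -
  note [measurable] = smooth_fun_measurable[OF test_fun_smooth[OF \<phi>]]
  obtain R where R: "R > 0" "\<And>x. R < \<bar>x\<bar> \<Longrightarrow> \<phi> x = 0" using test_fun_support[OF \<phi>] by blast
  define q where "q j n = (\<integral>x. mollify n (E j) x * of_real (\<phi> x) \<partial>lborel)" for j n
  have im: "integrable lborel (\<lambda>x. mollify n (E j) x * of_real (\<phi> x))" for j n
    by (intro loc_int_test_integrable mollify_loc_int E_loc_int \<phi>)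
  have eq: "(\<integral>x. mollified n \<alpha> x * of_real (\<phi> x) \<partial>lborel) = (\<Sum>j. \<alpha> j * q j n)" for n
  proof -
    obtain T where T: "summable T" "\<And>x j. x \<in> {-R..R} \<Longrightarrow> cmod (\<alpha> j * mollify n (E j) x) \<le> T j"
      using mollified_dominated[OF \<alpha>, of R n] by blast
    define f where "f j x = \<alpha> j * (mollify n (E j) x * of_real (\<phi> x))" for j x
    have fT: "cmod (f j x) \<le> T j * \<bar>\<phi> x\<bar>" for j x
    proof (cases "\<bar>x\<bar> \<le> R")
      case True
      have "cmod (f j x) = cmod (\<alpha> j * mollify n (E j) x) * \<bar>\<phi> x\<bar>" by (simp add: f_def norm_mult)
      then show ?thesis using T(2)[of x j] True by (auto simp: abs_le_iff intro!: mult_right_mono)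
    qed (simp add: f_def R(2))
    have "(\<integral>x. (\<Sum>j. f j x) \<partial>lborel) = (\<Sum>j. \<integral>x. f j x \<partial>lborel)"
    proof (rule integral_suminf)
      show "integrable lborel (f j)" for j unfolding f_def[abs_def] by (intro integrable_mult_right im)
      show "AE x in lborel. summable (\<lambda>j. norm (f j x))"
        by (intro AE_I2 summable_comparison_test'[OF summable_mult2[OF T(1)]]) (use fT in auto)
      show "summable (\<lambda>j. \<integral>x. norm (f j x) \<partial>lborel)"
      proof (rule summable_comparison_test'[OF summable_mult2[OF T(1)], of 0])
        fix j :: nat
        have "(\<integral>x. norm (f j x) \<partial>lborel) \<le> (\<integral>x. T j * \<bar>\<phi> x\<bar> \<partial>lborel)"
          by (intro integral_mono integrable_norm integrable_mult_right integrable_abs test_fun_integrable \<phi> fT)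
             (auto simp: f_def intro!: integrable_mult_right im)
        then show "norm (\<integral>x. norm (f j x) \<partial>lborel) \<le> T j * (\<integral>x. \<bar>\<phi> x\<bar> \<partial>lborel)" by simp
      qed
    qed
    moreover have "(\<Sum>j. f j x) = mollified n \<alpha> x * of_real (\<phi> x)" for x
    proof (cases "\<bar>x\<bar> \<le> R")
      case True
      then have "summable (\<lambda>j. \<alpha> j * mollify n (E j) x)"
        using T by (intro summable_comparison_test'[OF T(1), of 0]) (auto simp: abs_le_iff)
      then show ?thesis unfolding mollified_def f_def by (simp add: suminf_mult2 mult.assoc)
    qed (simp add: f_def R(2))
    ultimately show ?thesis by (simp add: f_def q_def)
  qed
  \<comment> \<open>Mollifiers live in [-1, 1], so shifts in that interval give a majorant
    independent of n.\<close>
  obtain T where T: "summable T" "\<And>z j. z \<in> {-1..1} \<Longrightarrow> cmod (\<alpha> j * pairing j (\<lambda>y. \<phi> (y - z))) \<le> T j"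
    using action_bound[OF \<alpha> bdd_family_translates[OF \<phi>, of 1]] by auto
  have qT: "norm (\<alpha> j * q j n) \<le> T j" for j n
  proof -
    have "\<alpha> j * q j n = (\<integral>z. of_real (mollifier n z) * (\<alpha> j * pairing j (\<lambda>y. \<phi> (y - z))) \<partial>lborel)"
      unfolding q_def mollify_E_pairing[OF \<phi>]
      by (subst integral_mult_right_zero[symmetric]) (simp add: mult_ac)
    also have "norm \<dots> \<le> (\<integral>z. mollifier n z * T j \<partial>lborel)"
    proof (rule norm_integral_le)
      show "integrable lborel (\<lambda>z. mollifier n z * T j)" by (intro integrable_mult_left test_fun_integrable test_fun_mollifier)
      fix z
      show "norm (of_real (mollifier n z) * (\<alpha> j * pairing j (\<lambda>y. \<phi> (y - z)))) \<le> mollifier n z * T j"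
      proof (cases "\<bar>z\<bar> \<le> 1")
        case True
        then show ?thesis using T(2)[of z j]
          by (simp add: norm_mult[of "of_real _"] mollifier_nonneg mult_left_mono abs_le_iff)
      next
        case False then show ?thesis using mollifier_zero_1[of z n] by simp
      qed
    qed
    also have "\<dots> = T j" by (simp add: integral_mollifier)
    finally show ?thesis .
  qed
  have "(\<lambda>n. \<Sum>j. \<alpha> j * q j n) \<longlonglongrightarrow> (\<Sum>j. \<alpha> j * pairing j \<phi>)"
  proof -
    have "(\<lambda>n. \<alpha> j * q j n) \<longlonglongrightarrow> \<alpha> j * pairing j \<phi>" for j
      unfolding q_def pairing_def
      by (intro tendsto_mult tendsto_const locL1_pairing mollify_locL1 mollify_loc_int E_loc_int \<phi>)
    moreover have "\<forall>\<^sub>F (k, n) in sequentially \<times>\<^sub>F sequentially. norm (\<alpha> k * q k n) \<le> T k"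
      by (rule always_eventually) (use qT in auto)
    ultimately show ?thesis
      using tannerys_theorem[of "\<lambda>j n. \<alpha> j * q j n" "\<lambda>j. \<alpha> j * pairing j \<phi>" sequentially T] T(1) by simp
  qed
  then show ?thesis unfolding eq action_def .
qed

text \<open>A sequence in \<open>H\<^sup>\<theta>\<close> is a locally integrable function if and only if its mollifications converge
  locally in the mean; this makes the functionals below measurable.\<close>

definition represents :: "(nat \<Rightarrow> complex) \<Rightarrow> (real \<Rightarrow> complex) \<Rightarrow> bool" where
  "represents \<alpha> f \<longleftrightarrow> loc_int f \<and> (\<forall>\<phi>. test_fun \<phi> \<longrightarrow> action \<alpha> \<phi> = (\<integral>x. f x * of_real (\<phi> x) \<partial>lborel))"

lemma represents_mollified:
  assumes "represents \<alpha> f" shows "mollified n \<alpha> = mollify n f"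
  using assms test_fun_translate[OF test_fun_mollifier]
  unfolding represents_def by (intro ext) (simp add: mollified_action mollify_def)

lemma represents_imp_locL1:
  assumes "represents \<alpha> f" shows "locL1 (\<lambda>n. mollified n \<alpha>) f"
  unfolding represents_mollified[OF assms] using assms mollify_locL1 unfolding represents_def by blast

lemma ex_represents_iff:
  assumes \<alpha>: "\<alpha> \<in> Hspace lam \<theta>"
  shows "(\<exists>f. represents \<alpha> f) \<longleftrightarrow> locCauchy (\<lambda>n. mollified n \<alpha>)"
proof
  assume "\<exists>f. represents \<alpha> f"
  then show "locCauchy (\<lambda>n. mollified n \<alpha>)"
  proof
    fix f assume f: "represents \<alpha> f"
    then have "loc_int f" unfolding represents_def by blast
    then show ?thesis
      by (intro locL1_imp_locCauchy[OF represents_imp_locL1[OF f] mollified_measurable] loc_int_measurable)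
  qed
next
  assume "locCauchy (\<lambda>n. mollified n \<alpha>)"
  then obtain f where f: "loc_int f" "locL1 (\<lambda>n. mollified n \<alpha>) f"
    using loc_complete[of "\<lambda>n. mollified n \<alpha>"] mollified_loc_int[OF \<alpha>] by blast
  have "action \<alpha> \<phi> = (\<integral>x. f x * of_real (\<phi> x) \<partial>lborel)" if \<phi>: "test_fun \<phi>" for \<phi>
    by (rule LIMSEQ_unique[OF mollified_pairing_tendsto[OF \<alpha> \<phi>] locL1_pairing[OF f(2) mollified_loc_int[OF \<alpha>] f(1) \<phi>]])
  then show "\<exists>f. represents \<alpha> f" using f(1) unfolding represents_def by blast
qed

text \<open>Mollification contracts the integral, which bounds the supremum from above, and Fatou
  along the mollifications gives the other inequality. The right-hand side mentions the coefficients
  only.\<close>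

lemma represents_integral:
  assumes "represents \<alpha> f"
  shows "(\<integral>\<^sup>+x. ennreal (cmod (f x) ^ (2 ^ k)) \<partial>lborel) = (SUP n. \<integral>\<^sup>+x. ennreal (cmod (mollified n \<alpha> x) ^ (2 ^ k)) \<partial>lborel)"
proof (rule antisym)
  have f: "loc_int f" using assms unfolding represents_def by blast
  show "(\<integral>\<^sup>+x. ennreal (cmod (f x) ^ (2 ^ k)) \<partial>lborel) \<le> (SUP n. \<integral>\<^sup>+x. ennreal (cmod (mollified n \<alpha> x) ^ (2 ^ k)) \<partial>lborel)"
    by (rule locL1_Fatou[OF represents_imp_locL1[OF assms] _ f])
       (auto simp: represents_mollified[OF assms] mollify_loc_int[OF f] intro!: always_eventually SUP_upper)
  show "(SUP n. \<integral>\<^sup>+x. ennreal (cmod (mollified n \<alpha> x) ^ (2 ^ k)) \<partial>lborel) \<le> (\<integral>\<^sup>+x. ennreal (cmod (f x) ^ (2 ^ k)) \<partial>lborel)"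
    unfolding represents_mollified[OF assms] by (intro SUP_least mollify_norm_le f)
qed

lemma is_function_iff:
  assumes \<alpha>: "\<alpha> \<in> Hspace lam \<theta>"
    and e: "\<And>j. e j \<in> borel_measurable borel" "\<And>j. AE x in lborel. e j x = E j x"
  shows "is_function e \<alpha> f \<longleftrightarrow> represents \<alpha> f"
proof -
  have p: "(\<integral>x. e j x * of_real (\<phi> x) \<partial>lborel) = pairing j \<phi>" if "test_fun \<phi>" for j \<phi>
  proof -
    note [measurable] = e(1) smooth_fun_measurable[OF test_fun_smooth[OF that]]
    show ?thesis unfolding pairing_def by (rule integral_cong_AE) (use e(2)[of j] in auto)
  qed
  show ?thesis
    unfolding is_function_def represents_def loc_int_def[symmetric]
    using action_sums[OF \<alpha>] by (auto simp: p sums_iff)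
qed

text \<open>All representing functions give the same supremum over mollifications, so the infimum is
  that supremum or, over the empty set, infinity. Both the case distinction and the value are now
  countable expressions in the coordinates.\<close>

lemma int_pow_eq:
  assumes \<alpha>: "\<alpha> \<in> Hspace lam \<theta>"
    and e: "\<And>j. e j \<in> borel_measurable borel" "\<And>j. AE x in lborel. e j x = E j x"
  shows "int_pow e (2 ^ k) \<alpha> = (if locCauchy (\<lambda>n. mollified n \<alpha>)
    then (SUP n. \<integral>\<^sup>+x. ennreal (cmod (mollified n \<alpha> x) ^ (2 ^ k)) \<partial>lborel) else \<infinity>)"
proof (cases "locCauchy (\<lambda>n. mollified n \<alpha>)")
  case True
  then obtain f where f: "represents \<alpha> f" using ex_represents_iff[OF \<alpha>] by blast
  have "int_pow e (2 ^ k) \<alpha> = (INF f\<in>{f. represents \<alpha> f}. SUP n. \<integral>\<^sup>+x. ennreal (cmod (mollified n \<alpha> x) ^ (2 ^ k)) \<partial>lborel)"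
    unfolding int_pow_def is_function_iff[OF \<alpha> e] by (rule INF_cong) (auto simp: represents_integral)
  also have "\<dots> = (SUP n. \<integral>\<^sup>+x. ennreal (cmod (mollified n \<alpha> x) ^ (2 ^ k)) \<partial>lborel)"
    using f by (intro cINF_const) auto
  finally show ?thesis using True by simp
next
  case False
  then show ?thesis using ex_represents_iff[OF \<alpha>] unfolding int_pow_def is_function_iff[OF \<alpha> e] by simp
qed

lemma int_pow_represents:
  assumes \<alpha>: "\<alpha> \<in> Hspace lam \<theta>"
    and e: "\<And>j. e j \<in> borel_measurable borel" "\<And>j. AE x in lborel. e j x = E j x"
    and f: "represents \<alpha> f"
  shows "int_pow e (2 ^ k) \<alpha> = (\<integral>\<^sup>+x. ennreal (cmod (f x) ^ (2 ^ k)) \<partial>lborel)"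
  using ex_represents_iff[OF \<alpha>] f unfolding int_pow_eq[OF \<alpha> e] represents_integral[OF f] by auto

lemma mollified_joint_measurable [measurable]:
  "(\<lambda>p. mollified n (fst p) (snd p)) \<in> borel_measurable ((\<Pi>\<^sub>M j\<in>UNIV. borel) \<Otimes>\<^sub>M borel)"
  unfolding mollified_def[abs_def] by measurable

lemma int_pow_measurable:
  assumes M: "space M = Hspace lam \<theta>" "sets M = sets (restrict_space (\<Pi>\<^sub>M j\<in>UNIV. (borel :: complex measure)) (Hspace lam \<theta>))"
    and e: "\<And>j. e j \<in> borel_measurable borel" "\<And>j. AE x in lborel. e j x = E j x"
  shows "int_pow e (2 ^ k) \<in> borel_measurable M"
proof -
  let ?P = "\<Pi>\<^sub>M j\<in>UNIV. (borel :: complex measure)"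
  let ?F = "\<lambda>\<alpha>. if locCauchy (\<lambda>n. mollified n \<alpha>)
    then (SUP n. \<integral>\<^sup>+x. ennreal (cmod (mollified n \<alpha> x) ^ (2 ^ k)) \<partial>lborel) else \<infinity>"
  have 1: "(\<lambda>\<alpha>. \<integral>\<^sup>+x. ennreal (cmod (mollified n \<alpha> x) ^ (2 ^ k)) \<partial>lborel) \<in> borel_measurable ?P" for n
    by (rule lborel.borel_measurable_nn_integral) measurable
  have 2: "(\<lambda>\<alpha>. \<integral>\<^sup>+x. ennreal (cmod (mollified i \<alpha> x - mollified j \<alpha> x)) * indicator {-real R..real R} x \<partial>lborel) \<in> borel_measurable ?P" for i j R
    by (rule lborel.borel_measurable_nn_integral) measurable
  have "Measurable.pred ?P (\<lambda>\<alpha>. locCauchy (\<lambda>n. mollified n \<alpha>))"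
    unfolding locCauchy_def using 2 by measurable
  then have "?F \<in> borel_measurable ?P" using 1 by measurable
  then have "?F \<in> borel_measurable (restrict_space ?P (Hspace lam \<theta>))" by (rule measurable_restrict_space1)
  then have F: "?F \<in> borel_measurable M" by (simp add: measurable_cong_sets[OF M(2) refl])
  show ?thesis by (subst measurable_cong[OF int_pow_eq[OF _ e]]) (use M(1) F in auto)
qed

end

section \<open>Gaussian integrals\<close>

lemma lborel_complex: "(lborel :: complex measure) = distr (lborel \<Otimes>\<^sub>M lborel) borel (\<lambda>(x, y). Complex x y)"
proof (rule lborel_eqI)
  have m: "(\<lambda>(x, y). Complex x y) \<in> borel_measurable ((lborel :: real measure) \<Otimes>\<^sub>M (lborel :: real measure))"
  proof -
    have "(\<lambda>(x, y). complex_of_real x + \<i> * complex_of_real y) \<in> borel_measurable ((lborel :: real measure) \<Otimes>\<^sub>M (lborel :: real measure))"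
      by measurable
    then show ?thesis by (simp add: Complex_eq)
  qed
  fix l u :: complex assume lu: "\<And>b. b \<in> Basis \<Longrightarrow> l \<bullet> b \<le> u \<bullet> b"
  have Re: "Re l \<le> Re u" and Im: "Im l \<le> Im u"
    using lu[of 1] lu[of \<i>] by (auto simp: Basis_complex_def inner_complex_def)
  have "(\<lambda>(x, y). Complex x y) -` box l u \<inter> space ((lborel :: real measure) \<Otimes>\<^sub>M (lborel :: real measure))
     = {Re l<..<Re u} \<times> {Im l<..<Im u}"
    by (auto simp: box_def Basis_complex_def inner_complex_def space_pair_measure)
  then have "emeasure (distr (lborel \<Otimes>\<^sub>M lborel) borel (\<lambda>(x, y). Complex x y)) (box l u)
     = emeasure (lborel \<Otimes>\<^sub>M lborel) ({Re l<..<Re u} \<times> {Im l<..<Im u})"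
    by (subst emeasure_distr[OF m]) auto
  also have "\<dots> = ennreal (Re u - Re l) * ennreal (Im u - Im l)"
    using Re Im by (subst lborel.emeasure_pair_measure_Times) auto
  also have "\<dots> = ennreal (\<Prod>b\<in>Basis. (u - l) \<bullet> b)"
    using Re Im by (simp add: Basis_complex_def inner_complex_def ennreal_mult[symmetric] prod.insert)
  finally show "emeasure (distr (lborel \<Otimes>\<^sub>M lborel) borel (\<lambda>(x, y). Complex x y)) (box l u)
    = ennreal (\<Prod>b\<in>Basis. (u - l) \<bullet> b)" .
qed simp

definition cgauss :: "real \<Rightarrow> complex measure" where
  "cgauss l = density lborel (\<lambda>z. ennreal (l / pi * exp (- l * (cmod z)\<^sup>2)))"

lemma sets_cgauss [measurable_cong, simp]: "sets (cgauss l) = sets borel"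
  by (simp add: cgauss_def)

lemma nn_integral_real_gauss:
  assumes "l > 0" shows "(\<integral>\<^sup>+x. ennreal (sqrt (l / pi) * exp (- l * x\<^sup>2)) \<partial>lborel) = 1"
proof -
  let ?s = "1 / sqrt (2 * l)"
  have s: "?s\<^sup>2 = 1 / (2 * l)" "?s > 0" using assms by (auto simp: power_divide)
  have "normal_density 0 ?s x = sqrt (l / pi) * exp (- l * x\<^sup>2)" for x
    using assms unfolding normal_density_def s(1) by (simp add: real_sqrt_divide field_simps)
  moreover have "(\<integral>\<^sup>+x. normal_density 0 ?s x \<partial>lborel) = 1"
    using nn_integral_eq_integral[OF integrable_normal_density[of ?s 0]] s(2) by simp
  ultimately show ?thesis by simp
qed

lemma nn_integral_cgauss_1:
  assumes l: "l > 0" shows "(\<integral>\<^sup>+z. ennreal (l / pi * exp (- l * (cmod z)\<^sup>2)) \<partial>lborel) = 1"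
proof -
  have m: "(\<lambda>(x, y). Complex x y) \<in> borel_measurable ((lborel :: real measure) \<Otimes>\<^sub>M (lborel :: real measure))"
  proof -
    have "(\<lambda>(x, y). complex_of_real x + \<i> * complex_of_real y) \<in> borel_measurable ((lborel :: real measure) \<Otimes>\<^sub>M (lborel :: real measure))"
      by measurable
    then show ?thesis by (simp add: Complex_eq)
  qed
  let ?g = "\<lambda>x. ennreal (sqrt (l / pi) * exp (- l * x\<^sup>2))"
  have "(\<integral>\<^sup>+z. ennreal (l / pi * exp (- l * (cmod z)\<^sup>2)) \<partial>lborel)
    = (\<integral>\<^sup>+p. ennreal (l / pi * exp (- l * (cmod (case p of (x, y) \<Rightarrow> Complex x y))\<^sup>2)) \<partial>(lborel \<Otimes>\<^sub>M lborel))"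
    by (subst lborel_complex, rule nn_integral_distr[OF m]) measurable
  also have "\<dots> = (\<integral>\<^sup>+p. ?g (fst p) * ?g (snd p) \<partial>(lborel \<Otimes>\<^sub>M lborel))"
  proof (rule nn_integral_cong)
    fix p :: "real \<times> real"
    have "sqrt (l / pi) * exp (- l * x\<^sup>2) * (sqrt (l / pi) * exp (- l * y\<^sup>2)) = l / pi * exp (- l * (x\<^sup>2 + y\<^sup>2))" for x y
    proof -
      have "sqrt (l / pi) * exp (- l * x\<^sup>2) * (sqrt (l / pi) * exp (- l * y\<^sup>2))
        = (sqrt (l / pi) * sqrt (l / pi)) * (exp (- l * x\<^sup>2) * exp (- l * y\<^sup>2))" by (simp only: mult_ac)
      also have "\<dots> = l / pi * exp (- l * (x\<^sup>2 + y\<^sup>2))"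
        using l by (simp add: exp_add[symmetric] algebra_simps)
      finally show ?thesis .
    qed
    then show "ennreal (l / pi * exp (- l * (cmod (case p of (x, y) \<Rightarrow> Complex x y))\<^sup>2)) = ?g (fst p) * ?g (snd p)"
      using l by (cases p) (simp add: ennreal_mult[symmetric] cmod_power2)
  qed
  also have "\<dots> = (\<integral>\<^sup>+x. \<integral>\<^sup>+y. ?g x * ?g y \<partial>lborel \<partial>lborel)"
    by (subst lborel.nn_integral_fst[symmetric]) auto
  also have "\<dots> = 1" using nn_integral_real_gauss[OF l] by (simp add: nn_integral_cmult nn_integral_multc)
  finally show ?thesis .
qed

lemma prob_space_cgauss: "l > 0 \<Longrightarrow> prob_space (cgauss l)"
  by (rule prob_spaceI) (use nn_integral_cgauss_1[of l] in \<open>simp add: cgauss_def emeasure_density\<close>)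

lemma cgauss_exp_square:
  assumes "l > 0" "t < l" shows "(\<integral>\<^sup>+z. ennreal (exp (t * (cmod z)\<^sup>2)) \<partial>cgauss l) = ennreal (l / (l - t))"
proof -
  have "(\<integral>\<^sup>+z. ennreal (exp (t * (cmod z)\<^sup>2)) \<partial>cgauss l)
    = (\<integral>\<^sup>+z. ennreal (l / (l - t)) * ennreal ((l - t) / pi * exp (- (l - t) * (cmod z)\<^sup>2)) \<partial>lborel)"
    unfolding cgauss_def
  proof (subst nn_integral_density, measurable, rule nn_integral_cong)
    fix z :: complex
    have "l / pi * exp (- l * (cmod z)\<^sup>2) * exp (t * (cmod z)\<^sup>2) = l / pi * exp (- (l - t) * (cmod z)\<^sup>2)"
      by (simp add: exp_add[symmetric] algebra_simps)
    also have "\<dots> = l / (l - t) * ((l - t) / pi * exp (- (l - t) * (cmod z)\<^sup>2))" using assms by simp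
    finally show "ennreal (l / pi * exp (- l * (cmod z)\<^sup>2)) * ennreal (exp (t * (cmod z)\<^sup>2))
      = ennreal (l / (l - t)) * ennreal ((l - t) / pi * exp (- (l - t) * (cmod z)\<^sup>2))"
      using assms by (simp add: ennreal_mult[symmetric])
  qed
  also have "\<dots> = ennreal (l / (l - t))"
    using assms nn_integral_cgauss_1[of "l - t"] by (subst nn_integral_cmult) auto
  finally show ?thesis .
qed

text \<open>Completion of the square: the exponent is centred at \<open>?a\<close>, and translation
  invariance of Lebesgue measure removes the shift.\<close>

lemma cgauss_exp_linear:
  assumes l: "l > 0" shows "(\<integral>\<^sup>+z. ennreal (exp (Re (c * z))) \<partial>cgauss l) = ennreal (exp ((cmod c)\<^sup>2 / (4 * l)))"
proof -
  let ?a = "cnj c / of_real (2 * l)"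
  have sq: "Re (c * z) - l * (cmod z)\<^sup>2 = (cmod c)\<^sup>2 / (4 * l) - l * (cmod (z - ?a))\<^sup>2" for z
  proof -
    have "(cmod (z - ?a))\<^sup>2 = (cmod z)\<^sup>2 - 2 * Re (z * cnj ?a) + (cmod ?a)\<^sup>2"
      by (simp only: cmod_power2 minus_complex.sel times_complex.sel cnj.sel) (simp add: power2_eq_square algebra_simps)
    moreover have "Re (z * cnj ?a) = Re (c * z) / (2 * l)" by (simp add: mult.commute)
    moreover have "(cmod ?a)\<^sup>2 = (cmod c)\<^sup>2 / (4 * l\<^sup>2)" using l by (simp add: norm_divide power_divide power_mult_distrib norm_mult)
    ultimately have "(cmod (z - ?a))\<^sup>2 = (cmod z)\<^sup>2 - 2 * (Re (c * z) / (2 * l)) + (cmod c)\<^sup>2 / (4 * l\<^sup>2)"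
      by (simp only:)
    moreover have "l * (A - 2 * (p / (2 * l)) + q / (4 * l\<^sup>2)) = l * A - p + q / (4 * l)" for A p q
      using l by (simp add: field_simps power2_eq_square)
    ultimately have "l * (cmod (z - ?a))\<^sup>2 = l * (cmod z)\<^sup>2 - Re (c * z) + (cmod c)\<^sup>2 / (4 * l)"
      by (simp only:)
    then show ?thesis by linarith
  qed
  have "(\<integral>\<^sup>+z. ennreal (exp (Re (c * z))) \<partial>cgauss l)
    = (\<integral>\<^sup>+z. ennreal (exp ((cmod c)\<^sup>2 / (4 * l))) * ennreal (l / pi * exp (- l * (cmod (z - ?a))\<^sup>2)) \<partial>lborel)"
    unfolding cgauss_def
  proof (subst nn_integral_density, measurable, rule nn_integral_cong)
    fix z
    have "exp (- l * (cmod z)\<^sup>2) * exp (Re (c * z)) = exp ((cmod c)\<^sup>2 / (4 * l)) * exp (- l * (cmod (z - ?a))\<^sup>2)"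
      unfolding exp_add[symmetric] using sq[of z] by simp
    then have "l / pi * exp (- l * (cmod z)\<^sup>2) * exp (Re (c * z)) = exp ((cmod c)\<^sup>2 / (4 * l)) * (l / pi * exp (- l * (cmod (z - ?a))\<^sup>2))"
      by (simp only: mult.assoc mult.left_commute[of _ "l / pi"])
    then show "ennreal (l / pi * exp (- l * (cmod z)\<^sup>2)) * ennreal (exp (Re (c * z)))
      = ennreal (exp ((cmod c)\<^sup>2 / (4 * l))) * ennreal (l / pi * exp (- l * (cmod (z - ?a))\<^sup>2))"
      using l by (simp only: ennreal_mult[symmetric] exp_ge_zero mult_nonneg_nonneg divide_nonneg_pos pi_gt_zero less_imp_le)
  qed
  also have "\<dots> = ennreal (exp ((cmod c)\<^sup>2 / (4 * l))) * (\<integral>\<^sup>+z. ennreal (l / pi * exp (- l * (cmod (z - ?a))\<^sup>2)) \<partial>lborel)"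
    by (rule nn_integral_cmult) measurable
  also have "(\<integral>\<^sup>+z. ennreal (l / pi * exp (- l * (cmod (z - ?a))\<^sup>2)) \<partial>lborel)
     = (\<integral>\<^sup>+z. ennreal (l / pi * exp (- l * (cmod (z - ?a))\<^sup>2)) \<partial>distr lborel borel ((+) ?a))"
    by (simp add: lborel_distr_plus)
  also have "\<dots> = (\<integral>\<^sup>+z. ennreal (l / pi * exp (- l * (cmod z)\<^sup>2)) \<partial>lborel)"
    by (subst nn_integral_distr) auto
  finally show ?thesis by (simp only: nn_integral_cgauss_1[OF l] mult_1_right)
qed

text \<open>The variance is squeezed out of the exponential moment: t y \<le> exp (t y) - 1 gives t
  m \<le> t / (l - t) for t of either sign, and t tends to 0 from the right and from the
  left.\<close>

lemma cgauss_mean: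
  assumes l: "l > 0"
  shows "integrable (cgauss l) (\<lambda>z. (cmod z)\<^sup>2)" "(\<integral>z. (cmod z)\<^sup>2 \<partial>cgauss l) = 1 / l"
proof -
  interpret prob_space "cgauss l" by (rule prob_space_cgauss[OF l])
  have iexp: "integrable (cgauss l) (\<lambda>z. exp (t * (cmod z)\<^sup>2))"
    and vexp: "(\<integral>z. exp (t * (cmod z)\<^sup>2) \<partial>cgauss l) = l / (l - t)" if "t < l" for t
  proof -
    show i: "integrable (cgauss l) (\<lambda>z. exp (t * (cmod z)\<^sup>2))"
      by (rule integrableI_bounded) (auto simp: cgauss_exp_square[OF l that])
    show "(\<integral>z. exp (t * (cmod z)\<^sup>2) \<partial>cgauss l) = l / (l - t)"
      using cgauss_exp_square[OF l that] l that by (subst (asm) nn_integral_eq_integral[OF i]) auto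
  qed
  have lin: "t * y \<le> exp (t * y) - 1" for t y :: real using exp_ge_add_one_self[of "t * y"] by linarith
  show i: "integrable (cgauss l) (\<lambda>z. (cmod z)\<^sup>2)"
  proof (rule Bochner_Integration.integrable_bound)
    show "integrable (cgauss l) (\<lambda>z. 2 / l * exp (l / 2 * (cmod z)\<^sup>2))"
      using l by (intro integrable_mult_right iexp) simp
    have "y \<le> 2 / l * exp (l / 2 * y)" for y
      using lin[of "l/2" y] l by (simp add: field_simps)
    then show "AE z in cgauss l. norm ((cmod z)\<^sup>2) \<le> norm (2 / l * exp (l / 2 * (cmod z)\<^sup>2))" using l by auto
  qed (use l in auto)
  let ?m = "\<integral>z. (cmod z)\<^sup>2 \<partial>cgauss l"
  have key: "t * ?m \<le> t / (l - t)" if "t < l" for t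
  proof -
    have "t * ?m = (\<integral>z. t * (cmod z)\<^sup>2 \<partial>cgauss l)" by simp
    also have "\<dots> \<le> (\<integral>z. exp (t * (cmod z)\<^sup>2) - 1 \<partial>cgauss l)"
      by (intro integral_mono integrable_mult_right i Bochner_Integration.integrable_diff iexp that lin) auto
    also have "\<dots> = l / (l - t) - 1" using iexp[OF that] vexp[OF that] prob_space by simp
    also have "\<dots> = t / (l - t)" using that by (simp add: field_simps)
    finally show ?thesis .
  qed
  show "?m = 1 / l"
  proof (rule antisym)
    have "((\<lambda>t. 1 / (l - t)) \<longlongrightarrow> 1 / (l - 0)) (at_right 0)" using l by (intro tendsto_intros) auto
    moreover have "\<forall>\<^sub>F t in at_right 0. ?m \<le> 1 / (l - t)"
    proof -
      have "\<forall>\<^sub>F t in at_right 0. t \<in> {0<..<l}" using l by (rule eventually_at_right_real)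
      then show ?thesis
      proof eventually_elim
        case (elim t)
        then have "t * ?m \<le> t * (1 / (l - t))" using key[of t] by simp
        then show ?case using elim by (simp only: mult_le_cancel_left) auto
      qed
    qed
    ultimately have "?m \<le> 1 / (l - 0)" by (intro tendsto_lowerbound[of _ _ "at_right 0"]) auto
    then show "?m \<le> 1 / l" by simp
    have "((\<lambda>t. 1 / (l - t)) \<longlongrightarrow> 1 / (l - 0)) (at_left 0)" using l by (intro tendsto_intros) auto
    moreover have "\<forall>\<^sub>F t in at_left 0. 1 / (l - t) \<le> ?m"
    proof -
      have "\<forall>\<^sub>F t in at_left (0::real). t \<in> {-1<..<0}" by (rule eventually_at_left_real) simp
      then show ?thesis
      proof eventually_elim
        case (elim t)
        then have "t * ?m \<le> t * (1 / (l - t))" using key[of t] l by simp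
        then show ?case using elim by (simp only: mult_le_cancel_left) auto
      qed
    qed
    ultimately have "1 / (l - 0) \<le> ?m" by (intro tendsto_upperbound[of _ _ "at_left 0"]) auto
    then show "1 / l \<le> ?m" by simp
  qed
qed

section \<open>Independent coordinates under the Gaussian measure\<close>

lemma ennreal_prod_mono:
  "(\<And>j. j \<in> F \<Longrightarrow> f j \<le> (g j :: ennreal)) \<Longrightarrow> prod f F \<le> prod g F"
  by (induction F rule: infinite_finite_induct) (auto intro!: mult_mono)

locale gaussian_coords =
  fixes lam :: "nat \<Rightarrow> real" and \<theta> :: real and \<mu> :: "(nat \<Rightarrow> complex) measure"
  assumes gm: "gaussian_measure lam \<theta> \<mu>"
    and l_0: "0 < lam 0" and l_mono: "incseq lam" and l_lim: "filterlim lam at_top sequentially"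
begin

lemma l_pos: "0 < lam j" using l_0 incseqD[OF l_mono, of 0 j] by linarith

lemma finite_level: "finite {j. lam j \<le> \<Lambda>}"
proof -
  have "\<forall>\<^sub>F j in sequentially. \<Lambda> < lam j" using l_lim by (simp add: filterlim_at_top_dense)
  then obtain N where "\<And>j. j \<ge> N \<Longrightarrow> \<Lambda> < lam j" unfolding eventually_sequentially by blast
  then have "{j. lam j \<le> \<Lambda>} \<subseteq> {..<N}" by (auto simp: not_less[symmetric])
  then show ?thesis using finite_subset by blast
qed

lemma prob: "prob_space \<mu>" using gm unfolding gaussian_measure_def by blast

lemma space_\<mu>: "space \<mu> = Hspace lam \<theta>" using gm unfolding gaussian_measure_def by blast

lemma sets_\<mu>: "sets \<mu> = sets (restrict_space (\<Pi>\<^sub>M j\<in>UNIV. (borel :: complex measure)) (Hspace lam \<theta>))"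
  using gm unfolding gaussian_measure_def by blast

lemma coord_measurable [measurable]: "(\<lambda>\<alpha>. \<alpha> j) \<in> borel_measurable \<mu>"
  unfolding measurable_cong_sets[OF sets_\<mu> refl] by (rule measurable_restrict_space1) measurable

lemma restrict_measurable: "(\<lambda>\<alpha>. restrict \<alpha> J) \<in> measurable \<mu> (\<Pi>\<^sub>M j\<in>J. borel)"
  by (rule measurable_restrict) measurable

text \<open>Independence is only given on full spectral levels. The index set is enlarged to such a
  level with factors equal to 1, which integrate to 1 against probability measures.\<close>

lemma nn_integral_prod_coords:
  assumes F: "finite F" and f: "\<And>j. j \<in> F \<Longrightarrow> f j \<in> borel_measurable borel"
  shows "(\<integral>\<^sup>+\<alpha>. (\<Prod>j\<in>F. f j (\<alpha> j)) \<partial>\<mu>) = (\<Prod>j\<in>F. \<integral>\<^sup>+z. f j z \<partial>cgauss (lam j))"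
proof -
  \<comment> \<open>A sum of positive eigenvalues dominates each of them; index 0 is included
    because the cylindrical laws are prescribed for \<Lambda> \<ge> \<open>lam 0\<close>.\<close>
  define \<Lambda> where "\<Lambda> = (\<Sum>j\<in>insert 0 F. lam j)"
  have L: "lam j \<le> \<Lambda>" if "j \<in> insert 0 F" for j
    unfolding \<Lambda>_def using F l_pos that by (intro member_le_sum) (auto intro: less_imp_le)
  let ?J = "{j. lam j \<le> \<Lambda>}"
  have J: "finite ?J" "F \<subseteq> ?J" using finite_level L by auto
  interpret product_sigma_finite "\<lambda>j. cgauss (lam j)"
    using prob_space_cgauss[OF l_pos] by (simp add: product_sigma_finite_def prob_space_imp_sigma_finite)
  define h where "h j = (if j \<in> F then f j else (\<lambda>_. 1))" for j
  have h: "h j \<in> borel_measurable borel" for j using f by (simp add: h_def)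
  have eq: "distr \<mu> (\<Pi>\<^sub>M j\<in>?J. borel) (\<lambda>\<alpha>. restrict \<alpha> ?J) = (\<Pi>\<^sub>M j\<in>?J. cgauss (lam j))"
    using gm L unfolding gaussian_measure_def cgauss_def by simp
  have "(\<integral>\<^sup>+\<alpha>. (\<Prod>j\<in>F. f j (\<alpha> j)) \<partial>\<mu>) = (\<integral>\<^sup>+\<alpha>. (\<Prod>j\<in>?J. h j (restrict \<alpha> ?J j)) \<partial>\<mu>)"
  proof (rule nn_integral_cong)
    fix \<alpha>
    have "(\<Prod>j\<in>?J. h j (restrict \<alpha> ?J j)) = (\<Prod>j\<in>?J. if j \<in> F then f j (\<alpha> j) else 1)"
      by (intro prod.cong) (auto simp: h_def)
    also have "\<dots> = (\<Prod>j\<in>F. f j (\<alpha> j))"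
      using J by (subst prod.inter_restrict[symmetric]) (auto simp: Int_absorb1 inf.absorb2)
    finally show "(\<Prod>j\<in>F. f j (\<alpha> j)) = (\<Prod>j\<in>?J. h j (restrict \<alpha> ?J j))" by simp
  qed
  also have "\<dots> = (\<integral>\<^sup>+\<omega>. (\<Prod>j\<in>?J. h j (\<omega> j)) \<partial>distr \<mu> (\<Pi>\<^sub>M j\<in>?J. borel) (\<lambda>\<alpha>. restrict \<alpha> ?J))"
  proof -
    have hj: "(\<lambda>\<omega>. h j (\<omega> j)) \<in> borel_measurable (\<Pi>\<^sub>M j\<in>?J. borel)" if "j \<in> ?J" for j
      by (rule measurable_compose[OF measurable_component_singleton[OF that] h])
    have "(\<lambda>\<omega>. \<Prod>j\<in>?J. h j (\<omega> j)) \<in> borel_measurable (\<Pi>\<^sub>M j\<in>?J. borel)"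
      by (rule borel_measurable_prod_ennreal[OF hj])
    then show ?thesis by (subst nn_integral_distr[OF restrict_measurable]) simp_all
  qed
  also have "\<dots> = (\<Prod>j\<in>?J. \<integral>\<^sup>+z. h j z \<partial>cgauss (lam j))"
    unfolding eq using h by (intro product_nn_integral_prod J) (simp add: cgauss_def)
  also have "\<dots> = (\<Prod>j\<in>?J. if j \<in> F then \<integral>\<^sup>+z. f j z \<partial>cgauss (lam j) else 1)"
    using prob_space.emeasure_space_1[OF prob_space_cgauss[OF l_pos]]
    by (intro prod.cong) (auto simp: h_def)
  also have "\<dots> = (\<Prod>j\<in>F. \<integral>\<^sup>+z. f j z \<partial>cgauss (lam j))"
    using J by (subst prod.inter_restrict[symmetric]) (auto simp: inf.absorb2)
  finally show ?thesis .
qed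

lemma mean_square:
  "integrable \<mu> (\<lambda>\<alpha>. (cmod (\<alpha> j))\<^sup>2)" "(\<integral>\<alpha>. (cmod (\<alpha> j))\<^sup>2 \<partial>\<mu>) = 1 / lam j"
proof -
  have "(\<integral>\<^sup>+\<alpha>. ennreal ((cmod (\<alpha> j))\<^sup>2) \<partial>\<mu>) = (\<integral>\<^sup>+z. ennreal ((cmod z)\<^sup>2) \<partial>cgauss (lam j))"
    using nn_integral_prod_coords[of "{j}" "\<lambda>_ z. ennreal ((cmod z)\<^sup>2)"] by simp
  also have "\<dots> = ennreal (1 / lam j)"
    using nn_integral_eq_integral[OF cgauss_mean(1)[OF l_pos]] cgauss_mean(2)[OF l_pos] by simp
  finally have e: "(\<integral>\<^sup>+\<alpha>. ennreal ((cmod (\<alpha> j))\<^sup>2) \<partial>\<mu>) = ennreal (1 / lam j)" .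
  show i: "integrable \<mu> (\<lambda>\<alpha>. (cmod (\<alpha> j))\<^sup>2)" by (rule integrableI_bounded) (auto simp: e)
  show "(\<integral>\<alpha>. (cmod (\<alpha> j))\<^sup>2 \<partial>\<mu>) = 1 / lam j"
    using e l_pos[of j] by (subst (asm) nn_integral_eq_integral[OF i]) auto
qed

lemma exp_mass:
  assumes F: "finite F" and t: "\<And>j. j \<in> F \<Longrightarrow> 2 * t \<le> lam j"
  shows "(\<integral>\<^sup>+\<alpha>. ennreal (exp (t * (\<Sum>j\<in>F. (cmod (\<alpha> j))\<^sup>2))) \<partial>\<mu>) \<le> ennreal (2 ^ card F)"
proof -
  have "(\<integral>\<^sup>+\<alpha>. ennreal (exp (t * (\<Sum>j\<in>F. (cmod (\<alpha> j))\<^sup>2))) \<partial>\<mu>) = (\<integral>\<^sup>+\<alpha>. (\<Prod>j\<in>F. ennreal (exp (t * (cmod (\<alpha> j))\<^sup>2))) \<partial>\<mu>)"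
    by (simp add: sum_distrib_left exp_sum[OF F] prod_ennreal)
  also have "\<dots> = (\<Prod>j\<in>F. \<integral>\<^sup>+z. ennreal (exp (t * (cmod z)\<^sup>2)) \<partial>cgauss (lam j))"
    by (rule nn_integral_prod_coords[OF F]) measurable
  also have "\<dots> \<le> (\<Prod>j\<in>F. ennreal 2)"
  proof (rule ennreal_prod_mono)
    fix j assume j: "j \<in> F"
    have "t < lam j" using t[OF j] l_pos[of j] by linarith
    then show "(\<integral>\<^sup>+z. ennreal (exp (t * (cmod z)\<^sup>2)) \<partial>cgauss (lam j)) \<le> ennreal 2"
      unfolding cgauss_exp_square[OF l_pos \<open>t < lam j\<close>] using t[OF j]
      by (intro ennreal_leI) (simp add: field_simps)
  qed
  also have "\<dots> = ennreal (2 ^ card F)" by (simp only: prod_constant ennreal_power zero_le_numeral)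
  finally show ?thesis .
qed

definition renorm :: "nat set \<Rightarrow> (nat \<Rightarrow> complex) \<Rightarrow> real" where
  "renorm F \<alpha> = (\<Sum>j\<in>F. (cmod (\<alpha> j))\<^sup>2 - 1 / lam j)"

lemma renorm_measurable [measurable]: "renorm F \<in> borel_measurable \<mu>"
  unfolding renorm_def[abs_def] by measurable

text \<open>Centring cancels the first order: with x = - s / l the exponential moment of one
  coordinate is exp (x - ln (1 + x)), which is at most exp (2 x^2). The cost is therefore governed
  by the sum of 1/l^2. Events on a disjoint set of coordinates factor out, which is what comparison
  of low and high modes requires.\<close>

lemma exp_renorm:
  assumes F: "finite F" "finite G" "F \<inter> G = {}" and B: "\<And>j. j \<in> G \<Longrightarrow> B j \<in> sets borel"
    and s: "\<And>j. j \<in> F \<Longrightarrow> 2 * \<bar>s\<bar> \<le> lam j"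
  shows "(\<integral>\<^sup>+\<alpha>. ennreal (exp (s * renorm F \<alpha>)) * (\<Prod>j\<in>G. indicator (B j) (\<alpha> j)) \<partial>\<mu>)
    \<le> ennreal (exp (2 * s\<^sup>2 * (\<Sum>j\<in>F. 1 / (lam j)\<^sup>2))) * (\<Prod>j\<in>G. emeasure (cgauss (lam j)) (B j))"
proof -
  define f where "f j z = (if j \<in> F then ennreal (exp (s * ((cmod z)\<^sup>2 - 1 / lam j))) else indicator (B j) z)" for j and z :: complex
  have fm: "f j \<in> borel_measurable borel" if "j \<in> F \<union> G" for j
    using that B unfolding f_def[abs_def] by (cases "j \<in> F") auto
  have split: "(\<Prod>j\<in>F \<union> G. q j) = (\<Prod>j\<in>F. q j) * (\<Prod>j\<in>G. q j)" for q :: "nat \<Rightarrow> ennreal"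
    by (rule prod.union_disjoint) (use F in auto)
  have notF: "j \<notin> F" if "j \<in> G" for j using that F(3) by blast
  have "(\<integral>\<^sup>+\<alpha>. ennreal (exp (s * renorm F \<alpha>)) * (\<Prod>j\<in>G. indicator (B j) (\<alpha> j)) \<partial>\<mu>) = (\<integral>\<^sup>+\<alpha>. (\<Prod>j\<in>F \<union> G. f j (\<alpha> j)) \<partial>\<mu>)"
  proof (rule nn_integral_cong)
    fix \<alpha>
    have "ennreal (exp (s * renorm F \<alpha>)) = (\<Prod>j\<in>F. f j (\<alpha> j))"
      by (simp add: renorm_def sum_distrib_left exp_sum[OF F(1)] f_def prod_ennreal cong: prod.cong)
    moreover have "(\<Prod>j\<in>G. indicator (B j) (\<alpha> j)) = (\<Prod>j\<in>G. f j (\<alpha> j))"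
      by (rule prod.cong) (use notF in \<open>auto simp: f_def\<close>)
    ultimately show "ennreal (exp (s * renorm F \<alpha>)) * (\<Prod>j\<in>G. indicator (B j) (\<alpha> j)) = (\<Prod>j\<in>F \<union> G. f j (\<alpha> j))"
      by (simp add: split)
  qed
  also have "\<dots> = (\<Prod>j\<in>F \<union> G. \<integral>\<^sup>+z. f j z \<partial>cgauss (lam j))"
    by (rule nn_integral_prod_coords) (use F fm in auto)
  also have "\<dots> = (\<Prod>j\<in>F. \<integral>\<^sup>+z. f j z \<partial>cgauss (lam j)) * (\<Prod>j\<in>G. \<integral>\<^sup>+z. f j z \<partial>cgauss (lam j))" by (rule split)
  also have "(\<Prod>j\<in>G. \<integral>\<^sup>+z. f j z \<partial>cgauss (lam j)) = (\<Prod>j\<in>G. emeasure (cgauss (lam j)) (B j))"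
  proof (rule prod.cong[OF refl])
    fix j assume "j \<in> G"
    then have "(\<integral>\<^sup>+z. f j z \<partial>cgauss (lam j)) = (\<integral>\<^sup>+z. indicator (B j) z \<partial>cgauss (lam j))" by (simp add: f_def notF)
    also have "\<dots> = emeasure (cgauss (lam j)) (B j)" by (rule nn_integral_indicator) (use B \<open>j \<in> G\<close> in auto)
    finally show "(\<integral>\<^sup>+z. f j z \<partial>cgauss (lam j)) = emeasure (cgauss (lam j)) (B j)" .
  qed
  also have "(\<Prod>j\<in>F. \<integral>\<^sup>+z. f j z \<partial>cgauss (lam j)) \<le> (\<Prod>j\<in>F. ennreal (exp (2 * s\<^sup>2 * (1 / (lam j)\<^sup>2))))"
  proof (rule ennreal_prod_mono)
    fix j assume j: "j \<in> F"
    define x where "x = - (s / lam j)"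
    have sl: "s < lam j" using s[OF j] l_pos[of j] by linarith
    have x: "\<bar>x\<bar> \<le> 1/2" using s[OF j] l_pos[of j] by (simp add: x_def field_simps)
    have x1: "1 + x > 0" using x by linarith
    have "(\<integral>\<^sup>+z. f j z \<partial>cgauss (lam j)) = (\<integral>\<^sup>+z. ennreal (exp x) * ennreal (exp (s * (cmod z)\<^sup>2)) \<partial>cgauss (lam j))"
      using j by (intro nn_integral_cong) (simp add: f_def x_def ennreal_mult[symmetric] exp_add[symmetric] algebra_simps)
    also have "\<dots> = ennreal (exp x) * ennreal (lam j / (lam j - s))"
    proof -
      have "(\<lambda>z. ennreal (exp (s * (cmod z)\<^sup>2))) \<in> borel_measurable (cgauss (lam j))"
        unfolding measurable_cong_sets[OF sets_cgauss refl]
        by (intro measurable_compose[OF _ measurable_ennreal] borel_measurable_continuous_onI continuous_intros)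
      then show ?thesis by (simp only: nn_integral_cmult cgauss_exp_square[OF l_pos sl])
    qed
    also have "lam j / (lam j - s) = 1 / (1 + x)" using l_pos[of j] sl by (simp add: x_def field_simps)
    also have "ennreal (exp x) * ennreal (1 / (1 + x)) = ennreal (exp (x - ln (1 + x)))"
      using x1 by (simp add: ennreal_mult[symmetric] exp_diff)
    also have "\<dots> \<le> ennreal (exp (2 * s\<^sup>2 * (1 / (lam j)\<^sup>2)))"
    proof (intro ennreal_leI)
      have "\<bar>ln (1 + x) - x\<bar> \<le> 2 * x\<^sup>2" by (rule abs_ln_one_plus_x_minus_x_bound[OF x])
      moreover have "2 * x\<^sup>2 = 2 * s\<^sup>2 * (1 / (lam j)\<^sup>2)" by (simp add: x_def power_divide)
      ultimately show "exp (x - ln (1 + x)) \<le> exp (2 * s\<^sup>2 * (1 / (lam j)\<^sup>2))" by simp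
    qed
    finally show "(\<integral>\<^sup>+z. f j z \<partial>cgauss (lam j)) \<le> ennreal (exp (2 * s\<^sup>2 * (1 / (lam j)\<^sup>2)))" .
  qed
  also have "(\<Prod>j\<in>F. ennreal (exp (2 * s\<^sup>2 * (1 / (lam j)\<^sup>2)))) = ennreal (exp (2 * s\<^sup>2 * (\<Sum>j\<in>F. 1 / (lam j)\<^sup>2)))"
    by (simp add: sum_distrib_left exp_sum[OF F(1)] prod_ennreal)
  finally show ?thesis by (simp add: mult_right_mono)
qed

text \<open>Linearisation: \<open>exp (|w|\<^sup>2 / (4 g))\<close> is itself a Gaussian average of exponentials of real-linear
  functionals of \<open>w\<close>.\<close>

lemma exp_square_field:
  assumes F: "finite F" and g: "(\<Sum>j\<in>F. (cmod (c j))\<^sup>2 / lam j) \<le> g" "g > 0"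
  shows "(\<integral>\<^sup>+\<alpha>. ennreal (exp ((cmod (\<Sum>j\<in>F. \<alpha> j * c j))\<^sup>2 / (4 * g))) \<partial>\<mu>) \<le> 2"
proof -
  interpret \<mu>: prob_space \<mu> by (rule prob)
  interpret G: prob_space "cgauss g" by (rule prob_space_cgauss[OF g(2)])
  interpret pair_sigma_finite "cgauss g" \<mu> by unfold_locales
  let ?w = "\<lambda>\<alpha>. \<Sum>j\<in>F. \<alpha> j * c j"
  let ?g = "\<Sum>j\<in>F. (cmod (c j))\<^sup>2 / lam j"
  have "(\<integral>\<^sup>+\<alpha>. ennreal (exp ((cmod (?w \<alpha>))\<^sup>2 / (4 * g))) \<partial>\<mu>)
    = (\<integral>\<^sup>+\<alpha>. \<integral>\<^sup>+z. ennreal (exp (Re (?w \<alpha> * z))) \<partial>cgauss g \<partial>\<mu>)"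
    by (simp only: cgauss_exp_linear[OF g(2)])
  also have "\<dots> = (\<integral>\<^sup>+z. \<integral>\<^sup>+\<alpha>. ennreal (exp (Re (?w \<alpha> * z))) \<partial>\<mu> \<partial>cgauss g)"
    by (rule Fubini') measurable
  also have "\<dots> = (\<integral>\<^sup>+z. ennreal (exp ((?g / 4) * (cmod z)\<^sup>2)) \<partial>cgauss g)"
  proof (rule nn_integral_cong)
    fix z
    have "(\<integral>\<^sup>+\<alpha>. ennreal (exp (Re (?w \<alpha> * z))) \<partial>\<mu>) = (\<integral>\<^sup>+\<alpha>. (\<Prod>j\<in>F. ennreal (exp (Re ((c j * z) * \<alpha> j)))) \<partial>\<mu>)"
    proof (rule nn_integral_cong)
      fix \<alpha>
      have "Re (?w \<alpha> * z) = (\<Sum>j\<in>F. Re ((c j * z) * \<alpha> j))"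
        unfolding sum_distrib_right Re_sum by (intro sum.cong) (simp_all only: mult_ac)
      then show "ennreal (exp (Re (?w \<alpha> * z))) = (\<Prod>j\<in>F. ennreal (exp (Re ((c j * z) * \<alpha> j))))"
        by (simp only: exp_sum[OF F] prod_ennreal exp_ge_zero)
    qed
    also have "\<dots> = (\<Prod>j\<in>F. \<integral>\<^sup>+y. ennreal (exp (Re ((c j * z) * y))) \<partial>cgauss (lam j))"
      by (rule nn_integral_prod_coords[OF F]) measurable
    also have "\<dots> = (\<Prod>j\<in>F. ennreal (exp ((cmod (c j * z))\<^sup>2 / (4 * lam j))))"
      by (simp only: cgauss_exp_linear[OF l_pos])
    also have "\<dots> = ennreal (exp (\<Sum>j\<in>F. (cmod (c j * z))\<^sup>2 / (4 * lam j)))"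
      by (simp add: exp_sum[OF F] prod_ennreal)
    also have "(\<Sum>j\<in>F. (cmod (c j * z))\<^sup>2 / (4 * lam j)) = (?g / 4) * (cmod z)\<^sup>2"
      by (simp add: norm_mult power_mult_distrib sum_distrib_right sum_distrib_left sum_divide_distrib mult_ac)
    finally show "(\<integral>\<^sup>+\<alpha>. ennreal (exp (Re (?w \<alpha> * z))) \<partial>\<mu>) = ennreal (exp ((?g / 4) * (cmod z)\<^sup>2))" .
  qed
  also have "\<dots> = ennreal (g / (g - ?g / 4))" by (rule cgauss_exp_square) (use g in auto)
  also have "\<dots> \<le> ennreal 2" using g by (intro ennreal_leI) (simp add: field_simps)
  finally show ?thesis by simp
qed

lemma coord_event_pos:
  assumes "finite G" "\<And>j. j \<in> G \<Longrightarrow> open (B j) \<and> B j \<noteq> {}"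
  shows "0 < (\<Prod>j\<in>G. emeasure (cgauss (lam j)) (B j))"
proof -
  have "emeasure (cgauss (lam j)) (B j) \<noteq> 0" if j: "j \<in> G" for j
  proof
    have B: "B j \<in> sets borel" using assms(2)[OF j] by auto
    assume "emeasure (cgauss (lam j)) (B j) = 0"
    then have "(\<integral>\<^sup>+z. ennreal (lam j / pi * exp (- lam j * (cmod z)\<^sup>2)) * indicator (B j) z \<partial>lborel) = 0"
      unfolding cgauss_def using B by (subst (asm) emeasure_density) auto
    then have "AE z in lborel. ennreal (lam j / pi * exp (- lam j * (cmod z)\<^sup>2)) * indicator (B j) z = 0"
      using B by (subst (asm) nn_integral_0_iff_AE) auto
    then have "AE z in lborel. z \<notin> B j"
      by eventually_elim (use l_pos[of j] in \<open>auto simp: indicator_def not_less mult_le_0_iff divide_le_0_iff split: if_splits\<close>)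
    then have null: "B j \<in> null_sets lborel" using B by (subst AE_iff_null_sets) auto
    obtain a where "a \<in> B j" using assms(2)[OF j] by blast
    then obtain r where "r > 0" "ball a r \<subseteq> B j" using assms(2)[OF j] open_contains_ball by blast
    then have "ball a r \<in> null_sets lborel" using null null_sets_subset[of _ lborel "ball a r"] by auto
    then have "emeasure lborel (ball a r) = 0" by auto
    then show False using \<open>r > 0\<close> negligible_iff_null_sets open_not_negligible[of "ball a r"]
      by (metis \<open>ball a r \<in> null_sets lborel\<close> ball_eq_empty null_sets_completionI not_le open_ball)
  qed
  then show ?thesis using assms(1) by (simp add: zero_less_iff_neq_zero prod_zero_iff)
qed

end

section \<open>Moment bounds for frequency blocks\<close>

text \<open>The analysis runs with the classical eigenfunctions \<open>E\<close>, whereas the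
  functionals of the theorem are formed with the given \<open>e\<close>; the two agree almost
  everywhere.\<close>

locale gibbs_setting = admissible_eigenbasis V lam E E' b + gaussian_coords lam \<theta> \<mu>
  for V lam E E' b \<theta> \<mu> +
  fixes e :: "nat \<Rightarrow> real \<Rightarrow> complex"
  assumes e_measurable: "e j \<in> borel_measurable borel" and e_AE: "AE x in lborel. e j x = E j x"
begin

sublocale prob_space \<mu> by (rule prob)

sublocale M_lborel: pair_sigma_finite \<mu> "lborel :: real measure"
  by unfold_locales

section \<open>Trace bounds from the summability exponent\<close>

definition S1 :: real where "S1 = (\<Sum>j. lam j powr (- (1 + b)))"

lemma S1_nonneg: "0 \<le> S1"
  unfolding S1_def by (rule suminf_nonneg[OF lam_sum]) simp

lemma sum_le_S1: "finite F \<Longrightarrow> (\<Sum>j\<in>F. lam j powr (- (1 + b))) \<le> S1"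
  unfolding S1_def by (rule sum_le_suminf[OF lam_sum]) auto

text \<open>With c = b this bounds the trace below L by L^b, with c = 1 + b the number of modes by
  L^(1+b).\<close>

lemma sum_powr_le:
  assumes F: "finite F" and c: "c \<ge> 0" "L > 0" and le: "\<And>j. j \<in> F \<Longrightarrow> lam j powr c \<le> L powr c"
  shows "(\<Sum>j\<in>F. lam j powr (- (1 + b) + c)) \<le> S1 * L powr c"
proof -
  have "(\<Sum>j\<in>F. lam j powr (- (1 + b) + c)) \<le> (\<Sum>j\<in>F. lam j powr (- (1 + b)) * L powr c)"
    by (intro sum_mono) (auto simp: powr_add intro!: mult_left_mono le)
  also have "\<dots> \<le> S1 * L powr c"
    unfolding sum_distrib_right[symmetric] by (intro mult_right_mono sum_le_S1 F) auto
  finally show ?thesis .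
qed

lemma sum_inverse_low:
  assumes F: "finite F" and L: "L > 0" "\<And>j. j \<in> F \<Longrightarrow> lam j \<le> L"
  shows "(\<Sum>j\<in>F. 1 / lam j) \<le> S1 * L powr b"
proof -
  have "(\<Sum>j\<in>F. 1 / lam j) = (\<Sum>j\<in>F. lam j powr (- (1 + b) + b))"
    using lam_pos by (intro sum.cong) (auto simp: powr_minus_divide abs_of_pos)
  also have "\<dots> \<le> S1 * L powr b"
    using L lam_pos b by (intro sum_powr_le F) (auto intro!: powr_mono2 simp: less_imp_le)
  finally show ?thesis .
qed

lemma card_low:
  assumes F: "finite F" and L: "L > 0" "\<And>j. j \<in> F \<Longrightarrow> lam j \<le> L"
  shows "real (card F) \<le> S1 * L powr (1 + b)"
proof -
  have "real (card F) = (\<Sum>j\<in>F. lam j powr (- (1 + b) + (1 + b)))"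
    using lam_pos by (simp add: less_imp_neq[symmetric])
  also have "\<dots> \<le> S1 * L powr (1 + b)"
    using L lam_pos b by (intro sum_powr_le F) (auto intro!: powr_mono2 simp: less_imp_le)
  finally show ?thesis .
qed

lemma sum_inverse_square_high:
  assumes F: "finite F" and L: "L > 0" "\<And>j. j \<in> F \<Longrightarrow> L \<le> lam j"
  shows "(\<Sum>j\<in>F. 1 / (lam j)\<^sup>2) \<le> S1 * L powr (- (1 - b))"
proof -
  have "(\<Sum>j\<in>F. 1 / (lam j)\<^sup>2) \<le> (\<Sum>j\<in>F. lam j powr (- (1 + b)) * L powr (- (1 - b)))"
  proof (rule sum_mono)
    fix j assume j: "j \<in> F"
    have "1 / (lam j)\<^sup>2 = lam j powr (- (1 + b)) * lam j powr (- (1 - b))"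
      using lam_pos[of j] by (simp add: powr_add[symmetric] powr_minus_divide powr_numeral)
    also have "\<dots> \<le> lam j powr (- (1 + b)) * L powr (- (1 - b))"
      using L(1) L(2)[OF j] b by (intro mult_left_mono powr_mono2') auto
    finally show "1 / (lam j)\<^sup>2 \<le> lam j powr (- (1 + b)) * L powr (- (1 - b))" .
  qed
  also have "\<dots> \<le> S1 * L powr (- (1 - b))"
    unfolding sum_distrib_right[symmetric] by (intro mult_right_mono sum_le_S1 F) auto
  finally show ?thesis .
qed

lemma comb_joint_measurable [measurable]: "(\<lambda>p. comb F (fst p) (snd p)) \<in> borel_measurable (\<mu> \<Otimes>\<^sub>M lborel)"
proof -
  have "(\<lambda>p. fst p j * E j (snd p)) \<in> borel_measurable (\<mu> \<Otimes>\<^sub>M lborel)" for j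
    by (intro borel_measurable_times measurable_compose[OF measurable_fst coord_measurable]
        measurable_compose[OF measurable_snd]) (simp add: E_measurable)
  then show ?thesis unfolding comb_def by (intro borel_measurable_sum)
qed

text \<open>At each x the field is a complex Gaussian whose variance is the Green function
  \<open>?g x\<close>, and the coefficient a is small enough to be absorbed by its exponential
  square moment. What remains is \<open>?g x\<close> squared, whose integral is at most
  \<open>G\<close> times the trace.\<close>

lemma field_moment:
  assumes F: "finite F" and G: "G > 0" "\<And>x. (\<Sum>j\<in>F. (cmod (E j x))\<^sup>2 / lam j) \<le> G"
    and a: "0 \<le> a" "a \<le> 1 / (8 * G)"
  shows "(\<integral>\<^sup>+\<alpha>. \<integral>\<^sup>+x. ennreal (cmod (comb F \<alpha> x) ^ 4 * exp (a * (cmod (comb F \<alpha> x))\<^sup>2)) \<partial>lborel \<partial>\<mu>)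
    \<le> ennreal (256 * G * (\<Sum>j\<in>F. 1 / lam j))"
proof -
  let ?g = "\<lambda>x. \<Sum>j\<in>F. (cmod (E j x))\<^sup>2 / lam j"
  have g0: "0 \<le> ?g x" for x using lam_pos by (intro sum_nonneg) (auto intro: divide_nonneg_pos)
  have pt: "(\<integral>\<^sup>+\<alpha>. ennreal (cmod (comb F \<alpha> x) ^ 4 * exp (a * (cmod (comb F \<alpha> x))\<^sup>2)) \<partial>\<mu>) \<le> ennreal (256 * G * ?g x)" for x
  proof (cases "?g x = 0")
    case True
    then have "\<forall>j\<in>F. (cmod (E j x))\<^sup>2 / lam j = 0"
      using F lam_pos by (subst (asm) sum_nonneg_eq_0_iff) (auto intro: divide_nonneg_pos)
    then have "comb F \<alpha> x = 0" for \<alpha>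
      using lam_pos less_imp_neq unfolding comb_def by (intro sum.neutral) fastforce
    then show ?thesis by simp
  next
    case False
    then have gp: "?g x > 0" using g0[of x] by linarith
    have le: "u\<^sup>2 * exp (a * u) \<le> 128 * (?g x)\<^sup>2 * exp (u / (4 * ?g x))" if "u \<ge> 0" for u
    proof -
      \<comment> \<open>The available exponent u / (4 g) is 2 y: one copy of y absorbs the factor
        u^2, the other absorbs a u.\<close>
      define y where "y = u / (8 * ?g x)"
      have y0: "0 \<le> y" using that gp by (simp add: y_def)
      have "u\<^sup>2 = 64 * (?g x)\<^sup>2 * y\<^sup>2" using gp by (simp add: y_def field_simps power2_eq_square)
      moreover have "y\<^sup>2 \<le> 2 * exp y" using exp_lower_Taylor_quadratic[OF y0] y0 by simp
      ultimately have 1: "u\<^sup>2 \<le> 128 * (?g x)\<^sup>2 * exp y"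
        using mult_left_mono[of "y\<^sup>2" "2 * exp y" "64 * (?g x)\<^sup>2"] by simp
      have "a \<le> 1 / (8 * ?g x)"
        using a(2) G(2)[of x] gp by (elim order_trans) (auto intro!: divide_left_mono)
      then have "a * u \<le> y" using that mult_right_mono[of a "1 / (8 * ?g x)" u] by (simp add: y_def)
      then have "u\<^sup>2 * exp (a * u) \<le> 128 * (?g x)\<^sup>2 * (exp y * exp y)"
        using 1 unfolding mult.assoc[symmetric] by (intro mult_mono) auto
      also have "exp y * exp y = exp (u / (4 * ?g x))" using gp by (simp add: exp_add[symmetric] y_def)
      finally show ?thesis by (simp add: mult.assoc)
    qed
    have "(\<integral>\<^sup>+\<alpha>. ennreal (cmod (comb F \<alpha> x) ^ 4 * exp (a * (cmod (comb F \<alpha> x))\<^sup>2)) \<partial>\<mu>)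
       \<le> (\<integral>\<^sup>+\<alpha>. ennreal (128 * (?g x)\<^sup>2) * ennreal (exp ((cmod (\<Sum>j\<in>F. \<alpha> j * E j x))\<^sup>2 / (4 * ?g x))) \<partial>\<mu>)"
    proof (intro nn_integral_mono)
      fix \<alpha>
      show "ennreal (cmod (comb F \<alpha> x) ^ 4 * exp (a * (cmod (comb F \<alpha> x))\<^sup>2))
        \<le> ennreal (128 * (?g x)\<^sup>2) * ennreal (exp ((cmod (\<Sum>j\<in>F. \<alpha> j * E j x))\<^sup>2 / (4 * ?g x)))"
        using le[of "(cmod (comb F \<alpha> x))\<^sup>2"]
        by (subst ennreal_mult[symmetric]) (auto simp: comb_def power_mult[symmetric] intro!: ennreal_leI)
    qed
    also have "\<dots> = ennreal (128 * (?g x)\<^sup>2) * (\<integral>\<^sup>+\<alpha>. ennreal (exp ((cmod (\<Sum>j\<in>F. \<alpha> j * E j x))\<^sup>2 / (4 * ?g x))) \<partial>\<mu>)"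
      by (rule nn_integral_cmult) measurable
    also have "\<dots> \<le> ennreal (128 * (?g x)\<^sup>2) * 2"
      by (intro mult_left_mono exp_square_field F gp) auto
    also have "\<dots> = ennreal (256 * (?g x * ?g x))"
      by (simp add: power2_eq_square ennreal_mult''[symmetric] flip: ennreal_numeral)
    \<comment> \<open>Only one of the two factors is replaced by its supremum; the other must stay,
      because it is integrable in x with integral the sum of 1 / \<open>lam j\<close>.\<close>
    also have "\<dots> \<le> ennreal (256 * G * ?g x)"
      using G(2)[of x] g0[of x] by (intro ennreal_leI) (simp add: mult_right_mono mult.assoc)
    finally show ?thesis .
  qed
  have m: "(\<lambda>p. ennreal (cmod (comb F (fst p) (snd p)) ^ 4 * exp (a * (cmod (comb F (fst p) (snd p)))\<^sup>2))) \<in> borel_measurable (\<mu> \<Otimes>\<^sub>M lborel)"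
    by measurable
  have "(\<integral>\<^sup>+\<alpha>. \<integral>\<^sup>+x. ennreal (cmod (comb F \<alpha> x) ^ 4 * exp (a * (cmod (comb F \<alpha> x))\<^sup>2)) \<partial>lborel \<partial>\<mu>)
    = (\<integral>\<^sup>+x. \<integral>\<^sup>+\<alpha>. ennreal (cmod (comb F \<alpha> x) ^ 4 * exp (a * (cmod (comb F \<alpha> x))\<^sup>2)) \<partial>\<mu> \<partial>lborel)"
    using M_lborel.Fubini[OF m] by simp
  also have "\<dots> \<le> (\<integral>\<^sup>+x. ennreal (256 * G * ?g x) \<partial>lborel)" by (intro nn_integral_mono pt)
  also have "\<dots> = (\<integral>\<^sup>+x. (\<Sum>j\<in>F. ennreal (256 * G / lam j) * ennreal ((cmod (E j x))\<^sup>2)) \<partial>lborel)"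
    using G(1) lam_pos
    by (intro nn_integral_cong) (simp add: sum_distrib_left ennreal_mult[symmetric] less_imp_le)
  also have "\<dots> = (\<Sum>j\<in>F. ennreal (256 * G / lam j))"
    by (subst nn_integral_sum) (auto simp: nn_integral_cmult E_norm)
  also have "\<dots> = ennreal (256 * G * (\<Sum>j\<in>F. 1 / lam j))"
    using G(1) lam_pos by (subst sum_ennreal) (auto simp: sum_distrib_left less_imp_le)
  finally show ?thesis .
qed

lemma comb_fourth_integrable:
  assumes F: "finite F" shows "integrable lborel (\<lambda>x. cmod (comb F \<alpha> x) ^ 4)"
proof -
  let ?C = "1 * (\<Sum>j\<in>F. (cmod (\<alpha> j))\<^sup>2) + (\<Sum>j\<in>F. lam j * (cmod (\<alpha> j))\<^sup>2) / 1"
  show ?thesis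
  proof (rule Bochner_Integration.integrable_bound)
    show "integrable lborel (\<lambda>x. ?C * (cmod (comb F \<alpha> x))\<^sup>2)" by (intro integrable_mult_right comb_norm F)
    have "cmod (comb F \<alpha> x) ^ 4 \<le> ?C * (cmod (comb F \<alpha> x))\<^sup>2" for x
      using mult_right_mono[OF comb_sup[OF F, of 1 \<alpha> x], of "(cmod (comb F \<alpha> x))\<^sup>2"]
      by (simp add: power_add[symmetric])
    then show "AE x in lborel. norm (cmod (comb F \<alpha> x) ^ 4) \<le> norm (?C * (cmod (comb F \<alpha> x))\<^sup>2)"
      by (intro AE_I2) (auto intro: order_trans[OF _ abs_ge_self])
  qed measurable
qed

text \<open>Jensen's inequality for the probability density \<open>|w|\<^sup>2 / \<integral> |w|\<^sup>2\<close>, in the form of the tangent line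
  inequality for the exponential: it trades one factor \<open>|w|\<^sup>2\<close> of the quartic for the mass.\<close>

lemma exp_quartic:
  assumes F: "finite F" and k: "0 \<le> k" and R: "(\<Sum>j\<in>F. (cmod (\<alpha> j))\<^sup>2) \<le> R"
  shows "ennreal (exp (k * (\<integral>x. cmod (comb F \<alpha> x) ^ 4 \<partial>lborel)) - 1)
    \<le> ennreal k * (\<integral>\<^sup>+x. ennreal (cmod (comb F \<alpha> x) ^ 4 * exp (k * R * (cmod (comb F \<alpha> x))\<^sup>2)) \<partial>lborel)"
proof -
  let ?w = "comb F \<alpha>"
  define Q where "Q = (\<Sum>j\<in>F. (cmod (\<alpha> j))\<^sup>2)"
  define D where "D = (\<integral>x. cmod (?w x) ^ 4 \<partial>lborel)"
  have Q0: "0 \<le> Q" unfolding Q_def by (intro sum_nonneg) auto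
  show ?thesis
  proof (cases "Q = 0")
    case True
    then have "\<forall>j\<in>F. \<alpha> j = 0" unfolding Q_def using F by (subst (asm) sum_nonneg_eq_0_iff) auto
    then have "?w x = 0" for x unfolding comb_def by simp
    then show ?thesis by simp
  next
    case False
    then have Qp: "Q > 0" using Q0 by simp
    define c where "c = k * D"
    \<comment> \<open>Under the density \<open>|w|^2 / Q\<close> the variable k Q
      \<open>|w|^2\<close> has mean \<open>c\<close>. The function \<open>h\<close> is the density
      times the tangent line of exp at \<open>c\<close>, minus 1, so its integral is exactly exp c -
      1.\<close>
    define h where "h x = (exp c * (1 - c) - 1) / Q * (cmod (?w x))\<^sup>2 + exp c * k * cmod (?w x) ^ 4" for x
    have ih: "integrable lborel h" unfolding h_def[abs_def]
      by (intro Bochner_Integration.integrable_add integrable_mult_right comb_norm(1) comb_fourth_integrable F)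
    have "(\<integral>x. h x \<partial>lborel) = (exp c * (1 - c) - 1) / Q * Q + exp c * k * D"
      unfolding h_def D_def Q_def comb_norm(2)[OF F, symmetric]
      by (subst Bochner_Integration.integral_add)
         (auto intro!: integrable_mult_right comb_norm(1) comb_fourth_integrable F)
    also have "\<dots> = (exp c * (1 - c) - 1) + exp c * k * D" using Qp by simp
    also have "\<dots> = exp c - 1" by (simp add: c_def algebra_simps)
    finally have int: "(\<integral>x. h x \<partial>lborel) = exp c - 1" .
    have hle: "h x \<le> k * (cmod (?w x) ^ 4 * exp (k * R * (cmod (?w x))\<^sup>2))" for x
    proof -
      define u where "u = (cmod (?w x))\<^sup>2"
      define y where "y = k * Q * u"
      have u0: "0 \<le> u" by (simp add: u_def)
      have u4: "cmod (?w x) ^ 4 = u\<^sup>2" by (simp add: u_def power_mult[symmetric])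
      have t1: "exp c * (1 + (y - c)) \<le> exp y"
        using mult_left_mono[OF exp_ge_add_one_self[of "y - c"], of "exp c"] by (simp add: exp_add[symmetric])
      have t2: "exp y - 1 \<le> y * exp y"
        using mult_left_mono[OF exp_ge_add_one_self[of "- y"], of "exp y"] by (simp add: exp_minus algebra_simps)
      have "h x = (exp c * (1 - c) - 1) / Q * u + exp c * k * u\<^sup>2" unfolding h_def u4 by (simp only: u_def)
      also have "\<dots> = u / Q * (exp c * (1 + (y - c)) - 1)"
        using Qp by (simp add: y_def power2_eq_square field_simps)
      also have "\<dots> \<le> u / Q * (y * exp y)" using t1 t2 u0 Qp by (intro mult_left_mono) auto
      also have "\<dots> = k * u\<^sup>2 * exp y" using Qp by (simp add: y_def power2_eq_square)
      also have "\<dots> \<le> k * u\<^sup>2 * exp (k * R * u)"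
        using R k u0 unfolding y_def Q_def by (intro mult_left_mono) (auto intro!: mult_right_mono mult_left_mono)
      finally show ?thesis by (simp add: u4 u_def[symmetric] mult.assoc)
    qed
    have "ennreal (exp c - 1) \<le> ennreal (\<integral>x. max 0 (h x) \<partial>lborel)"
      unfolding int[symmetric] by (intro ennreal_leI integral_mono ih integrable_max) auto
    also have "\<dots> = (\<integral>\<^sup>+x. ennreal (max 0 (h x)) \<partial>lborel)"
      by (intro nn_integral_eq_integral[symmetric] integrable_max ih) auto
    also have "\<dots> \<le> (\<integral>\<^sup>+x. ennreal k * ennreal (cmod (?w x) ^ 4 * exp (k * R * (cmod (?w x))\<^sup>2)) \<partial>lborel)"
      using hle k by (intro nn_integral_mono) (auto simp: ennreal_mult[symmetric] intro!: ennreal_leI)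
    also have "\<dots> = ennreal k * (\<integral>\<^sup>+x. ennreal (cmod (?w x) ^ 4 * exp (k * R * (cmod (?w x))\<^sup>2)) \<partial>lborel)"
      by (rule nn_integral_cmult) measurable
    finally show ?thesis by (simp add: c_def D_def)
  qed
qed

section \<open>Dyadic blocks and their tails\<close>

definition J :: "nat \<Rightarrow> nat set" where "J k = {j. lam j \<le> 2 ^ k}"
definition block :: "nat \<Rightarrow> nat set" where "block k = J (Suc k) - J k"
definition low :: "nat \<Rightarrow> (nat \<Rightarrow> complex) \<Rightarrow> real \<Rightarrow> complex" where "low k \<alpha> = comb (J k) \<alpha>"
definition mass :: "nat set \<Rightarrow> (nat \<Rightarrow> complex) \<Rightarrow> real" where "mass F \<alpha> = (\<Sum>j\<in>F. (cmod (\<alpha> j))\<^sup>2)"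
definition quart :: "nat \<Rightarrow> (nat \<Rightarrow> complex) \<Rightarrow> real" where
  "quart k \<alpha> = (\<integral>x. cmod (comb (block k) \<alpha> x) ^ 4 \<partial>lborel)"

lemma J_finite [simp]: "finite (J k)" unfolding J_def by (rule finite_level)
lemma block_finite [simp]: "finite (block k)" unfolding block_def by simp
lemma J_mono: "k \<le> l \<Longrightarrow> J k \<subseteq> J l"
  unfolding J_def by (auto intro: order_trans power_increasing)
lemma J_le: "j \<in> J k \<Longrightarrow> lam j \<le> 2 ^ k" by (simp add: J_def)
lemma block_bounds: "j \<in> block k \<Longrightarrow> 2 ^ k < lam j \<and> lam j \<le> 2 ^ Suc k" by (auto simp: block_def J_def)

lemma mass_measurable [measurable]: "mass F \<in> borel_measurable \<mu>"
  unfolding mass_def[abs_def] by measurable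

lemma quart_measurable [measurable]: "quart k \<in> borel_measurable \<mu>"
proof -
  have "(\<lambda>\<alpha>. \<integral>x. cmod (comb (block k) \<alpha> x) ^ 4 \<partial>lborel) \<in> borel_measurable \<mu>"
  proof (rule lborel.borel_measurable_lebesgue_integral)
    have "(\<lambda>p. cmod (comb (block k) (fst p) (snd p)) ^ 4) \<in> borel_measurable (\<mu> \<Otimes>\<^sub>M lborel)" by measurable
    then show "(\<lambda>(\<alpha>, x). cmod (comb (block k) \<alpha> x) ^ 4) \<in> borel_measurable (\<mu> \<Otimes>\<^sub>M lborel)"
      by (simp add: case_prod_beta)
  qed
  then show ?thesis by (simp add: quart_def[abs_def])
qed

lemma quart_nonneg: "0 \<le> quart k \<alpha>" unfolding quart_def by simp

lemma two_pow_powr: "(2 ^ k) powr c = 2 powr (real k * c)"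
  by (simp add: powr_powr flip: powr_realpow)

text \<open>The gain 2^(- k (1/2 - b)) of block k is cut into eight equal powers: up to four are
  spent on the weights \<open>wt\<close>, and the rest yields geometric decay over the
  blocks.\<close>

definition \<rho> :: real where "\<rho> = 2 powr (- ((1/2 - b) / 8))"

lemma rho: "0 < \<rho>" "\<rho> < 1"
  unfolding \<rho>_def using b by (auto intro!: powr_less_one)

lemma rho_pow: "\<rho> ^ (8 * k) = 2 powr (- (real k * (1/2 - b)))"
  unfolding \<rho>_def by (simp add: powr_realpow[symmetric] powr_powr mult.commute flip: powr_numeral)

lemma block_green: "(\<Sum>j\<in>block k. (cmod (E j x))\<^sup>2 / lam j) \<le> 2 / sqrt (2 ^ k)"
  using block_bounds by (intro green_diagonal_high) (auto intro: less_imp_le)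

text \<open>Green function bound times trace, the product that controls the quartic moments of a
  block: 2^(-k/2) against 2^(k b).\<close>

lemma block_const: "2 / sqrt (2 ^ k) * (\<Sum>j\<in>block k. 1 / lam j) \<le> 4 * S1 * \<rho> ^ (8 * k)"
proof -
  have "(\<Sum>j\<in>block k. 1 / lam j) \<le> S1 * (2 ^ Suc k) powr b"
    using block_bounds by (intro sum_inverse_low) auto
  also have "\<dots> = S1 * 2 powr b * 2 powr (real k * b)"
    unfolding two_pow_powr by (simp add: powr_add[symmetric] algebra_simps)
  also have "\<dots> \<le> S1 * 2 * 2 powr (real k * b)"
    using b S1_nonneg powr_mono[of b 1 2] by (intro mult_right_mono mult_left_mono) auto
  finally have "2 / sqrt (2 ^ k) * (\<Sum>j\<in>block k. 1 / lam j) \<le> 2 / sqrt (2 ^ k) * (S1 * 2 * 2 powr (real k * b))"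
    by (intro mult_left_mono) auto
  also have "\<dots> = 4 * S1 * (2 powr (real k * b) / sqrt (2 ^ k))" by simp
  also have "2 powr (real k * b) / sqrt (2 ^ k) = \<rho> ^ (8 * k)"
    unfolding rho_pow powr_half_sqrt[OF zero_le_power[OF zero_le_numeral], symmetric] two_pow_powr
    by (simp add: powr_diff[symmetric] algebra_simps)
  finally show ?thesis .
qed

lemma quart_moment:
  "(\<integral>\<^sup>+\<alpha>. ennreal (quart k \<alpha>) \<partial>\<mu>) \<le> ennreal (1024 * S1 * \<rho> ^ (8 * k))"
proof -
  have "(\<integral>\<^sup>+\<alpha>. ennreal (quart k \<alpha>) \<partial>\<mu>)
    = (\<integral>\<^sup>+\<alpha>. \<integral>\<^sup>+x. ennreal (cmod (comb (block k) \<alpha> x) ^ 4 * exp (0 * (cmod (comb (block k) \<alpha> x))\<^sup>2)) \<partial>lborel \<partial>\<mu>)"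
    unfolding quart_def
    by (subst nn_integral_eq_integral[symmetric]) (auto intro: comb_fourth_integrable)
  also have "\<dots> \<le> ennreal (256 * (2 / sqrt (2 ^ k)) * (\<Sum>j\<in>block k. 1 / lam j))"
    by (rule field_moment[OF _ _ block_green]) auto
  also have "\<dots> \<le> ennreal (1024 * S1 * \<rho> ^ (8 * k))"
    using block_const[of k] by (intro ennreal_leI) simp
  finally show ?thesis .
qed

text \<open>Exponential Chebyshev inequality on the event of bounded mass. The third hypothesis is
  the smallness condition of \<open>field_moment\<close> with a = \<kappa> R and Green function
  bound 2 / sqrt (2^k).\<close>

lemma quart_tail:
  assumes \<kappa>: "0 \<le> \<kappa>" "0 \<le> R" "\<kappa> * R * (16 / sqrt (2 ^ k)) \<le> 1" and T: "1 \<le> \<kappa> * T"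
  shows "emeasure \<mu> {\<alpha>\<in>space \<mu>. T < quart k \<alpha> \<and> mass (block k) \<alpha> \<le> R}
    \<le> ennreal (2 * exp (- (\<kappa> * T)) * (\<kappa> * (1024 * S1 * \<rho> ^ (8 * k))))"
proof -
  let ?A = "{\<alpha>\<in>space \<mu>. T < quart k \<alpha> \<and> mass (block k) \<alpha> \<le> R}"
  let ?w = "comb (block k)"
  let ?I = "\<lambda>\<alpha>. \<integral>\<^sup>+x. ennreal (cmod (?w \<alpha> x) ^ 4 * exp (\<kappa> * R * (cmod (?w \<alpha> x))\<^sup>2)) \<partial>lborel"
  have [measurable]: "?I \<in> borel_measurable \<mu>"
  proof (rule lborel.borel_measurable_nn_integral)
    have "(\<lambda>p. ennreal (cmod (?w (fst p) (snd p)) ^ 4 * exp (\<kappa> * R * (cmod (?w (fst p) (snd p)))\<^sup>2))) \<in> borel_measurable (\<mu> \<Otimes>\<^sub>M lborel)"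
      by measurable
    then show "(\<lambda>(\<alpha>, x). ennreal (cmod (?w \<alpha> x) ^ 4 * exp (\<kappa> * R * (cmod (?w \<alpha> x))\<^sup>2))) \<in> borel_measurable (\<mu> \<Otimes>\<^sub>M lborel)"
      by (simp add: case_prod_beta)
  qed
  \<comment> \<open>Chebyshev is applied to exp - 1 instead of exp: since \<kappa> T \<ge> 1 this
    costs only a factor 2, and the bound keeps the factor \<rho>^(8 k), which makes the events
    summable over blocks.\<close>
  have e2: "1 \<le> 2 * exp (- (\<kappa> * T)) * (exp (\<kappa> * T) - 1)"
  proof -
    have "exp (\<kappa> * T) \<ge> 2" using exp_ge_add_one_self[of "\<kappa> * T"] T by linarith
    then have "exp (- (\<kappa> * T)) \<le> 1/2" by (simp add: exp_minus field_simps)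
    moreover have "2 * exp (- (\<kappa> * T)) * (exp (\<kappa> * T) - 1) = 2 - 2 * exp (- (\<kappa> * T))"
      by (simp add: exp_minus field_simps)
    ultimately show ?thesis by linarith
  qed
  have "emeasure \<mu> ?A = (\<integral>\<^sup>+\<alpha>. indicator ?A \<alpha> \<partial>\<mu>)" by (rule nn_integral_indicator[symmetric]) measurable
  also have "\<dots> \<le> (\<integral>\<^sup>+\<alpha>. ennreal (2 * exp (- (\<kappa> * T))) * (ennreal \<kappa> * ?I \<alpha>) \<partial>\<mu>)"
  proof (intro nn_integral_mono)
    fix \<alpha>
    show "indicator ?A \<alpha> \<le> ennreal (2 * exp (- (\<kappa> * T))) * (ennreal \<kappa> * ?I \<alpha>)"
    proof (cases "\<alpha> \<in> ?A")
      case True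
      then have Q: "(\<Sum>j\<in>block k. (cmod (\<alpha> j))\<^sup>2) \<le> R" and D: "T < quart k \<alpha>" by (auto simp: mass_def)
      have "1 \<le> 2 * exp (- (\<kappa> * T)) * (exp (\<kappa> * quart k \<alpha>) - 1)"
        using e2 D \<kappa>(1) by (elim order_trans) (auto intro!: mult_left_mono)
      then have "ennreal 1 \<le> ennreal (2 * exp (- (\<kappa> * T)) * (exp (\<kappa> * quart k \<alpha>) - 1))" by (rule ennreal_leI)
      also have "\<dots> = ennreal (2 * exp (- (\<kappa> * T))) * ennreal (exp (\<kappa> * quart k \<alpha>) - 1)" by (rule ennreal_mult'') (use \<kappa>(1) quart_nonneg in auto)
      also have "\<dots> \<le> ennreal (2 * exp (- (\<kappa> * T))) * (ennreal \<kappa> * ?I \<alpha>)"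
        unfolding quart_def by (intro mult_left_mono exp_quartic \<kappa> Q) auto
      finally show ?thesis using True by simp
    qed simp
  qed
  also have "\<dots> = ennreal (2 * exp (- (\<kappa> * T))) * (ennreal \<kappa> * (\<integral>\<^sup>+\<alpha>. ?I \<alpha> \<partial>\<mu>))"
    by (subst nn_integral_cmult, measurable, subst nn_integral_cmult, measurable)
  also have "\<dots> \<le> ennreal (2 * exp (- (\<kappa> * T))) * (ennreal \<kappa> * ennreal (1024 * S1 * \<rho> ^ (8 * k)))"
  proof (intro mult_left_mono)
    have "(\<integral>\<^sup>+\<alpha>. ?I \<alpha> \<partial>\<mu>) \<le> ennreal (256 * (2 / sqrt (2 ^ k)) * (\<Sum>j\<in>block k. 1 / lam j))"
    proof (rule field_moment[OF _ _ block_green])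
      show "\<kappa> * R \<le> 1 / (8 * (2 / sqrt (2 ^ k)))" using \<kappa>(3) by (simp add: field_simps)
    qed (use \<kappa> in auto)
    also have "\<dots> \<le> ennreal (1024 * S1 * \<rho> ^ (8 * k))"
      using block_const[of k] by (intro ennreal_leI) simp
    finally show "(\<integral>\<^sup>+\<alpha>. ?I \<alpha> \<partial>\<mu>) \<le> ennreal (1024 * S1 * \<rho> ^ (8 * k))" .
  qed auto
  also have "ennreal (2 * exp (- (\<kappa> * T))) * (ennreal \<kappa> * ennreal (1024 * S1 * \<rho> ^ (8 * k)))
    = ennreal (2 * exp (- (\<kappa> * T)) * (\<kappa> * (1024 * S1 * \<rho> ^ (8 * k))))"
  proof -
    have "ennreal a * (ennreal \<kappa> * ennreal z) = ennreal (a * (\<kappa> * z))" if "0 \<le> a" for a z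
      using \<kappa>(1) that by (simp add: ennreal_mult')
    then show ?thesis by (simp only: mult_nonneg_nonneg zero_le_numeral exp_ge_zero)
  qed
  finally show ?thesis .
qed

text \<open>Exponential Chebyshev with rate 2^k / 2, half of the smallest eigenvalue of the block.
  The exponential moment is at most 2 to the number of modes, that is exp (4 S1 X) with X = 2^(k
  (1+b)), against the gain exp (- H X / 2); the condition on H leaves the margin X.\<close>

lemma mass_tail:
  assumes H: "H \<ge> 8 * S1 + 2"
  shows "emeasure \<mu> {\<alpha>\<in>space \<mu>. H * 2 powr (real k * b) < mass (block k) \<alpha>} \<le> ennreal (exp (- (2 powr (real k * (1 + b)))))"
proof -
  let ?A = "{\<alpha>\<in>space \<mu>. H * 2 powr (real k * b) < mass (block k) \<alpha>}"
  define t where "t = (2::real) ^ k / 2"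
  define X where "X = 2 powr (real k * (1 + b))"
  have X0: "X > 0" by (simp add: X_def)
  have tX: "t * (H * 2 powr (real k * b)) = H / 2 * X"
    by (simp add: t_def X_def powr_add[symmetric] algebra_simps powr_realpow[symmetric])
  have card: "real (card (block k)) \<le> 4 * S1 * X"
  proof -
    have "real (card (block k)) \<le> S1 * (2 ^ Suc k) powr (1 + b)" using block_bounds by (intro card_low) auto
    also have "\<dots> = S1 * 2 powr (1 + b) * X" unfolding two_pow_powr X_def by (simp add: powr_add[symmetric] algebra_simps)
    also have "\<dots> \<le> S1 * 4 * X"
      using b S1_nonneg powr_mono[of "1 + b" 2 2] X0 by (intro mult_right_mono mult_left_mono) auto
    finally show ?thesis by simp
  qed
  have "emeasure \<mu> ?A = (\<integral>\<^sup>+\<alpha>. indicator ?A \<alpha> \<partial>\<mu>)" by (rule nn_integral_indicator[symmetric]) measurable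
  also have "\<dots> \<le> (\<integral>\<^sup>+\<alpha>. ennreal (exp (- (H / 2 * X))) * ennreal (exp (t * (\<Sum>j\<in>block k. (cmod (\<alpha> j))\<^sup>2))) \<partial>\<mu>)"
  proof (intro nn_integral_mono)
    fix \<alpha>
    have "1 \<le> exp (- (H / 2 * X)) * exp (t * (\<Sum>j\<in>block k. (cmod (\<alpha> j))\<^sup>2))" if "\<alpha> \<in> ?A"
    proof -
      have "H / 2 * X \<le> t * (\<Sum>j\<in>block k. (cmod (\<alpha> j))\<^sup>2)"
        unfolding tX[symmetric] using that by (intro mult_left_mono) (auto simp: mass_def t_def)
      then show ?thesis by (simp add: exp_add[symmetric])
    qed
    then show "indicator ?A \<alpha> \<le> ennreal (exp (- (H / 2 * X))) * ennreal (exp (t * (\<Sum>j\<in>block k. (cmod (\<alpha> j))\<^sup>2)))"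
      by (cases "\<alpha> \<in> ?A") (auto simp: ennreal_mult[symmetric] ennreal_1[symmetric] simp del: ennreal_1 intro!: ennreal_leI)
  qed
  also have "\<dots> = ennreal (exp (- (H / 2 * X))) * (\<integral>\<^sup>+\<alpha>. ennreal (exp (t * (\<Sum>j\<in>block k. (cmod (\<alpha> j))\<^sup>2))) \<partial>\<mu>)"
    by (rule nn_integral_cmult) measurable
  also have "\<dots> \<le> ennreal (exp (- (H / 2 * X))) * ennreal (2 ^ card (block k))"
    using block_bounds by (intro mult_left_mono exp_mass) (auto simp: t_def intro: less_imp_le)
  also have "\<dots> \<le> ennreal (exp (- (H / 2 * X))) * ennreal (exp (4 * S1 * X))"
  proof (intro mult_left_mono ennreal_leI)
    have "(2::real) ^ card (block k) \<le> exp 1 ^ card (block k)" using exp_ge_add_one_self[of 1] by (intro power_mono) auto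
    also have "\<dots> = exp (real (card (block k)))" by (simp flip: exp_of_nat_mult)
    also have "\<dots> \<le> exp (4 * S1 * X)" using card by simp
    finally show "(2::real) ^ card (block k) \<le> exp (4 * S1 * X)" .
  qed auto
  also have "\<dots> = ennreal (exp ((4 * S1 - H / 2) * X))" by (simp add: ennreal_mult[symmetric] exp_add[symmetric] algebra_simps)
  also have "\<dots> \<le> ennreal (exp (- X))"
  proof -
    have "(4 * S1 - H / 2) * X \<le> (- 1) * X" using H X0 by (intro mult_right_mono) auto
    then show ?thesis by (intro ennreal_leI) simp
  qed
  finally show ?thesis by (simp add: X_def)
qed

end

section \<open>The quartic functional\<close>

lemma square_sum_weighted:
  fixes a q :: "nat \<Rightarrow> real"
  assumes q: "\<And>r. r \<in> I \<Longrightarrow> q r > 0" "sum q I \<le> 1"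
  shows "(\<Sum>r\<in>I. a r)\<^sup>2 \<le> (\<Sum>r\<in>I. (a r)\<^sup>2 / q r)"
proof -
  have "(\<Sum>r\<in>I. a r)\<^sup>2 = (\<Sum>r\<in>I. sqrt (q r) * (a r / sqrt (q r)))\<^sup>2"
    using q(1) by (intro arg_cong[where f = "\<lambda>x. x\<^sup>2"] sum.cong) (auto simp: less_imp_neq[symmetric])
  also have "\<dots> \<le> (\<Sum>r\<in>I. (sqrt (q r))\<^sup>2) * (\<Sum>r\<in>I. (a r / sqrt (q r))\<^sup>2)"
    by (rule Cauchy_Schwarz_ineq_sum)
  also have "(\<Sum>r\<in>I. (sqrt (q r))\<^sup>2) = sum q I" using q(1) by (intro sum.cong) (auto simp: less_imp_le)
  also have "(\<Sum>r\<in>I. (a r / sqrt (q r))\<^sup>2) = (\<Sum>r\<in>I. (a r)\<^sup>2 / q r)"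
    using q(1) by (intro sum.cong) (auto simp: power_divide less_imp_le)
  also have "sum q I * (\<Sum>r\<in>I. (a r)\<^sup>2 / q r) \<le> 1 * (\<Sum>r\<in>I. (a r)\<^sup>2 / q r)"
    using q by (intro mult_right_mono sum_nonneg divide_nonneg_pos) auto
  finally show ?thesis by simp
qed

text \<open>Weighted Cauchy-Schwarz twice, whence the cube of the weights. Blocks can be summed
  without a loss that grows with their number.\<close>

lemma quartic_sum_weighted:
  fixes z :: "nat \<Rightarrow> complex" and q :: "nat \<Rightarrow> real"
  assumes q: "\<And>r. r \<in> I \<Longrightarrow> q r > 0" "sum q I \<le> 1"
  shows "cmod (\<Sum>r\<in>I. z r) ^ 4 \<le> (\<Sum>r\<in>I. cmod (z r) ^ 4 / (q r) ^ 3)"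
proof -
  have "cmod (\<Sum>r\<in>I. z r) ^ 4 \<le> (\<Sum>r\<in>I. cmod (z r)) ^ 4" by (intro power_mono norm_sum) auto
  also have "\<dots> = ((\<Sum>r\<in>I. cmod (z r))\<^sup>2)\<^sup>2" by (simp flip: power_mult)
  also have "\<dots> \<le> (\<Sum>r\<in>I. (cmod (z r))\<^sup>2 / q r)\<^sup>2" by (intro power_mono square_sum_weighted q) auto
  also have "\<dots> \<le> (\<Sum>r\<in>I. ((cmod (z r))\<^sup>2 / q r)\<^sup>2 / q r)" by (intro square_sum_weighted q)
  also have "\<dots> = (\<Sum>r\<in>I. cmod (z r) ^ 4 / (q r) ^ 3)"
    by (simp add: power_divide power2_eq_square power3_eq_cube power4_eq_xxxx mult_ac)
  finally show ?thesis .
qed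

context gibbs_setting
begin

definition wt :: "nat \<Rightarrow> real" where "wt r = (1 - \<rho>) * \<rho> ^ r"

lemma wt_pos: "0 < wt r" using rho by (simp add: wt_def)

lemma wt_sum: "(\<Sum>r<n. wt r) \<le> 1"
proof -
  have "(\<Sum>r<n. wt r) = 1 - \<rho> ^ n"
    unfolding wt_def sum_distrib_left[symmetric] using rho by (simp add: one_diff_power_eq)
  then show ?thesis using rho by simp
qed

lemma low_telescope: "low (K + n) \<alpha> x = low K \<alpha> x + (\<Sum>r<n. comb (block (K + r)) \<alpha> x)"
proof (induction n)
  case (Suc n)
  have "J (K + Suc n) = J (K + n) \<union> block (K + n)" using J_mono[of "K + n" "K + Suc n"] by (auto simp: block_def)
  moreover have "J (K + n) \<inter> block (K + n) = {}" by (auto simp: block_def)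
  ultimately have "low (K + Suc n) \<alpha> x = low (K + n) \<alpha> x + comb (block (K + n)) \<alpha> x"
    unfolding low_def comb_def by (simp add: sum.union_disjoint)
  then show ?case using Suc by simp
qed simp

lemma low_quartic:
  "(\<integral>\<^sup>+x. ennreal (cmod (low K \<alpha> x) ^ 4) \<partial>lborel) \<le> ennreal (2 * sqrt (2 ^ K) * (mass (J K) \<alpha>)\<^sup>2)"
proof -
  have "cmod (low K \<alpha> x) ^ 4 \<le> (2 * sqrt (2 ^ K) * mass (J K) \<alpha>) * (cmod (low K \<alpha> x))\<^sup>2" for x
    using mult_right_mono[OF comb_sup_low[OF J_finite[of K] _ J_le, where c = \<alpha> and x = x], where c = "(cmod (low K \<alpha> x))\<^sup>2"]
    by (simp add: low_def mass_def flip: power_add)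
  then have "(\<integral>\<^sup>+x. ennreal (cmod (low K \<alpha> x) ^ 4) \<partial>lborel)
     \<le> (\<integral>\<^sup>+x. ennreal ((2 * sqrt (2 ^ K) * mass (J K) \<alpha>) * (cmod (low K \<alpha> x))\<^sup>2) \<partial>lborel)"
    by (intro nn_integral_mono ennreal_leI)
  also have "\<dots> = ennreal (\<integral>x. (2 * sqrt (2 ^ K) * mass (J K) \<alpha>) * (cmod (low K \<alpha> x))\<^sup>2 \<partial>lborel)"
    unfolding low_def
    by (intro nn_integral_eq_integral integrable_mult_right comb_norm) (auto simp: mass_def intro!: AE_I2 mult_nonneg_nonneg sum_nonneg)
  also have "(\<integral>x. (2 * sqrt (2 ^ K) * mass (J K) \<alpha>) * (cmod (low K \<alpha> x))\<^sup>2 \<partial>lborel) = 2 * sqrt (2 ^ K) * (mass (J K) \<alpha>)\<^sup>2"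
    unfolding low_def integral_mult_right_zero comb_norm(2)[OF J_finite] mass_def
    by (simp add: power2_eq_square[of "\<Sum>j\<in>J K. (cmod (\<alpha> j))\<^sup>2"])
  finally show ?thesis .
qed

lemma low_measurable [measurable]: "low k \<alpha> \<in> borel_measurable borel"
  unfolding low_def by measurable

text \<open>Frequencies up to 2^K are kept together and bounded through their mass, higher ones
  block by block with geometric weights, so that the bound passes to the limit in n.\<close>

lemma low_quartic_bound:
  "(\<integral>\<^sup>+x. ennreal (cmod (low (K + n) \<alpha> x) ^ 4) \<partial>lborel)
    \<le> ennreal (16 * sqrt (2 ^ K) * (mass (J K) \<alpha>)\<^sup>2 + 8 * (\<Sum>r<n. quart (K + r) \<alpha> / wt r ^ 3))"
proof -
  let ?w = "\<lambda>r x. comb (block (K + r)) \<alpha> x"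
  have split: "cmod (y + z) ^ 4 \<le> 8 * cmod y ^ 4 + 8 * cmod z ^ 4" for y z :: complex
  proof -
    have sq: "(p + q)\<^sup>2 \<le> 2 * p\<^sup>2 + 2 * q\<^sup>2" for p q :: real
      using zero_le_power2[of "p - q"] by (simp add: power2_eq_square algebra_simps)
    have "cmod (y + z) ^ 4 \<le> (cmod y + cmod z) ^ 4" by (intro power_mono norm_triangle_ineq) auto
    also have "\<dots> = ((cmod y + cmod z)\<^sup>2)\<^sup>2" by (simp flip: power_mult)
    also have "\<dots> \<le> (2 * (cmod y)\<^sup>2 + 2 * (cmod z)\<^sup>2)\<^sup>2" by (intro power_mono sq) auto
    also have "\<dots> \<le> 2 * (2 * (cmod y)\<^sup>2)\<^sup>2 + 2 * (2 * (cmod z)\<^sup>2)\<^sup>2" by (rule sq)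
    also have "\<dots> = 8 * cmod y ^ 4 + 8 * cmod z ^ 4" by (simp add: power_mult_distrib flip: power_mult)
    finally show ?thesis .
  qed
  have pt: "cmod (low (K + n) \<alpha> x) ^ 4 \<le> 8 * cmod (low K \<alpha> x) ^ 4 + (\<Sum>r<n. 8 / wt r ^ 3 * cmod (?w r x) ^ 4)" for x
  proof -
    have "cmod (low (K + n) \<alpha> x) ^ 4 \<le> 8 * cmod (low K \<alpha> x) ^ 4 + 8 * cmod (\<Sum>r<n. ?w r x) ^ 4"
      unfolding low_telescope by (rule split)
    also have "\<dots> \<le> 8 * cmod (low K \<alpha> x) ^ 4 + 8 * (\<Sum>r<n. cmod (?w r x) ^ 4 / wt r ^ 3)"
      by (intro add_left_mono mult_left_mono quartic_sum_weighted wt_pos wt_sum) auto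
    finally show ?thesis by (simp add: sum_distrib_left)
  qed
  have "(\<integral>\<^sup>+x. ennreal (cmod (low (K + n) \<alpha> x) ^ 4) \<partial>lborel)
    \<le> (\<integral>\<^sup>+x. 8 * ennreal (cmod (low K \<alpha> x) ^ 4) + (\<Sum>r<n. ennreal (8 / wt r ^ 3) * ennreal (cmod (?w r x) ^ 4)) \<partial>lborel)"
  proof (intro nn_integral_mono)
    fix x
    have "ennreal (cmod (low (K + n) \<alpha> x) ^ 4) \<le> ennreal (8 * cmod (low K \<alpha> x) ^ 4 + (\<Sum>r<n. 8 / wt r ^ 3 * cmod (?w r x) ^ 4))"
      by (rule ennreal_leI[OF pt])
    also have "\<dots> = 8 * ennreal (cmod (low K \<alpha> x) ^ 4) + (\<Sum>r<n. ennreal (8 / wt r ^ 3) * ennreal (cmod (?w r x) ^ 4))"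
    proof -
      have "(\<Sum>r<n. ennreal (8 / wt r ^ 3) * ennreal (cmod (?w r x) ^ 4)) = (\<Sum>r<n. ennreal (8 / wt r ^ 3 * cmod (?w r x) ^ 4))"
        by (intro sum.cong refl ennreal_mult''[symmetric]) simp
      also have "\<dots> = ennreal (\<Sum>r<n. 8 / wt r ^ 3 * cmod (?w r x) ^ 4)"
        by (rule sum_ennreal) (use wt_pos in \<open>simp add: less_imp_le\<close>)
      finally show ?thesis
        using wt_pos by (subst ennreal_plus) (auto simp: ennreal_mult' less_imp_le intro!: sum_nonneg)
    qed
    finally show "ennreal (cmod (low (K + n) \<alpha> x) ^ 4) \<le> 8 * ennreal (cmod (low K \<alpha> x) ^ 4) + (\<Sum>r<n. ennreal (8 / wt r ^ 3) * ennreal (cmod (?w r x) ^ 4))" .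
  qed
  also have "\<dots> = 8 * (\<integral>\<^sup>+x. ennreal (cmod (low K \<alpha> x) ^ 4) \<partial>lborel)
     + (\<Sum>r<n. ennreal (8 / wt r ^ 3) * (\<integral>\<^sup>+x. ennreal (cmod (?w r x) ^ 4) \<partial>lborel))"
    by (subst nn_integral_add) (auto simp: nn_integral_cmult nn_integral_sum)
  also have "(\<Sum>r<n. ennreal (8 / wt r ^ 3) * (\<integral>\<^sup>+x. ennreal (cmod (?w r x) ^ 4) \<partial>lborel)) = ennreal (8 * (\<Sum>r<n. quart (K + r) \<alpha> / wt r ^ 3))"
  proof -
    have "ennreal (8 / wt r ^ 3) * (\<integral>\<^sup>+x. ennreal (cmod (?w r x) ^ 4) \<partial>lborel) = ennreal (8 * (quart (K + r) \<alpha> / wt r ^ 3))" for r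
      unfolding quart_def using wt_pos[of r]
      by (subst nn_integral_eq_integral[OF comb_fourth_integrable]) (auto simp: ennreal_mult[symmetric])
    then show ?thesis
      using wt_pos quart_nonneg by (simp add: sum_distrib_left sum_ennreal less_imp_le)
  qed
  also have "8 * (\<integral>\<^sup>+x. ennreal (cmod (low K \<alpha> x) ^ 4) \<partial>lborel) \<le> 8 * ennreal (2 * sqrt (2 ^ K) * (mass (J K) \<alpha>)\<^sup>2)"
    by (intro mult_left_mono low_quartic) auto
  also have "8 * ennreal (2 * sqrt (2 ^ K) * (mass (J K) \<alpha>)\<^sup>2) = ennreal (16 * sqrt (2 ^ K) * (mass (J K) \<alpha>)\<^sup>2)"
    by (simp add: ennreal_mult'[symmetric] flip: ennreal_numeral)
  finally show ?thesis
    using wt_pos quart_nonneg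
    by (subst ennreal_plus) (auto intro!: sum_nonneg simp: less_imp_le)
qed

section \<open>Almost sure regularity of the random series\<close>

definition regular :: "(nat \<Rightarrow> complex) \<Rightarrow> bool" where
  "regular \<alpha> \<longleftrightarrow> summable (\<lambda>k. quart k \<alpha> / wt k ^ 3)"

text \<open>The expected quartic of block k is of order \<rho>^(8 k), and division by the cubed
  weight costs \<rho>^(3 k); the expectations remain summable.\<close>

lemma AE_regular: "AE \<alpha> in \<mu>. regular \<alpha>"
proof -
  let ?c = "1024 * S1 / (1 - \<rho>) ^ 3"
  have le: "(\<integral>\<^sup>+\<alpha>. ennreal (quart k \<alpha> / wt k ^ 3) \<partial>\<mu>) \<le> ennreal (?c * \<rho> ^ k)" for k
  proof -
    have "(\<integral>\<^sup>+\<alpha>. ennreal (quart k \<alpha> / wt k ^ 3) \<partial>\<mu>) = ennreal (1 / wt k ^ 3) * (\<integral>\<^sup>+\<alpha>. ennreal (quart k \<alpha>) \<partial>\<mu>)"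
      using wt_pos[of k] by (subst nn_integral_cmult[symmetric]) (auto simp: ennreal_mult'[symmetric])
    also have "\<dots> \<le> ennreal (1 / wt k ^ 3) * ennreal (1024 * S1 * \<rho> ^ (8 * k))"
      by (intro mult_left_mono quart_moment) auto
    also have "\<dots> = ennreal (1 / wt k ^ 3 * (1024 * S1 * \<rho> ^ (8 * k)))" using wt_pos[of k] by (simp add: ennreal_mult'[symmetric])
    also have "\<dots> \<le> ennreal (?c * \<rho> ^ k)"
    proof (intro ennreal_leI)
      have "1 / wt k ^ 3 * (1024 * S1 * \<rho> ^ (8 * k)) = ?c * \<rho> ^ (5 * k)"
      proof -
        have "wt k ^ 3 = (1 - \<rho>) ^ 3 * \<rho> ^ (3 * k)" by (simp add: wt_def power_mult_distrib mult.commute flip: power_mult)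
        moreover have "\<rho> ^ (8 * k) = \<rho> ^ (5 * k) * \<rho> ^ (3 * k)" by (simp flip: power_add)
        ultimately show ?thesis using rho by simp
      qed
      also have "\<dots> \<le> ?c * \<rho> ^ k" using rho S1_nonneg by (intro mult_left_mono power_decreasing) auto
      finally show "1 / wt k ^ 3 * (1024 * S1 * \<rho> ^ (8 * k)) \<le> ?c * \<rho> ^ k" .
    qed
    finally show ?thesis .
  qed
  have "(\<integral>\<^sup>+\<alpha>. (\<Sum>k. ennreal (quart k \<alpha> / wt k ^ 3)) \<partial>\<mu>) = (\<Sum>k. \<integral>\<^sup>+\<alpha>. ennreal (quart k \<alpha> / wt k ^ 3) \<partial>\<mu>)"
    by (rule nn_integral_suminf) measurable
  also have "\<dots> \<le> (\<Sum>k. ennreal (?c * \<rho> ^ k))" by (intro suminf_le le) auto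
  also have "\<dots> < \<infinity>"
    using rho S1_nonneg by (subst suminf_ennreal2) (auto intro!: summable_mult summable_geometric)
  finally have "AE \<alpha> in \<mu>. (\<Sum>k. ennreal (quart k \<alpha> / wt k ^ 3)) \<noteq> \<infinity>" by (intro nn_integral_PInf_AE) auto
  then show ?thesis
    by eventually_elim (use wt_pos quart_nonneg in \<open>auto simp: regular_def less_imp_le intro!: summable_suminf_not_top\<close>)
qed

lemma low_pairing:
  assumes "test_fun \<phi>"
  shows "(\<integral>x. low k \<alpha> x * of_real (\<phi> x) \<partial>lborel) = (\<Sum>j\<in>J k. \<alpha> j * pairing j \<phi>)"
proof -
  have "(\<integral>x. low k \<alpha> x * of_real (\<phi> x) \<partial>lborel) = (\<integral>x. (\<Sum>j\<in>J k. \<alpha> j * (E j x * of_real (\<phi> x))) \<partial>lborel)"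
    unfolding low_def comb_def by (simp add: sum_distrib_right mult.assoc)
  also have "\<dots> = (\<Sum>j\<in>J k. \<alpha> j * pairing j \<phi>)"
    unfolding pairing_def
    by (subst Bochner_Integration.integral_sum)
       (auto intro!: integrable_mult_right loc_int_test_integrable E_loc_int assms)
  finally show ?thesis .
qed

lemma J_exhaust: "filterlim J (finite_subsets_at_top UNIV) sequentially"
  unfolding filterlim_finite_subsets_at_top
proof (intro allI impI)
  fix X :: "nat set" assume X: "finite X \<and> X \<subseteq> UNIV"
  obtain n :: nat where n: "(\<Sum>j\<in>X. lam j) < 2 ^ n" using real_arch_pow[of 2] by auto
  have sub: "X \<subseteq> J k" if "k \<ge> n" for k
  proof
    fix j assume "j \<in> X"
    then have "lam j \<le> (\<Sum>j\<in>X. lam j)" using X lam_pos by (intro member_le_sum) (auto intro: less_imp_le)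
    also have "\<dots> \<le> 2 ^ n" using n by simp
    also have "\<dots> \<le> 2 ^ k" using that by (intro power_increasing) auto
    finally show "j \<in> J k" by (simp add: J_def)
  qed
  show "\<forall>\<^sub>F k in sequentially. finite (J k) \<and> X \<subseteq> J k \<and> J k \<subseteq> UNIV"
    by (rule eventually_mono[OF eventually_ge_at_top[of n]]) (simp add: sub)
qed

lemma J_sum_tendsto:
  assumes "\<alpha> \<in> Hspace lam \<theta>" and \<phi>: "test_fun \<phi>"
  shows "(\<lambda>k. \<Sum>j\<in>J k. \<alpha> j * pairing j \<phi>) \<longlonglongrightarrow> action \<alpha> \<phi>"
proof -
  obtain T where T: "summable T" "\<And>j. cmod (\<alpha> j * pairing j \<phi>) \<le> T j"
    using action_bound[OF assms(1) bdd_family_translates[OF \<phi>, of 0]] by auto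
  then have "summable (\<lambda>j. cmod (\<alpha> j * pairing j \<phi>))" by (intro summable_comparison_test'[OF T(1), of 0]) auto
  then have "((\<lambda>j. \<alpha> j * pairing j \<phi>) has_sum action \<alpha> \<phi>) UNIV"
    by (rule norm_summable_imp_has_sum[OF _ action_sums[OF assms]])
  then show ?thesis unfolding has_sum_def by (rule filterlim_compose[OF _ J_exhaust])
qed

lemma low_loc_int: "loc_int (low k \<alpha>)"
  unfolding low_def by (intro continuous_loc_int comb_cont)

text \<open>Summable weighted quartics make the blocks absolutely summable in mean on bounded
  intervals, so the partial sums converge locally to a function; absolute convergence of the
  pairings identifies it with the distribution.\<close>

lemma regular_represents:
  assumes \<alpha>: "\<alpha> \<in> Hspace lam \<theta>" and reg: "regular \<alpha>"
  shows "\<exists>f. represents \<alpha> f \<and> locL1 (\<lambda>k. low k \<alpha>) f"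
proof -
  have "locCauchy (\<lambda>k. low k \<alpha>)"
    unfolding locCauchy_def
  proof (intro allI)
    fix R m :: nat
    define a where "a k = 2 * real R * \<rho> ^ k + quart k \<alpha> / wt k ^ 3" for k
    have a0: "0 \<le> a k" for k using rho wt_pos[of k] quart_nonneg[of k \<alpha>] by (simp add: a_def)
    have sa: "summable a" unfolding a_def
      using reg rho unfolding regular_def by (intro summable_add summable_mult summable_geometric) auto
    have blk: "(\<integral>\<^sup>+x. ennreal (cmod (comb (block k) \<alpha> x)) * indicator {-real R..real R} x \<partial>lborel) \<le> ennreal (a k)" for k
    proof -
      let ?w = "comb (block k) \<alpha>"
      \<comment> \<open>Either y is at most the summable term \<rho>^k, or it exceeds
        \<open>wt k\<close>, and then y is dominated by y^4 / \<open>wt k\<close>^3.\<close>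
      have pt: "y \<le> \<rho> ^ k + 1 / wt k ^ 3 * y ^ 4" if "y \<ge> 0" for y
      proof (cases "y \<le> \<rho> ^ k")
        case True
        have "0 \<le> 1 / wt k ^ 3 * y ^ 4" using wt_pos[of k] by simp
        then show ?thesis using True by linarith
      next
        case False
        have "wt k \<le> \<rho> ^ k" using rho unfolding wt_def by (simp add: mult_left_le_one_le)
        then have "wt k \<le> y" using False by simp
        then have "wt k ^ 3 \<le> y ^ 3" using wt_pos[of k] by (intro power_mono) auto
        then have "y * wt k ^ 3 \<le> y * y ^ 3" using that by (rule mult_left_mono)
        then have "y \<le> 1 / wt k ^ 3 * y ^ 4" using wt_pos[of k] by (simp add: field_simps power4_eq_xxxx power3_eq_cube)
        moreover have "0 \<le> \<rho> ^ k" using rho by simp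
        ultimately show ?thesis by linarith
      qed
      have "(\<integral>\<^sup>+x. ennreal (cmod (?w x)) * indicator {-real R..real R} x \<partial>lborel)
        \<le> (\<integral>\<^sup>+x. ennreal (\<rho> ^ k) * indicator {-real R..real R} x + ennreal (1 / wt k ^ 3 * cmod (?w x) ^ 4) \<partial>lborel)"
        using pt rho wt_pos[of k]
        by (intro nn_integral_mono) (auto simp: indicator_def simp flip: ennreal_plus intro!: ennreal_leI)
      also have "\<dots> = ennreal (\<rho> ^ k) * emeasure lborel {-real R..real R} + ennreal (\<integral>x. 1 / wt k ^ 3 * cmod (?w x) ^ 4 \<partial>lborel)"
        using wt_pos[of k]
        by (subst nn_integral_add, simp, simp, subst nn_integral_eq_integral)
           (auto intro!: integrable_mult_right comb_fourth_integrable AE_I2 simp: nn_integral_cmult)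
      also have "\<dots> = ennreal (a k)"
      proof -
        have "emeasure lborel {-real R..real R} = ennreal (2 * real R)" by (subst emeasure_lborel_Icc) auto
        moreover have "(\<integral>x. 1 / wt k ^ 3 * cmod (?w x) ^ 4 \<partial>lborel) = quart k \<alpha> / wt k ^ 3" by (simp add: quart_def)
        ultimately show ?thesis
          using rho wt_pos[of k] quart_nonneg[of k \<alpha>]
          by (simp only: a_def ennreal_mult'[symmetric] ennreal_plus[symmetric] zero_le_power less_imp_le
              mult_nonneg_nonneg divide_nonneg_pos zero_less_power of_nat_0_le_iff zero_le_numeral) (simp add: mult_ac)
      qed
      finally show ?thesis .
    qed
    obtain N where N: "\<And>m' n. m' \<ge> N \<Longrightarrow> norm (sum a {m'..<n}) < 1 / real (Suc m)"
      using summable_Cauchy[of a] sa by (metis of_nat_0_less_iff zero_less_Suc zero_less_divide_1_iff)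
    have main: "(\<integral>\<^sup>+x. ennreal (cmod (low (i + n) \<alpha> x - low i \<alpha> x)) * indicator {-real R..real R} x \<partial>lborel) \<le> ennreal (1 / real (Suc m))"
      if "i \<ge> N" for i n
    proof -
      have "(\<integral>\<^sup>+x. ennreal (cmod (low (i + n) \<alpha> x - low i \<alpha> x)) * indicator {-real R..real R} x \<partial>lborel)
        \<le> (\<integral>\<^sup>+x. (\<Sum>r<n. ennreal (cmod (comb (block (i + r)) \<alpha> x)) * indicator {-real R..real R} x) \<partial>lborel)"
        by (intro nn_integral_mono) (auto simp: low_telescope indicator_def intro!: ennreal_leI norm_sum)
      also have "\<dots> = (\<Sum>r<n. \<integral>\<^sup>+x. ennreal (cmod (comb (block (i + r)) \<alpha> x)) * indicator {-real R..real R} x \<partial>lborel)"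
        by (rule nn_integral_sum) measurable
      also have "\<dots> \<le> (\<Sum>r<n. ennreal (a (i + r)))" by (intro sum_mono blk)
      also have "\<dots> = ennreal (sum a {i..<i + n})"
        using a0 using sum.shift_bounds_nat_ivl[of a 0 i n] by (simp add: sum_ennreal atLeast0LessThan add.commute)
      also have "\<dots> \<le> ennreal (1 / real (Suc m))"
        using N[OF that, of "i + n"] by (intro ennreal_leI) (simp add: abs_le_iff less_imp_le)
      finally show ?thesis .
    qed
    have "(\<integral>\<^sup>+x. ennreal (cmod (low i \<alpha> x - low j \<alpha> x)) * indicator {-real R..real R} x \<partial>lborel) \<le> ennreal (1 / real (Suc m))"
      if "i \<ge> N" "j \<ge> N" for i j
    proof (cases "i \<le> j")
      case True
      then show ?thesis using main[OF that(1), of "j - i"] by (simp add: norm_minus_commute)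
    next
      case False
      then show ?thesis using main[OF that(2), of "i - j"] by simp
    qed
    then show "\<exists>N. \<forall>i\<ge>N. \<forall>j\<ge>N. (\<integral>\<^sup>+x. ennreal (cmod (low i \<alpha> x - low j \<alpha> x)) * indicator {-real R..real R} x \<partial>lborel) \<le> ennreal (1 / real (Suc m))"
      by blast
  qed
  from loc_complete[OF low_loc_int this] obtain f where f: "loc_int f" "locL1 (\<lambda>k. low k \<alpha>) f" by blast
  have "action \<alpha> \<phi> = (\<integral>x. f x * of_real (\<phi> x) \<partial>lborel)" if \<phi>: "test_fun \<phi>" for \<phi>
    by (rule LIMSEQ_unique[OF J_sum_tendsto[OF \<alpha> \<phi>]])
       (use locL1_pairing[OF f(2) low_loc_int f(1) \<phi>] in \<open>simp add: low_pairing[OF \<phi>]\<close>)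
  then show ?thesis using f unfolding represents_def by blast
qed

lemma int_pow_4_le:
  assumes \<alpha>: "\<alpha> \<in> Hspace lam \<theta>" and reg: "regular \<alpha>"
    and B: "\<And>n. 16 * sqrt (2 ^ K) * (mass (J K) \<alpha>)\<^sup>2 + 8 * (\<Sum>r<n. quart (K + r) \<alpha> / wt r ^ 3) \<le> B"
  shows "int_pow e 4 \<alpha> \<le> ennreal B"
proof -
  obtain f where f: "represents \<alpha> f" "locL1 (\<lambda>k. low k \<alpha>) f" using regular_represents[OF \<alpha> reg] by blast
  have "int_pow e 4 \<alpha> = (\<integral>\<^sup>+x. ennreal (cmod (f x) ^ 4) \<partial>lborel)"
    using int_pow_represents[OF \<alpha> e_measurable e_AE f(1), of 2] by simp
  also have "\<dots> \<le> ennreal B"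
  proof (rule locL1_Fatou[OF f(2) low_loc_int])
    show "loc_int f" using f(1) unfolding represents_def by blast
    show "\<forall>\<^sub>F k in sequentially. (\<integral>\<^sup>+x. ennreal (cmod (low k \<alpha> x) ^ 4) \<partial>lborel) \<le> ennreal B"
      using eventually_ge_at_top[of K]
    proof eventually_elim
      case (elim k)
      have "(\<integral>\<^sup>+x. ennreal (cmod (low (K + (k - K)) \<alpha> x) ^ 4) \<partial>lborel) \<le> ennreal B"
        by (rule order_trans[OF low_quartic_bound ennreal_leI[OF B]])
      then show ?case using elim by simp
    qed
  qed
  finally show ?thesis .
qed

lemma int_pow_4_finite:
  assumes \<alpha>: "\<alpha> \<in> Hspace lam \<theta>" and reg: "regular \<alpha>" shows "int_pow e 4 \<alpha> < \<infinity>"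
proof -
  have "int_pow e 4 \<alpha> \<le> ennreal (16 * sqrt (2 ^ 0) * (mass (J 0) \<alpha>)\<^sup>2 + 8 * (\<Sum>k. quart k \<alpha> / wt k ^ 3))"
  proof (rule int_pow_4_le[OF \<alpha> reg])
    fix n
    have "(\<Sum>r<n. quart r \<alpha> / wt r ^ 3) \<le> (\<Sum>k. quart k \<alpha> / wt k ^ 3)"
      using reg wt_pos quart_nonneg unfolding regular_def by (intro sum_le_suminf) (auto simp: less_imp_le)
    then show "16 * sqrt (2 ^ 0) * (mass (J 0) \<alpha>)\<^sup>2 + 8 * (\<Sum>r<n. quart (0 + r) \<alpha> / wt r ^ 3)
       \<le> 16 * sqrt (2 ^ 0) * (mass (J 0) \<alpha>)\<^sup>2 + 8 * (\<Sum>k. quart k \<alpha> / wt k ^ 3)" by simp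
  qed
  then show ?thesis by (simp add: le_less_trans)
qed

lemma AE_int_pow_4_finite: "AE \<alpha> in \<mu>. int_pow e 4 \<alpha> < \<infinity>"
  using AE_regular AE_space[of \<mu>] by eventually_elim (use int_pow_4_finite space_\<mu> in auto)

lemma int_pow_measurable' [measurable]: "int_pow e 4 \<in> borel_measurable \<mu>" "int_pow e 2 \<in> borel_measurable \<mu>"
  using int_pow_measurable[OF space_\<mu> sets_\<mu> e_measurable e_AE, of 2]
    int_pow_measurable[OF space_\<mu> sets_\<mu> e_measurable e_AE, of 1] by simp_all

section \<open>Levels of the quartic functional\<close>

definition level :: "real \<Rightarrow> nat \<Rightarrow> real" where
  "level H K = 32 * H\<^sup>2 * 2 powr (real K * (1/2 + 2 * b))"

lemma level_ge: "H \<ge> 1 \<Longrightarrow> 2 powr (real K / 2) \<le> level H K"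
proof -
  assume H: "H \<ge> 1"
  have "real K / 2 \<le> real K * (1/2 + 2 * b)" using b by (simp add: algebra_simps)
  then have "2 powr (real K / 2) \<le> 2 powr (real K * (1/2 + 2 * b))" by (intro powr_mono) auto
  also have "\<dots> \<le> level H K"
  proof -
    have "1 \<le> 32 * H\<^sup>2" using one_le_power[OF H, of 2] by linarith
    from mult_right_mono[OF this, of "2 powr (real K * (1/2 + 2 * b))"] show ?thesis by (simp add: level_def)
  qed
  finally show ?thesis .
qed

text \<open>Between two consecutive levels the weight is then at most exp (2 t), where t is the
  lower one; this is beaten by the tail exp (- 4 t).\<close>

lemma level_Suc: "level H (Suc K) \<le> 4 * level H K"
proof -
  have "2 powr (real (Suc K) * (1/2 + 2 * b)) = 2 powr (1/2 + 2 * b) * 2 powr (real K * (1/2 + 2 * b))"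
    by (simp add: powr_add[symmetric] add_divide_distrib algebra_simps)
  also have "\<dots> \<le> 2 powr 2 * 2 powr (real K * (1/2 + 2 * b))"
    using b by (intro mult_right_mono powr_mono) auto
  finally have "2 powr (real (Suc K) * (1/2 + 2 * b)) \<le> 4 * 2 powr (real K * (1/2 + 2 * b))" by simp
  then show ?thesis unfolding level_def using mult_left_mono[of _ _ "32 * H\<^sup>2"] by fastforce
qed

text \<open>Half of the level pays for the low modes, whose bound is 16 H^2 2^(K (1/2 + 2 b)). The
  other half pays for the blocks: thresholds proportional to \<open>wt r ^ 4\<close> become
  \<open>wt r\<close> after division by the cubed weight and sum to at most 1/16 of the level, times
  8.\<close>

lemma int_pow_4_le_level:
  assumes \<alpha>: "\<alpha> \<in> Hspace lam \<theta>" and reg: "regular \<alpha>" and H: "H \<ge> 0"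
    and M: "mass (J K) \<alpha> \<le> H * 2 powr (real K * b)"
    and D: "\<And>r. quart (K + r) \<alpha> \<le> wt r ^ 4 * (level H K / 16)"
  shows "int_pow e 4 \<alpha> \<le> ennreal (level H K)"
proof (rule int_pow_4_le[OF \<alpha> reg])
  fix n
  let ?T = "level H K / 16"
  have T0: "0 \<le> ?T" by (simp add: level_def)
  have "(mass (J K) \<alpha>)\<^sup>2 \<le> (H * 2 powr (real K * b))\<^sup>2"
    by (intro power_mono M) (simp add: mass_def sum_nonneg)
  then have "16 * sqrt (2 ^ K) * (mass (J K) \<alpha>)\<^sup>2 \<le> 16 * sqrt (2 ^ K) * (H * 2 powr (real K * b))\<^sup>2"
    by (intro mult_left_mono) auto
  also have "\<dots> = 16 * H\<^sup>2 * (sqrt (2 ^ K) * (2 powr (real K * b))\<^sup>2)" by (simp add: power_mult_distrib)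
  also have "sqrt (2 ^ K) * (2 powr (real K * b))\<^sup>2 = 2 powr (real K * (1/2 + 2 * b))"
    unfolding powr_half_sqrt[OF zero_le_power[OF zero_le_numeral], symmetric] two_pow_powr
    by (simp add: powr_power powr_add[symmetric] algebra_simps)
  finally have 1: "16 * sqrt (2 ^ K) * (mass (J K) \<alpha>)\<^sup>2 \<le> level H K / 2" by (simp add: level_def)
  have "(\<Sum>r<n. quart (K + r) \<alpha> / wt r ^ 3) \<le> (\<Sum>r<n. wt r * ?T)"
  proof (rule sum_mono)
    fix r
    have "quart (K + r) \<alpha> / wt r ^ 3 \<le> wt r ^ 4 * ?T / wt r ^ 3"
      using wt_pos[of r] by (intro divide_right_mono D) auto
    also have "\<dots> = wt r * ?T" using wt_pos[of r] by (simp add: power4_eq_xxxx power3_eq_cube)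
    finally show "quart (K + r) \<alpha> / wt r ^ 3 \<le> wt r * ?T" .
  qed
  also have "\<dots> \<le> 1 * ?T" unfolding sum_distrib_right[symmetric] using T0 wt_sum by (intro mult_right_mono) auto
  finally show "16 * sqrt (2 ^ K) * (mass (J K) \<alpha>)\<^sup>2 + 8 * (\<Sum>r<n. quart (K + r) \<alpha> / wt r ^ 3) \<le> level H K"
    using 1 by simp
qed

lemma powr_eventually_ge: "c > 0 \<Longrightarrow> \<forall>\<^sub>F K in sequentially. C \<le> 2 powr (real K * c)"
proof -
  assume c: "c > 0"
  have "filterlim (\<lambda>K. (2 powr c) ^ K) at_infinity sequentially"
    by (rule filterlim_realpow_sequentially_gt1) (use c in \<open>simp add: gr_one_powr\<close>)
  then have "filterlim (\<lambda>K. (2 powr c) ^ K) at_top sequentially"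
    by (rule filterlim_at_infinity_imp_filterlim_at_top) simp
  then have "filterlim (\<lambda>K. 2 powr (real K * c)) at_top sequentially"
    by (simp add: powr_power mult.commute)
  then show ?thesis by (simp add: filterlim_at_top)
qed

text \<open>Above the level \<open>level H K\<close> the low frequencies \<open>\<lambda> \<le> 2\<^sup>K\<close> are controlled by the mass, so a large
  quartic functional forces a rare event in some block \<open>K + r\<close>.\<close>

lemma level_tail:
  assumes H: "H \<ge> 1" "H \<ge> 8 * S1 + 2" and A: "A \<in> sets \<mu>"
    and M: "\<forall>\<^sub>F K in sequentially. emeasure \<mu> {\<alpha>\<in>A. H * 2 powr (real K * b) < mass (J K) \<alpha>} \<le> ennreal (exp (- (4 * level H K)))"
  shows "\<exists>C\<ge>0. \<forall>\<^sub>F K in sequentially. emeasure \<mu> {\<alpha>\<in>A. ennreal (level H K) < int_pow e 4 \<alpha>} \<le> ennreal (C * exp (- (4 * level H K)))"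
proof -
  \<comment> \<open>This is \<kappa> \<rho>^(4 r) for the rate \<kappa> = 64 /
    \<open>wt r ^ 4\<close> used below, and it does not depend on r.\<close>
  define c where "c = 64 / (1 - \<rho>) ^ 4"
  have c0: "c > 0" using rho by (simp add: c_def)
  define C1 where "C1 = 2 * c * (1024 * S1)"
  have C10: "0 \<le> C1" using c0 S1_nonneg by (simp add: C1_def)
  \<comment> \<open>One summand for each kind of rare event: low mass, block quartics and block
    masses, the latter two after a geometric sum over r.\<close>
  define C where "C = 1 + C1 / (1 - \<rho>) + 1 / (1 - exp (- 1))"
  have C0: "0 \<le> C" unfolding C_def using C10 rho by (intro add_nonneg_nonneg divide_nonneg_pos) auto
  \<comment> \<open>Both conditions exploit the gap 1/2 - b: the first makes the rate \<kappa>
    admissible in every block K + r, the second puts 4 \<open>level H K\<close> below 2^(K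
    (1+b)).\<close>
  have ev1: "\<forall>\<^sub>F K in sequentially. c * H * 16 \<le> 2 powr (real K * (1/2 - b))" by (rule powr_eventually_ge) (use b in auto)
  have ev2: "\<forall>\<^sub>F K in sequentially. 128 * H\<^sup>2 \<le> 2 powr (real K * (1/2 - b))" by (rule powr_eventually_ge) (use b in auto)
  have "\<forall>\<^sub>F K in sequentially. emeasure \<mu> {\<alpha>\<in>A. ennreal (level H K) < int_pow e 4 \<alpha>} \<le> ennreal (C * exp (- (4 * level H K)))"
    using ev1 ev2 M
  proof eventually_elim
    case (elim K)
    define y where "y = 4 * level H K"
    have y1: "1 \<le> y" using level_ge[OF H(1), of K] ge_one_powr_ge_zero[of 2 "real K / 2"] by (simp add: y_def)
    \<comment> \<open>\<open>BM\<close>: the low modes have too much mass. \<open>BQ r\<close>: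
      block K + r has too much mass. \<open>BD r\<close>: its mass is moderate but its quartic
      exceeds the share allotted to it.\<close>
    define BM where "BM = {\<alpha>\<in>A. H * 2 powr (real K * b) < mass (J K) \<alpha>}"
    define BQ where "BQ r = {\<alpha>\<in>space \<mu>. H * 2 powr (real (K + r) * b) < mass (block (K + r)) \<alpha>}" for r
    define BD where "BD r = {\<alpha>\<in>space \<mu>. wt r ^ 4 * (level H K / 16) < quart (K + r) \<alpha> \<and> mass (block (K + r)) \<alpha> \<le> H * 2 powr (real (K + r) * b)}" for r
    have [measurable]: "BM \<in> sets \<mu>" "BQ r \<in> sets \<mu>" "BD r \<in> sets \<mu>" for r
      unfolding BM_def BQ_def BD_def using A by measurable
    have incl: "AE \<alpha> in \<mu>. \<alpha> \<in> {\<alpha>\<in>A. ennreal (level H K) < int_pow e 4 \<alpha>} \<longrightarrow> \<alpha> \<in> BM \<union> ((\<Union>r. BD r) \<union> (\<Union>r. BQ r))"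
      using AE_regular AE_space
    proof eventually_elim
      case (elim \<alpha>)
      show ?case
      proof (rule impI, rule ccontr)
        assume 1: "\<alpha> \<in> {\<alpha>\<in>A. ennreal (level H K) < int_pow e 4 \<alpha>}" and "\<not> \<alpha> \<in> BM \<union> ((\<Union>r. BD r) \<union> (\<Union>r. BQ r))"
        then have n: "\<alpha> \<notin> BM" "\<And>r. \<alpha> \<notin> BD r" "\<And>r. \<alpha> \<notin> BQ r" by auto
        have "int_pow e 4 \<alpha> \<le> ennreal (level H K)"
        proof (rule int_pow_4_le_level)
          show "\<alpha> \<in> Hspace lam \<theta>" using elim space_\<mu> by simp
          show "mass (J K) \<alpha> \<le> H * 2 powr (real K * b)" using n(1) 1 by (auto simp: BM_def not_less)
          show "quart (K + r) \<alpha> \<le> wt r ^ 4 * (level H K / 16)" for r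
            using n(2)[of r] n(3)[of r] elim(2) by (auto simp: BD_def BQ_def not_less)
        qed (use elim H in auto)
        then show False using 1 by (auto simp: not_less[symmetric])
      qed
    qed
    have bM: "emeasure \<mu> BM \<le> ennreal (exp (- y))" using elim(3) by (simp add: BM_def y_def)
    have bQ: "emeasure \<mu> (BQ r) \<le> ennreal (exp (- y) * exp (- 1) ^ r)" for r
    proof -
      define X where "X = 2 powr (real K * (1 + b))"
      have "y \<le> X"
      proof -
        have "y = 128 * H\<^sup>2 * 2 powr (real K * (1/2 + 2 * b))" by (simp add: y_def level_def)
        also have "\<dots> \<le> 2 powr (real K * (1/2 - b)) * 2 powr (real K * (1/2 + 2 * b))"
          using elim(2) by (intro mult_right_mono) auto
        also have "\<dots> = X" unfolding X_def powr_add[symmetric] by (simp add: algebra_simps)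
        finally show ?thesis .
      qed
      have X1: "X \<ge> 1" unfolding X_def using b by (intro ge_one_powr_ge_zero) auto
      \<comment> \<open>Growth of the exponent with r leaves room for an extra - r beside - y, which
        makes the mass events summable over r.\<close>
      have "real r + 1 \<le> 2 powr (real r * (1 + b))"
      proof -
        have "r + 1 \<le> 2 ^ r" using less_exp[of r] by linarith
        then have "real (r + 1) \<le> real (2 ^ r)" by (simp only: of_nat_le_iff)
        then have "real r + 1 \<le> 2 ^ r" by simp
        also have "\<dots> = 2 powr (real r)" by (simp add: powr_realpow)
        also have "\<dots> \<le> 2 powr (real r * (1 + b))" using b by (intro powr_mono) (auto simp: algebra_simps)
        finally show ?thesis .
      qed
      then have "X * (real r + 1) \<le> X * 2 powr (real r * (1 + b))" using X1 by (intro mult_left_mono) auto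
      also have "\<dots> = 2 powr (real (K + r) * (1 + b))" unfolding X_def powr_add[symmetric] by (simp add: algebra_simps)
      finally have "X * (real r + 1) \<le> 2 powr (real (K + r) * (1 + b))" .
      moreover have "X + real r \<le> X * (real r + 1)" using X1 mult_right_mono[of 1 X "real r"] by (simp add: algebra_simps)
      ultimately have "y + real r \<le> 2 powr (real (K + r) * (1 + b))" using \<open>y \<le> X\<close> by linarith
      then have "exp (- (2 powr (real (K + r) * (1 + b)))) \<le> exp (- y) * exp (- real r)" by (simp flip: exp_add)
      also have "exp (- real r) = exp (- 1) ^ r" by (simp flip: exp_of_nat_mult)
      finally show ?thesis
        using mass_tail[OF H(2), of "K + r"] unfolding BQ_def by (meson ennreal_leI order_trans)
    qed
    have bD: "emeasure \<mu> (BD r) \<le> ennreal (exp (- y) * C1 * \<rho> ^ r)" for r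
    proof -
      \<comment> \<open>Chosen so that \<kappa> times the quartic threshold of block K + r equals y
        = 4 \<open>level H K\<close> for every r.\<close>
      define \<kappa> where "\<kappa> = 64 / wt r ^ 4"
      have k0: "0 \<le> \<kappa>" using wt_pos[of r] by (simp add: \<kappa>_def)
      have kT: "\<kappa> * (wt r ^ 4 * (level H K / 16)) = y" using wt_pos[of r] by (simp add: \<kappa>_def y_def)
      have kr: "\<kappa> * \<rho> ^ (4 * r) = c"
      proof -
        have "wt r ^ 4 = (1 - \<rho>) ^ 4 * \<rho> ^ (4 * r)" by (simp add: wt_def power_mult_distrib mult.commute flip: power_mult)
        then show ?thesis using rho by (simp add: \<kappa>_def c_def)
      qed
      have sq: "2 powr (real k * b) / sqrt (2 ^ k) = \<rho> ^ (8 * k)" for k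
        unfolding rho_pow powr_half_sqrt[OF zero_le_power[OF zero_le_numeral], symmetric] two_pow_powr
        by (simp add: powr_diff[symmetric] algebra_simps)
      have r4: "\<rho> ^ (8 * (K + r)) = \<rho> ^ (4 * r) * (\<rho> ^ (4 * r) * \<rho> ^ (8 * K))"
        by (simp add: power_add[symmetric] algebra_simps)
      have "\<kappa> * (H * 2 powr (real (K + r) * b)) * (16 / sqrt (2 ^ (K + r))) = 16 * H * (\<kappa> * (2 powr (real (K + r) * b) / sqrt (2 ^ (K + r))))"
        by simp
      also have "\<dots> = 16 * H * (c * (\<rho> ^ (4 * r) * \<rho> ^ (8 * K)))" unfolding sq r4 kr[symmetric] by simp
      also have "\<dots> \<le> 16 * H * (c * (1 * \<rho> ^ (8 * K)))"
        using H c0 rho by (intro mult_left_mono mult_right_mono) (auto intro: power_le_one)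
      also have "\<dots> = (c * H * 16) * 2 powr (- (real K * (1/2 - b)))" by (simp add: rho_pow)
      also have "\<dots> \<le> 2 powr (real K * (1/2 - b)) * 2 powr (- (real K * (1/2 - b)))" using elim(1) by (intro mult_right_mono) auto
      also have "\<dots> = 1" by (simp flip: powr_add)
      finally have cond: "\<kappa> * (H * 2 powr (real (K + r) * b)) * (16 / sqrt (2 ^ (K + r))) \<le> 1" .
      have "emeasure \<mu> (BD r) \<le> ennreal (2 * exp (- (\<kappa> * (wt r ^ 4 * (level H K / 16)))) * (\<kappa> * (1024 * S1 * \<rho> ^ (8 * (K + r)))))"
        unfolding BD_def by (rule quart_tail[OF k0 _ cond]) (use H y1 kT in auto)
      also have "\<dots> \<le> ennreal (exp (- y) * C1 * \<rho> ^ r)"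
      proof (intro ennreal_leI)
        have "2 * exp (- y) * (\<kappa> * (1024 * S1 * \<rho> ^ (8 * (K + r)))) = exp (- y) * C1 * (\<rho> ^ (4 * r) * \<rho> ^ (8 * K))"
          unfolding r4 C1_def kr[symmetric] by simp
        also have "\<dots> \<le> exp (- y) * C1 * (\<rho> ^ r * 1)"
          using C10 rho by (intro mult_left_mono mult_mono power_decreasing) (auto intro: power_le_one)
        finally show "2 * exp (- (\<kappa> * (wt r ^ 4 * (level H K / 16)))) * (\<kappa> * (1024 * S1 * \<rho> ^ (8 * (K + r)))) \<le> exp (- y) * C1 * \<rho> ^ r"
          unfolding kT by simp
      qed
      finally show ?thesis .
    qed
    have uD: "emeasure \<mu> (\<Union>r. BD r) \<le> ennreal (exp (- y) * C1 * (1 / (1 - \<rho>)))"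
    proof -
      have "emeasure \<mu> (\<Union>r. BD r) \<le> (\<Sum>r. emeasure \<mu> (BD r))" by (rule emeasure_subadditive_countably) auto
      also have "\<dots> \<le> (\<Sum>r. ennreal (exp (- y) * C1 * \<rho> ^ r))" by (intro suminf_le bD) auto
      also have "\<dots> = ennreal (exp (- y) * C1 * (1 / (1 - \<rho>)))"
        using rho C10 by (intro suminf_ennreal_eq sums_mult geometric_sums) auto
      finally show ?thesis .
    qed
    have uQ: "emeasure \<mu> (\<Union>r. BQ r) \<le> ennreal (exp (- y) * (1 / (1 - exp (- 1))))"
    proof -
      have "emeasure \<mu> (\<Union>r. BQ r) \<le> (\<Sum>r. emeasure \<mu> (BQ r))" by (rule emeasure_subadditive_countably) auto
      also have "\<dots> \<le> (\<Sum>r. ennreal (exp (- y) * exp (- 1) ^ r))" by (intro suminf_le bQ) auto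
      also have "\<dots> = ennreal (exp (- y) * (1 / (1 - exp (- 1))))"
        by (intro suminf_ennreal_eq sums_mult geometric_sums) auto
      finally show ?thesis .
    qed
    have "emeasure \<mu> {\<alpha>\<in>A. ennreal (level H K) < int_pow e 4 \<alpha>} \<le> emeasure \<mu> (BM \<union> ((\<Union>r. BD r) \<union> (\<Union>r. BQ r)))"
      using incl by (intro emeasure_mono_AE) auto
    also have "\<dots> \<le> emeasure \<mu> BM + emeasure \<mu> ((\<Union>r. BD r) \<union> (\<Union>r. BQ r))" by (rule emeasure_subadditive) auto
    also have "\<dots> \<le> emeasure \<mu> BM + (emeasure \<mu> (\<Union>r. BD r) + emeasure \<mu> (\<Union>r. BQ r))"
      by (intro add_left_mono emeasure_subadditive) auto
    also have "\<dots> \<le> ennreal (exp (- y)) + (ennreal (exp (- y) * C1 * (1 / (1 - \<rho>))) + ennreal (exp (- y) * (1 / (1 - exp (- 1)))))"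
      by (intro add_mono bM uD uQ)
    also have "\<dots> = ennreal (C * exp (- y))"
      using C10 rho by (simp add: C_def algebra_simps flip: ennreal_plus)
    finally show ?case by (simp add: y_def)
  qed
  then show ?thesis using C0 by blast
qed

lemma exp_ereal_half: "exp_ereal (ereal (1/2) * enn2ereal X) = (if X = \<infinity> then \<infinity> else ennreal (exp (enn2real X / 2)))"
  by (cases X) (auto simp: exp_ereal_def enn2ereal_ennreal)

lemma exp_ereal_minus_half: "exp_ereal (- (ereal (1/2) * enn2ereal X)) = (if X = \<infinity> then 0 else ennreal (exp (- enn2real X / 2)))"
  by (cases X) (auto simp: exp_ereal_def enn2ereal_ennreal)

lemma focusing_measurable [measurable]:
  assumes "A \<in> sets \<mu>" shows "focusing_weight e A \<in> borel_measurable \<mu>"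
proof -
  have "(\<lambda>x::ennreal. if x = \<infinity> then \<infinity> else ennreal (exp (enn2real x / 2))) \<in> borel_measurable borel"
    by (rule measurable_If) auto
  from measurable_compose[OF int_pow_measurable'(1) this] show ?thesis
    unfolding focusing_weight_def[abs_def] exp_ereal_half
    by (rule borel_measurable_times_ennreal[OF _ borel_measurable_indicator[OF assms]])
qed

lemma defocusing_measurable [measurable]: "defocusing_weight e \<in> borel_measurable \<mu>"
proof -
  have "(\<lambda>x::ennreal. if x = \<infinity> then 0 else ennreal (exp (- enn2real x / 2))) \<in> borel_measurable borel"
    by (rule measurable_If) auto
  from measurable_compose[OF int_pow_measurable'(1) this] show ?thesis
    unfolding defocusing_weight_def[abs_def] exp_ereal_minus_half .
qed

text \<open>A layer decomposition: between consecutive levels the weight is bounded by its value at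
  the upper one and the probability by the tail at the lower one. Almost sure finiteness of the
  quartic ensures that the layers cover almost everything.\<close>

lemma focusing_integrable:
  assumes H: "H \<ge> 1" "H \<ge> 8 * S1 + 2" and A: "A \<in> sets \<mu>"
    and M: "\<forall>\<^sub>F K in sequentially. emeasure \<mu> {\<alpha>\<in>A. H * 2 powr (real K * b) < mass (J K) \<alpha>} \<le> ennreal (exp (- (4 * level H K)))"
  shows "(\<integral>\<^sup>+\<alpha>. focusing_weight e A \<alpha> \<partial>\<mu>) < \<infinity>"
proof -
  let ?t = "level H" and ?X = "int_pow e 4"
  obtain C N where C: "C \<ge> 0" "\<And>K. K \<ge> N \<Longrightarrow> emeasure \<mu> {\<alpha>\<in>A. ennreal (?t K) < ?X \<alpha>} \<le> ennreal (C * exp (- (4 * ?t K)))"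
    using level_tail[OF assms] unfolding eventually_sequentially by blast
  note [measurable] = A
  have t0: "0 < ?t K" for K using level_ge[OF H(1), of K] by (smt (verit) powr_gt_zero)
  define S where "S K = {\<alpha>\<in>A. ennreal (?t (N + K)) < ?X \<alpha>}" for K
  have Ssp: "S K = {\<alpha>\<in>space \<mu>. \<alpha> \<in> A \<and> ennreal (?t (N + K)) < ?X \<alpha>}" for K
    using sets.sets_into_space[OF A] by (auto simp: S_def)
  have [measurable]: "S K \<in> sets \<mu>" for K unfolding Ssp by measurable
  have pt: "AE \<alpha> in \<mu>. focusing_weight e A \<alpha> \<le> ennreal (exp (?t N / 2)) + (\<Sum>K. ennreal (exp (?t (N + Suc K) / 2)) * indicator (S K) \<alpha>)"
    using AE_int_pow_4_finite
  proof eventually_elim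
    case (elim \<alpha>)
    then obtain x where x: "?X \<alpha> = ennreal x" "0 \<le> x" by (cases "?X \<alpha>") auto
    show ?case
    proof (cases "\<alpha> \<in> A")
      case True
      have W: "focusing_weight e A \<alpha> = ennreal (exp (x / 2))"
        unfolding focusing_weight_def exp_ereal_half using True x by simp
      show ?thesis
      proof (cases "x \<le> ?t N")
        case True
        then have "focusing_weight e A \<alpha> \<le> ennreal (exp (?t N / 2))" unfolding W by (intro ennreal_leI) auto
        then show ?thesis by (rule order_trans) simp
      next
        case False
        have "\<exists>K. x \<le> ?t (N + K)"
        proof -
          have "\<forall>\<^sub>F K in sequentially. x \<le> 2 powr (real K * (1/2))" by (rule powr_eventually_ge) simp
          then obtain K where "K \<ge> N" "x \<le> 2 powr (real K * (1/2))"
            unfolding eventually_sequentially by (metis le_cases)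
          then have "x \<le> ?t (N + (K - N))" using level_ge[OF H(1), of K] by simp
          then show ?thesis ..
        qed
        \<comment> \<open>The first level that reaches x. It is positive, so its predecessor is
          exceeded and places \<alpha> in the layer \<open>S K'\<close>.\<close>
        define K where "K = (LEAST K. x \<le> ?t (N + K))"
        have K: "x \<le> ?t (N + K)" unfolding K_def by (rule LeastI_ex) fact
        have "K \<noteq> 0" using K False by (cases K) auto
        then obtain K' where K': "K = Suc K'" by (cases K) auto
        have "\<not> x \<le> ?t (N + K')" using not_less_Least[of K' "\<lambda>K. x \<le> ?t (N + K)"] K' unfolding K_def by auto
        then have "\<alpha> \<in> S K'" using True x t0[of "N + K'"] by (auto simp: S_def ennreal_less_iff less_imp_le)
        then have "focusing_weight e A \<alpha> \<le> ennreal (exp (?t (N + Suc K') / 2)) * indicator (S K') \<alpha>"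
          unfolding W using K K' by (auto intro!: ennreal_leI)
        also have "\<dots> \<le> (\<Sum>K. ennreal (exp (?t (N + Suc K) / 2)) * indicator (S K) \<alpha>)"
        proof -
          have "g K' \<le> suminf g" for g :: "nat \<Rightarrow> ennreal" using sum_le_suminf[of g "{K'}"] by simp
          then show ?thesis .
        qed
        finally show ?thesis by (rule order_trans) simp
      qed
    qed (simp add: focusing_weight_def)
  qed
  have "(\<integral>\<^sup>+\<alpha>. focusing_weight e A \<alpha> \<partial>\<mu>)
    \<le> (\<integral>\<^sup>+\<alpha>. ennreal (exp (?t N / 2)) + (\<Sum>K. ennreal (exp (?t (N + Suc K) / 2)) * indicator (S K) \<alpha>) \<partial>\<mu>)"
    by (rule nn_integral_mono_AE[OF pt])
  also have "\<dots> = ennreal (exp (?t N / 2)) + (\<Sum>K. ennreal (exp (?t (N + Suc K) / 2)) * emeasure \<mu> (S K))"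
    by (subst nn_integral_add, simp, measurable, subst nn_integral_suminf, measurable)
       (simp add: nn_integral_cmult emeasure_space_1)
  also have "\<dots> \<le> ennreal (exp (?t N / 2)) + (\<Sum>K. ennreal (C * (2 powr (- 1/2)) ^ K))"
  proof (intro add_left_mono suminf_le)
    fix K
    let ?u = "?t (N + K)"
    \<comment> \<open>Passing to the next level costs at most exp (2 u), leaving exp (- 2 u) of the
      tail, and u is at least 2^(K/2).\<close>
    have "ennreal (exp (?t (N + Suc K) / 2)) * emeasure \<mu> (S K) \<le> ennreal (exp (2 * ?u)) * ennreal (C * exp (- (4 * ?u)))"
      using level_Suc[of H "N + K"] C(2)[of "N + K"] unfolding S_def
      by (intro mult_mono ennreal_leI) auto
    also have "\<dots> = ennreal (C * exp (- (2 * ?u)))"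
      using C(1) by (simp add: ennreal_mult'[symmetric] exp_add[symmetric] mult_ac flip: mult.assoc[of "exp _"])
    also have "\<dots> \<le> ennreal (C * (2 powr (- 1/2)) ^ K)"
    proof (intro ennreal_leI mult_left_mono C)
      have "2 powr (real K / 2) \<le> exp (2 * ?u)"
      proof -
        have "2 powr (real K / 2) \<le> 2 powr (real (N + K) / 2)" by (intro powr_mono) auto
        also have "\<dots> \<le> ?u" by (rule level_ge[OF H(1)])
        also have "\<dots> \<le> exp (2 * ?u)" using exp_ge_add_one_self[of "2 * ?u"] t0[of "N + K"] by linarith
        finally show ?thesis .
      qed
      then have "exp (- (2 * ?u)) \<le> 1 / 2 powr (real K / 2)" by (simp add: exp_minus divide_simps)
      also have "\<dots> = 2 powr (real K * (- 1/2))" by (simp add: powr_minus_divide)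
      also have "\<dots> = (2 powr (- 1/2)) ^ K" by (rule powr_power[symmetric]) simp
      finally show "exp (- (2 * ?u)) \<le> (2 powr (- 1/2)) ^ K" .
    qed
    finally show "ennreal (exp (?t (N + Suc K) / 2)) * emeasure \<mu> (S K) \<le> ennreal (C * (2 powr (- 1/2)) ^ K)" .
  qed auto
  also have "\<dots> < \<infinity>"
  proof -
    have "(2::real) powr (- 1/2) < 1" by (intro powr_less_one) auto
    then show ?thesis
      using C(1) by (subst suminf_ennreal2) (auto intro!: summable_mult summable_geometric)
  qed
  finally show ?thesis .
qed

end

section \<open>The renormalised mass\<close>

lemma gibbs_well_definedI:
  assumes [measurable]: "F \<in> borel_measurable M" and pos: "0 < (\<integral>\<^sup>+x. F x \<partial>M)" and fin: "(\<integral>\<^sup>+x. F x \<partial>M) < \<infinity>"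
  shows "in_L1_ennreal M F \<and> gibbs_well_defined M F"
proof -
  let ?Z = "\<integral>\<^sup>+x. F x \<partial>M"
  have "prob_space (density M (\<lambda>x. F x / ?Z))"
  proof (rule prob_spaceI)
    have "emeasure (density M (\<lambda>x. F x / ?Z)) (space M) = (\<integral>\<^sup>+x. F x / ?Z * indicator (space M) x \<partial>M)"
      by (rule emeasure_density) auto
    also have "\<dots> = (\<integral>\<^sup>+x. F x / ?Z \<partial>M)" by (rule nn_integral_cong) simp
    also have "\<dots> = ?Z / ?Z" by (rule nn_integral_divide) measurable
    also have "\<dots> = 1" using pos fin by (intro ennreal_divide_self) auto
    finally show "emeasure (density M (\<lambda>x. F x / ?Z)) (space (density M (\<lambda>x. F x / ?Z))) = 1" by simp
  qed
  then show ?thesis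
    using pos fin unfolding in_L1_ennreal_def gibbs_well_defined_def partition_const_def gibbs_def by simp
qed

context gibbs_setting
begin

lemma truncated_renorm: "truncated_mass lam \<mu> \<Lambda> = renorm {j. lam j \<le> \<Lambda>}"
  by (intro ext) (simp add: truncated_mass_def renorm_def mean_square)

lemma renorm_mass: "finite F \<Longrightarrow> renorm F \<alpha> = mass F \<alpha> - (\<Sum>j\<in>F. 1 / lam j)"
  by (simp add: renorm_def mass_def sum_subtractf)

lemma renorm_diff:
  assumes "finite G" "F \<subseteq> G" shows "renorm (G - F) \<alpha> = renorm G \<alpha> - renorm F \<alpha>"
  unfolding renorm_def by (rule sum_diff[OF assms])

lemma exp_renorm_plain:
  assumes F: "finite F" and s: "\<And>j. j \<in> F \<Longrightarrow> 2 * \<bar>s\<bar> \<le> lam j"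
  shows "(\<integral>\<^sup>+\<alpha>. ennreal (exp (s * renorm F \<alpha>)) \<partial>\<mu>) \<le> ennreal (exp (2 * s\<^sup>2 * (\<Sum>j\<in>F. 1 / (lam j)\<^sup>2)))"
  using exp_renorm[OF F finite.emptyI _ _ s] by simp

text \<open>The second moment is read off from the exponential moments at s and - s by y^2 \<le> exp
  y + exp (- y), avoiding the fourth moments of the coordinates.\<close>

lemma renorm_second_moment:
  assumes F: "finite F"
  shows "(\<integral>\<^sup>+\<alpha>. ennreal ((renorm F \<alpha>)\<^sup>2) \<partial>\<mu>) \<le> ennreal (16 * (\<Sum>j\<in>F. 1 / (lam j)\<^sup>2))"
proof (cases "F = {}")
  case True then show ?thesis by (simp add: renorm_def)
next
  case False
  let ?v = "\<Sum>j\<in>F. 1 / (lam j)\<^sup>2"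
  have v: "?v > 0" using F False lam_pos by (intro sum_pos) (auto simp: less_imp_neq[symmetric])
  \<comment> \<open>Normalised so that the exponent 2 s^2 v equals 1/2. It is admissible because
    each 1 / \<open>lam j\<close> is at most sqrt v.\<close>
  define s where "s = 1 / (2 * sqrt ?v)"
  have s0: "s > 0" using v by (simp add: s_def)
  have s2: "s\<^sup>2 = 1 / (4 * ?v)" using v by (simp add: s_def power_divide power_mult_distrib)
  have sl: "2 * \<bar>s\<bar> \<le> lam j" if "j \<in> F" for j
  proof -
    have "1 / (lam j)\<^sup>2 \<le> ?v" using F that by (intro member_le_sum) auto
    then have "1 / lam j \<le> sqrt ?v" using lam_pos[of j] by (intro real_le_rsqrt) (simp add: power_divide)
    then have "1 \<le> lam j * sqrt ?v" using lam_pos[of j] by (simp add: divide_le_eq mult.commute)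
    then show ?thesis using v s0 by (simp add: s_def divide_le_eq)
  qed
  have half: "2 * s\<^sup>2 * ?v = 1/2" using v unfolding s2 by simp
  have cosh: "y\<^sup>2 \<le> exp y + exp (- y)" for y :: real
  proof -
    have pos: "z\<^sup>2 \<le> exp z + exp (- z)" if "z \<ge> 0" for z :: real
    proof -
      have "1 + z + z\<^sup>2 / 2 \<le> exp z" by (rule exp_lower_Taylor_quadratic[OF that])
      moreover have "(1 - z / 2)\<^sup>2 \<ge> 0" by simp
      moreover have "1 - z \<le> exp (- z)" using exp_ge_add_one_self[of "- z"] by simp
      ultimately show ?thesis
      proof -
        have "cosh z \<ge> 1 + z\<^sup>2 / 2"
        proof -
          define g where "g t = cosh t - 1 - t\<^sup>2 / 2" for t :: real
          have "g 0 \<le> g z"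
          proof (rule DERIV_nonneg_imp_nondecreasing[OF that])
            fix t :: real assume t: "0 \<le> t" "t \<le> z"
            have "t \<le> sinh t"
            proof -
              have "sinh 0 - 0 \<le> sinh t - t"
              proof (rule DERIV_nonneg_imp_nondecreasing[OF t(1)])
                fix u :: real
                show "\<exists>y. ((\<lambda>t. sinh t - t) has_real_derivative y) (at u) \<and> 0 \<le> y"
                  by (rule exI[of _ "cosh u - 1"]) (auto intro!: derivative_eq_intros simp: cosh_real_ge_1)
              qed
              then show ?thesis by simp
            qed
            then show "\<exists>y. (g has_real_derivative y) (at t) \<and> 0 \<le> y"
              unfolding g_def[abs_def]
              by (intro exI[of _ "sinh t - t"]) (auto intro!: derivative_eq_intros)
          qed
          then show ?thesis by (simp add: g_def)
        qed
        then show ?thesis by (simp add: cosh_def)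
      qed
    qed
    show ?thesis using pos[of y] pos[of "- y"] by (cases "y \<ge> 0") auto
  qed
  have "(\<integral>\<^sup>+\<alpha>. ennreal ((renorm F \<alpha>)\<^sup>2) \<partial>\<mu>)
    \<le> (\<integral>\<^sup>+\<alpha>. ennreal (1 / s\<^sup>2) * (ennreal (exp (s * renorm F \<alpha>)) + ennreal (exp (- s * renorm F \<alpha>))) \<partial>\<mu>)"
  proof (intro nn_integral_mono)
    fix \<alpha>
    have "(renorm F \<alpha>)\<^sup>2 = 1 / s\<^sup>2 * (s * renorm F \<alpha>)\<^sup>2" using s0 by (simp add: power_mult_distrib)
    also have "\<dots> \<le> 1 / s\<^sup>2 * (exp (s * renorm F \<alpha>) + exp (- s * renorm F \<alpha>))"
      using cosh[of "s * renorm F \<alpha>"] by (intro mult_left_mono) auto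
    finally have "ennreal ((renorm F \<alpha>)\<^sup>2) \<le> ennreal (1 / s\<^sup>2 * (exp (s * renorm F \<alpha>) + exp (- s * renorm F \<alpha>)))"
      by (rule ennreal_leI)
    also have "\<dots> = ennreal (1 / s\<^sup>2) * (ennreal (exp (s * renorm F \<alpha>)) + ennreal (exp (- s * renorm F \<alpha>)))"
      by (subst ennreal_mult') auto
    finally show "ennreal ((renorm F \<alpha>)\<^sup>2) \<le> ennreal (1 / s\<^sup>2) * (ennreal (exp (s * renorm F \<alpha>)) + ennreal (exp (- s * renorm F \<alpha>)))" .
  qed
  also have "\<dots> = ennreal (1 / s\<^sup>2) * ((\<integral>\<^sup>+\<alpha>. ennreal (exp (s * renorm F \<alpha>)) \<partial>\<mu>) + (\<integral>\<^sup>+\<alpha>. ennreal (exp (- s * renorm F \<alpha>)) \<partial>\<mu>))"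
    by (subst nn_integral_cmult, measurable, subst nn_integral_add, measurable)
  also have "\<dots> \<le> ennreal (1 / s\<^sup>2) * (ennreal (exp (1/2)) + ennreal (exp (1/2)))"
    using exp_renorm_plain[OF F, of s] exp_renorm_plain[OF F, of "- s"] sl half
    by (intro mult_left_mono add_mono) auto
  also have "\<dots> = ennreal (4 * ?v * (2 * exp (1/2)))"
    unfolding s2 using v by (simp add: ennreal_mult'[symmetric] flip: ennreal_plus)
  also have "\<dots> \<le> ennreal (16 * ?v)"
  proof (intro ennreal_leI)
    have "exp (1/2 :: real) \<le> 2" using exp_bound[of "1/2"] by (simp add: power2_eq_square)
    then show "4 * ?v * (2 * exp (1/2)) \<le> 16 * ?v" using v by simp
  qed
  finally show ?thesis .
qed

section \<open>Square-mean convergence of the truncated masses\<close>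

definition rate :: "real \<Rightarrow> real" where "rate \<Lambda> = 16 * (S1 * \<Lambda> powr (- (1 - b)))"

lemma rate_nonneg: "0 \<le> rate \<Lambda>" using S1_nonneg by (simp add: rate_def)

lemma rate_tendsto: "(rate \<longlongrightarrow> 0) at_top"
proof -
  have "((\<lambda>\<Lambda>. 16 * (S1 * \<Lambda> powr (- (1 - b)))) \<longlongrightarrow> 16 * (S1 * 0)) at_top"
    using b by (intro tendsto_intros tendsto_neg_powr filterlim_ident) auto
  then show ?thesis by (simp add: rate_def[abs_def])
qed

lemma truncated_diff:
  assumes K: "K > 0" "K \<le> \<Lambda>" "K \<le> \<Lambda>'"
  shows "(\<integral>\<^sup>+\<alpha>. ennreal ((truncated_mass lam \<mu> \<Lambda> \<alpha> - truncated_mass lam \<mu> \<Lambda>' \<alpha>)\<^sup>2) \<partial>\<mu>) \<le> ennreal (rate K)"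
proof -
  have main: "(\<integral>\<^sup>+\<alpha>. ennreal ((truncated_mass lam \<mu> x \<alpha> - truncated_mass lam \<mu> y \<alpha>)\<^sup>2) \<partial>\<mu>) \<le> ennreal (rate K)"
    if "K \<le> x" "x \<le> y" for x y
  proof -
    let ?F = "{j. lam j \<le> y} - {j. lam j \<le> x}"
    have "truncated_mass lam \<mu> y \<alpha> - truncated_mass lam \<mu> x \<alpha> = renorm ?F \<alpha>" for \<alpha>
      unfolding truncated_renorm by (rule renorm_diff[symmetric]) (use finite_level that in auto)
    then have "(truncated_mass lam \<mu> x \<alpha> - truncated_mass lam \<mu> y \<alpha>)\<^sup>2 = (renorm ?F \<alpha>)\<^sup>2" for \<alpha>
      by (metis power2_commute)
    then have "(\<integral>\<^sup>+\<alpha>. ennreal ((truncated_mass lam \<mu> x \<alpha> - truncated_mass lam \<mu> y \<alpha>)\<^sup>2) \<partial>\<mu>) \<le> ennreal (16 * (\<Sum>j\<in>?F. 1 / (lam j)\<^sup>2))"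
      using renorm_second_moment[of ?F] finite_level by simp
    also have "\<dots> \<le> ennreal (rate K)"
      unfolding rate_def using K that finite_level
      by (intro ennreal_leI mult_left_mono sum_inverse_square_high) auto
    finally show ?thesis .
  qed
  show ?thesis
    using main[of \<Lambda> \<Lambda>'] main[of \<Lambda>' \<Lambda>] K by (cases "\<Lambda> \<le> \<Lambda>'") (auto simp: power2_commute)
qed

lemma truncated_measurable [measurable]: "truncated_mass lam \<mu> \<Lambda> \<in> borel_measurable \<mu>"
  unfolding truncated_renorm by measurable

lemma norm_L2_le:
  assumes [measurable]: "f \<in> borel_measurable \<mu>" and le: "(\<integral>\<^sup>+\<alpha>. ennreal ((f \<alpha>)\<^sup>2) \<partial>\<mu>) \<le> ennreal c" and c: "0 \<le> c"
  shows "integrable \<mu> (\<lambda>\<alpha>. (f \<alpha>)\<^sup>2)" "norm_L2_real \<mu> f \<le> sqrt c"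
proof -
  show i: "integrable \<mu> (\<lambda>\<alpha>. (f \<alpha>)\<^sup>2)"
    using le by (intro integrableI_bounded) (auto intro: le_less_trans)
  have "(\<integral>\<alpha>. (f \<alpha>)\<^sup>2 \<partial>\<mu>) \<le> c" using le c by (subst (asm) nn_integral_eq_integral[OF i]) auto
  then show "norm_L2_real \<mu> f \<le> sqrt c" by (simp add: norm_L2_real_def)
qed

lemma truncated_in_L2: "in_L2_real \<mu> (truncated_mass lam \<mu> \<Lambda>)"
proof -
  have "(\<integral>\<^sup>+\<alpha>. ennreal ((truncated_mass lam \<mu> \<Lambda> \<alpha>)\<^sup>2) \<partial>\<mu>) \<le> ennreal (16 * (\<Sum>j | lam j \<le> \<Lambda>. 1 / (lam j)\<^sup>2))"
    unfolding truncated_renorm by (rule renorm_second_moment[OF finite_level])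
  moreover have "0 \<le> 16 * (\<Sum>j | lam j \<le> \<Lambda>. 1 / (lam j)\<^sup>2)" by (simp add: sum_nonneg)
  ultimately show ?thesis
    unfolding in_L2_real_def using norm_L2_le(1)[OF truncated_measurable] truncated_measurable by blast
qed

lemma truncated_L2_Cauchy: "L2_Cauchy_from \<mu> (lam 0) (truncated_mass lam \<mu>)"
  unfolding L2_Cauchy_from_def
proof (intro conjI allI impI truncated_in_L2)
  fix \<epsilon> :: real assume e: "\<epsilon> > 0"
  have "\<forall>\<^sub>F \<Lambda> in at_top. rate \<Lambda> < \<epsilon>\<^sup>2" using order_tendstoD(2)[OF rate_tendsto] e by simp
  then obtain K0 where K0: "\<And>\<Lambda>. \<Lambda> \<ge> K0 \<Longrightarrow> rate \<Lambda> < \<epsilon>\<^sup>2" unfolding eventually_at_top_linorder by blast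
  let ?K = "max K0 (lam 0)"
  have "norm_L2_real \<mu> (\<lambda>x. truncated_mass lam \<mu> \<Lambda> x - truncated_mass lam \<mu> \<Lambda>' x) < \<epsilon>" if "\<Lambda> \<ge> ?K" "\<Lambda>' \<ge> ?K" for \<Lambda> \<Lambda>'
  proof -
    have "norm_L2_real \<mu> (\<lambda>x. truncated_mass lam \<mu> \<Lambda> x - truncated_mass lam \<mu> \<Lambda>' x) \<le> sqrt (rate ?K)"
      by (rule norm_L2_le(2)[OF _ truncated_diff rate_nonneg]) (use that lam_pos[of 0] in auto)
    also have "\<dots> < \<epsilon>" using real_sqrt_less_mono[OF K0[of ?K]] e by simp
    finally show ?thesis .
  qed
  then show "\<exists>K\<ge>lam 0. \<forall>\<Lambda>\<ge>K. \<forall>\<Lambda>'\<ge>K. norm_L2_real \<mu> (\<lambda>x. truncated_mass lam \<mu> \<Lambda> x - truncated_mass lam \<mu> \<Lambda>' x) < \<epsilon>"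
    by (intro exI[of _ ?K]) auto
qed

text \<open>A limit is constructed in mean along dyadic truncations. Fatou along an almost
  everywhere convergent subsequence then bounds the squared distance of every truncation, dyadic or
  not, from that limit.\<close>

lemma truncated_L2_limit: "\<exists>\<M>. L2_limit \<mu> (truncated_mass lam \<mu>) \<M>"
proof -
  let ?s = "\<lambda>n. truncated_mass lam \<mu> (2 ^ n)"
  have isn: "integrable \<mu> (?s n)" for n
    unfolding truncated_renorm renorm_def[abs_def]
    by (intro Bochner_Integration.integrable_sum Bochner_Integration.integrable_diff mean_square) auto
  have rate2: "(\<lambda>n. rate (2 ^ n)) \<longlonglongrightarrow> 0"
    by (rule filterlim_compose[OF rate_tendsto filterlim_realpow_sequentially_gt1[THEN filterlim_at_infinity_imp_filterlim_at_top]]) auto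
  have "\<exists>f. integrable \<mu> f \<and> (\<lambda>n. \<integral>\<^sup>+x. norm (?s n x - f x) \<partial>\<mu>) \<longlonglongrightarrow> 0 \<and>
    (\<exists>r. strict_mono r \<and> (AE x in \<mu>. (\<lambda>i. ?s (r i) x) \<longlonglongrightarrow> f x))"
  proof (rule L1_complete[OF isn])
    fix \<epsilon> :: real assume e: "\<epsilon> > 0"
    have "\<forall>\<^sub>F n in sequentially. rate (2 ^ n) < \<epsilon>\<^sup>2" using order_tendstoD(2)[OF rate2] e by simp
    then obtain N where N: "rate (2 ^ N) < \<epsilon>\<^sup>2" unfolding eventually_sequentially by blast
    have "(\<integral>\<^sup>+x. norm (?s i x - ?s j x) \<partial>\<mu>) \<le> ennreal \<epsilon>" if "i \<ge> N" "j \<ge> N" for i j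
    proof -
      \<comment> \<open>Young's inequality, balanced so that a second moment of at most \<epsilon>^2
        gives a first moment of at most \<epsilon>.\<close>
      have "\<bar>y\<bar> \<le> \<epsilon> / 2 + 1 / (2 * \<epsilon>) * y\<^sup>2" for y :: real
      proof -
        have "0 \<le> (\<bar>y\<bar> - \<epsilon>)\<^sup>2 / (2 * \<epsilon>)" using e by simp
        also have "\<dots> = \<epsilon> / 2 + 1 / (2 * \<epsilon>) * y\<^sup>2 - \<bar>y\<bar>" using e by (simp add: power2_diff field_simps power2_eq_square)
        finally show ?thesis by simp
      qed
      then have "(\<integral>\<^sup>+x. norm (?s i x - ?s j x) \<partial>\<mu>) \<le> (\<integral>\<^sup>+x. ennreal (\<epsilon> / 2) + ennreal (1 / (2 * \<epsilon>)) * ennreal ((?s i x - ?s j x)\<^sup>2) \<partial>\<mu>)"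
        using e by (intro nn_integral_mono) (auto simp: ennreal_mult'[symmetric] simp flip: ennreal_plus intro!: ennreal_leI)
      also have "\<dots> = ennreal (\<epsilon> / 2) + ennreal (1 / (2 * \<epsilon>)) * (\<integral>\<^sup>+x. ennreal ((?s i x - ?s j x)\<^sup>2) \<partial>\<mu>)"
        by (subst nn_integral_add) (auto simp: nn_integral_cmult emeasure_space_1)
      also have "\<dots> \<le> ennreal (\<epsilon> / 2) + ennreal (1 / (2 * \<epsilon>)) * ennreal (\<epsilon>\<^sup>2)"
      proof (intro add_left_mono mult_left_mono)
        have "(\<integral>\<^sup>+x. ennreal ((?s i x - ?s j x)\<^sup>2) \<partial>\<mu>) \<le> ennreal (rate (2 ^ N))"
          using that by (intro truncated_diff power_increasing) auto
        also have "\<dots> \<le> ennreal (\<epsilon>\<^sup>2)" using N by (intro ennreal_leI) simp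
        finally show "(\<integral>\<^sup>+x. ennreal ((?s i x - ?s j x)\<^sup>2) \<partial>\<mu>) \<le> ennreal (\<epsilon>\<^sup>2)" .
      qed auto
      also have "\<dots> = ennreal \<epsilon>"
        using e by (simp add: ennreal_mult'[symmetric] power2_eq_square flip: ennreal_plus)
      finally show ?thesis .
    qed
    then show "\<exists>N. \<forall>i\<ge>N. \<forall>j\<ge>N. (\<integral>\<^sup>+x. norm (?s i x - ?s j x) \<partial>\<mu>) \<le> ennreal \<epsilon>" by blast
  qed
  then obtain f r where f: "integrable \<mu> f" and r: "strict_mono r" "AE x in \<mu>. (\<lambda>i. ?s (r i) x) \<longlonglongrightarrow> f x" by blast
  have [measurable]: "f \<in> borel_measurable \<mu>" using f by (rule borel_measurable_integrable)
  have le: "(\<integral>\<^sup>+\<alpha>. ennreal ((truncated_mass lam \<mu> \<Lambda> \<alpha> - f \<alpha>)\<^sup>2) \<partial>\<mu>) \<le> ennreal (rate \<Lambda>)" if "\<Lambda> > 0" for \<Lambda>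
  proof (rule nn_integral_AE_limit_le[where u = "\<lambda>i \<alpha>. ennreal ((truncated_mass lam \<mu> \<Lambda> \<alpha> - ?s (r i) \<alpha>)\<^sup>2)"])
    show "AE \<alpha> in \<mu>. (\<lambda>i. ennreal ((truncated_mass lam \<mu> \<Lambda> \<alpha> - ?s (r i) \<alpha>)\<^sup>2)) \<longlonglongrightarrow> ennreal ((truncated_mass lam \<mu> \<Lambda> \<alpha> - f \<alpha>)\<^sup>2)"
      using r(2) by eventually_elim (intro tendsto_ennrealI tendsto_power tendsto_diff tendsto_const)
    obtain n :: nat where n: "\<Lambda> < 2 ^ n" using real_arch_pow[of 2] by auto
    show "\<forall>\<^sub>F i in sequentially. (\<integral>\<^sup>+\<alpha>. ennreal ((truncated_mass lam \<mu> \<Lambda> \<alpha> - ?s (r i) \<alpha>)\<^sup>2) \<partial>\<mu>) \<le> ennreal (rate \<Lambda>)"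
      using eventually_ge_at_top[of n]
    proof eventually_elim
      case (elim i)
      have "(2::real) ^ n \<le> 2 ^ r i" using elim seq_suble[OF r(1), of i] by (intro power_increasing) auto
      then have "\<Lambda> \<le> 2 ^ r i" using n by linarith
      then show ?case using that by (intro truncated_diff) auto
    qed
  qed measurable
  have "in_L2_real \<mu> f"
  proof -
    let ?F = "truncated_mass lam \<mu> 1"
    have "integrable \<mu> (\<lambda>\<alpha>. 2 * (?F \<alpha> - f \<alpha>)\<^sup>2 + 2 * (?F \<alpha>)\<^sup>2)"
      using norm_L2_le(1)[OF _ le[of 1] rate_nonneg] truncated_in_L2[of 1] unfolding in_L2_real_def
      by (intro Bochner_Integration.integrable_add integrable_mult_right) auto
    then have "integrable \<mu> (\<lambda>\<alpha>. (f \<alpha>)\<^sup>2)"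
    proof (rule Bochner_Integration.integrable_bound)
      have "y\<^sup>2 \<le> 2 * (x - y)\<^sup>2 + 2 * x\<^sup>2" for x y :: real
        using zero_le_power2[of "2 * x - y"] by (simp add: power2_eq_square algebra_simps)
      then show "AE \<alpha> in \<mu>. norm ((f \<alpha>)\<^sup>2) \<le> norm (2 * (?F \<alpha> - f \<alpha>)\<^sup>2 + 2 * (?F \<alpha>)\<^sup>2)" by simp
    qed measurable
    then show ?thesis unfolding in_L2_real_def by simp
  qed
  moreover have "((\<lambda>\<Lambda>. norm_L2_real \<mu> (\<lambda>x. truncated_mass lam \<mu> \<Lambda> x - f x)) \<longlongrightarrow> 0) at_top"
  proof (rule tendsto_sandwich[OF _ _ tendsto_const])
    show "\<forall>\<^sub>F \<Lambda> in at_top. 0 \<le> norm_L2_real \<mu> (\<lambda>x. truncated_mass lam \<mu> \<Lambda> x - f x)" by (simp add: norm_L2_real_def)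
    show "\<forall>\<^sub>F \<Lambda> in at_top. norm_L2_real \<mu> (\<lambda>x. truncated_mass lam \<mu> \<Lambda> x - f x) \<le> sqrt (rate \<Lambda>)"
      using eventually_gt_at_top[of 0] by eventually_elim (rule norm_L2_le(2)[OF _ le rate_nonneg], measurable)
    show "((\<lambda>\<Lambda>. sqrt (rate \<Lambda>)) \<longlongrightarrow> 0) at_top" using tendsto_real_sqrt[OF rate_tendsto] by simp
  qed
  ultimately show ?thesis unfolding L2_limit_def by blast
qed

lemma L2_limit_in_probability:
  assumes lim: "L2_limit \<mu> (truncated_mass lam \<mu>) \<M>" and d: "\<delta> > 0"
  shows "(\<lambda>L. emeasure \<mu> {\<alpha>\<in>space \<mu>. \<delta> < \<bar>renorm (J L) \<alpha> - \<M> \<alpha>\<bar>}) \<longlonglongrightarrow> 0"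
proof -
  have [measurable]: "\<M> \<in> borel_measurable \<mu>" and M2: "integrable \<mu> (\<lambda>\<alpha>. (\<M> \<alpha>)\<^sup>2)"
    using lim unfolding L2_limit_def in_L2_real_def by auto
  let ?n = "\<lambda>L. norm_L2_real \<mu> (\<lambda>x. truncated_mass lam \<mu> (2 ^ L) x - \<M> x)"
  have JL: "renorm (J L) = truncated_mass lam \<mu> (2 ^ L)" for L unfolding truncated_renorm J_def ..
  have i: "integrable \<mu> (\<lambda>x. (truncated_mass lam \<mu> (2 ^ L) x - \<M> x)\<^sup>2)" for L
  proof -
    have "integrable \<mu> (\<lambda>\<alpha>. 2 * (truncated_mass lam \<mu> (2 ^ L) \<alpha>)\<^sup>2 + 2 * (\<M> \<alpha>)\<^sup>2)"
      using truncated_in_L2[of "2 ^ L"] M2 unfolding in_L2_real_def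
      by (intro Bochner_Integration.integrable_add integrable_mult_right) auto
    then show ?thesis
    proof (rule Bochner_Integration.integrable_bound)
      have "(x - y)\<^sup>2 \<le> 2 * x\<^sup>2 + 2 * y\<^sup>2" for x y :: real
        using zero_le_power2[of "x + y"] by (simp add: power2_eq_square algebra_simps)
      then show "AE \<alpha> in \<mu>. norm ((truncated_mass lam \<mu> (2 ^ L) \<alpha> - \<M> \<alpha>)\<^sup>2) \<le> norm (2 * (truncated_mass lam \<mu> (2 ^ L) \<alpha>)\<^sup>2 + 2 * (\<M> \<alpha>)\<^sup>2)" by simp
    qed measurable
  qed
  have le: "emeasure \<mu> {\<alpha>\<in>space \<mu>. \<delta> < \<bar>renorm (J L) \<alpha> - \<M> \<alpha>\<bar>} \<le> ennreal (1 / \<delta>\<^sup>2 * (?n L)\<^sup>2)" for L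
  proof -
    let ?A = "{\<alpha>\<in>space \<mu>. \<delta> < \<bar>renorm (J L) \<alpha> - \<M> \<alpha>\<bar>}"
    have "emeasure \<mu> ?A = (\<integral>\<^sup>+\<alpha>. indicator ?A \<alpha> \<partial>\<mu>)" by (rule nn_integral_indicator[symmetric]) measurable
    also have "\<dots> \<le> (\<integral>\<^sup>+\<alpha>. ennreal (1 / \<delta>\<^sup>2 * (truncated_mass lam \<mu> (2 ^ L) \<alpha> - \<M> \<alpha>)\<^sup>2) \<partial>\<mu>)"
    proof (intro nn_integral_mono)
      fix \<alpha>
      have "1 \<le> 1 / \<delta>\<^sup>2 * (truncated_mass lam \<mu> (2 ^ L) \<alpha> - \<M> \<alpha>)\<^sup>2" if "\<alpha> \<in> ?A"
      proof -
        have "\<delta>\<^sup>2 \<le> \<bar>truncated_mass lam \<mu> (2 ^ L) \<alpha> - \<M> \<alpha>\<bar>\<^sup>2"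
          using that d by (intro power_mono) (auto simp: JL)
        then show ?thesis using d by (simp add: field_simps)
      qed
      then show "indicator ?A \<alpha> \<le> ennreal (1 / \<delta>\<^sup>2 * (truncated_mass lam \<mu> (2 ^ L) \<alpha> - \<M> \<alpha>)\<^sup>2)"
        by (cases "\<alpha> \<in> ?A") (auto simp: ennreal_1[symmetric] simp del: ennreal_1 intro!: ennreal_leI)
    qed
    also have "\<dots> = ennreal (\<integral>\<alpha>. 1 / \<delta>\<^sup>2 * (truncated_mass lam \<mu> (2 ^ L) \<alpha> - \<M> \<alpha>)\<^sup>2 \<partial>\<mu>)"
      by (intro nn_integral_eq_integral integrable_mult_right i) auto
    also have "(\<integral>\<alpha>. 1 / \<delta>\<^sup>2 * (truncated_mass lam \<mu> (2 ^ L) \<alpha> - \<M> \<alpha>)\<^sup>2 \<partial>\<mu>) = 1 / \<delta>\<^sup>2 * (?n L)\<^sup>2"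
      unfolding norm_L2_real_def by simp
    finally show ?thesis .
  qed
  have "filterlim (\<lambda>L::nat. (2::real) ^ L) at_top sequentially"
    by (rule filterlim_at_infinity_imp_filterlim_at_top[OF filterlim_realpow_sequentially_gt1]) auto
  from filterlim_compose[OF _ this] lim have "?n \<longlonglongrightarrow> 0" unfolding L2_limit_def by blast
  then have "(\<lambda>L. 1 / \<delta>\<^sup>2 * (?n L)\<^sup>2) \<longlonglongrightarrow> 1 / \<delta>\<^sup>2 * 0\<^sup>2" by (intro tendsto_intros)
  then have "(\<lambda>L. ennreal (1 / \<delta>\<^sup>2 * (?n L)\<^sup>2)) \<longlonglongrightarrow> ennreal 0" by (intro tendsto_ennrealI) simp
  then show ?thesis by (intro ennreal_sandwich0[OF le]) simp
qed

section \<open>The three Gibbs measures\<close>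

text \<open>The weight is at most 1, and it is positive wherever the quartic is finite, hence almost
  everywhere.\<close>

lemma defocusing_gibbs: "in_L1_ennreal \<mu> (defocusing_weight e) \<and> gibbs_well_defined \<mu> (defocusing_weight e)"
proof (rule gibbs_well_definedI)
  have form: "defocusing_weight e \<alpha> = (if int_pow e 4 \<alpha> = \<infinity> then 0 else ennreal (exp (- enn2real (int_pow e 4 \<alpha>) / 2)))" for \<alpha>
    unfolding defocusing_weight_def exp_ereal_minus_half ..
  have "defocusing_weight e \<alpha> \<le> 1" for \<alpha>
    unfolding form by (auto simp: ennreal_1[symmetric] simp del: ennreal_1 intro!: ennreal_leI)
  then have "(\<integral>\<^sup>+\<alpha>. defocusing_weight e \<alpha> \<partial>\<mu>) \<le> (\<integral>\<^sup>+\<alpha>. 1 \<partial>\<mu>)" by (intro nn_integral_mono)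
  then show "(\<integral>\<^sup>+\<alpha>. defocusing_weight e \<alpha> \<partial>\<mu>) < \<infinity>" by (simp add: emeasure_space_1 le_less_trans)
  show "0 < (\<integral>\<^sup>+\<alpha>. defocusing_weight e \<alpha> \<partial>\<mu>)"
  proof (rule ccontr)
    assume "\<not> ?thesis"
    then have "AE \<alpha> in \<mu>. defocusing_weight e \<alpha> = 0" by (subst (asm) not_gr_zero, subst (asm) nn_integral_0_iff_AE) auto
    then have "AE \<alpha> in \<mu>. False"
      using AE_int_pow_4_finite by eventually_elim (auto simp: form split: if_splits)
    then show False by simp
  qed
qed measurable

text \<open>Since the weight is at least 1 on the cut-off set, positivity of the normalisation
  reduces to positive probability of that set. The intersection with the space appears because the
  cut-off sets are sets of arbitrary sequences.\<close>

lemma focusing_gibbs: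
  assumes H: "H \<ge> 1" "H \<ge> 8 * S1 + 2" and A: "A \<inter> space \<mu> \<in> sets \<mu>" and pos: "emeasure \<mu> (A \<inter> space \<mu>) > 0"
    and M: "\<forall>\<^sub>F K in sequentially. emeasure \<mu> {\<alpha>\<in>A \<inter> space \<mu>. H * 2 powr (real K * b) < mass (J K) \<alpha>} \<le> ennreal (exp (- (4 * level H K)))"
  shows "in_L1_ennreal \<mu> (focusing_weight e A) \<and> gibbs_well_defined \<mu> (focusing_weight e A)"
proof (rule gibbs_well_definedI)
  let ?A = "A \<inter> space \<mu>"
  have cong: "focusing_weight e A \<alpha> = focusing_weight e ?A \<alpha>" if "\<alpha> \<in> space \<mu>" for \<alpha>
    using that by (simp add: focusing_weight_def indicator_def)
  show "focusing_weight e A \<in> borel_measurable \<mu>"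
    using focusing_measurable[OF A] by (subst measurable_cong[OF cong])
  have eq: "(\<integral>\<^sup>+\<alpha>. focusing_weight e A \<alpha> \<partial>\<mu>) = (\<integral>\<^sup>+\<alpha>. focusing_weight e ?A \<alpha> \<partial>\<mu>)" by (rule nn_integral_cong[OF cong])
  show "(\<integral>\<^sup>+\<alpha>. focusing_weight e A \<alpha> \<partial>\<mu>) < \<infinity>" unfolding eq by (rule focusing_integrable[OF H A M])
  have "indicator ?A \<alpha> \<le> focusing_weight e ?A \<alpha>" for \<alpha>
  proof -
    have "1 \<le> exp_ereal (ereal (1/2) * enn2ereal (int_pow e 4 \<alpha>))"
      unfolding exp_ereal_half by (auto simp: ennreal_1[symmetric] simp del: ennreal_1 intro!: ennreal_leI)
    then show ?thesis unfolding focusing_weight_def by (auto simp: indicator_def)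
  qed
  then have "(\<integral>\<^sup>+\<alpha>. indicator ?A \<alpha> \<partial>\<mu>) \<le> (\<integral>\<^sup>+\<alpha>. focusing_weight e ?A \<alpha> \<partial>\<mu>)" by (intro nn_integral_mono)
  then show "0 < (\<integral>\<^sup>+\<alpha>. focusing_weight e A \<alpha> \<partial>\<mu>)" unfolding eq using pos A by (auto intro: less_le_trans)
qed

lemma level_eventually_le: "\<forall>\<^sub>F K in sequentially. 4 * level H K \<le> 2 powr (real K * (1 + b))"
proof -
  have "\<forall>\<^sub>F K in sequentially. 128 * H\<^sup>2 \<le> 2 powr (real K * (1/2 - b))" by (rule powr_eventually_ge) (use b in auto)
  then show ?thesis
  proof eventually_elim
    case (elim K)
    have "4 * level H K = 128 * H\<^sup>2 * 2 powr (real K * (1/2 + 2 * b))" by (simp add: level_def)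
    also have "\<dots> \<le> 2 powr (real K * (1/2 - b)) * 2 powr (real K * (1/2 + 2 * b))"
      using elim by (intro mult_right_mono) auto
    also have "\<dots> = 2 powr (real K * (1 + b))" unfolding powr_add[symmetric] by (simp add: algebra_simps)
    finally show ?case .
  qed
qed

text \<open>Chebyshev with a negative exponent of size 2^K / 2. With X = 2^(K (1+b)) the
  second-order cost is at most S1 X / 2 and the gain is H X / 4, uniformly in \<open>L\<close>; the
  condition on H leaves the margin X.\<close>

lemma renorm_lower_tail:
  assumes H: "H \<ge> 4 + 2 * S1"
  shows "emeasure \<mu> {\<alpha>\<in>space \<mu>. renorm (J L - J K) \<alpha> \<le> - (H / 2 * 2 powr (real K * b))} \<le> ennreal (exp (- (2 powr (real K * (1 + b)))))"
proof -
  let ?F = "J L - J K"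
  let ?A = "{\<alpha>\<in>space \<mu>. renorm ?F \<alpha> \<le> - (H / 2 * 2 powr (real K * b))}"
  define s where "s = - ((2::real) ^ K / 2)"
  define X where "X = 2 powr (real K * (1 + b))"
  have X0: "X > 0" by (simp add: X_def)
  have F: "finite ?F" by simp
  have Fl: "2 ^ K < lam j" if "j \<in> ?F" for j using that by (auto simp: J_def)
  have pow: "(2::real) ^ K = 2 powr real K" by (rule powr_realpow[symmetric]) simp
  have kX: "2 ^ K * 2 powr (real K * b) = X" unfolding X_def pow powr_add[symmetric] by (simp add: algebra_simps)
  have v: "2 * s\<^sup>2 * (\<Sum>j\<in>?F. 1 / (lam j)\<^sup>2) \<le> S1 / 2 * X"
  proof -
    have "(\<Sum>j\<in>?F. 1 / (lam j)\<^sup>2) \<le> S1 * (2 ^ K) powr (- (1 - b))"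
      using Fl by (intro sum_inverse_square_high F) (auto intro: less_imp_le)
    then have "2 * s\<^sup>2 * (\<Sum>j\<in>?F. 1 / (lam j)\<^sup>2) \<le> 2 * s\<^sup>2 * (S1 * (2 ^ K) powr (- (1 - b)))"
      by (intro mult_left_mono) auto
    also have "\<dots> = S1 / 2 * ((2 ^ K)\<^sup>2 * (2 ^ K) powr (- (1 - b)))" by (simp add: s_def power_divide)
    also have "(2 ^ K)\<^sup>2 * (2 ^ K) powr (- (1 - b)) = X"
      unfolding two_pow_powr X_def unfolding power2_eq_square pow powr_add[symmetric] by (simp add: algebra_simps)
    finally show ?thesis .
  qed
  have "emeasure \<mu> ?A = (\<integral>\<^sup>+\<alpha>. indicator ?A \<alpha> \<partial>\<mu>)" by (rule nn_integral_indicator[symmetric]) measurable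
  also have "\<dots> \<le> (\<integral>\<^sup>+\<alpha>. ennreal (exp (- (H / 4 * X))) * ennreal (exp (s * renorm ?F \<alpha>)) \<partial>\<mu>)"
  proof (intro nn_integral_mono)
    fix \<alpha>
    have "1 \<le> exp (- (H / 4 * X)) * exp (s * renorm ?F \<alpha>)" if "\<alpha> \<in> ?A"
    proof -
      have "(2 ^ K / 2) * renorm ?F \<alpha> \<le> (2 ^ K / 2) * (- (H / 2 * 2 powr (real K * b)))"
        using that by (intro mult_left_mono) auto
      also have "\<dots> = - (H / 4 * X)" by (simp add: kX[symmetric])
      finally show ?thesis by (simp add: s_def exp_add[symmetric])
    qed
    then show "indicator ?A \<alpha> \<le> ennreal (exp (- (H / 4 * X))) * ennreal (exp (s * renorm ?F \<alpha>))"
      by (cases "\<alpha> \<in> ?A") (auto simp: ennreal_mult[symmetric] ennreal_1[symmetric] simp del: ennreal_1 intro!: ennreal_leI)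
  qed
  also have "\<dots> = ennreal (exp (- (H / 4 * X))) * (\<integral>\<^sup>+\<alpha>. ennreal (exp (s * renorm ?F \<alpha>)) \<partial>\<mu>)"
    by (rule nn_integral_cmult) measurable
  also have "\<dots> \<le> ennreal (exp (- (H / 4 * X))) * ennreal (exp (2 * s\<^sup>2 * (\<Sum>j\<in>?F. 1 / (lam j)\<^sup>2)))"
    using Fl by (intro mult_left_mono exp_renorm_plain F) (auto simp: s_def intro: less_imp_le)
  also have "\<dots> \<le> ennreal (exp (- (H / 4 * X))) * ennreal (exp (S1 / 2 * X))"
    using v by (intro mult_left_mono ennreal_leI) auto
  also have "\<dots> = ennreal (exp ((S1 / 2 - H / 4) * X))" by (simp add: ennreal_mult[symmetric] exp_add[symmetric] algebra_simps)
  also have "\<dots> \<le> ennreal (exp (- X))"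
  proof -
    have "(S1 / 2 - H / 4) * X \<le> (- 1) * X" using H X0 by (intro mult_right_mono) auto
    then show ?thesis by (intro ennreal_leI) simp
  qed
  finally show ?thesis by (simp add: X_def)
qed

text \<open>By independence, conditioning the coordinates in \<open>G\<close> does not affect the
  exponential bound for the coordinates in \<open>F\<close>, so at most half of the product event is
  lost. The lower bound does not involve \<open>F\<close>, which allows \<open>F\<close> to exhaust
  all high modes.\<close>

lemma product_event:
  assumes FG: "finite F" "finite G" "F \<inter> G = {}" and B: "\<And>j. j \<in> G \<Longrightarrow> open (B j) \<and> B j \<noteq> {}"
    and d: "\<delta> > 0" "\<And>j. j \<in> F \<Longrightarrow> 6 / \<delta> \<le> lam j" "(\<Sum>j\<in>F. 1 / (lam j)\<^sup>2) \<le> \<delta>\<^sup>2 / 18"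
  shows "(\<Prod>j\<in>G. emeasure (cgauss (lam j)) (B j)) / 2 \<le> emeasure \<mu> {\<alpha>\<in>space \<mu>. (\<forall>j\<in>G. \<alpha> j \<in> B j) \<and> \<bar>renorm F \<alpha>\<bar> \<le> \<delta>}"
proof -
  let ?p = "\<Prod>j\<in>G. emeasure (cgauss (lam j)) (B j)"
  let ?I = "\<lambda>\<alpha>. \<Prod>j\<in>G. indicator (B j) (\<alpha> j) :: ennreal"
  have Bs: "B j \<in> sets borel" if "j \<in> G" for j using B[OF that] by auto
  define P where "P = {\<alpha>\<in>space \<mu>. (\<forall>j\<in>G. \<alpha> j \<in> B j) \<and> \<bar>renorm F \<alpha>\<bar> \<le> \<delta>}"
  define N where "N = {\<alpha>\<in>space \<mu>. (\<forall>j\<in>G. \<alpha> j \<in> B j) \<and> \<not> \<bar>renorm F \<alpha>\<bar> \<le> \<delta>}"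
  have Im: "?I \<in> borel_measurable \<mu>"
    using Bs by (intro borel_measurable_prod_ennreal measurable_compose[OF coord_measurable] borel_measurable_indicator) auto
  have I: "?I \<alpha> = (if \<forall>j\<in>G. \<alpha> j \<in> B j then 1 else 0)" for \<alpha>
    using FG(2) by (auto simp: indicator_def intro!: prod.neutral)
  have Gset: "{\<alpha>\<in>space \<mu>. \<forall>j\<in>G. \<alpha> j \<in> B j} \<in> sets \<mu>"
  proof -
    have "{\<alpha>\<in>space \<mu>. \<forall>j\<in>G. \<alpha> j \<in> B j} = ?I -` {1} \<inter> space \<mu>" unfolding I by (auto split: if_splits)
    then show ?thesis using measurable_sets[OF Im, of "{1}"] by simp
  qed
  have Rset: "{\<alpha>\<in>space \<mu>. \<bar>renorm F \<alpha>\<bar> \<le> \<delta>} \<in> sets \<mu>" by measurable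
  have PN: "P = {\<alpha>\<in>space \<mu>. \<forall>j\<in>G. \<alpha> j \<in> B j} \<inter> {\<alpha>\<in>space \<mu>. \<bar>renorm F \<alpha>\<bar> \<le> \<delta>}"
    "N = {\<alpha>\<in>space \<mu>. \<forall>j\<in>G. \<alpha> j \<in> B j} - {\<alpha>\<in>space \<mu>. \<bar>renorm F \<alpha>\<bar> \<le> \<delta>}" by (auto simp: P_def N_def)
  have sets: "P \<in> sets \<mu>" "N \<in> sets \<mu>" unfolding PN using Gset Rset by auto
  have "?p = (\<integral>\<^sup>+\<alpha>. ?I \<alpha> \<partial>\<mu>)"
    using Bs by (subst nn_integral_prod_coords[OF FG(2)]) (auto intro!: prod.cong)
  also have "\<dots> = (\<integral>\<^sup>+\<alpha>. indicator P \<alpha> + indicator N \<alpha> \<partial>\<mu>)"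
    by (intro nn_integral_cong) (unfold I, auto simp: P_def N_def indicator_def)
  also have "\<dots> = emeasure \<mu> P + emeasure \<mu> N" using sets by (subst nn_integral_add) auto
  finally have p: "?p = emeasure \<mu> P + emeasure \<mu> N" .
  \<comment> \<open>Deviations beyond \<delta> then gain exp (- 3), while each sign costs at most
    exp 1; the total 2 exp (- 2) is at most 1/2.\<close>
  define s where "s = 3 / \<delta>"
  have s: "2 * \<bar>s\<bar> \<le> lam j" if "j \<in> F" for j using d(1) d(2)[OF that] by (simp add: s_def)
  have s2: "2 * s\<^sup>2 * (\<Sum>j\<in>F. 1 / (lam j)\<^sup>2) \<le> 1"
  proof -
    have "2 * s\<^sup>2 * (\<Sum>j\<in>F. 1 / (lam j)\<^sup>2) \<le> 2 * s\<^sup>2 * (\<delta>\<^sup>2 / 18)" using d(3) by (intro mult_left_mono) auto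
    also have "\<dots> = 1" using d(1) by (simp add: s_def power_divide)
    finally show ?thesis .
  qed
  have E: "(\<integral>\<^sup>+\<alpha>. ennreal (exp (t * renorm F \<alpha>)) * ?I \<alpha> \<partial>\<mu>) \<le> ennreal (exp 1) * ?p" if "t = s \<or> t = - s" for t
  proof -
    have "(\<integral>\<^sup>+\<alpha>. ennreal (exp (t * renorm F \<alpha>)) * ?I \<alpha> \<partial>\<mu>) \<le> ennreal (exp (2 * t\<^sup>2 * (\<Sum>j\<in>F. 1 / (lam j)\<^sup>2))) * ?p"
      using s that by (intro exp_renorm FG Bs) auto
    also have "\<dots> \<le> ennreal (exp 1) * ?p" using s2 that by (intro mult_right_mono ennreal_leI) auto
    finally show ?thesis .
  qed
  have "emeasure \<mu> N = (\<integral>\<^sup>+\<alpha>. indicator N \<alpha> \<partial>\<mu>)" using sets by simp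
  also have "\<dots> \<le> (\<integral>\<^sup>+\<alpha>. ennreal (exp (- 3)) * (ennreal (exp (s * renorm F \<alpha>)) * ?I \<alpha> + ennreal (exp (- s * renorm F \<alpha>)) * ?I \<alpha>) \<partial>\<mu>)"
  proof (intro nn_integral_mono)
    fix \<alpha>
    show "indicator N \<alpha> \<le> ennreal (exp (- 3)) * (ennreal (exp (s * renorm F \<alpha>)) * ?I \<alpha> + ennreal (exp (- s * renorm F \<alpha>)) * ?I \<alpha>)"
    proof (cases "\<alpha> \<in> N")
      case True
      then have I1: "?I \<alpha> = 1" and r: "\<delta> < \<bar>renorm F \<alpha>\<bar>" using I by (auto simp: N_def)
      have "3 \<le> \<bar>s * renorm F \<alpha>\<bar>"
        using r d(1) by (simp add: s_def abs_mult field_simps)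
      then have "1 \<le> exp (- 3) * (exp (s * renorm F \<alpha>) + exp (- s * renorm F \<alpha>))"
      proof (cases "s * renorm F \<alpha> \<ge> 0")
        case True
        then have "1 \<le> exp (- 3) * exp (s * renorm F \<alpha>)" using \<open>3 \<le> \<bar>s * renorm F \<alpha>\<bar>\<close> by (simp add: exp_add[symmetric])
        then show ?thesis by (simp add: distrib_left add_increasing2)
      next
        case False
        then have "1 \<le> exp (- 3) * exp (- s * renorm F \<alpha>)" using \<open>3 \<le> \<bar>s * renorm F \<alpha>\<bar>\<close> by (simp add: exp_add[symmetric])
        then show ?thesis by (simp add: distrib_left add_increasing)
      qed
      from ennreal_leI[OF this] show ?thesis
        using True unfolding I1 by (simp add: ennreal_mult')
    qed simp
  qed
  also have "\<dots> = ennreal (exp (- 3)) * ((\<integral>\<^sup>+\<alpha>. ennreal (exp (s * renorm F \<alpha>)) * ?I \<alpha> \<partial>\<mu>) + (\<integral>\<^sup>+\<alpha>. ennreal (exp (- s * renorm F \<alpha>)) * ?I \<alpha> \<partial>\<mu>))"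
    using Im by (subst nn_integral_cmult, simp, subst nn_integral_add) auto
  also have "\<dots> \<le> ennreal (exp (- 3)) * (ennreal (exp 1) * ?p + ennreal (exp 1) * ?p)"
    by (intro mult_left_mono add_mono E) auto
  also have "\<dots> = ennreal (2 * exp (- 2)) * ?p"
  proof -
    have "ennreal (exp (- 3)) * (ennreal (exp 1) * ?p + ennreal (exp 1) * ?p) = (ennreal (exp (- 3)) * (ennreal (exp 1) + ennreal (exp 1))) * ?p"
      by (simp add: distrib_left distrib_right mult.assoc)
    also have "ennreal (exp (- 3)) * (ennreal (exp 1) + ennreal (exp 1)) = ennreal (2 * exp (- 2))"
      by (simp add: ennreal_mult'[symmetric] exp_add[symmetric] distrib_left flip: ennreal_plus)
    finally show ?thesis .
  qed
  also have "\<dots> \<le> ennreal (1/2) * ?p"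
  proof (intro mult_right_mono ennreal_leI)
    have "2 \<le> exp (1::real)" using exp_ge_add_one_self[of 1] by simp
    then have "2 * 2 \<le> exp (1::real) * exp 1" by (intro mult_mono) auto
    then have "4 \<le> exp (2::real)" by (simp add: exp_add[symmetric])
    then show "2 * exp (- 2) \<le> (1/2 :: real)" by (simp add: exp_minus field_simps)
  qed auto
  finally have N: "emeasure \<mu> N \<le> ennreal (1/2) * ?p" .
  have "?p \<noteq> \<infinity>" unfolding p using emeasure_finite by (simp add: ennreal_add_eq_top)
  then obtain x where x: "?p = ennreal x" "0 \<le> x" by (cases ?p) auto
  obtain y where y: "emeasure \<mu> P = ennreal y" "0 \<le> y" using emeasure_finite[of P] by (cases "emeasure \<mu> P") auto
  obtain z where z: "emeasure \<mu> N = ennreal z" "0 \<le> z" using emeasure_finite[of N] by (cases "emeasure \<mu> N") auto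
  have "x = y + z" using p x y z by (simp flip: ennreal_plus)
  moreover have "ennreal (1/2 * x) = ennreal (1/2) * ennreal x" by (rule ennreal_mult') simp
  then have "z \<le> 1/2 * x" using N unfolding x(1) z(1) using x(2) ennreal_le_iff[of "1/2 * x" z] by simp
  ultimately have "x / 2 \<le> y" by simp
  then have "ennreal x / 2 \<le> ennreal y" using ennreal_leI[of "x/2" y] x(2) by (simp add: divide_ennreal[symmetric] flip: ennreal_numeral)
  then show ?thesis unfolding x(1) using y(1) by (simp add: P_def)
qed

lemma block_far:
  assumes "\<delta> > 0"
  shows "\<forall>\<^sub>F K in sequentially. \<forall>F. finite F \<and> F \<inter> J K = {} \<longrightarrow> (\<forall>j\<in>F. 6 / \<delta> \<le> lam j) \<and> (\<Sum>j\<in>F. 1 / (lam j)\<^sup>2) \<le> \<delta>\<^sup>2 / 18"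
proof -
  have pw: "filterlim (\<lambda>L::nat. (2::real) ^ L) at_top sequentially"
    by (rule filterlim_at_infinity_imp_filterlim_at_top[OF filterlim_realpow_sequentially_gt1]) auto
  have "(\<lambda>K. rate (2 ^ K)) \<longlonglongrightarrow> 0" by (rule filterlim_compose[OF rate_tendsto pw])
  then have e1: "\<forall>\<^sub>F K in sequentially. rate (2 ^ K) < 16 * (\<delta>\<^sup>2 / 18)" using assms by (intro order_tendstoD(2)) auto
  have e2: "\<forall>\<^sub>F K in sequentially. 6 / \<delta> \<le> 2 ^ K" using pw by (simp add: filterlim_at_top)
  show ?thesis using e1 e2
  proof eventually_elim
    case (elim K)
    have "(\<forall>j\<in>F. 6 / \<delta> \<le> lam j) \<and> (\<Sum>j\<in>F. 1 / (lam j)\<^sup>2) \<le> \<delta>\<^sup>2 / 18" if F: "finite F" "F \<inter> J K = {}" for F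
    proof
      have Fl: "2 ^ K \<le> lam j" if "j \<in> F" for j using F(2) that by (auto simp: J_def disjoint_iff not_le)
      show "\<forall>j\<in>F. 6 / \<delta> \<le> lam j" using Fl elim(2) by force
      have "(\<Sum>j\<in>F. 1 / (lam j)\<^sup>2) \<le> S1 * (2 ^ K) powr (- (1 - b))" by (rule sum_inverse_square_high[OF F(1) _ Fl]) simp
      then show "(\<Sum>j\<in>F. 1 / (lam j)\<^sup>2) \<le> \<delta>\<^sup>2 / 18" using elim(1) by (simp add: rate_def)
    qed
    then show ?case by blast
  qed
qed

text \<open>The functional \<M> is only known as a limit in probability, so both conditions are
  checked on a truncation at 2^L, with L chosen after everything else.\<close>

lemma renormalised_gibbs:
  assumes lim: "L2_limit \<mu> (truncated_mass lam \<mu>) \<M>" and m: "m > 0"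
  shows "in_L1_ennreal \<mu> (focusing_weight e {\<alpha>. \<bar>\<M> \<alpha>\<bar> \<le> m}) \<and> gibbs_well_defined \<mu> (focusing_weight e {\<alpha>. \<bar>\<M> \<alpha>\<bar> \<le> m})"
proof -
  have [measurable]: "\<M> \<in> borel_measurable \<mu>" using lim unfolding L2_limit_def in_L2_real_def by auto
  let ?A = "{\<alpha>. \<bar>\<M> \<alpha>\<bar> \<le> m}"
  have Asp: "?A \<inter> space \<mu> = {\<alpha>\<in>space \<mu>. \<bar>\<M> \<alpha>\<bar> \<le> m}" by auto
  have A: "?A \<inter> space \<mu> \<in> sets \<mu>" unfolding Asp by measurable
  \<comment> \<open>Large enough for the block mass tail and for the lower tail of the renormalised
    mass, with m + 1 \<le> H/2 - S1 left for the deviation argument below.\<close>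
  define H where "H = 8 * S1 + 2 * m + 4"
  have H: "H \<ge> 1" "H \<ge> 8 * S1 + 2" "H \<ge> 4 + 2 * S1" "m + 1 \<le> H / 2 - S1"
    using m S1_nonneg unfolding H_def by (simp_all add: field_simps)
  show ?thesis
  proof (rule focusing_gibbs[OF H(1,2) A])
    show "0 < emeasure \<mu> (?A \<inter> space \<mu>)"
    proof -
      \<comment> \<open>One third each for the renormalised mass of \<open>J K\<close>, for that of
        the modes between K and L, and for the distance of the truncation from \<M>.\<close>
      let ?d = "m / 3"
      have "\<forall>\<^sub>F K in sequentially. \<forall>F. finite F \<and> F \<inter> J K = {} \<longrightarrow> (\<forall>j\<in>F. 6 / ?d \<le> lam j) \<and> (\<Sum>j\<in>F. 1 / (lam j)\<^sup>2) \<le> ?d\<^sup>2 / 18"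
        using m by (intro block_far) simp
      then obtain K where K: "\<And>F. finite F \<Longrightarrow> F \<inter> J K = {} \<Longrightarrow> (\<forall>j\<in>F. 6 / ?d \<le> lam j) \<and> (\<Sum>j\<in>F. 1 / (lam j)\<^sup>2) \<le> ?d\<^sup>2 / 18"
        unfolding eventually_sequentially by (meson order_refl)
      define \<eta> where "\<eta> = ?d / (real (card (J K)) + 1)"
      have eta: "\<eta> > 0" using m by (simp add: \<eta>_def add_nonneg_pos)
      \<comment> \<open>Annuli around the mean square value: the coordinates must nearly cancel
        their own renormalisation, with the error \<eta> shared among all modes of
        \<open>J K\<close>.\<close>
      define B where "B j = {z::complex. \<bar>(cmod z)\<^sup>2 - 1 / lam j\<bar> < \<eta>}" for j
      have B: "open (B j) \<and> B j \<noteq> {}" for j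
      proof
        show "open (B j)" unfolding B_def by (intro open_Collect_less continuous_intros)
        have "of_real (sqrt (1 / lam j)) \<in> B j" using eta lam_pos[of j] by (simp add: B_def)
        then show "B j \<noteq> {}" by blast
      qed
      let ?p = "\<Prod>j\<in>J K. emeasure (cgauss (lam j)) (B j)"
      have p0: "0 < ?p" by (rule coord_event_pos) (use B in auto)
      have "0 < ?p / 2" using p0 by (simp add: ennreal_zero_less_divide)
      then have "\<forall>\<^sub>F L in sequentially. emeasure \<mu> {\<alpha>\<in>space \<mu>. ?d < \<bar>renorm (J L) \<alpha> - \<M> \<alpha>\<bar>} < ?p / 2"
        using m by (intro order_tendstoD(2)[OF L2_limit_in_probability[OF lim]]) auto
      \<comment> \<open>The lower bound \<open>?p / 2\<close> for the product event is the same for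
        all L, so L can be taken large enough for the exceptional event to be smaller.\<close>
      then obtain L where L: "L \<ge> K" "emeasure \<mu> {\<alpha>\<in>space \<mu>. ?d < \<bar>renorm (J L) \<alpha> - \<M> \<alpha>\<bar>} < ?p / 2"
        using eventually_happens'[OF sequentially_bot eventually_conj[OF eventually_ge_at_top[of K]]] by blast
      let ?P = "{\<alpha>\<in>space \<mu>. (\<forall>j\<in>J K. \<alpha> j \<in> B j) \<and> \<bar>renorm (J L - J K) \<alpha>\<bar> \<le> ?d}"
      let ?N = "{\<alpha>\<in>space \<mu>. ?d < \<bar>renorm (J L) \<alpha> - \<M> \<alpha>\<bar>}"
      have "?p / 2 \<le> emeasure \<mu> ?P"
        using K[of "J L - J K"] m B by (intro product_event) auto
      also have "\<dots> \<le> emeasure \<mu> ((?A \<inter> space \<mu>) \<union> ?N)"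
      proof (rule emeasure_mono)
        show "?P \<subseteq> (?A \<inter> space \<mu>) \<union> ?N"
        proof
          fix \<alpha> assume P: "\<alpha> \<in> ?P"
          have "\<bar>renorm (J K) \<alpha>\<bar> \<le> (\<Sum>j\<in>J K. \<eta>)"
            unfolding renorm_def using P by (intro order_trans[OF sum_abs] sum_mono) (auto simp: B_def less_imp_le)
          also have "\<dots> \<le> ?d" using m by (simp add: \<eta>_def field_simps)
          finally have "\<bar>renorm (J K) \<alpha>\<bar> \<le> ?d" .
          moreover have "renorm (J L) \<alpha> = renorm (J K) \<alpha> + renorm (J L - J K) \<alpha>"
            using renorm_diff[OF J_finite J_mono[OF L(1)], of \<alpha>] by simp
          moreover have "\<bar>renorm (J L - J K) \<alpha>\<bar> \<le> ?d" using P by simp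
          moreover have "\<bar>renorm (J L) \<alpha> - \<M> \<alpha>\<bar> \<le> ?d" if "\<alpha> \<notin> ?N" using P that by simp
          ultimately have "\<bar>\<M> \<alpha>\<bar> \<le> m" if "\<alpha> \<notin> ?N" using that by linarith
          then show "\<alpha> \<in> (?A \<inter> space \<mu>) \<union> ?N" using P by auto
        qed
      qed (use A in measurable)
      also have "\<dots> \<le> emeasure \<mu> (?A \<inter> space \<mu>) + emeasure \<mu> ?N" by (rule emeasure_subadditive[OF A]) measurable
      finally have le: "?p / 2 \<le> emeasure \<mu> (?A \<inter> space \<mu>) + emeasure \<mu> ?N" .
      show ?thesis
      proof (rule ccontr)
        assume "\<not> ?thesis"
        then have "emeasure \<mu> (?A \<inter> space \<mu>) = 0" by simp
        then show False using le L(2) by simp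
      qed
    qed
    show "\<forall>\<^sub>F K in sequentially. emeasure \<mu> {\<alpha>\<in>?A \<inter> space \<mu>. H * 2 powr (real K * b) < mass (J K) \<alpha>} \<le> ennreal (exp (- (4 * level H K)))"
      using level_eventually_le[of H]
    proof eventually_elim
      case (elim K)
      let ?X = "2 powr (real K * b)"
      have X1: "1 \<le> ?X" using b by (intro ge_one_powr_ge_zero) auto
      let ?C = "{\<alpha>\<in>?A \<inter> space \<mu>. H * ?X < mass (J K) \<alpha>}"
      \<comment> \<open>The truncation index L depends on \<epsilon>, which absorbs the probability
        that the truncated renormalised mass is not close to \<M>.\<close>
      show ?case
      proof (rule ennreal_le_epsilon)
        fix \<epsilon> :: real assume e: "0 < \<epsilon>"
        have "\<forall>\<^sub>F L in sequentially. emeasure \<mu> {\<alpha>\<in>space \<mu>. 1 < \<bar>renorm (J L) \<alpha> - \<M> \<alpha>\<bar>} < ennreal \<epsilon>"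
          using e by (intro order_tendstoD(2)[OF L2_limit_in_probability[OF lim]]) auto
        then obtain L where L: "L \<ge> K" "emeasure \<mu> {\<alpha>\<in>space \<mu>. 1 < \<bar>renorm (J L) \<alpha> - \<M> \<alpha>\<bar>} < ennreal \<epsilon>"
          using eventually_happens'[OF sequentially_bot eventually_conj[OF eventually_ge_at_top[of K]]] by blast
        let ?N = "{\<alpha>\<in>space \<mu>. 1 < \<bar>renorm (J L) \<alpha> - \<M> \<alpha>\<bar>}"
        let ?R = "{\<alpha>\<in>space \<mu>. renorm (J L - J K) \<alpha> \<le> - (H / 2 * ?X)}"
        have "emeasure \<mu> ?C \<le> emeasure \<mu> (?R \<union> ?N)"
        proof (rule emeasure_mono)
          show "?C \<subseteq> ?R \<union> ?N"
          proof
            fix \<alpha> assume C: "\<alpha> \<in> ?C"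
            \<comment> \<open>Too much low mass makes the renormalised mass of \<open>J K\<close> at
              least (H - S1) X, while that of \<open>J L\<close> is at most m + 1 on the cut-off
              event; the modes in between must compensate by a large negative amount.\<close>
            have "renorm (J L - J K) \<alpha> \<le> - (H / 2 * ?X)" if "\<alpha> \<notin> ?N"
            proof -
              have r: "renorm (J L - J K) \<alpha> = renorm (J L) \<alpha> - renorm (J K) \<alpha>"
                by (rule renorm_diff[OF J_finite J_mono[OF L(1)]])
              have "(\<Sum>j\<in>J K. 1 / lam j) \<le> S1 * (2 ^ K) powr b" by (rule sum_inverse_low) (auto simp: J_le)
              then have "(\<Sum>j\<in>J K. 1 / lam j) \<le> S1 * ?X" by (simp add: two_pow_powr)
              then have "renorm (J K) \<alpha> \<ge> H * ?X - S1 * ?X" using C by (simp add: renorm_mass)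
              moreover have "renorm (J L) \<alpha> \<le> m + 1" using C that by auto
              moreover have "(m + 1) * 1 \<le> (H / 2 - S1) * ?X" using H(4) X1 m by (intro mult_mono) auto
              ultimately show ?thesis unfolding r by (simp add: algebra_simps)
            qed
            then show "\<alpha> \<in> ?R \<union> ?N" using C by auto
          qed
        qed measurable
        also have "\<dots> \<le> emeasure \<mu> ?R + emeasure \<mu> ?N" by (rule emeasure_subadditive) measurable
        also have "\<dots> \<le> ennreal (exp (- (2 powr (real K * (1 + b))))) + ennreal \<epsilon>"
          by (intro add_mono renorm_lower_tail H(3) less_imp_le[OF L(2)])
        also have "\<dots> \<le> ennreal (exp (- (4 * level H K))) + ennreal \<epsilon>" using elim by (intro add_right_mono ennreal_leI) auto
        finally show "emeasure \<mu> ?C \<le> ennreal (exp (- (4 * level H K))) + ennreal \<epsilon>" .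
      qed
    qed
  qed
qed

section \<open>Mass of the coefficients and the integral of the squared modulus\<close>

lemma low_mass: "(\<integral>\<^sup>+x. ennreal (cmod (comb F \<alpha> x) ^ 2) \<partial>lborel) = ennreal (mass F \<alpha>)" if "finite F"
  using comb_norm[OF that, of \<alpha>] by (subst nn_integral_eq_integral) (auto simp: mass_def)

lemma int_pow_2_le:
  assumes \<alpha>: "\<alpha> \<in> Hspace lam \<theta>" and reg: "regular \<alpha>" and m: "\<And>L. mass (J L) \<alpha> \<le> m"
  shows "int_pow e 2 \<alpha> \<le> ennreal m"
proof -
  obtain f where f: "represents \<alpha> f" "locL1 (\<lambda>k. low k \<alpha>) f" using regular_represents[OF \<alpha> reg] by blast
  have "int_pow e 2 \<alpha> = (\<integral>\<^sup>+x. ennreal (cmod (f x) ^ 2) \<partial>lborel)"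
    using int_pow_represents[OF \<alpha> e_measurable e_AE f(1), of 1] by simp
  also have "\<dots> \<le> ennreal m"
  proof (rule locL1_Fatou[OF f(2) low_loc_int])
    show "loc_int f" using f(1) unfolding represents_def by blast
    show "\<forall>\<^sub>F k in sequentially. (\<integral>\<^sup>+x. ennreal (cmod (low k \<alpha> x) ^ 2) \<partial>lborel) \<le> ennreal m"
      unfolding low_def by (intro always_eventually allI) (simp only: low_mass[OF J_finite] ennreal_leI m)
  qed
  finally show ?thesis .
qed

text \<open>The distance of the function from its partial sums is bounded by the tail of the
  coefficient series, which tends to 0. The factor 2 comes from the elementary square inequality and
  is harmless, since H may be chosen at least 2 m.\<close>

lemma mass_le_int_pow_2:
  assumes \<alpha>: "\<alpha> \<in> Hspace lam \<theta>" and reg: "regular \<alpha>" and sm: "summable (\<lambda>j. (cmod (\<alpha> j))\<^sup>2)"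
  shows "ennreal (mass (J K) \<alpha>) \<le> 2 * int_pow e 2 \<alpha>"
proof -
  obtain f where f: "represents \<alpha> f" "locL1 (\<lambda>k. low k \<alpha>) f" using regular_represents[OF \<alpha> reg] by blast
  have lf: "loc_int f" using f(1) unfolding represents_def by blast
  note [measurable] = loc_int_measurable[OF lf]
  define t where "t k = (\<Sum>j. (cmod (\<alpha> j))\<^sup>2) - mass (J k) \<alpha>" for k
  have mass_le: "mass F \<alpha> \<le> (\<Sum>j. (cmod (\<alpha> j))\<^sup>2)" if "finite F" for F
    unfolding mass_def using that by (intro sum_le_suminf sm) auto
  have t0: "t \<longlonglongrightarrow> 0"
  proof -
    have "((\<lambda>j. (cmod (\<alpha> j))\<^sup>2) has_sum (\<Sum>j. (cmod (\<alpha> j))\<^sup>2)) UNIV"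
      using sm by (intro norm_summable_imp_has_sum summable_sums) auto
    then have "(\<lambda>k. mass (J k) \<alpha>) \<longlonglongrightarrow> (\<Sum>j. (cmod (\<alpha> j))\<^sup>2)"
      unfolding has_sum_def mass_def by (rule filterlim_compose[OF _ J_exhaust])
    then have "(\<lambda>k. (\<Sum>j. (cmod (\<alpha> j))\<^sup>2) - mass (J k) \<alpha>) \<longlonglongrightarrow> (\<Sum>j. (cmod (\<alpha> j))\<^sup>2) - (\<Sum>j. (cmod (\<alpha> j))\<^sup>2)" by (intro tendsto_intros)
    then show ?thesis by (simp add: t_def[abs_def])
  qed
  have err: "(\<integral>\<^sup>+x. ennreal (cmod (f x - low k \<alpha> x) ^ 2) \<partial>lborel) \<le> ennreal (t k)" for k
  proof (rule locL1_Fatou)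
    show "locL1 (\<lambda>l x. low l \<alpha> x - low k \<alpha> x) (\<lambda>x. f x - low k \<alpha> x)" using f(2) by (simp add: locL1_def)
    show "loc_int (\<lambda>x. low l \<alpha> x - low k \<alpha> x)" for l
      unfolding low_def by (intro continuous_loc_int continuous_intros comb_cont)
    show "loc_int (\<lambda>x. f x - low k \<alpha> x)" using lf low_loc_int[of k \<alpha>] unfolding loc_int_def by (auto intro: set_integral_diff)
    show "\<forall>\<^sub>F l in sequentially. (\<integral>\<^sup>+x. ennreal (cmod (low l \<alpha> x - low k \<alpha> x) ^ 2) \<partial>lborel) \<le> ennreal (t k)"
      using eventually_ge_at_top[of k]
    proof eventually_elim
      case (elim l)
      have sub: "J k \<subseteq> J l" by (rule J_mono[OF elim])
      have "low l \<alpha> x - low k \<alpha> x = comb (J l - J k) \<alpha> x" for x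
        unfolding low_def comb_def by (rule sum_diff[symmetric]) (use sub in auto)
      then have "(\<integral>\<^sup>+x. ennreal (cmod (low l \<alpha> x - low k \<alpha> x) ^ 2) \<partial>lborel) = ennreal (mass (J l - J k) \<alpha>)"
        by (simp only: low_mass[OF finite_Diff[OF J_finite]])
      also have "mass (J l - J k) \<alpha> = mass (J l) \<alpha> - mass (J k) \<alpha>" unfolding mass_def by (rule sum_diff) (use sub in auto)
      also have "\<dots> \<le> t k" using mass_le[OF J_finite, of l] by (simp add: t_def)
      finally show ?case by (simp add: ennreal_leI)
    qed
  qed
  let ?a = "\<integral>\<^sup>+x. ennreal (cmod (f x) ^ 2) \<partial>lborel"
  have "ennreal (mass (J k) \<alpha>) \<le> 2 * ?a + 2 * ennreal (t k)" for k
  proof -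
    have sq: "cmod w ^ 2 \<le> 2 * cmod z ^ 2 + 2 * cmod (z - w) ^ 2" for w z :: complex
    proof -
      have "cmod w \<le> cmod z + cmod (z - w)" using norm_triangle_ineq4[of z "z - w"] by simp
      then have "cmod w ^ 2 \<le> (cmod z + cmod (z - w)) ^ 2" by (intro power_mono) auto
      also have "\<dots> \<le> 2 * cmod z ^ 2 + 2 * cmod (z - w) ^ 2"
        using zero_le_power2[of "cmod z - cmod (z - w)"] by (simp add: power2_eq_square algebra_simps)
      finally show ?thesis .
    qed
    have "ennreal (mass (J k) \<alpha>) = (\<integral>\<^sup>+x. ennreal (cmod (low k \<alpha> x) ^ 2) \<partial>lborel)" unfolding low_def by (rule low_mass[symmetric]) simp
    also have "\<dots> \<le> (\<integral>\<^sup>+x. 2 * ennreal (cmod (f x) ^ 2) + 2 * ennreal (cmod (f x - low k \<alpha> x) ^ 2) \<partial>lborel)"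
    proof (intro nn_integral_mono)
      fix x
      have "ennreal (cmod (low k \<alpha> x) ^ 2) \<le> ennreal (2 * cmod (f x) ^ 2 + 2 * cmod (f x - low k \<alpha> x) ^ 2)" by (rule ennreal_leI[OF sq])
      also have "\<dots> = 2 * ennreal (cmod (f x) ^ 2) + 2 * ennreal (cmod (f x - low k \<alpha> x) ^ 2)"
        by (subst ennreal_plus) (auto simp: ennreal_mult')
      finally show "ennreal (cmod (low k \<alpha> x) ^ 2) \<le> 2 * ennreal (cmod (f x) ^ 2) + 2 * ennreal (cmod (f x - low k \<alpha> x) ^ 2)" .
    qed
    also have "\<dots> = 2 * ?a + 2 * (\<integral>\<^sup>+x. ennreal (cmod (f x - low k \<alpha> x) ^ 2) \<partial>lborel)"
      by (subst nn_integral_add) (auto simp: nn_integral_cmult)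
    also have "\<dots> \<le> 2 * ?a + 2 * ennreal (t k)" by (intro add_left_mono mult_left_mono err) auto
    finally show ?thesis .
  qed
  moreover have "ennreal (mass (J K) \<alpha>) \<le> ennreal (mass (J k) \<alpha>)" if "k \<ge> K" for k
    unfolding mass_def by (intro ennreal_leI sum_mono2 J_mono that) auto
  ultimately have "\<forall>k\<ge>K. ennreal (mass (J K) \<alpha>) \<le> 2 * ?a + 2 * ennreal (t k)" by (meson order_trans)
  moreover have "(\<lambda>k. 2 * ?a + 2 * ennreal (t k)) \<longlonglongrightarrow> 2 * ?a + 2 * ennreal 0"
    by (intro tendsto_add tendsto_const ennreal_tendsto_cmult tendsto_ennrealI t0) auto
  ultimately have "ennreal (mass (J K) \<alpha>) \<le> 2 * ?a + 2 * ennreal 0" by (intro LIMSEQ_le_const) auto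
  also have "\<dots> = 2 * int_pow e 2 \<alpha>"
    using int_pow_represents[OF \<alpha> e_measurable e_AE f(1), of 1] by simp
  finally show ?thesis .
qed

text \<open>For b = 0 the expected total mass is finite, so almost every sequence is square summable
  and the cut-off bounds every partial mass. The exceptional low mass event is then null.\<close>

lemma focusing_gibbs_mass:
  assumes b0: "b = 0" and m: "m > 0"
  shows "in_L1_ennreal \<mu> (focusing_weight e {\<alpha>. int_pow e 2 \<alpha> \<le> ennreal m}) \<and>
    gibbs_well_defined \<mu> (focusing_weight e {\<alpha>. int_pow e 2 \<alpha> \<le> ennreal m})"
proof -
  have sl: "summable (\<lambda>j. 1 / lam j)"
    using lam_sum lam_pos unfolding b0 by (simp add: powr_minus_divide abs_of_pos)
  let ?A = "{\<alpha>. int_pow e 2 \<alpha> \<le> ennreal m}"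
  have Asp: "?A \<inter> space \<mu> = {\<alpha>\<in>space \<mu>. int_pow e 2 \<alpha> \<le> ennreal m}" by auto
  have A: "?A \<inter> space \<mu> \<in> sets \<mu>" unfolding Asp by measurable
  define H where "H = 8 * S1 + 2 * m + 2"
  have H: "H \<ge> 1" "H \<ge> 8 * S1 + 2" "H \<ge> 2 * m" using m S1_nonneg by (auto simp: H_def)
  show ?thesis
  proof (rule focusing_gibbs[OF H(1,2) A])
    have AEs: "AE \<alpha> in \<mu>. summable (\<lambda>j. (cmod (\<alpha> j))\<^sup>2)"
    proof -
      have "(\<integral>\<^sup>+\<alpha>. ennreal ((cmod (\<alpha> j))\<^sup>2) \<partial>\<mu>) = ennreal (1 / lam j)" for j
        using nn_integral_eq_integral[OF mean_square(1)] mean_square(2) by simp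
      then have "(\<integral>\<^sup>+\<alpha>. (\<Sum>j. ennreal ((cmod (\<alpha> j))\<^sup>2)) \<partial>\<mu>) = (\<Sum>j. ennreal (1 / lam j))"
        by (subst nn_integral_suminf) auto
      also have "\<dots> < \<infinity>" using sl lam_pos by (subst suminf_ennreal2) (auto intro: less_imp_le)
      finally have "AE \<alpha> in \<mu>. (\<Sum>j. ennreal ((cmod (\<alpha> j))\<^sup>2)) \<noteq> \<infinity>" by (intro nn_integral_PInf_AE) auto
      then show ?thesis by eventually_elim (auto intro!: summable_suminf_not_top)
    qed
    have "emeasure \<mu> {\<alpha>\<in>?A \<inter> space \<mu>. H * 2 powr (real K * b) < mass (J K) \<alpha>} = 0" for K
    proof -
      have "AE \<alpha> in \<mu>. \<alpha> \<notin> {\<alpha>\<in>?A \<inter> space \<mu>. H * 2 powr (real K * b) < mass (J K) \<alpha>}"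
        using AEs AE_regular AE_space
      proof eventually_elim
        case (elim \<alpha>)
        have "mass (J K) \<alpha> \<le> H" if "int_pow e 2 \<alpha> \<le> ennreal m"
        proof -
          have "ennreal (mass (J K) \<alpha>) \<le> 2 * int_pow e 2 \<alpha>" using elim space_\<mu> by (intro mass_le_int_pow_2) auto
          also have "\<dots> \<le> 2 * ennreal m" by (intro mult_left_mono that) auto
          also have "\<dots> = ennreal (2 * m)" using m by (simp add: ennreal_mult')
          finally show ?thesis using m H(3) by (simp add: ennreal_le_iff)
        qed
        then show ?case by (auto simp: b0)
      qed
      moreover have "{\<alpha>\<in>?A \<inter> space \<mu>. H * 2 powr (real K * b) < mass (J K) \<alpha>} \<in> sets \<mu>"
      proof -
        have "{\<alpha>\<in>?A \<inter> space \<mu>. H * 2 powr (real K * b) < mass (J K) \<alpha>} = (?A \<inter> space \<mu>) \<inter> {\<alpha>\<in>space \<mu>. H * 2 powr (real K * b) < mass (J K) \<alpha>}" by auto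
        then show ?thesis using A by simp
      qed
      ultimately show ?thesis by (subst (asm) AE_iff_null_sets[symmetric]) auto
    qed
    then show "\<forall>\<^sub>F K in sequentially. emeasure \<mu> {\<alpha>\<in>?A \<inter> space \<mu>. H * 2 powr (real K * b) < mass (J K) \<alpha>} \<le> ennreal (exp (- (4 * level H K)))"
      by simp
    show "0 < emeasure \<mu> (?A \<inter> space \<mu>)"
    proof -
      \<comment> \<open>One third each for the mass of \<open>J K\<close>, for the renormalised mass
        of the remaining modes and for their expected mass, which is part of the tail of a
        convergent series.\<close>
      let ?d = "m / 3"
      have "((\<lambda>j. 1 / lam j) has_sum (\<Sum>j. 1 / lam j)) UNIV"
        using sl lam_pos by (intro norm_summable_imp_has_sum summable_sums) (auto simp: abs_of_pos)
      then have "(\<lambda>k. \<Sum>j\<in>J k. 1 / lam j) \<longlonglongrightarrow> (\<Sum>j. 1 / lam j)"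
        unfolding has_sum_def by (rule filterlim_compose[OF _ J_exhaust])
      then have "\<forall>\<^sub>F K in sequentially. (\<Sum>j. 1 / lam j) - ?d < (\<Sum>j\<in>J K. 1 / lam j)"
        using m by (intro order_tendstoD(1)) auto
      moreover have "\<forall>\<^sub>F K in sequentially. \<forall>F. finite F \<and> F \<inter> J K = {} \<longrightarrow> (\<forall>j\<in>F. 6 / ?d \<le> lam j) \<and> (\<Sum>j\<in>F. 1 / (lam j)\<^sup>2) \<le> ?d\<^sup>2 / 18"
        using m by (intro block_far) auto
      ultimately have "\<forall>\<^sub>F K in sequentially. (\<Sum>j. 1 / lam j) - ?d < (\<Sum>j\<in>J K. 1 / lam j) \<and>
        (\<forall>F. finite F \<and> F \<inter> J K = {} \<longrightarrow> (\<forall>j\<in>F. 6 / ?d \<le> lam j) \<and> (\<Sum>j\<in>F. 1 / (lam j)\<^sup>2) \<le> ?d\<^sup>2 / 18)" by (rule eventually_conj)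
      then obtain K where K1: "(\<Sum>j. 1 / lam j) - ?d < (\<Sum>j\<in>J K. 1 / lam j)"
        and K: "\<And>F. finite F \<Longrightarrow> F \<inter> J K = {} \<Longrightarrow> (\<forall>j\<in>F. 6 / ?d \<le> lam j) \<and> (\<Sum>j\<in>F. 1 / (lam j)\<^sup>2) \<le> ?d\<^sup>2 / 18"
        unfolding eventually_sequentially by auto
      define \<eta> where "\<eta> = ?d / (real (card (J K)) + 1)"
      have eta: "\<eta> > 0" using m by (simp add: \<eta>_def add_nonneg_pos)
      define B where "B j = {z::complex. (cmod z)\<^sup>2 < \<eta>}" for j :: nat
      have B: "open (B j) \<and> B j \<noteq> {}" for j
      proof
        show "open (B j)" unfolding B_def by (intro open_Collect_less continuous_intros)
        have "0 \<in> B j" using eta by (simp add: B_def)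
        then show "B j \<noteq> {}" by blast
      qed
      let ?p = "\<Prod>j\<in>J K. emeasure (cgauss (lam j)) (B j)"
      have p0: "0 < ?p" by (rule coord_event_pos) (use B in auto)
      \<comment> \<open>Truncated versions of the cut-off event. They decrease in n and have
        probability at least \<open>?p / 2\<close> for every n, so continuity from above keeps the
        bound for their intersection.\<close>
      define S where "S n = {\<alpha>\<in>space \<mu>. mass (J (K + n)) \<alpha> \<le> m}" for n
      have Ss [measurable]: "S n \<in> sets \<mu>" for n unfolding S_def by measurable
      have Sp: "?p / 2 \<le> emeasure \<mu> (S n)" for n
      proof -
        let ?F = "J (K + n) - J K"
        have "?p / 2 \<le> emeasure \<mu> {\<alpha>\<in>space \<mu>. (\<forall>j\<in>J K. \<alpha> j \<in> B j) \<and> \<bar>renorm ?F \<alpha>\<bar> \<le> ?d}"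
          using K[of ?F] m B by (intro product_event) auto
        also have "\<dots> \<le> emeasure \<mu> (S n)"
        proof (rule emeasure_mono)
          show "{\<alpha>\<in>space \<mu>. (\<forall>j\<in>J K. \<alpha> j \<in> B j) \<and> \<bar>renorm ?F \<alpha>\<bar> \<le> ?d} \<subseteq> S n"
          proof
            fix \<alpha> assume P: "\<alpha> \<in> {\<alpha>\<in>space \<mu>. (\<forall>j\<in>J K. \<alpha> j \<in> B j) \<and> \<bar>renorm ?F \<alpha>\<bar> \<le> ?d}"
            have "mass (J K) \<alpha> \<le> (\<Sum>j\<in>J K. \<eta>)"
              unfolding mass_def using P by (intro sum_mono) (auto simp: B_def less_imp_le)
            also have "\<dots> \<le> ?d" using m by (simp add: \<eta>_def field_simps)
            finally have 1: "mass (J K) \<alpha> \<le> ?d" .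
            have sub: "J K \<subseteq> J (K + n)" by (rule J_mono) simp
            have "(\<Sum>j\<in>?F. 1 / lam j) = (\<Sum>j\<in>J (K + n). 1 / lam j) - (\<Sum>j\<in>J K. 1 / lam j)" by (rule sum_diff) (use sub in auto)
            also have "(\<Sum>j\<in>J (K + n). 1 / lam j) \<le> (\<Sum>j. 1 / lam j)" using lam_pos by (intro sum_le_suminf sl) (auto intro: less_imp_le)
            finally have 2: "(\<Sum>j\<in>?F. 1 / lam j) \<le> ?d" using K1 by linarith
            have "mass (J (K + n)) \<alpha> = mass (J K) \<alpha> + mass ?F \<alpha>"
              unfolding mass_def using sum.subset_diff[OF sub J_finite] by (simp add: add.commute)
            moreover have "mass ?F \<alpha> = renorm ?F \<alpha> + (\<Sum>j\<in>?F. 1 / lam j)" by (simp add: renorm_mass)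
            moreover have "renorm ?F \<alpha> \<le> ?d" using P by auto
            ultimately have "mass (J (K + n)) \<alpha> \<le> ?d + (?d + ?d)" using 1 2 by linarith
            then show "\<alpha> \<in> S n" using P by (simp add: S_def)
          qed
        qed measurable
        finally show ?thesis .
      qed
      have dec: "decseq S"
        unfolding decseq_def
      proof (intro allI impI subsetI)
        fix n n' \<alpha> assume "n \<le> n'" "\<alpha> \<in> S n'"
        moreover have "mass (J (K + n)) \<alpha> \<le> mass (J (K + n')) \<alpha>"
          unfolding mass_def by (intro sum_mono2 J_mono) (use \<open>n \<le> n'\<close> in auto)
        ultimately show "\<alpha> \<in> S n" by (auto simp: S_def)
      qed
      have "?p / 2 \<le> (INF n. emeasure \<mu> (S n))" by (intro INF_greatest Sp)
      also have "\<dots> = emeasure \<mu> (\<Inter>n. S n)" by (rule INF_emeasure_decseq) (use dec in auto)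
      also have "\<dots> \<le> emeasure \<mu> (?A \<inter> space \<mu>)"
      proof (rule emeasure_mono_AE[OF _ A])
        show "AE \<alpha> in \<mu>. \<alpha> \<in> (\<Inter>n. S n) \<longrightarrow> \<alpha> \<in> ?A \<inter> space \<mu>"
          using AE_regular AE_space
        proof eventually_elim
          case (elim \<alpha>)
          show ?case
          proof
            assume "\<alpha> \<in> (\<Inter>n. S n)"
            then have "mass (J (K + n)) \<alpha> \<le> m" for n by (auto simp: S_def)
            moreover have "mass (J L) \<alpha> \<le> mass (J (K + L)) \<alpha>" for L unfolding mass_def by (intro sum_mono2 J_mono) auto
            ultimately have "mass (J L) \<alpha> \<le> m" for L using order_trans by blast
            then have "int_pow e 2 \<alpha> \<le> ennreal m" using elim space_\<mu> by (intro int_pow_2_le) auto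
            then show "\<alpha> \<in> ?A \<inter> space \<mu>" using elim by auto
          qed
        qed
      qed
      finally have "?p / 2 \<le> emeasure \<mu> (?A \<inter> space \<mu>)" .
      moreover have "0 < ?p / 2" using p0 by (simp add: ennreal_zero_less_divide)
      ultimately show ?thesis by (rule less_le_trans[rotated])
    qed
  qed
qed

end

theorem proposition2p2:
  fixes s \<theta> :: real
    and V :: "real \<Rightarrow> real"
    and lam :: "nat \<Rightarrow> real"
    and e :: "nat \<Rightarrow> real \<Rightarrow> complex"
    and \<mu>0 :: "(nat \<Rightarrow> complex) measure"
  assumes "1 < s"
    and "admissible s V"
    and "eigenbasis V lam e"
    and "\<theta> < 1/2 - 1/s"
    and "gaussian_measure lam \<theta> \<mu>0"
  shows "(in_L1_ennreal \<mu>0 (defocusing_weight e) \<and> gibbs_well_defined \<mu>0 (defocusing_weight e))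
    \<and> (2 < s \<longrightarrow> (\<forall>m::real. 0 < m \<longrightarrow>
         in_L1_ennreal \<mu>0 (focusing_weight e {\<alpha>. int_pow e 2 \<alpha> \<le> ennreal m}) \<and>
         gibbs_well_defined \<mu>0 (focusing_weight e {\<alpha>. int_pow e 2 \<alpha> \<le> ennreal m})))
    \<and> (s \<le> 2 \<longrightarrow>
         L2_Cauchy_from \<mu>0 (lam 0) (truncated_mass lam \<mu>0) \<and>
         (\<exists>\<M>. L2_limit \<mu>0 (truncated_mass lam \<mu>0) \<M>) \<and>
         (8/5 < s \<longrightarrow> (\<forall>\<M>. L2_limit \<mu>0 (truncated_mass lam \<mu>0) \<M> \<longrightarrow> (\<forall>m::real. 0 < m \<longrightarrow>
            in_L1_ennreal \<mu>0 (focusing_weight e {\<alpha>. \<bar>\<M> \<alpha>\<bar> \<le> m}) \<and>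
            gibbs_well_defined \<mu>0 (focusing_weight e {\<alpha>. \<bar>\<M> \<alpha>\<bar> \<le> m})))))"
proof -
  note s = \<open>1 < s\<close>
  have V: "smooth_fun V" "\<And>x. 0 \<le> V x" using \<open>admissible s V\<close> unfolding admissible_def by auto
  obtain C where C: "C \<ge> 1" "\<And>x. 1 \<le> \<bar>x\<bar> \<Longrightarrow> 1 / C * jb x powr s \<le> V x"
    using \<open>admissible s V\<close> unfolding admissible_def by blast
  have growth: "\<bar>x\<bar> powr s / C \<le> V x" if "1 \<le> \<bar>x\<bar>" for x
  proof -
    have "\<bar>x\<bar> \<le> jb x" unfolding jb_def by (rule real_le_rsqrt) simp
    then have "\<bar>x\<bar> powr s / C \<le> jb x powr s / C" using s C(1) by (intro divide_right_mono powr_mono2) auto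
    then show ?thesis using C(2)[OF that] by simp
  qed
  obtain E E' where "classical_eigenbasis V lam E E'" and eE: "\<And>j. AE x in lborel. e j x = E j x"
    using eigenbasis_classical[OF V \<open>eigenbasis V lam e\<close>] by blast
  then interpret classical_eigenbasis V lam E E' by simp
  \<comment> \<open>Two requirements meet here: 1/2 + 1/s < 1 + b for summability over the
    eigenvalues, and b < 1/2 for the tails to beat the levels. For s > 2 the value 0 satisfies both;
    for b = 1/(2 s) both reduce to 1 < s.\<close>
  define b where "b = (if 2 < s then 0 else 1 / (2 * s))"
  have b: "0 \<le> b" "b < 1/2" "1/2 + 1/s < 1 + b" using s by (auto simp: b_def field_simps)
  have sum: "summable (\<lambda>j. lam j powr (- (1 + b)))"
    by (rule eigenvalue_sum[OF C(1) _ growth b(3)]) (use s in auto)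
  have e_meas: "e j \<in> borel_measurable borel" for j
    using \<open>eigenbasis V lam e\<close> unfolding eigenbasis_def schroedinger_def in_L2_def by auto
  interpret gibbs_setting V lam E E' b \<theta> \<mu>0 e
    by unfold_locales (use b sum e_meas eE lam_0 lam_mono lam_lim \<open>gaussian_measure lam \<theta> \<mu>0\<close> in auto)
  show ?thesis
  proof (intro conjI impI allI)
    fix m :: real assume "2 < s" "0 < m"
    then have "b = 0" by (simp add: b_def)
    then show "in_L1_ennreal \<mu>0 (focusing_weight e {\<alpha>. int_pow e 2 \<alpha> \<le> ennreal m})"
      "gibbs_well_defined \<mu>0 (focusing_weight e {\<alpha>. int_pow e 2 \<alpha> \<le> ennreal m})"
      using focusing_gibbs_mass \<open>0 < m\<close> by auto
  qed (use defocusing_gibbs truncated_L2_Cauchy truncated_L2_limit renormalised_gibbs in auto)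
qed

end
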